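(* Let $\Theta$ be an inner function, let $a, a' \in \partial\mathbb{D}$, and let $\mu_a, \mu_{a'}$ denote the corresponding Clark measures for $\Theta$. Then $$\mathcal{B}_\Theta^a \cong \mathcal{B}_\Theta^{a'} \quad\Longleftrightarrow\quad \kappa(\mu_a) = \kappa(\mu_{a'}).$$
   Context: $\mathbb{D}$ is the open unit disk, $\partial\mathbb{D}$ the unit circle. $H^2$ is the Hardy space of $\mathbb{D}$, viewed (via boundary values) as a closed subspace of $L^2 = L^2(\partial\mathbb{D})$; $H^\infty$ is the algebra of bounded analytic functions on $\mathbb{D}$. Inner functions are assumed non-constant. For an inner function $\Theta$, $\mathcal{K}_\Theta := H^2 \ominus \Theta H^2$, and $P_\Theta$ is the orthogonal projection of $L^2$ onto $\mathcal{K}_\Theta$. For $\phi\in L^2$, the truncated Toeplitz operator $A_\phi = A_\phi^\Theta$ is the densely defined operator $A_\phi f := P_\Theta(\phi f)$, $f\in\mathcal{K}_\Theta\cap H^\infty$. $\mathcal{T}_\Theta$ is the set of those $A_\phi$ ($\phi \in L^2$) that extend to bounded operators on $\mathcal{K}_\Theta$ (identified with their extensions). The conjugation $C$ on $\mathcal{K}_\Theta$ is $Cf := \overline{zf}\,\Theta$ (boundary values on $\partial\mathbb{D}$). Sedlock algebras: for $a\in\mathbb{C}$, $$\mathcal{B}_\Theta^a := \{A_{\phi + a\overline{A_zC\phi}+c}\in\mathcal{T}_\Theta : \phi\in\mathcal{K}_\Theta,\ c\in\mathbb{C}\}.$$ Clark measures: for $a\in\partial\mathbb{D}$, $\mu_a$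 is the unique finite positive Borel measure on $\partial\mathbb{D}$ with $\Re\left(\frac{a+\Theta(z)}{a-\Theta(z)}\right) = \int_{\partial\mathbb{D}}\frac{1-|z|^2}{|\zeta-z|^2}\,d\mu_a(\zeta)$ for all $z\in\mathbb{D}$. For a positive measure $\mu$ on $\partial\mathbb{D}$, $\kappa(\mu) := (\epsilon,n)$, where $0\le n\le\infty$ is the number of atoms of $\mu$, and $\epsilon=0$ if $\mu$ is purely atomic, $\epsilon=1$ if $\mu$ has a non-zero continuous (atomless) part. For sets of operators $\mathcal{A}_1\subset B(\mathcal{H}_1)$, $\mathcal{A}_2\subset B(\mathcal{H}_2)$ on Hilbert spaces, $\mathcal{A}_1\cong\mathcal{A}_2$ (spatially isomorphic) means there is a unitary $U:\mathcal{H}_1\to\mathcal{H}_2$ with $U\mathcal{A}_1U^* = \mathcal{A}_2$. *)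

theory Defs
  imports "HOL-Analysis.Analysis"
begin

section \<open>The Hilbert space $L^2(\partial\mathbb{D})$\<close>

text \<open>Normalised arc length; its space is the unit circle with the Borel subsets of the circle.\<close>

definition circ :: "complex measure" where
  "circ = distr (uniform_measure lborel {0..2 * pi}) (restrict_space borel (sphere 0 1)) cis"

definition square_integrable :: "(complex \<Rightarrow> complex) \<Rightarrow> bool" where
  "square_integrable f \<longleftrightarrow>
     f \<in> borel_measurable circ \<and> integrable circ (\<lambda>z. (cmod (f z))\<^sup>2)"

lemma square_integrable_zero: "square_integrable (\<lambda>_. 0)"
  by (simp add: square_integrable_def)

lemma square_integrable_scale:
  "square_integrable f \<Longrightarrow> square_integrable (\<lambda>z. c * f z)"
  by (auto simp: square_integrable_def norm_mult power_mult_distrib)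

lemma square_integrable_cnj:
  "square_integrable f \<Longrightarrow> square_integrable (\<lambda>z. cnj (f z))"
  using measurable_compose[of f circ borel cnj borel]
    borel_measurable_continuous_onI[OF continuous_on_cnj[OF continuous_on_id]]
  by (auto simp: square_integrable_def id_def)

lemma square_integrable_add:
  assumes "square_integrable f" "square_integrable g"
  shows "square_integrable (\<lambda>z. f z + g z)"
proof -
  have [measurable]: "f \<in> borel_measurable circ" "g \<in> borel_measurable circ"
    using assms by (auto simp: square_integrable_def)
  have "integrable circ (\<lambda>z. 2 * (cmod (f z))\<^sup>2 + 2 * (cmod (g z))\<^sup>2)"
    using assms by (auto simp: square_integrable_def)
  then have "integrable circ (\<lambda>z. (cmod (f z + g z))\<^sup>2)"
  proof (rule Bochner_Integration.integrable_bound)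
    show "AE z in circ. norm ((cmod (f z + g z))\<^sup>2)
            \<le> norm (2 * (cmod (f z))\<^sup>2 + 2 * (cmod (g z))\<^sup>2)"
    proof (intro AE_I2)
      fix z
      have "(cmod (f z + g z))\<^sup>2 \<le> (cmod (f z) + cmod (g z))\<^sup>2"
        by (intro power_mono norm_triangle_ineq) auto
      also have "\<dots> \<le> 2 * (cmod (f z))\<^sup>2 + 2 * (cmod (g z))\<^sup>2"
        using zero_le_power2[of "cmod (f z) - cmod (g z)"]
        by (simp add: power2_sum power2_diff)
      finally show "norm ((cmod (f z + g z))\<^sup>2)
            \<le> norm (2 * (cmod (f z))\<^sup>2 + 2 * (cmod (g z))\<^sup>2)" by simp
    qed
  qed measurable
  then show ?thesis by (simp add: square_integrable_def)
qed

lemma integrable_mult_cnj: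
  assumes "square_integrable f" "square_integrable g"
  shows "integrable circ (\<lambda>z. f z * cnj (g z))"
proof -
  have [measurable]: "f \<in> borel_measurable circ" "(\<lambda>z. cnj (g z)) \<in> borel_measurable circ"
    using assms square_integrable_cnj[of g] by (auto simp: square_integrable_def)
  have "integrable circ (\<lambda>z. (cmod (f z))\<^sup>2 + (cmod (g z))\<^sup>2)"
    using assms by (auto simp: square_integrable_def)
  then show ?thesis
  proof (rule Bochner_Integration.integrable_bound)
    show "AE z in circ. norm (f z * cnj (g z)) \<le> norm ((cmod (f z))\<^sup>2 + (cmod (g z))\<^sup>2)"
    proof (intro AE_I2)
      fix z
      have "0 \<le> (cmod (f z) - cmod (g z))\<^sup>2" "0 \<le> cmod (f z) * cmod (g z)" by simp_all
      then have "cmod (f z) * cmod (g z) \<le> (cmod (f z))\<^sup>2 + (cmod (g z))\<^sup>2"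
        unfolding power2_diff by linarith
      then show "norm (f z * cnj (g z)) \<le> norm ((cmod (f z))\<^sup>2 + (cmod (g z))\<^sup>2)"
        by (simp add: norm_mult)
    qed
  qed measurable
qed

quotient_type l2 = "complex \<Rightarrow> complex" / partial:
  "\<lambda>f g. square_integrable f \<and> square_integrable g \<and> (AE z in circ. f z = g z)"
proof (rule part_equivpI)
  show "\<exists>f. square_integrable f \<and> square_integrable f \<and> (AE z in circ. f z = f z)"
    using square_integrable_zero by auto
  show "symp (\<lambda>f g. square_integrable f \<and> square_integrable g \<and> (AE z in circ. f z = g z))"
    by (auto simp: symp_def elim: eventually_mono)
  show "transp (\<lambda>f g. square_integrable f \<and> square_integrable g \<and> (AE z in circ. f z = g z))"
    by (auto simp: transp_def elim: eventually_elim2)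
qed

lift_definition l2_scale :: "complex \<Rightarrow> l2 \<Rightarrow> l2" (infixr "*\<^sub>C" 75) is "\<lambda>c f z. c * f z"
  by (auto simp: square_integrable_scale elim: eventually_mono)

lift_definition l2_cnj :: "l2 \<Rightarrow> l2" is "\<lambda>f z. cnj (f z)"
  by (auto simp: square_integrable_cnj elim: eventually_mono)

lift_definition l2_inner :: "l2 \<Rightarrow> l2 \<Rightarrow> complex" is "\<lambda>f g. \<integral>z. f z * cnj (g z) \<partial>circ"
proof (elim conjE)
  fix f f' g g'
  assume *: "square_integrable f" "square_integrable f'" "AE z in circ. f z = f' z"
    "square_integrable g" "square_integrable g'" "AE z in circ. g z = g' z"
  show "(\<integral>z. f z * cnj (g z) \<partial>circ) = (\<integral>z. f' z * cnj (g' z) \<partial>circ)"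
    using integrable_mult_cnj[OF *(1,4)] integrable_mult_cnj[OF *(2,5)] *(3,6)
    by (intro integral_cong_AE) (auto elim: eventually_elim2)
qed

text \<open>The pointwise product of two square-integrable functions need not be square integrable;
  in that case the value is the dummy 0.\<close>

lift_definition l2_mult :: "l2 \<Rightarrow> l2 \<Rightarrow> l2" (infixl "\<odot>" 70) is
  "\<lambda>f g. if square_integrable (\<lambda>z. f z * g z) then (\<lambda>z. f z * g z) else (\<lambda>_. 0)"
proof (elim conjE)
  fix f f' g g'
  assume *: "square_integrable f" "square_integrable f'" "AE z in circ. f z = f' z"
    "square_integrable g" "square_integrable g'" "AE z in circ. g z = g' z"
  have [measurable]: "f \<in> borel_measurable circ" "g \<in> borel_measurable circ"
     "f' \<in> borel_measurable circ" "g' \<in> borel_measurable circ"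
    using * by (auto simp: square_integrable_def)
  have ae: "AE z in circ. f z * g z = f' z * g' z"
    using *(3,6) by eventually_elim simp
  have "integrable circ (\<lambda>z. (cmod (f z * g z))\<^sup>2) \<longleftrightarrow> integrable circ (\<lambda>z. (cmod (f' z * g' z))\<^sup>2)"
    by (rule integrable_cong_AE) (measurable, use ae in eventually_elim, simp)
  then have "square_integrable (\<lambda>z. f z * g z) \<longleftrightarrow> square_integrable (\<lambda>z. f' z * g' z)"
    by (simp add: square_integrable_def)
  then show "square_integrable (if square_integrable (\<lambda>z. f z * g z) then \<lambda>z. f z * g z else (\<lambda>_. 0)) \<and>
    square_integrable (if square_integrable (\<lambda>z. f' z * g' z) then \<lambda>z. f' z * g' z else (\<lambda>_. 0)) \<and>
    (AE z in circ. (if square_integrable (\<lambda>z. f z * g z) then \<lambda>z. f z * g z else (\<lambda>_. 0)) z =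
      (if square_integrable (\<lambda>z. f' z * g' z) then \<lambda>z. f' z * g' z else (\<lambda>_. 0)) z)"
    using ae square_integrable_zero by auto
qed

instantiation l2 :: real_inner
begin

lift_definition zero_l2 :: l2 is "\<lambda>_. 0"
  by (simp add: square_integrable_zero)

lift_definition plus_l2 :: "l2 \<Rightarrow> l2 \<Rightarrow> l2" is "\<lambda>f g z. f z + g z"
  by (auto simp: square_integrable_add elim: eventually_elim2)

definition "scaleR_l2 r f = complex_of_real r *\<^sub>C f"

definition "uminus_l2 f = (- 1) *\<^sub>C (f :: l2)"

definition "minus_l2 f g = f + - (g :: l2)"

definition "inner_l2 f g = Re (l2_inner f g)"

definition "norm_l2 f = sqrt (inner f (f :: l2))"

definition "dist_l2 f g = norm (f - g :: l2)"

definition "sgn_l2 f = inverse (norm f) *\<^sub>R (f :: l2)"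

definition "uniformity_l2 = (INF e\<in>{0 <..}. principal {(x :: l2, y). dist x y < e})"

definition "open_l2 U \<longleftrightarrow> (\<forall>x\<in>U. \<forall>\<^sub>F (x', y) in uniformity. (x' :: l2) = x \<longrightarrow> y \<in> U)"

instance
proof
  fix f g h :: l2 and r s :: real
  note ops = scaleR_l2_def uminus_l2_def minus_l2_def
  show "f + g + h = f + (g + h)" by transfer (auto simp: square_integrable_add add.assoc)
  show "f + g = g + f" by transfer (auto simp: square_integrable_add add.commute)
  show "0 + f = f" by transfer auto
  show "- f + f = 0"
    unfolding ops
    by transfer (auto simp: square_integrable_zero)
  show "f - g = f + - g" by (simp add: ops)
  show "r *\<^sub>R (f + g) = r *\<^sub>R f + r *\<^sub>R g"
    unfolding ops
    by transfer (auto simp: distrib_left intro!: square_integrable_add square_integrable_scale)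
  show "(r + s) *\<^sub>R f = r *\<^sub>R f + s *\<^sub>R f"
    unfolding ops
    by transfer (auto simp: distrib_right intro!: square_integrable_add square_integrable_scale)
  show "r *\<^sub>R s *\<^sub>R f = (r * s) *\<^sub>R f"
    unfolding ops
    by transfer (auto simp: mult.assoc intro!: square_integrable_scale)
  show "1 *\<^sub>R f = f" unfolding ops by transfer auto
  show "dist f g = norm (f - g)" by (simp add: dist_l2_def)
  show "sgn f = inverse (norm f) *\<^sub>R f" by (simp add: sgn_l2_def)
  show "inner f g = inner g f"
    unfolding inner_l2_def
  proof transfer
    fix f g
    have "(\<integral>z. f z * cnj (g z) \<partial>circ) = (\<integral>z. cnj (g z * cnj (f z)) \<partial>circ)"
      by (simp add: mult.commute)
    also have "\<dots> = cnj (\<integral>z. g z * cnj (f z) \<partial>circ)" by (rule Bochner_Integration.integral_cnj)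
    finally show "Re (\<integral>z. f z * cnj (g z) \<partial>circ) = Re (\<integral>z. g z * cnj (f z) \<partial>circ)" by simp
  qed
  show "inner (f + g) h = inner f h + inner g h"
    unfolding inner_l2_def
    by transfer (auto simp: distrib_right integrable_mult_cnj)
  show "inner (r *\<^sub>R f) g = r * inner f g"
    unfolding inner_l2_def ops
    by transfer (auto simp: mult.assoc)
  have norm_sq: "Re (\<integral>z. u z * cnj (u z) \<partial>circ) = (\<integral>z. (cmod (u z))\<^sup>2 \<partial>circ)" for u
    by (simp add: complex_norm_square[symmetric] flip: of_real_power)
  show "0 \<le> inner f f"
    unfolding inner_l2_def by transfer (simp only: norm_sq, simp)
  show "inner f f = 0 \<longleftrightarrow> f = 0"
    unfolding inner_l2_def
  proof transfer
    fix u assume "square_integrable u \<and> square_integrable u \<and> (AE z in circ. u z = u z)"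
    then have "integrable circ (\<lambda>z. (cmod (u z))\<^sup>2)" "square_integrable u"
      by (auto simp: square_integrable_def)
    then show "(Re (\<integral>z. u z * cnj (u z) \<partial>circ) = 0) =
       (square_integrable u \<and> square_integrable (\<lambda>_. 0) \<and> (AE z in circ. u z = 0))"
      unfolding norm_sq
      by (subst integral_nonneg_eq_0_iff_AE) (auto simp: square_integrable_zero)
  qed
  show "norm f = sqrt (inner f f)" by (simp add: norm_l2_def)
qed (simp_all add: uniformity_l2_def open_l2_def)

end

section \<open>Operators on subspaces of $L^2$\<close>

text \<open>Operators on a subspace \<open>H\<close> are extensional functions, so that two operators on \<open>H\<close> are
  equal as soon as they agree on \<open>H\<close>.\<close>

definition complex_linear_on :: "l2 set \<Rightarrow> (l2 \<Rightarrow> l2) \<Rightarrow> bool" where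
  "complex_linear_on H T \<longleftrightarrow>
     (\<forall>f\<in>H. \<forall>g\<in>H. T (f + g) = T f + T g) \<and> (\<forall>c. \<forall>f\<in>H. T (c *\<^sub>C f) = c *\<^sub>C T f)"

definition bounded_operators :: "l2 set \<Rightarrow> (l2 \<Rightarrow> l2) set" where
  "bounded_operators H =
     {T \<in> H \<rightarrow>\<^sub>E H. complex_linear_on H T \<and> (\<exists>M. \<forall>f\<in>H. norm (T f) \<le> M * norm f)}"

definition unitary_on :: "l2 set \<Rightarrow> l2 set \<Rightarrow> (l2 \<Rightarrow> l2) \<Rightarrow> bool" where
  "unitary_on H1 H2 U \<longleftrightarrow> bij_betw U H1 H2 \<and> complex_linear_on H1 U \<and>
     (\<forall>f\<in>H1. \<forall>g\<in>H1. l2_inner (U f) (U g) = l2_inner f g)"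

text \<open>For unitary \<open>U\<close> the adjoint is the inverse \<open>inv_into H1 U\<close>.\<close>

definition spatially_isomorphic ::
    "l2 set \<Rightarrow> (l2 \<Rightarrow> l2) set \<Rightarrow> l2 set \<Rightarrow> (l2 \<Rightarrow> l2) set \<Rightarrow> bool" where
  "spatially_isomorphic H1 \<A>1 H2 \<A>2 \<longleftrightarrow>
     (\<exists>U. unitary_on H1 H2 U \<and> (\<lambda>A. restrict (U \<circ> A \<circ> inv_into H1 U) H2) ` \<A>1 = \<A>2)"

definition orth_proj :: "l2 set \<Rightarrow> l2 \<Rightarrow> l2" where
  "orth_proj H g = (THE h. h \<in> H \<and> (\<forall>k\<in>H. l2_inner (g - h) k = 0))"

section \<open>Hardy spaces and model spaces\<close>

definition hardy2 :: "(complex \<Rightarrow> complex) set" where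
  "hardy2 = {f. f holomorphic_on ball 0 1 \<and>
     (\<exists>M. \<forall>r\<in>{0..<1}. (\<integral>\<zeta>. (cmod (f (of_real r * \<zeta>)))\<^sup>2 \<partial>circ) \<le> M)}"

definition hardy_inf :: "(complex \<Rightarrow> complex) set" where
  "hardy_inf = {f. f holomorphic_on ball 0 1 \<and> bounded (f ` ball 0 1)}"

text \<open>For \<open>f\<close> in a Hardy space the radial limits exist almost everywhere (Fatou) and form a
  square-integrable function; at the remaining points \<^const>\<open>Lim\<close> takes one fixed dummy
  value, so measurability is not affected.\<close>

definition boundary :: "(complex \<Rightarrow> complex) \<Rightarrow> l2" where
  "boundary f = abs_l2 (\<lambda>\<zeta>. Lim (at_left 1) (\<lambda>r::real. f (of_real r * \<zeta>)))"

definition H2 :: "l2 set" where "H2 = boundary ` hardy2"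

definition Hinf :: "l2 set" where "Hinf = boundary ` hardy_inf"

definition inner_function :: "(complex \<Rightarrow> complex) \<Rightarrow> bool" where
  "inner_function \<Theta> \<longleftrightarrow> \<Theta> \<in> hardy_inf \<and> \<not> \<Theta> constant_on ball 0 1 \<and>
     (AE \<zeta> in circ. \<exists>w. cmod w = 1 \<and> ((\<lambda>r::real. \<Theta> (of_real r * \<zeta>)) \<longlongrightarrow> w) (at_left 1))"

definition model_space :: "(complex \<Rightarrow> complex) \<Rightarrow> l2 set" where
  "model_space \<Theta> = {f \<in> H2. \<forall>g\<in>H2. l2_inner f (boundary \<Theta> \<odot> g) = 0}"

section \<open>Truncated Toeplitz operators and Sedlock algebras\<close>

definition is_tto :: "(complex \<Rightarrow> complex) \<Rightarrow> l2 \<Rightarrow> (l2 \<Rightarrow> l2) \<Rightarrow> bool" where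
  "is_tto \<Theta> \<phi> T \<longleftrightarrow> T \<in> bounded_operators (model_space \<Theta>) \<and>
     (\<forall>f \<in> model_space \<Theta> \<inter> Hinf. T f = orth_proj (model_space \<Theta>) (\<phi> \<odot> f))"

text \<open>The bounded extension is unique because \<open>model_space \<Theta> \<inter> Hinf\<close> is dense in
  \<open>model_space \<Theta>\<close>.\<close>

definition tto :: "(complex \<Rightarrow> complex) \<Rightarrow> l2 \<Rightarrow> l2 \<Rightarrow> l2" where
  "tto \<Theta> \<phi> = (THE T. is_tto \<Theta> \<phi> T)"

definition ttos :: "(complex \<Rightarrow> complex) \<Rightarrow> (l2 \<Rightarrow> l2) set" where
  "ttos \<Theta> = {T. \<exists>\<phi>. is_tto \<Theta> \<phi> T}"

definition l2_const :: "complex \<Rightarrow> l2" where "l2_const c = abs_l2 (\<lambda>_. c)"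

definition l2_id :: l2 where "l2_id = abs_l2 (\<lambda>z. z)"

definition model_conj :: "(complex \<Rightarrow> complex) \<Rightarrow> l2 \<Rightarrow> l2" where
  "model_conj \<Theta> f = l2_cnj (l2_id \<odot> f) \<odot> boundary \<Theta>"

definition sedlock_symbol :: "(complex \<Rightarrow> complex) \<Rightarrow> complex \<Rightarrow> l2 \<Rightarrow> complex \<Rightarrow> l2" where
  "sedlock_symbol \<Theta> a \<phi> c =
     \<phi> + a *\<^sub>C l2_cnj (tto \<Theta> l2_id (model_conj \<Theta> \<phi>)) + l2_const c"

definition sedlock :: "(complex \<Rightarrow> complex) \<Rightarrow> complex \<Rightarrow> (l2 \<Rightarrow> l2) set" where
  "sedlock \<Theta> a = {T \<in> ttos \<Theta>. \<exists>\<phi>\<in>model_space \<Theta>. \<exists>c. is_tto \<Theta> (sedlock_symbol \<Theta> a \<phi> c) T}"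

section \<open>Clark measures\<close>

definition is_clark_measure :: "(complex \<Rightarrow> complex) \<Rightarrow> complex \<Rightarrow> complex measure \<Rightarrow> bool" where
  "is_clark_measure \<Theta> a \<mu> \<longleftrightarrow> finite_measure \<mu> \<and> sets \<mu> = sets (restrict_space borel (sphere 0 1)) \<and>
     (\<forall>z\<in>ball 0 1. Re ((a + \<Theta> z) / (a - \<Theta> z)) =
        (\<integral>\<zeta>. (1 - (cmod z)\<^sup>2) / (cmod (\<zeta> - z))\<^sup>2 \<partial>\<mu>))"

definition clark_measure :: "(complex \<Rightarrow> complex) \<Rightarrow> complex \<Rightarrow> complex measure" where
  "clark_measure \<Theta> a = (THE \<mu>. is_clark_measure \<Theta> a \<mu>)"

definition atoms :: "complex measure \<Rightarrow> complex set" where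
  "atoms \<mu> = {\<zeta> \<in> space \<mu>. emeasure \<mu> {\<zeta>} > 0}"

text \<open>The continuous part of a finite \<open>\<mu>\<close> is its restriction to the complement of the (countable)
  set of atoms, so it vanishes iff that complement is a null set.\<close>

definition kappa :: "complex measure \<Rightarrow> nat \<times> enat" where
  "kappa \<mu> = (if emeasure \<mu> (space \<mu> - atoms \<mu>) = 0 then 0 else 1,
              if finite (atoms \<mu>) then enat (card (atoms \<mu>)) else \<infinity>)"

end

theory Submission
  imports Defs "HOL-Complex_Analysis.Complex_Analysis" "HOL-Probability.Probability"
begin

text \<open>
  Clark's unitary operator maps the model space onto $L^2(\mu_a)$, sending reproducing kernels to
  multiples of Cauchy kernels. It turns the Sedlock algebra at \<open>a\<close> into the algebra of all
  multiplications by bounded functions, since a symbol of the form in question and a multiplier have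
  the same matrix entries on reproducing kernels. The common eigenvectors of the multiplication
  algebra are the multiples of indicators of atoms, and $\mu_a$ has a continuous part iff some
  nonzero vector is orthogonal to all of them; hence a spatial isomorphism preserves \<open>\<kappa>\<close>.
  Conversely, if \<open>\<kappa>\<close> agrees, then a bijection between the atoms together with distribution and
  quantile functions on the continuous parts gives an almost everywhere invertible map \<open>\<tau>\<close> that
  carries the measure with positive density \<open>w\<close> against $\mu_{a'}$ to $\mu_a$, and $f \mapsto \sqrt{w}\,(f \circ \tau)$
  is a unitary operator $L^2(\mu_a) \to L^2(\mu_{a'})$ that conjugates the multiplication algebras.
\<close>


section \<open>The circle\<close>

text \<open>Clark's operator is built from two families: the reproducing kernels and their images
  under the conjugation \<open>C\<close>. The kernels alone reach, a priori, only the closure of the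
  analytic polynomials in L^2(\<mu>). With the conjugate family, totality reduces to the fact that a
  measure on the circle is determined by its Poisson integrals. The price is a mixed Gram matrix,
  whose diagonal is reached by a limit. A multiplier coming from a Sedlock symbol is a priori only
  square integrable. The squared modulus of the transform of a kernel is a multiple of a Poisson
  kernel, so an operator bound \<open>M\<close> tested on kernels says that
  \<open>M^2 - |h|^2\<close> has nonnegative Poisson integrals, hence is nonnegative almost
  everywhere. Elements of the model space are given by boundary values, so Fatou's theorem has to
  come first. It is derived from an L^2 maximal inequality, which rests on the semigroup law of the
  Poisson kernels.\<close>

lemma circle_measurable_borel:
  assumes "sets M = sets (restrict_space borel (sphere 0 1))"
    and "f \<in> measurable borel N"
  shows "f \<in> measurable M N"
  using measurable_restrict_space1[OF assms(2), of "sphere 0 1"] assms(1)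
  by (simp cong: measurable_cong_sets)

lemma circle_measurable_cont:
  fixes f :: "complex \<Rightarrow> 'a::topological_space"
  assumes "sets M = sets (restrict_space borel (sphere 0 1))"
    and "continuous_on (sphere 0 1) f"
  shows "f \<in> borel_measurable M"
  using borel_measurable_continuous_on_restrict[OF assms(2)] assms(1)
  by (simp cong: measurable_cong_sets)

lemma circle_space:
  assumes "sets M = sets (restrict_space borel (sphere (0::complex) 1))"
  shows "space M = sphere 0 1"
  using sets_eq_imp_space_eq[OF assms] by (simp add: space_restrict_space)

lemma sets_circ: "sets circ = sets (restrict_space borel (sphere 0 1))"
  by (simp add: circ_def)

lemma space_circ: "space circ = sphere 0 1"
  by (rule circle_space[OF sets_circ])

lemma measurable_cis_circle:
  "sets N = sets borel \<Longrightarrow> cis \<in> measurable N (restrict_space borel (sphere 0 1))"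
  by (intro measurable_restrict_space2)
     (auto simp: borel_measurable_continuous_onI continuous_intros cong: measurable_cong_sets)

lemma circ_density:
  "uniform_measure lborel {0..2 * pi} = density lborel (\<lambda>x. ennreal (indicator {0..2*pi} x / (2 * pi)))"
proof -
  have "indicator {0..2*pi} x / emeasure lborel {0..2*pi} = ennreal (indicator {0..2*pi} x / (2 * pi))" for x :: real
  proof -
    have "emeasure lborel {0..2*pi} = ennreal (2 * pi)" by simp
    moreover have "(indicator {0..2*pi} x :: ennreal) = ennreal (indicator {0..2*pi} x)"
      by (simp add: ennreal_indicator)
    moreover have "ennreal (indicator {0..2*pi} x) / ennreal (2 * pi) = ennreal (indicator {0..2*pi} x / (2 * pi))"
      by (rule divide_ennreal) auto
    ultimately show ?thesis by (simp only:)
  qed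
  then show ?thesis unfolding uniform_measure_def by (simp only:)
qed

lemma prob_space_circ: "prob_space circ"
  unfolding circ_def
  by (intro prob_space.prob_space_distr prob_space_uniform_measure measurable_cis_circle) auto

interpretation circ: prob_space circ by (rule prob_space_circ)

lemma circ_integral:
  fixes f :: "complex \<Rightarrow> 'a::{banach, second_countable_topology}"
  assumes "f \<in> borel_measurable circ"
  shows "(\<integral>z. f z \<partial>circ) = (\<integral>t. (indicator {0..2*pi} t / (2*pi)) *\<^sub>R f (cis t) \<partial>lborel)"
proof -
  have m: "f \<in> borel_measurable (restrict_space borel (sphere 0 1))"
    using assms by (simp add: sets_circ cong: measurable_cong_sets)
  have c: "cis \<in> measurable (uniform_measure lborel {0..2 * pi}) (restrict_space borel (sphere 0 1))"
    by (intro measurable_cis_circle) simp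
  have "(\<integral>z. f z \<partial>circ) = (\<integral>t. f (cis t) \<partial>(uniform_measure lborel {0..2 * pi}))"
    unfolding circ_def by (rule integral_distr[OF c m])
  also have "\<dots> = (\<integral>t. (indicator {0..2*pi} t / (2*pi)) *\<^sub>R f (cis t) \<partial>lborel)"
    unfolding circ_density
    by (rule integral_density) (use measurable_compose[OF c m] in \<open>auto cong: measurable_cong_sets\<close>)
  finally show ?thesis .
qed

lemma circ_integral_power:
  assumes "n \<ge> 1"
  shows "(\<integral>z. z ^ n \<partial>circ) = 0"
proof -
  have "(\<integral>z. z ^ n \<partial>circ) = (\<integral>t. (indicator {0..2*pi} t / (2*pi)) *\<^sub>R (cis t ^ n) \<partial>lborel)"
    by (intro circ_integral circle_measurable_cont[OF sets_circ] continuous_intros)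
  also have "\<dots> = (\<integral>t. indicator {0..2*pi} t *\<^sub>R (cis (real n * t) / (2*pi)) \<partial>lborel)"
    by (intro Bochner_Integration.integral_cong)
       (auto simp: Complex.DeMoivre scaleR_conv_of_real split: split_indicator)
  \<comment> \<open>\<open>cis (n * t) / (2 * pi * n * \<i>)\<close> is an antiderivative of the
    integrand, with equal values at both ends because \<open>n\<close> is an integer.\<close>
  also have "\<dots> = cis (real n * (2*pi)) / (2*pi*n*\<i>) - cis (real n * 0) / (2*pi*n*\<i>)"
  proof (rule integral_FTC_atLeastAtMost)
    fix x :: real
    have "((\<lambda>x. cis (real n * x) / (2*pi*n*\<i>)) has_vector_derivative (cis (real n * x) / (2*pi))) (at x)"
    proof -
      have "((\<lambda>x. cis (real n * x)) has_derivative (\<lambda>t. (real n * t) *\<^sub>R (\<i> * cis (real n * x)))) (at x)"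
        by (intro has_derivative_cis derivative_intros)
      then have "((\<lambda>x. inverse (2*pi*n*\<i>) * cis (real n * x)) has_derivative
          (\<lambda>t. inverse (2*pi*n*\<i>) * ((real n * t) *\<^sub>R (\<i> * cis (real n * x))))) (at x)"
        by (rule has_derivative_mult_right)
      moreover have "(\<lambda>x. inverse (2*pi*n*\<i>) * cis (real n * x)) = (\<lambda>x. cis (real n * x) / (2*pi*n*\<i>))"
        by (simp only: divide_inverse mult.commute)
      moreover have "(\<lambda>t. inverse (2*pi*n*\<i>) * ((real n * t) *\<^sub>R (\<i> * cis (real n * x)))) =
          (\<lambda>t. t *\<^sub>R (cis (real n * x) / (2*pi)))"
      proof (rule ext)
        fix t
        have "complex_of_real (real n) \<noteq> 0" "complex_of_real pi \<noteq> 0" using assms by auto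
        then show "inverse (2*pi*n*\<i>) * ((real n * t) *\<^sub>R (\<i> * cis (real n * x))) = t *\<^sub>R (cis (real n * x) / (2*pi))"
          by (simp add: scaleR_conv_of_real field_simps)
      qed
      ultimately show ?thesis
        unfolding has_vector_derivative_def by (simp only:)
    qed
    then show "((\<lambda>x. cis (real n * x) / (2*pi*n*\<i>)) has_vector_derivative (cis (real n * x) / (2*pi)))
        (at x within {0..2*pi})" by (rule has_vector_derivative_at_within)
  qed (auto intro!: continuous_intros)
  also have "cis (real n * (2*pi)) = 1"
    using cis_multiple_2pi[of "real n"] by (simp add: mult_ac)
  finally show ?thesis by simp
qed

lemma integrable_circ_bounded:
  fixes f :: "complex \<Rightarrow> 'a::{banach, second_countable_topology}"
  assumes "f \<in> borel_measurable circ" "\<And>z. cmod z = 1 \<Longrightarrow> norm (f z) \<le> B"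
  shows "integrable circ f"
  using assms by (intro circ.integrable_const_bound[of _ B] AE_I2) (auto simp: space_circ)

lemma integrable_circ_cont:
  fixes f :: "complex \<Rightarrow> 'a::{banach, second_countable_topology}"
  assumes "continuous_on (sphere 0 1) f"
  shows "integrable circ f"
proof -
  have "compact (f ` sphere 0 1)" using assms by (intro compact_continuous_image) auto
  then obtain B where "\<forall>x\<in>f ` sphere 0 1. norm x \<le> B"
    using compact_imp_bounded bounded_iff by metis
  then show ?thesis
    by (intro integrable_circ_bounded circle_measurable_cont[OF sets_circ] assms) auto
qed

lemma integrable_mult_bounded:
  fixes f g :: "'a \<Rightarrow> complex"
  assumes "integrable M g" "f \<in> borel_measurable M" "\<And>z. z \<in> space M \<Longrightarrow> cmod (f z) \<le> B"
  shows "integrable M (\<lambda>z. f z * g z)"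
proof (rule Bochner_Integration.integrable_bound)
  show "integrable M (\<lambda>z. B * norm (g z))" using assms(1) by simp
  show "(\<lambda>z. f z * g z) \<in> borel_measurable M" using assms by simp
  show "AE z in M. norm (f z * g z) \<le> norm (B * norm (g z))"
  proof (intro AE_I2)
    fix z assume "z \<in> space M"
    then have "cmod (f z) \<le> B" using assms by auto
    then have "cmod (f z) * cmod (g z) \<le> B * cmod (g z)" by (intro mult_right_mono) auto
    then show "norm (f z * g z) \<le> norm (B * norm (g z))" by (simp add: norm_mult)
  qed
qed

lemma cnj_circle: "cmod z = 1 \<Longrightarrow> cnj z = inverse z"
  using complex_div_cnj[of 1 z] by (simp add: divide_inverse)

lemma one_minus_mult_ne: 
  fixes z w :: complex
  assumes "cmod z < 1" "cmod w = 1" shows "1 - z * w \<noteq> 0"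
proof
  assume "1 - z * w = 0"
  then have "z * w = 1" by simp
  then have "cmod z * cmod w = 1" by (metis norm_mult norm_one)
  then show False using assms by simp
qed

lemma cauchy_kernel_bound:
  assumes "cmod z < 1" "cmod w = 1"
  shows "cmod (1 / (1 - z * w)) \<le> 1 / (1 - cmod z)"
proof -
  have "1 - cmod z \<le> cmod (1 - z * w)"
    using norm_triangle_ineq2[of 1 "z * w"] assms by (simp add: norm_mult)
  then show ?thesis using assms by (simp add: norm_divide frac_le)
qed

text \<open>The geometric expansion of the Cauchy kernel is integrated term by term; the norms are
  dominated by \<open>cmod z ^ n\<close> times the L^1 norm of \<open>g\<close>. Cauchy transforms
  are thus determined by Fourier coefficients, for Clark measures as well as for arc length.\<close>

lemma cauchy_transform_sums:
  fixes g :: "complex \<Rightarrow> complex"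
  assumes M: "sets M = sets (restrict_space borel (sphere 0 1))" "integrable M g" and z: "cmod z < 1"
  shows "(\<lambda>n. z ^ n * (\<integral>x. g x * cnj x ^ n \<partial>M)) sums (\<integral>x. g x / (1 - z * cnj x) \<partial>M)"
proof -
  have sp: "space M = sphere 0 1" by (rule circle_space[OF M(1)])
  have int: "integrable M (\<lambda>x. (z ^ n * cnj x ^ n) * g x)" for n
    by (rule integrable_mult_bounded[OF M(2), of _ 1])
       (use z in \<open>auto simp: sp norm_mult norm_power power_le_one intro!: circle_measurable_cont[OF M(1)] continuous_intros\<close>)
  have "(\<lambda>n. \<integral>x. (z ^ n * cnj x ^ n) * g x \<partial>M) sums (\<integral>x. (\<Sum>n. (z ^ n * cnj x ^ n) * g x) \<partial>M)"
  proof (rule sums_integral[OF int])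
    show "AE x in M. summable (\<lambda>n. norm ((z ^ n * cnj x ^ n) * g x))"
      using z by (intro AE_I2) (auto simp: sp norm_mult norm_power intro!: summable_mult2 summable_geometric)
    have "(\<integral>x. norm ((z ^ n * cnj x ^ n) * g x) \<partial>M) = cmod z ^ n * (\<integral>x. norm (g x) \<partial>M)" for n
    proof -
      have "(\<integral>x. norm ((z ^ n * cnj x ^ n) * g x) \<partial>M) = (\<integral>x. cmod z ^ n * norm (g x) \<partial>M)"
        by (intro Bochner_Integration.integral_cong) (auto simp: norm_mult norm_power sp)
      then show ?thesis by simp
    qed
    then show "summable (\<lambda>n. \<integral>x. norm ((z ^ n * cnj x ^ n) * g x) \<partial>M)"
      using z by (auto intro!: summable_mult2 summable_geometric)
  qed
  also have "(\<integral>x. (\<Sum>n. (z ^ n * cnj x ^ n) * g x) \<partial>M) = (\<integral>x. g x / (1 - z * cnj x) \<partial>M)"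
  proof (intro Bochner_Integration.integral_cong refl)
    fix x assume "x \<in> space M"
    then have "cmod (z * cnj x) < 1" using z by (simp add: sp norm_mult)
    then have "(\<lambda>n. (z * cnj x) ^ n * g x) sums (1 / (1 - z * cnj x) * g x)"
      by (intro sums_mult2 geometric_sums)
    then show "(\<Sum>n. (z ^ n * cnj x ^ n) * g x) = g x / (1 - z * cnj x)"
      by (simp add: sums_iff power_mult_distrib)
  qed
  finally have "(\<lambda>n. \<integral>x. (z ^ n * cnj x ^ n) * g x \<partial>M) sums (\<integral>x. g x / (1 - z * cnj x) \<partial>M)" .
  moreover have "(\<integral>x. (z ^ n * cnj x ^ n) * g x \<partial>M) = z ^ n * (\<integral>x. g x * cnj x ^ n \<partial>M)" for n
    by (subst Bochner_Integration.integral_mult_right_zero[symmetric])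
       (intro Bochner_Integration.integral_cong, auto simp: mult_ac)
  ultimately show ?thesis by simp
qed

lemma circ_orthonormal: "(\<integral>x. x ^ n * cnj x ^ m \<partial>circ) = (if n = m then 1 else 0)"
proof (cases "n = m")
  case True
  have "(\<integral>x. x ^ n * cnj x ^ m \<partial>circ) = (\<integral>x. 1 \<partial>circ)"
  proof (intro Bochner_Integration.integral_cong refl)
    fix x assume "x \<in> space circ"
    then have "x * cnj x = 1" by (simp add: space_circ complex_norm_square[symmetric])
    then show "x ^ n * cnj x ^ m = 1" using True by (simp flip: power_mult_distrib)
  qed
  then show ?thesis using True by (simp add: circ.prob_space)
next
  case False
  show ?thesis
  proof (cases "n > m")
    case True
    have "(\<integral>x. x ^ n * cnj x ^ m \<partial>circ) = (\<integral>x. x ^ (n - m) \<partial>circ)"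
    proof (intro Bochner_Integration.integral_cong refl)
      fix x assume "x \<in> space circ"
      then have "x * cnj x = 1" by (simp add: space_circ complex_norm_square[symmetric])
      then have "x ^ m * cnj x ^ m = 1" by (simp flip: power_mult_distrib)
      moreover have "x ^ n = x ^ (n - m) * x ^ m" using True by (simp flip: power_add)
      ultimately show "x ^ n * cnj x ^ m = x ^ (n - m)" by (simp add: mult.assoc)
    qed
    then show ?thesis using True False by (simp add: circ_integral_power)
  next
    case gt: False
    have "(\<integral>x. x ^ n * cnj x ^ m \<partial>circ) = (\<integral>x. cnj (x ^ (m - n)) \<partial>circ)"
    proof (intro Bochner_Integration.integral_cong refl)
      fix x assume "x \<in> space circ"
      then have "cmod x = 1" by (simp add: space_circ)
      then have x: "x \<noteq> 0" "cnj x = inverse x" by (auto simp: cnj_circle)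
      obtain k where m: "m = n + k" using gt le_Suc_ex not_less by blast
      show "x ^ n * cnj x ^ m = cnj (x ^ (m - n))"
      proof -
        have "x * cnj x = 1" using x by simp
        then have "x ^ n * cnj x ^ n = 1" by (simp flip: power_mult_distrib)
        then show ?thesis by (simp add: m power_add flip: mult.assoc)
      qed
    qed
    also have "\<dots> = cnj (\<integral>x. x ^ (m - n) \<partial>circ)" by (rule Bochner_Integration.integral_cnj)
    finally show ?thesis using gt False by (simp add: circ_integral_power)
  qed
qed

text \<open>Absolute summability of the coefficients justifies integrating the series termwise
  against a bounded function. Dilations \<open>f (r x)\<close> of analytic functions have such
  coefficients, and statements about boundary values are obtained from them by letting
  \<open>r\<close> tend to 1.\<close>

lemma power_series_integral:
  fixes c :: "nat \<Rightarrow> complex"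
  assumes c: "summable (\<lambda>n. cmod (c n))"
    and h: "h \<in> borel_measurable circ" "\<And>x. cmod x = 1 \<Longrightarrow> cmod (h x) \<le> B"
  shows "(\<lambda>n. c n * (\<integral>x. x ^ n * h x \<partial>circ)) sums (\<integral>x. (\<Sum>n. c n * x ^ n) * h x \<partial>circ)"
proof -
  have int: "integrable circ (\<lambda>x. c n * x ^ n * h x)" for n
    by (rule integrable_mult_bounded[OF integrable_circ_bounded[OF h], of _ "cmod (c n)"])
      (auto simp: space_circ norm_mult norm_power intro!: circle_measurable_cont[OF sets_circ] continuous_intros)
  have "(\<lambda>n. \<integral>x. c n * x ^ n * h x \<partial>circ) sums (\<integral>x. (\<Sum>n. c n * x ^ n * h x) \<partial>circ)"
  proof (rule sums_integral[OF int])
    show "AE x in circ. summable (\<lambda>n. norm (c n * x ^ n * h x))"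
      using summable_mult2[OF c] by (intro AE_I2) (simp add: space_circ norm_mult norm_power)
    have "(\<integral>x. norm (c n * x ^ n * h x) \<partial>circ) = cmod (c n) * (\<integral>x. cmod (h x) \<partial>circ)" for n
    proof -
      have "(\<integral>x. norm (c n * x ^ n * h x) \<partial>circ) = (\<integral>x. cmod (c n) * cmod (h x) \<partial>circ)"
        by (intro Bochner_Integration.integral_cong) (auto simp: space_circ norm_mult norm_power)
      then show ?thesis by simp
    qed
    then show "summable (\<lambda>n. \<integral>x. norm (c n * x ^ n * h x) \<partial>circ)"
      using summable_mult2[OF c] by simp
  qed
  moreover have "(\<integral>x. c n * x ^ n * h x \<partial>circ) = c n * (\<integral>x. x ^ n * h x \<partial>circ)" for n
    by (simp only: mult.assoc Bochner_Integration.integral_mult_right_zero)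
  moreover have "(\<integral>x. (\<Sum>n. c n * x ^ n) * h x \<partial>circ) = (\<integral>x. (\<Sum>n. c n * x ^ n * h x) \<partial>circ)"
  proof (intro Bochner_Integration.integral_cong refl)
    fix x assume "x \<in> space circ"
    then have "summable (\<lambda>n. c n * x ^ n)"
      using c by - (rule summable_norm_cancel, simp add: space_circ norm_mult norm_power)
    then show "(\<Sum>n. c n * x ^ n) * h x = (\<Sum>n. c n * x ^ n * h x)" by (rule suminf_mult2)
  qed
  ultimately show ?thesis by (simp only:)
qed

lemma power_series_coeff:
  fixes c :: "nat \<Rightarrow> complex"
  assumes c: "summable (\<lambda>n. cmod (c n))"
  shows "(\<integral>x. (\<Sum>n. c n * x ^ n) * cnj x ^ m \<partial>circ) = c m"
    and "(\<integral>x. (\<Sum>n. c n * x ^ n) * x ^ Suc m \<partial>circ) = 0"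
proof -
  have "(\<lambda>n. c n * (\<integral>x. x ^ n * cnj x ^ m \<partial>circ)) sums (\<integral>x. (\<Sum>n. c n * x ^ n) * cnj x ^ m \<partial>circ)"
    by (rule power_series_integral[OF c, of _ 1])
      (auto intro!: continuous_intros circle_measurable_cont[OF sets_circ] simp: norm_power)
  moreover have "(\<lambda>n. c n * (\<integral>x. x ^ n * cnj x ^ m \<partial>circ)) = (\<lambda>n. if n = m then c n else 0)"
    by (auto simp: circ_orthonormal fun_eq_iff)
  ultimately have "(\<lambda>n. if n = m then c n else 0) sums (\<integral>x. (\<Sum>n. c n * x ^ n) * cnj x ^ m \<partial>circ)"
    by (simp only:)
  then show "(\<integral>x. (\<Sum>n. c n * x ^ n) * cnj x ^ m \<partial>circ) = c m"
    by (rule sums_unique2[OF _ sums_single])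
  have "(\<lambda>n. c n * (\<integral>x. x ^ n * x ^ Suc m \<partial>circ)) sums (\<integral>x. (\<Sum>n. c n * x ^ n) * x ^ Suc m \<partial>circ)"
    by (rule power_series_integral[OF c, of _ 1])
      (auto intro!: continuous_intros circle_measurable_cont[OF sets_circ] simp: norm_power norm_mult)
  moreover have "(\<integral>x. x ^ n * x ^ Suc m \<partial>circ) = 0" for n
    unfolding power_add[symmetric] by (rule circ_integral_power) simp
  ultimately have "(\<lambda>n. 0) sums (\<integral>x. (\<Sum>n. c n * x ^ n) * x ^ Suc m \<partial>circ)"
    by (simp only: mult_zero_right)
  then show "(\<integral>x. (\<Sum>n. c n * x ^ n) * x ^ Suc m \<partial>circ) = 0"
    by (rule sums_unique2[OF _ sums_zero])
qed

text \<open>The series is integrated against the conjugate of its own sum;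
  \<open>power_series_coeff\<close> identifies the coefficient that each term meets.\<close>

lemma parseval:
  fixes c :: "nat \<Rightarrow> complex"
  assumes c: "summable (\<lambda>n. cmod (c n))"
  shows "(\<lambda>n. (cmod (c n))\<^sup>2) sums (\<integral>x. (cmod (\<Sum>n. c n * x ^ n))\<^sup>2 \<partial>circ)"
proof -
  define F where "F x = (\<Sum>n. c n * x ^ n)" for x
  have B: "cmod (F x) \<le> (\<Sum>n. cmod (c n))" if "cmod x = 1" for x
    unfolding F_def using c that summable_norm[of "\<lambda>n. c n * x ^ n"] by (simp add: norm_mult norm_power)
  have "(\<lambda>x. \<Sum>n. c n * x ^ n) \<in> borel_measurable circ"
    by (intro borel_measurable_suminf circle_measurable_cont[OF sets_circ] continuous_intros)
  then have Fm [measurable]: "F \<in> borel_measurable circ" by (simp add: F_def[abs_def])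
  have cF: "(\<lambda>x. cnj (F x)) \<in> borel_measurable circ"
    using measurable_compose[OF Fm borel_measurable_continuous_onI[OF continuous_on_cnj[OF continuous_on_id]]]
    by simp
  have "(\<lambda>n. c n * (\<integral>x. x ^ n * cnj (F x) \<partial>circ)) sums (\<integral>x. F x * cnj (F x) \<partial>circ)"
    using power_series_integral[OF c cF] B unfolding F_def[symmetric] by auto
  moreover have "(\<integral>x. x ^ n * cnj (F x) \<partial>circ) = cnj (c n)" for n
  proof -
    have "cnj (c n) = cnj (\<integral>x. F x * cnj x ^ n \<partial>circ)"
      using power_series_coeff(1)[OF c, of n] by (simp add: F_def)
    also have "\<dots> = (\<integral>x. x ^ n * cnj (F x) \<partial>circ)"
      by (simp add: mult.commute flip: Bochner_Integration.integral_cnj)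
    finally show ?thesis by simp
  qed
  moreover have "(\<integral>x. F x * cnj (F x) \<partial>circ) = of_real (\<integral>x. (cmod (F x))\<^sup>2 \<partial>circ)"
    by (simp add: complex_norm_square[symmetric] flip: of_real_power)
  ultimately have "(\<lambda>n. of_real ((cmod (c n))\<^sup>2)) sums (of_real (\<integral>x. (cmod (F x))\<^sup>2 \<partial>circ) :: complex)"
    by (simp only: complex_norm_square)
  then show ?thesis unfolding sums_of_real_iff F_def .
qed

section \<open>Square-integrable functions\<close>

text \<open>The notion \<open>square_integrable\<close> for an arbitrary measure, so that one
  development covers arc length and Clark measures. The Hilbert space arguments run on functions,
  not on classes modulo null sets; \<open>abs_l2\<close> and \<open>rep_l2\<close> enter at the
  interface with the definitions.\<close>

definition sqi :: "'a measure \<Rightarrow> ('a \<Rightarrow> complex) \<Rightarrow> bool" where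
  "sqi M f \<longleftrightarrow> f \<in> borel_measurable M \<and> integrable M (\<lambda>x. (cmod (f x))\<^sup>2)"

definition ip :: "'a measure \<Rightarrow> ('a \<Rightarrow> complex) \<Rightarrow> ('a \<Rightarrow> complex) \<Rightarrow> complex" where
  "ip M f g = (\<integral>x. f x * cnj (g x) \<partial>M)"

definition nsq :: "'a measure \<Rightarrow> ('a \<Rightarrow> complex) \<Rightarrow> real" where
  "nsq M f = (\<integral>x. (cmod (f x))\<^sup>2 \<partial>M)"

lemma square_integrable_iff: "square_integrable = sqi circ"
  by (auto simp: fun_eq_iff square_integrable_def sqi_def)

lemma sqi_measurable: "sqi M f \<Longrightarrow> f \<in> borel_measurable M"
  by (simp add: sqi_def)

lemma sqi_zero [simp]: "sqi M (\<lambda>_. 0)"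
  by (simp add: sqi_def)

lemma sqi_scale: "sqi M f \<Longrightarrow> sqi M (\<lambda>x. c * f x)"
  by (auto simp: sqi_def norm_mult power_mult_distrib)

lemma borel_measurable_cnj [measurable]:
  "f \<in> borel_measurable M \<Longrightarrow> (\<lambda>x. cnj (f x)) \<in> borel_measurable M"
  using measurable_compose[of f M borel cnj borel]
    borel_measurable_continuous_onI[OF continuous_on_cnj[OF continuous_on_id]]
  by (simp add: id_def)

lemma sqi_cnj: "sqi M f \<Longrightarrow> sqi M (\<lambda>x. cnj (f x))"
  by (auto simp: sqi_def)

lemma cmod_add_sq_le: "(cmod (a + b))\<^sup>2 \<le> 2 * (cmod a)\<^sup>2 + 2 * (cmod b)\<^sup>2"
proof -
  have "(cmod (a + b))\<^sup>2 \<le> (cmod a + cmod b)\<^sup>2"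
    by (intro power_mono norm_triangle_ineq) auto
  also have "\<dots> \<le> 2 * (cmod a)\<^sup>2 + 2 * (cmod b)\<^sup>2"
    using zero_le_power2[of "cmod a - cmod b"] by (simp add: power2_sum power2_diff)
  finally show ?thesis .
qed

lemma sqi_add:
  assumes f: "sqi M f" and g: "sqi M g"
  shows "sqi M (\<lambda>x. f x + g x)"
proof -
  have [measurable]: "f \<in> borel_measurable M" "g \<in> borel_measurable M"
    using f g by (auto simp: sqi_def)
  have "integrable M (\<lambda>x. (cmod (f x + g x))\<^sup>2)"
  proof (rule Bochner_Integration.integrable_bound)
    show "integrable M (\<lambda>x. 2 * (cmod (f x))\<^sup>2 + 2 * (cmod (g x))\<^sup>2)"
      using f g by (auto simp: sqi_def)
    show "AE x in M. norm ((cmod (f x + g x))\<^sup>2) \<le> norm (2 * (cmod (f x))\<^sup>2 + 2 * (cmod (g x))\<^sup>2)"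
      using cmod_add_sq_le by (intro AE_I2) (smt (verit) norm_of_real real_norm_def zero_le_power2)
  qed measurable
  then show ?thesis by (simp add: sqi_def)
qed

lemma sqi_diff:
  assumes "sqi M f" "sqi M g" shows "sqi M (\<lambda>x. f x - g x)"
  using sqi_add[OF assms(1) sqi_scale[OF assms(2), of "-1"]] by simp

lemma sqi_mult_bounded:
  assumes f: "sqi M f" and g: "g \<in> borel_measurable M" "\<And>x. x \<in> space M \<Longrightarrow> cmod (g x) \<le> B"
  shows "sqi M (\<lambda>x. g x * f x)"
proof -
  have [measurable]: "f \<in> borel_measurable M" "g \<in> borel_measurable M"
    using f g by (auto simp: sqi_def)
  have "integrable M (\<lambda>x. (cmod (g x * f x))\<^sup>2)"
  proof (rule Bochner_Integration.integrable_bound)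
    show "integrable M (\<lambda>x. B\<^sup>2 * (cmod (f x))\<^sup>2)"
      using f by (auto simp: sqi_def)
    show "AE x in M. norm ((cmod (g x * f x))\<^sup>2) \<le> norm (B\<^sup>2 * (cmod (f x))\<^sup>2)"
    proof (intro AE_I2)
      fix x assume "x \<in> space M"
      then have "(cmod (g x))\<^sup>2 * (cmod (f x))\<^sup>2 \<le> B\<^sup>2 * (cmod (f x))\<^sup>2"
        using g by (intro mult_right_mono power_mono) auto
      then show "norm ((cmod (g x * f x))\<^sup>2) \<le> norm (B\<^sup>2 * (cmod (f x))\<^sup>2)"
        by (simp add: norm_mult power_mult_distrib)
    qed
  qed measurable
  then show ?thesis by (simp add: sqi_def)
qed

lemma sqi_bounded:
  assumes "finite_measure M" "g \<in> borel_measurable M" "\<And>x. x \<in> space M \<Longrightarrow> cmod (g x) \<le> B"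
  shows "sqi M g"
proof -
  interpret finite_measure M by fact
  have "sqi M (\<lambda>_. 1)" by (simp add: sqi_def)
  from sqi_mult_bounded[OF this assms(2,3)] show ?thesis by simp
qed

lemma sqi_integrable_mult:
  assumes f: "sqi M f" and g: "sqi M g"
  shows "integrable M (\<lambda>x. f x * g x)"
proof (rule Bochner_Integration.integrable_bound)
  have [measurable]: "f \<in> borel_measurable M" "g \<in> borel_measurable M"
    using f g by (auto simp: sqi_def)
  show "(\<lambda>x. f x * g x) \<in> borel_measurable M" by measurable
  show "integrable M (\<lambda>x. (cmod (f x))\<^sup>2 + (cmod (g x))\<^sup>2)"
    using f g by (auto simp: sqi_def)
  show "AE x in M. norm (f x * g x) \<le> norm ((cmod (f x))\<^sup>2 + (cmod (g x))\<^sup>2)"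
  proof (intro AE_I2)
    fix x
    have "0 \<le> (cmod (f x) - cmod (g x))\<^sup>2" "0 \<le> cmod (f x) * cmod (g x)" by simp_all
    then have "cmod (f x) * cmod (g x) \<le> (cmod (f x))\<^sup>2 + (cmod (g x))\<^sup>2"
      unfolding power2_diff by linarith
    then show "norm (f x * g x) \<le> norm ((cmod (f x))\<^sup>2 + (cmod (g x))\<^sup>2)"
      by (simp add: norm_mult)
  qed
qed

lemma sqi_integrable_ip: "sqi M f \<Longrightarrow> sqi M g \<Longrightarrow> integrable M (\<lambda>x. f x * cnj (g x))"
  by (intro sqi_integrable_mult sqi_cnj)

lemma sqi_integrable: "finite_measure M \<Longrightarrow> sqi M f \<Longrightarrow> integrable M f"
  using sqi_integrable_mult[of M f "\<lambda>_. 1"] sqi_bounded[of M "\<lambda>_. 1" 1] by simp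

lemma sqi_cong_AE:
  assumes "sqi M f" "g \<in> borel_measurable M" "AE x in M. f x = g x"
  shows "sqi M g"
proof -
  have [measurable]: "f \<in> borel_measurable M" "g \<in> borel_measurable M" using assms by (auto simp: sqi_def)
  have "AE x in M. (cmod (f x))\<^sup>2 = (cmod (g x))\<^sup>2" using assms(3) by eventually_elim simp
  then have "integrable M (\<lambda>x. (cmod (f x))\<^sup>2) \<longleftrightarrow> integrable M (\<lambda>x. (cmod (g x))\<^sup>2)"
    by (intro integrable_cong_AE) measurable
  then show ?thesis using assms by (simp add: sqi_def)
qed

lemma ip_add_left:
  "sqi M f \<Longrightarrow> sqi M g \<Longrightarrow> sqi M h \<Longrightarrow> ip M (\<lambda>x. f x + g x) h = ip M f h + ip M g h"
  by (simp add: ip_def distrib_right sqi_integrable_ip)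

lemma ip_diff_left:
  "sqi M f \<Longrightarrow> sqi M g \<Longrightarrow> sqi M h \<Longrightarrow> ip M (\<lambda>x. f x - g x) h = ip M f h - ip M g h"
  by (simp add: ip_def left_diff_distrib sqi_integrable_ip)

lemma ip_scale_left: "ip M (\<lambda>x. c * f x) h = c * ip M f h"
  by (simp add: ip_def mult.assoc)

lemma ip_cnj: "cnj (ip M f g) = ip M g f"
  unfolding ip_def Bochner_Integration.integral_cnj[symmetric] by (simp add: mult.commute)

lemma ip_add_right:
  "sqi M f \<Longrightarrow> sqi M g \<Longrightarrow> sqi M h \<Longrightarrow> ip M h (\<lambda>x. f x + g x) = ip M h f + ip M h g"
  using ip_add_left[of M f g h] by (metis ip_cnj complex_cnj_add)

lemma ip_diff_right:
  "sqi M f \<Longrightarrow> sqi M g \<Longrightarrow> sqi M h \<Longrightarrow> ip M h (\<lambda>x. f x - g x) = ip M h f - ip M h g"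
  using ip_diff_left[of M f g h] by (metis ip_cnj complex_cnj_diff)

lemma ip_scale_right: "ip M h (\<lambda>x. c * f x) = cnj c * ip M h f"
  using ip_scale_left[of M c f h] by (metis ip_cnj complex_cnj_mult)

lemma ip_self: "ip M f f = of_real (nsq M f)"
  by (simp add: ip_def nsq_def complex_norm_square[symmetric] flip: of_real_power)

lemma nsq_nonneg [simp]: "nsq M f \<ge> 0"
  by (simp add: nsq_def)

lemma nsq_zero [simp]: "nsq M (\<lambda>_. 0) = 0"
  by (simp add: nsq_def)

lemma nsq_scale: "nsq M (\<lambda>x. c * f x) = (cmod c)\<^sup>2 * nsq M f"
  by (simp add: nsq_def norm_mult power_mult_distrib)

lemma nsq_eq_0: "sqi M f \<Longrightarrow> nsq M f = 0 \<longleftrightarrow> (AE x in M. f x = 0)"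
  unfolding nsq_def by (subst integral_nonneg_eq_0_iff_AE) (auto simp: sqi_def)

lemma nsq_add_le:
  assumes f: "sqi M f" and g: "sqi M g"
  shows "nsq M (\<lambda>x. f x + g x) \<le> 2 * nsq M f + 2 * nsq M g"
proof -
  have "nsq M (\<lambda>x. f x + g x) \<le> (\<integral>x. 2 * (cmod (f x))\<^sup>2 + 2 * (cmod (g x))\<^sup>2 \<partial>M)"
    unfolding nsq_def using f g sqi_add[OF f g] cmod_add_sq_le
    by (intro integral_mono) (auto simp: sqi_def)
  also have "\<dots> = 2 * nsq M f + 2 * nsq M g"
    using f g by (simp add: nsq_def sqi_def)
  finally show ?thesis .
qed

lemma nsq_cong_AE:
  "sqi M f \<Longrightarrow> sqi M g \<Longrightarrow> AE x in M. f x = g x \<Longrightarrow> nsq M f = nsq M g"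
  unfolding nsq_def by (intro integral_cong_AE) (auto simp: sqi_def)

lemma nsq_minus_commute: "nsq M (\<lambda>x. f x - g x) = nsq M (\<lambda>x. g x - f x)"
  by (simp add: nsq_def norm_minus_commute)

lemma ip_cong_AE:
  assumes "sqi M f" "sqi M f'" "sqi M g" "sqi M g'" "AE x in M. f x = f' x" "AE x in M. g x = g' x"
  shows "ip M f g = ip M f' g'"
  unfolding ip_def
  using assms sqi_integrable_ip[of M f g] sqi_integrable_ip[of M f' g']
  by (intro integral_cong_AE) (auto elim: eventually_elim2)

lemma ip_AE_zero: "AE x in M. f x = 0 \<Longrightarrow> sqi M f \<Longrightarrow> sqi M g \<Longrightarrow> ip M f g = 0"
  using ip_cong_AE[of M f "\<lambda>_. 0" g g] by (simp add: ip_def)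

lemma nsq_diff_expand:
  assumes f: "sqi M f" and g: "sqi M g"
  shows "nsq M (\<lambda>x. f x - g x) = nsq M f - 2 * Re (ip M f g) + nsq M g"
proof -
  have fg: "sqi M (\<lambda>x. f x - g x)" using f g by (rule sqi_diff)
  have "complex_of_real (nsq M (\<lambda>x. f x - g x)) = ip M f f - ip M g f - (ip M f g - ip M g g)"
    using f g fg by (simp add: ip_self[symmetric] ip_diff_left ip_diff_right)
  also have "ip M g f = cnj (ip M f g)" by (simp add: ip_cnj)
  finally have "Re (complex_of_real (nsq M (\<lambda>x. f x - g x))) =
      Re (ip M f f - cnj (ip M f g) - (ip M f g - ip M g g))" by simp
  then show ?thesis by (simp add: ip_self)
qed

lemma ip_cauchy_schwarz:
  assumes f: "sqi M f" and g: "sqi M g"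
  shows "(cmod (ip M f g))\<^sup>2 \<le> nsq M f * nsq M g"
proof (cases "nsq M g = 0")
  case True
  then have "AE x in M. g x = 0" using nsq_eq_0[OF g] by simp
  then have "ip M g f = 0" using f g by (intro ip_AE_zero)
  then have "ip M f g = 0" by (metis ip_cnj complex_cnj_zero)
  then show ?thesis using True by simp
next
  case False
  \<comment> \<open>\<open>c * g\<close> is the projection of \<open>f\<close> onto the line of
    \<open>g\<close>; the inequality is the nonnegativity of the squared distance from
    \<open>f\<close> to it.\<close>
  define c where "c = ip M f g / of_real (nsq M g)"
  have cg: "sqi M (\<lambda>x. c * g x)" using g by (rule sqi_scale)
  have "0 \<le> nsq M (\<lambda>x. f x - c * g x)" by simp
  also have "\<dots> = nsq M f - 2 * Re (ip M f (\<lambda>x. c * g x)) + nsq M (\<lambda>x. c * g x)"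
    by (rule nsq_diff_expand[OF f cg])
  also have "ip M f (\<lambda>x. c * g x) = cnj c * ip M f g"
    by (rule ip_scale_right)
  also have "\<dots> = of_real ((cmod (ip M f g))\<^sup>2 / nsq M g)"
    using complex_norm_square[of "ip M f g"] by (simp add: c_def mult.commute)
  also have "nsq M (\<lambda>x. c * g x) = (cmod (ip M f g))\<^sup>2 / nsq M g"
    unfolding nsq_scale using False by (simp add: c_def norm_divide power_divide power2_eq_square)
  finally have "(cmod (ip M f g))\<^sup>2 / nsq M g \<le> nsq M f" by simp
  moreover have "nsq M g > 0" using False nsq_nonneg[of M g] by linarith
  ultimately show ?thesis by (simp add: field_simps)
qed

lemma ip_tendsto:
  assumes f: "\<And>n. sqi M (f n)" "sqi M f0" "(\<lambda>n. nsq M (\<lambda>x. f n x - f0 x)) \<longlonglongrightarrow> 0" and g: "sqi M g"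
  shows "(\<lambda>n. ip M (f n) g) \<longlonglongrightarrow> ip M f0 g"
proof -
  have "(\<lambda>n. (cmod (ip M (f n) g - ip M f0 g))\<^sup>2) \<longlonglongrightarrow> 0"
  proof (rule tendsto_sandwich[OF _ _ tendsto_const])
    show "\<forall>\<^sub>F n in sequentially. (cmod (ip M (f n) g - ip M f0 g))\<^sup>2 \<le> nsq M (\<lambda>x. f n x - f0 x) * nsq M g"
      using ip_cauchy_schwarz[OF sqi_diff[OF f(1,2)] g] by (simp add: ip_diff_left f g)
    show "(\<lambda>n. nsq M (\<lambda>x. f n x - f0 x) * nsq M g) \<longlonglongrightarrow> 0"
      using tendsto_mult_right[OF f(3), of "nsq M g"] by simp
  qed simp
  then have "(\<lambda>n. sqrt ((cmod (ip M (f n) g - ip M f0 g))\<^sup>2)) \<longlonglongrightarrow> sqrt 0"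
    by (rule tendsto_real_sqrt)
  then show ?thesis by (simp add: tendsto_norm_zero_iff LIM_zero_iff)
qed

lemma nsq_tendsto:
  assumes f: "\<And>n. sqi M (f n)" "sqi M f0" "(\<lambda>n. nsq M (\<lambda>x. f n x - f0 x)) \<longlonglongrightarrow> 0"
  shows "(\<lambda>n. nsq M (f n)) \<longlonglongrightarrow> nsq M f0"
proof -
  have "nsq M (f n) = nsq M (\<lambda>x. f n x - f0 x) + 2 * Re (ip M (f n) f0) - nsq M f0" for n
    using nsq_diff_expand[OF f(1,2)] by simp
  moreover have "(\<lambda>n. nsq M (\<lambda>x. f n x - f0 x) + 2 * Re (ip M (f n) f0) - nsq M f0)
      \<longlonglongrightarrow> 0 + 2 * Re (ip M f0 f0) - nsq M f0"
    by (intro tendsto_intros ip_tendsto f)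
  ultimately show ?thesis by (simp add: ip_self)
qed

text \<open>The Riesz--Fischer theorem: a Cauchy sequence has a subsequence that moves by at most
  $4^{-k}$ at step $k$, and such a subsequence converges almost everywhere.\<close>

lemma riesz_fischer:
  fixes g :: "nat \<Rightarrow> 'a \<Rightarrow> complex"
  assumes g: "\<And>n. sqi M (g n)"
    and C: "\<And>e. e > 0 \<Longrightarrow> \<exists>N. \<forall>m\<ge>N. \<forall>n\<ge>N. nsq M (\<lambda>x. g m x - g n x) < e"
  obtains G s where "sqi M G" "(\<lambda>n. nsq M (\<lambda>x. g n x - G x)) \<longlonglongrightarrow> 0"
    "strict_mono s" "AE x in M. (\<lambda>k. g (s k) x) \<longlonglongrightarrow> G x"
proof -
  have [measurable]: "g n \<in> borel_measurable M" for n using g by (auto simp: sqi_def)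
  \<comment> \<open>The rate \<open>(1/8)^k\<close> leaves a summable \<open>(1/2)^k\<close> after
    multiplication by the weight \<open>4^k\<close>; finiteness of the weighted sum then makes the
    k-th increment at most \<open>(1/2)^k\<close> eventually, at almost every point.\<close>
  have "\<exists>N. \<forall>m\<ge>N. \<forall>n\<ge>N. nsq M (\<lambda>x. g m x - g n x) < (1/8)^k" for k :: nat
    by (rule C) simp
  then obtain N where N: "\<And>k m n. m \<ge> N k \<Longrightarrow> n \<ge> N k \<Longrightarrow> nsq M (\<lambda>x. g m x - g n x) < (1/8)^k"
    by metis
  \<comment> \<open>The summand \<open>k\<close> makes \<open>s\<close> strictly increasing, and the
    sum dominates \<open>N k\<close>.\<close>
  define s where "s k = k + (\<Sum>j\<le>k. N j)" for k
  have s: "strict_mono s" by (rule strict_monoI_Suc) (simp add: s_def)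
  have sN: "s k \<ge> N k" for k
    using member_le_sum[of k "{..k}" N] by (simp add: s_def)
  have sS: "s (Suc k) \<ge> N k" for k using sN[of k] strict_monoD[OF s, of k "Suc k"] by simp
  define d where "d k x = (cmod (g (s (Suc k)) x - g (s k) x))\<^sup>2" for k x
  have dm [measurable]: "d k \<in> borel_measurable M" for k unfolding d_def by measurable
  have d0: "d k x \<ge> 0" for k x by (simp add: d_def)
  have d_int: "integrable M (d k)" for k
    using sqi_diff[OF g g] unfolding d_def by (simp add: sqi_def)
  have dI: "(\<integral>x. d k x \<partial>M) \<le> (1/8)^k" for k
    using N[OF sS sN, of k] by (simp add: d_def nsq_def less_imp_le)
  have "(\<integral>\<^sup>+x. (\<Sum>k. ennreal (4^k * d k x)) \<partial>M) = (\<Sum>k. \<integral>\<^sup>+x. ennreal (4^k * d k x) \<partial>M)"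
    by (intro nn_integral_suminf) measurable
  also have "\<dots> \<le> (\<Sum>k. ennreal ((1/2)^k))"
  proof (intro suminf_le)
    fix k
    have "(\<integral>\<^sup>+x. ennreal (4^k * d k x) \<partial>M) = ennreal (\<integral>x. 4^k * d k x \<partial>M)"
      using d_int d0 by (intro nn_integral_eq_integral) auto
    also have "\<dots> \<le> ennreal (4^k * (1/8)^k)"
      using dI by (intro ennreal_leI) simp
    also have "(4::real)^k * (1/8)^k = (1/2)^k" by (simp flip: power_mult_distrib)
    finally show "(\<integral>\<^sup>+x. ennreal (4^k * d k x) \<partial>M) \<le> ennreal ((1/2)^k)" .
  qed auto
  also have "\<dots> = ennreal (\<Sum>k. (1/2)^k)" by (intro suminf_ennreal2) (auto intro: summable_geometric)
  finally have fin: "(\<integral>\<^sup>+x. (\<Sum>k. ennreal (4^k * d k x)) \<partial>M) \<noteq> \<infinity>"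
    by (metis ennreal_less_top infinity_ennreal_def leD)
  have "AE x in M. (\<Sum>k. ennreal (4^k * d k x)) \<noteq> \<infinity>"
    using fin by (intro nn_integral_noteq_infinite) measurable
  then have conv: "AE x in M. convergent (\<lambda>k. g (s k) x)"
  proof eventually_elim
    case (elim x)
    have sum4: "summable (\<lambda>k. 4^k * d k x)"
      using elim d0 by (intro summable_suminf_not_top) auto
    have "summable (\<lambda>k. g (s (Suc k)) x - g (s k) x)"
    proof (rule summable_comparison_test_ev)
      have "(\<lambda>k. 4^k * d k x) \<longlonglongrightarrow> 0" by (rule summable_LIMSEQ_zero[OF sum4])
      then have "\<forall>\<^sub>F k in sequentially. 4^k * d k x < 1"
        by (rule order_tendstoD) simp
      then show "\<forall>\<^sub>F k in sequentially. norm (g (s (Suc k)) x - g (s k) x) \<le> (1/2)^k"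
      proof eventually_elim
        case (elim k)
        have "(2^k * cmod (g (s (Suc k)) x - g (s k) x))\<^sup>2 = 4^k * d k x"
          by (simp add: d_def power_mult_distrib power2_eq_square flip: power_mult_distrib)
        also have "\<dots> \<le> 1\<^sup>2" using elim by simp
        finally have "2^k * cmod (g (s (Suc k)) x - g (s k) x) \<le> 1"
          by (rule power2_le_imp_le) simp
        then show ?case by (simp add: field_simps)
      qed
      show "summable (\<lambda>k. (1/2::real)^k)" by (rule summable_geometric) simp
    qed
    then have "convergent (\<lambda>n. \<Sum>k<n. g (s (Suc k)) x - g (s k) x)"
      by (simp add: summable_iff_convergent)
    then have "convergent (\<lambda>n. g (s n) x - g (s 0) x)"
      using sum_lessThan_telescope[of "\<lambda>k. g (s k) x"] by simp
    then show ?case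
      using convergent_add[OF _ convergent_const[of "g (s 0) x"], of "\<lambda>n. g (s n) x - g (s 0) x"] by simp
  qed
  define G where "G x = lim (\<lambda>k. g (s k) x)" for x
  have Gm [measurable]: "G \<in> borel_measurable M"
    unfolding G_def by (rule borel_measurable_lim_metric) measurable
  have AEG: "AE x in M. (\<lambda>k. g (s k) x) \<longlonglongrightarrow> G x"
    using conv by eventually_elim (simp add: G_def convergent_LIMSEQ_iff)
  \<comment> \<open>Fatou's lemma along the subsequence, with the first index \<open>n\<close> held
    fixed: this upgrades convergence of the subsequence to L^2 convergence of the whole
    sequence.\<close>
  have fatou: "(\<integral>\<^sup>+x. ennreal ((cmod (g n x - G x))\<^sup>2) \<partial>M) \<le> ennreal e"
    if e: "e > 0" and n: "\<And>m. m \<ge> n \<Longrightarrow> nsq M (\<lambda>x. g n x - g m x) < e" for n e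
  proof -
    have "(\<integral>\<^sup>+x. ennreal ((cmod (g n x - G x))\<^sup>2) \<partial>M)
        = (\<integral>\<^sup>+x. liminf (\<lambda>k. ennreal ((cmod (g n x - g (s k) x))\<^sup>2)) \<partial>M)"
    proof (rule nn_integral_cong_AE)
      show "AE x in M. ennreal ((cmod (g n x - G x))\<^sup>2) = liminf (\<lambda>k. ennreal ((cmod (g n x - g (s k) x))\<^sup>2))"
        using AEG
      proof eventually_elim
        case (elim x)
        then have "(\<lambda>k. ennreal ((cmod (g n x - g (s k) x))\<^sup>2)) \<longlonglongrightarrow> ennreal ((cmod (g n x - G x))\<^sup>2)"
          by (intro tendsto_ennrealI tendsto_intros)
        then show ?case by (intro lim_imp_Liminf[symmetric]) auto
      qed
    qed
    also have "\<dots> \<le> liminf (\<lambda>k. \<integral>\<^sup>+x. ennreal ((cmod (g n x - g (s k) x))\<^sup>2) \<partial>M)"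
      by (rule nn_integral_liminf) measurable
    also have "\<dots> \<le> liminf (\<lambda>k. ennreal e)"
    proof (rule Liminf_mono)
      show "\<forall>\<^sub>F k in sequentially. (\<integral>\<^sup>+x. ennreal ((cmod (g n x - g (s k) x))\<^sup>2) \<partial>M) \<le> ennreal e"
      proof (rule eventually_sequentiallyI[of n])
        fix k assume "k \<ge> n"
        then have "s k \<ge> n" using seq_suble[OF s, of k] by simp
        have "(\<integral>\<^sup>+x. ennreal ((cmod (g n x - g (s k) x))\<^sup>2) \<partial>M) = ennreal (nsq M (\<lambda>x. g n x - g (s k) x))"
          unfolding nsq_def using sqi_diff[OF g g] by (intro nn_integral_eq_integral) (auto simp: sqi_def)
        then show "(\<integral>\<^sup>+x. ennreal ((cmod (g n x - g (s k) x))\<^sup>2) \<partial>M) \<le> ennreal e"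
          using n[OF \<open>s k \<ge> n\<close>] by (simp add: ennreal_leI less_imp_le)
      qed
    qed
    also have "\<dots> = ennreal e" by (simp add: Liminf_const)
    finally show ?thesis .
  qed
  have diff_sqi: "sqi M (\<lambda>x. g n x - G x) \<and> nsq M (\<lambda>x. g n x - G x) \<le> e"
    if e: "e > 0" and n: "\<And>m. m \<ge> n \<Longrightarrow> nsq M (\<lambda>x. g n x - g m x) < e" for n e
  proof -
    have le: "(\<integral>\<^sup>+x. ennreal ((cmod (g n x - G x))\<^sup>2) \<partial>M) \<le> ennreal e" by (rule fatou[OF e n])
    have int: "integrable M (\<lambda>x. (cmod (g n x - G x))\<^sup>2)"
      using le by (intro integrableI_bounded) (auto simp: less_top[symmetric] top_unique)
    have "ennreal (nsq M (\<lambda>x. g n x - G x)) = (\<integral>\<^sup>+x. ennreal ((cmod (g n x - G x))\<^sup>2) \<partial>M)"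
      unfolding nsq_def using int by (intro nn_integral_eq_integral[symmetric]) auto
    then have "nsq M (\<lambda>x. g n x - G x) \<le> e" using le e by (metis ennreal_le_iff less_imp_le)
    then show ?thesis using int by (simp add: sqi_def)
  qed
  obtain N1 where N1: "\<forall>m\<ge>N1. \<forall>n\<ge>N1. nsq M (\<lambda>x. g m x - g n x) < 1" using C[of 1] by auto
  have N1s: "sqi M (\<lambda>x. g N1 x - G x)" using diff_sqi[of 1 N1] N1 by auto
  have "(\<lambda>x. g N1 x - (g N1 x - G x)) = G" by auto
  then have Gs: "sqi M G" using sqi_diff[OF g[of N1] N1s] by (simp only:)
  moreover have "(\<lambda>n. nsq M (\<lambda>x. g n x - G x)) \<longlonglongrightarrow> 0"
  proof (rule LIMSEQ_I)
    fix r :: real assume "r > 0"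
    then obtain N2 where N2: "\<forall>m\<ge>N2. \<forall>n\<ge>N2. nsq M (\<lambda>x. g m x - g n x) < r/2" using C[of "r/2"] by auto
    have "nsq M (\<lambda>x. g n x - G x) \<le> r/2" if "n \<ge> N2" for n
      using diff_sqi[of "r/2" n] N2 that \<open>r > 0\<close> by auto
    then show "\<exists>no. \<forall>n\<ge>no. norm (nsq M (\<lambda>x. g n x - G x) - 0) < r"
      using \<open>r > 0\<close> by (intro exI[of _ N2]) fastforce
  qed
  ultimately show ?thesis using that s AEG by blast
qed

text \<open>A minimising sequence in the subspace \<open>S\<close> is Cauchy by the parallelogram law; its limit
  differs from \<open>x\<close> by something orthogonal to \<open>S\<close>, hence by a null function if \<open>S\<close> is total.\<close>

lemma total_dense:
  assumes H: "\<And>f. f \<in> H \<Longrightarrow> sqi M f"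
    "\<And>f g c. f \<in> H \<Longrightarrow> g \<in> H \<Longrightarrow> (\<lambda>x. f x + c * g x) \<in> H"
    "\<And>f f0. (\<And>n. f n \<in> H) \<Longrightarrow> sqi M f0 \<Longrightarrow> (\<lambda>n. nsq M (\<lambda>x. f n x - f0 x)) \<longlonglongrightarrow> 0 \<Longrightarrow> f0 \<in> H"
    and S: "S \<subseteq> H" "(\<lambda>_. 0) \<in> S" "\<And>f g c. f \<in> S \<Longrightarrow> g \<in> S \<Longrightarrow> (\<lambda>x. f x + c * g x) \<in> S"
    and total: "\<And>f. f \<in> H \<Longrightarrow> (\<And>p. p \<in> S \<Longrightarrow> ip M f p = 0) \<Longrightarrow> nsq M f = 0"
    and x: "x \<in> H"
  obtains p where "\<And>n. p n \<in> S" "(\<lambda>n. nsq M (\<lambda>t. p n t - x t)) \<longlonglongrightarrow> 0"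
proof -
  define D where "D p = nsq M (\<lambda>t. p t - x t)" for p
  define d where "d = (INF p\<in>S. D p)"
  have bdd: "bdd_below (D ` S)" by (rule bdd_belowI[of _ 0]) (auto simp: D_def)
  have dle: "d \<le> D p" if "p \<in> S" for p unfolding d_def using bdd that by (rule cINF_lower)
  have Sq: "sqi M p" if "p \<in> S" for p using that S(1) H(1) by blast
  have "\<exists>p\<in>S. D p < d + 1 / Suc n" for n
  proof -
    have "(INF p\<in>S. D p) < d + 1 / Suc n" unfolding d_def by simp
    then show ?thesis using cINF_less_iff[of S D "d + 1 / Suc n"] bdd S(2) by blast
  qed
  then obtain p where p: "\<And>n. p n \<in> S" "\<And>n. D (p n) < d + 1 / Suc n" by metis
  have par: "nsq M (\<lambda>t. p m t - p n t) \<le> 2 / Suc m + 2 / Suc n" for m n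
  proof -
    let ?u = "\<lambda>t. p m t - x t" and ?v = "\<lambda>t. p n t - x t"
    have uv: "sqi M ?u" "sqi M ?v" using p(1) H(1) x Sq by (auto intro!: sqi_diff)
    have "(\<lambda>t. p m t + 1 * p n t) \<in> S" using p(1) by (intro S(3))
    \<comment> \<open>The midpoint of \<open>p m\<close> and \<open>p n\<close>. Closure of
      \<open>S\<close> is given in the form \<open>f + c * g\<close>, so scaling by 1/2 is written
      as adding a multiple to zero.\<close>
    then have "(\<lambda>t. 0 + (1/2) * (p m t + 1 * p n t)) \<in> S" using S(2) S(3)[of "\<lambda>_. 0" _ "1/2"] by blast
    then have "d \<le> D (\<lambda>t. 0 + (1/2) * (p m t + 1 * p n t))" by (rule dle)
    also have "\<dots> = nsq M (\<lambda>t. (1/2) * (?u t - (-1) * ?v t))"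
      unfolding D_def by (rule arg_cong[where f = "nsq M"]) (auto simp: field_simps)
    also have "\<dots> = (1/4) * nsq M (\<lambda>t. ?u t - (-1) * ?v t)"
      unfolding nsq_scale by (simp add: power2_eq_square norm_divide)
    also have "\<dots> = (1/4) * (nsq M ?u + 2 * Re (ip M ?u ?v) + nsq M ?v)"
      using nsq_diff_expand[OF uv(1) sqi_scale[OF uv(2), of "-1"]]
        ip_scale_right[of M ?u "-1" ?v] nsq_scale[of M "-1" ?v] by (simp add: algebra_simps)
    finally have 1: "4 * d \<le> nsq M ?u + 2 * Re (ip M ?u ?v) + nsq M ?v" by simp
    have "nsq M (\<lambda>t. p m t - p n t) = nsq M (\<lambda>t. ?u t - ?v t)" by simp
    also have "\<dots> = nsq M ?u - 2 * Re (ip M ?u ?v) + nsq M ?v" by (rule nsq_diff_expand[OF uv])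
    also have "\<dots> \<le> 2 * nsq M ?u + 2 * nsq M ?v - 4 * d" using 1 by linarith
    also have "\<dots> \<le> 2 * (d + 1 / Suc m) + 2 * (d + 1 / Suc n) - 4 * d"
      using p(2)[of m] p(2)[of n] unfolding D_def by (intro diff_mono add_mono mult_left_mono) auto
    finally show ?thesis by simp
  qed
  have "\<exists>N. \<forall>m\<ge>N. \<forall>n\<ge>N. nsq M (\<lambda>t. p m t - p n t) < e" if e: "e > 0" for e
  proof -
    obtain N where N: "inverse (real (Suc N)) < e / 4" using reals_Archimedean[of "e/4"] e by auto
    have "2 / Suc m < e / 2" if "m \<ge> N" for m
    proof -
      have "inverse (real (Suc m)) \<le> inverse (real (Suc N))" using that by (simp add: le_imp_inverse_le)
      then have "2 * inverse (real (Suc m)) < e / 2" using N by linarith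
      then show ?thesis by (simp only: divide_inverse)
    qed
    then have "\<forall>m\<ge>N. \<forall>n\<ge>N. nsq M (\<lambda>t. p m t - p n t) < e"
      using par by (smt (verit) field_sum_of_halves)
    then show ?thesis by blast
  qed
  from riesz_fischer[OF Sq[OF p(1)] this]
  obtain y s where y: "sqi M y" "(\<lambda>n. nsq M (\<lambda>t. p n t - y t)) \<longlonglongrightarrow> 0" by metis
  have yH: "y \<in> H" using H(3)[of p y] p(1) S(1) y by auto
  let ?r = "\<lambda>t. y t - x t"
  have xs: "sqi M x" using x H(1) by auto
  have rH: "?r \<in> H" using H(2)[OF yH x, of "-1"] by simp
  have rs: "sqi M ?r" using rH H(1) by auto
  have "(\<lambda>n. nsq M (\<lambda>t. p n t - x t)) \<longlonglongrightarrow> nsq M ?r"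
    using y xs p(1) Sq by (intro nsq_tendsto sqi_diff) auto
  moreover have "(\<lambda>n. nsq M (\<lambda>t. p n t - x t)) \<longlonglongrightarrow> d"
  proof (rule tendsto_sandwich[OF _ _ tendsto_const])
    show "\<forall>\<^sub>F n in sequentially. d \<le> nsq M (\<lambda>t. p n t - x t)"
      using dle[OF p(1)] by (auto simp: D_def)
    show "\<forall>\<^sub>F n in sequentially. nsq M (\<lambda>t. p n t - x t) \<le> d + 1 / Suc n"
      using p(2) by (auto simp: D_def less_imp_le)
    show "(\<lambda>n. d + 1 / real (Suc n)) \<longlonglongrightarrow> d"
      using tendsto_add[OF tendsto_const[of d] LIMSEQ_inverse_real_of_nat] by (simp add: inverse_eq_divide)
  qed
  ultimately have dr: "nsq M ?r = d" by (rule LIMSEQ_unique)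
  have orth: "ip M ?r q = 0" if q: "q \<in> S" for q
  proof -
    have qs: "sqi M q" by (rule Sq[OF q])
    \<comment> \<open>\<open>y\<close> need not lie in \<open>S\<close>, so minimality is passed
      from the \<open>p n\<close> to the limit.\<close>
    have ineq: "d \<le> nsq M (\<lambda>t. ?r t - c * q t)" for c
    proof -
      have "d \<le> nsq M (\<lambda>t. (p n t + (-c) * q t) - x t)" for n
        using dle[OF S(3)[OF p(1) q, of n "-c"]] unfolding D_def .
      moreover have "(\<lambda>n. nsq M (\<lambda>t. (p n t + (-c) * q t) - x t)) \<longlonglongrightarrow> nsq M (\<lambda>t. ?r t - c * q t)"
      proof (intro nsq_tendsto sqi_diff sqi_add sqi_scale y(1) xs qs Sq p(1))
        have "(\<lambda>t. p n t + - c * q t - x t - (y t - x t - c * q t)) = (\<lambda>t. p n t - y t)" for n by auto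
        then show "(\<lambda>n. nsq M (\<lambda>t. p n t + - c * q t - x t - (y t - x t - c * q t))) \<longlonglongrightarrow> 0"
          using y(2) by (simp only:)
      qed
      ultimately show ?thesis by (intro LIMSEQ_le_const) auto
    qed
    show ?thesis
    proof (cases "nsq M q = 0")
      case True
      then have "(cmod (ip M ?r q))\<^sup>2 \<le> 0" using ip_cauchy_schwarz[OF rs qs] by simp
      then show ?thesis by simp
    next
      case False
      then have pos: "nsq M q > 0" using nsq_nonneg[of M q] by linarith
      \<comment> \<open>The multiple of \<open>q\<close> closest to \<open>?r\<close>; unless
        \<open>?r\<close> is orthogonal to \<open>q\<close>, subtracting it would bring the squared
        distance below \<open>d\<close>.\<close>
      define c where "c = ip M ?r q / of_real (nsq M q)"
      have "nsq M ?r \<le> nsq M (\<lambda>t. ?r t - c * q t)" using ineq dr by simp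
      also have "\<dots> = nsq M ?r - 2 * Re (ip M ?r (\<lambda>t. c * q t)) + nsq M (\<lambda>t. c * q t)"
        by (rule nsq_diff_expand[OF rs sqi_scale[OF qs]])
      also have "ip M ?r (\<lambda>x. c * q x) = cnj c * ip M ?r q"
        by (rule ip_scale_right)
      also have "\<dots> = of_real ((cmod (ip M ?r q))\<^sup>2 / nsq M q)"
        using complex_norm_square[of "ip M ?r q"] by (simp add: c_def mult.commute)
      also have "nsq M (\<lambda>x. c * q x) = (cmod (ip M ?r q))\<^sup>2 / nsq M q"
        unfolding nsq_scale using False by (simp add: c_def norm_divide power_divide power2_eq_square)
      finally have "(cmod (ip M ?r q))\<^sup>2 / nsq M q \<le> 0" by simp
      then have "(cmod (ip M ?r q))\<^sup>2 \<le> 0" using pos by (simp add: field_simps)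
      then show ?thesis by simp
    qed
  qed
  then have "nsq M ?r = 0" by (intro total rH)
  then show ?thesis using \<open>(\<lambda>n. nsq M (\<lambda>t. p n t - x t)) \<longlonglongrightarrow> nsq M ?r\<close> p(1) that[of p] by simp
qed

section \<open>Poisson kernel and the maximal inequality\<close>

definition taylor :: "(complex \<Rightarrow> complex) \<Rightarrow> nat \<Rightarrow> complex" where
  "taylor f n = (deriv ^^ n) f 0 / fact n"

lemma taylor_sums:
  assumes "f holomorphic_on ball 0 1" "cmod z < 1"
  shows "(\<lambda>n. taylor f n * z ^ n) sums f z"
  using holomorphic_power_series[OF assms(1), of z] assms(2) by (simp add: taylor_def)

lemma taylor_0: "taylor f 0 = f 0"
  by (simp add: taylor_def)

lemma taylor_summable:
  assumes f: "f holomorphic_on ball 0 1" and r: "0 \<le> r" "r < 1"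
  shows "summable (\<lambda>n. cmod (taylor f n * of_real r ^ n))"
proof -
  \<comment> \<open>Any radius strictly between \<open>r\<close> and 1 would do: convergence there
    gives absolute convergence at \<open>r\<close>.\<close>
  have s: "summable (\<lambda>n. taylor f n * (of_real ((1 + r) / 2)) ^ n)"
    by (rule sums_summable[OF taylor_sums[OF f]]) (use r in \<open>auto simp del: of_real_divide of_real_add\<close>)
  show ?thesis
    by (rule powser_insidea[OF s]) (use r in \<open>simp del: of_real_divide of_real_add\<close>)
qed

lemma holo_on_circle:
  assumes f: "f holomorphic_on ball 0 1" and r: "0 \<le> r" "r < 1" and x: "cmod x = 1"
  shows "f (of_real r * x) = (\<Sum>n. (taylor f n * of_real r ^ n) * x ^ n)"
proof -
  have "(\<lambda>n. taylor f n * (of_real r * x) ^ n) sums f (of_real r * x)"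
    by (rule taylor_sums[OF f]) (use r x in \<open>simp add: norm_mult\<close>)
  then show ?thesis by (simp add: sums_iff power_mult_distrib mult.assoc)
qed

lemma dilate_cont:
  assumes f: "f holomorphic_on ball 0 1" and r: "0 \<le> r" "r < 1"
  shows "continuous_on (sphere 0 1) (\<lambda>x. f (of_real r * x))"
proof (rule continuous_on_compose2[OF holomorphic_on_imp_continuous_on[OF f]])
  show "continuous_on (sphere 0 1) (\<lambda>x. complex_of_real r * x)" by (intro continuous_intros)
qed (use r in \<open>auto simp: norm_mult\<close>)

lemma dilate_measurable:
  assumes f: "f holomorphic_on ball 0 1" and r: "0 \<le> r" "r < 1"
  shows "(\<lambda>x. f (of_real r * x)) \<in> borel_measurable circ"
  by (intro circle_measurable_cont[OF sets_circ] dilate_cont assms)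

lemma dilate_integrable:
  assumes f: "f holomorphic_on ball 0 1" and r: "0 \<le> r" "r < 1"
  shows "integrable circ (\<lambda>x. f (of_real r * x))"
  by (intro integrable_circ_cont dilate_cont assms)

lemma dilate_coeff:
  assumes f: "f holomorphic_on ball 0 1" and r: "0 \<le> r" "r < 1"
  shows "(\<integral>x. f (of_real r * x) * cnj x ^ n \<partial>circ) = taylor f n * of_real r ^ n"
    and "(\<integral>x. f (of_real r * x) * x ^ Suc n \<partial>circ) = 0"
proof -
  have "(\<integral>x. f (of_real r * x) * h x \<partial>circ) = (\<integral>x. (\<Sum>n. (taylor f n * of_real r ^ n) * x ^ n) * h x \<partial>circ)" for h
    by (intro Bochner_Integration.integral_cong refl) (simp add: space_circ holo_on_circle[OF f r])
  then show "(\<integral>x. f (of_real r * x) * cnj x ^ n \<partial>circ) = taylor f n * of_real r ^ n"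
    "(\<integral>x. f (of_real r * x) * x ^ Suc n \<partial>circ) = 0"
    using power_series_coeff[OF taylor_summable[OF f r], of n] by (simp_all only:)
qed

text \<open>The Cauchy kernel reproduces an analytic function. Its conjugate is a power series in
  \<open>x\<close>, and of the products \<open>f (r x) * x ^ n\<close> only the one with
  \<open>n = 0\<close> has a nonzero integral, which leaves the value at the centre.\<close>

lemma dilate_cauchy:
  assumes f: "f holomorphic_on ball 0 1" and r: "0 \<le> r" "r < 1" and z: "cmod z < 1"
  shows "(\<integral>x. f (of_real r * x) / (1 - z * cnj x) \<partial>circ) = f (of_real r * z)"
    and "(\<integral>x. f (of_real r * x) * cnj (1 / (1 - z * cnj x)) \<partial>circ) = f 0"
proof -
  have "(\<lambda>n. z ^ n * (taylor f n * of_real r ^ n)) sums (\<integral>x. f (of_real r * x) / (1 - z * cnj x) \<partial>circ)"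
    using cauchy_transform_sums[OF sets_circ dilate_integrable[OF f r] z]
    unfolding dilate_coeff(1)[OF f r] .
  moreover have "r * cmod z < 1"
    using r z mult_right_mono[of r 1 "cmod z"] by simp
  then have "(\<lambda>n. taylor f n * (of_real r * z) ^ n) sums f (of_real r * z)"
    using r by (intro taylor_sums[OF f]) (simp add: norm_mult)
  then have "(\<lambda>n. z ^ n * (taylor f n * of_real r ^ n)) sums f (of_real r * z)"
    by (simp add: power_mult_distrib mult_ac)
  ultimately show "(\<integral>x. f (of_real r * x) / (1 - z * cnj x) \<partial>circ) = f (of_real r * z)"
    by (rule sums_unique2)
  let ?g = "\<lambda>x. cnj (f (of_real r * x))"
  have gi: "integrable circ ?g" using dilate_integrable[OF f r] by simp
  have c: "(\<integral>x. ?g x * cnj x ^ n \<partial>circ) = (if n = 0 then cnj (f 0) else 0)" for n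
  proof -
    have "(\<integral>x. ?g x * cnj x ^ n \<partial>circ) = cnj (\<integral>x. f (of_real r * x) * x ^ n \<partial>circ)"
      by (simp flip: Bochner_Integration.integral_cnj)
    moreover have "(\<integral>x. f (of_real r * x) * x ^ n \<partial>circ) = (if n = 0 then f 0 else 0)"
      using dilate_coeff(1)[OF f r, of 0] dilate_coeff(2)[OF f r, of "n - 1"] by (cases n) (auto simp: taylor_0)
    ultimately show ?thesis by simp
  qed
  have "(\<lambda>n. z ^ n * (if n = 0 then cnj (f 0) else 0)) sums (\<integral>x. ?g x / (1 - z * cnj x) \<partial>circ)"
    using cauchy_transform_sums[OF sets_circ gi z] unfolding c .
  moreover have "(\<lambda>n. z ^ n * (if n = 0 then cnj (f 0) else 0)) = (\<lambda>n. if n = 0 then cnj (f 0) else 0)"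
    by auto
  ultimately have "(\<lambda>n. if n = 0 then cnj (f 0) else 0) sums (\<integral>x. ?g x / (1 - z * cnj x) \<partial>circ)"
    by (simp only:)
  then have "(\<integral>x. ?g x / (1 - z * cnj x) \<partial>circ) = cnj (f 0)"
    by (rule sums_unique2[OF _ sums_single])
  then have "cnj (\<integral>x. ?g x / (1 - z * cnj x) \<partial>circ) = f 0" by simp
  then show "(\<integral>x. f (of_real r * x) * cnj (1 / (1 - z * cnj x)) \<partial>circ) = f 0"
    unfolding Bochner_Integration.integral_cnj[symmetric] by simp
qed

section \<open>The Poisson kernel and its semigroup law\<close>

definition pois :: "complex \<Rightarrow> complex \<Rightarrow> real" where
  "pois z x = (1 - (cmod z)\<^sup>2) / (cmod (x - z))\<^sup>2"

lemma cmod_diff_circle: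
  assumes "cmod x = 1" shows "cmod (x - z) = cmod (1 - z * cnj x)"
proof -
  have "x * cnj x = 1" using assms by (simp add: complex_norm_square[symmetric])
  then have "1 - z * cnj x = (x - z) * cnj x" by (simp add: algebra_simps)
  then show ?thesis using assms by (simp add: norm_mult)
qed

text \<open>Splits the Poisson kernel into an analytic and an antianalytic Cauchy kernel, so that
  Poisson integrals are computed from two Cauchy transforms and the mean.\<close>

lemma pois_eq:
  assumes "cmod x = 1" "cmod z < 1"
  shows "of_real (pois z x) = 1 / (1 - z * cnj x) + cnj (1 / (1 - z * cnj x)) - 1"
proof -
  define u where "u = z * cnj x"
  have u: "cmod u = cmod z" using assms by (simp add: u_def norm_mult)
  have ne: "1 - u \<noteq> 0" "1 - cnj u \<noteq> 0"
  proof -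
    show "1 - u \<noteq> 0" using u assms by auto
    then show "1 - cnj u \<noteq> 0" by (metis complex_cnj_cancel_iff complex_cnj_diff complex_cnj_one complex_cnj_zero complex_cnj_cnj)
  qed
  have "complex_of_real (pois z x) = (1 - of_real ((cmod u)\<^sup>2)) / of_real ((cmod (1 - u))\<^sup>2)"
    using cmod_diff_circle[OF assms(1), of z] by (simp add: pois_def u u_def[symmetric])
  also have "\<dots> = (1 - u * cnj u) / ((1 - u) * (1 - cnj u))"
    unfolding complex_norm_square by simp
  also have "\<dots> = 1 / (1 - u) + 1 / (1 - cnj u) - 1"
  proof -
    have *: "(p + q - p * q) / (p * q) = 1 / p + 1 / q - 1" if "p \<noteq> 0" "q \<noteq> 0" for p q :: complex
      using that by (simp add: field_simps)
    \<comment> \<open>With \<open>p = 1 - u\<close> and \<open>q = 1 - cnj u\<close> the numerator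
      is \<open>p + q - p * q\<close>.\<close>
    have "1 - u * cnj u = (1 - u) + (1 - cnj u) - (1 - u) * (1 - cnj u)" by (simp add: algebra_simps)
    then show ?thesis using *[OF ne] by (simp only:)
  qed
  finally show ?thesis by (simp add: u_def)
qed

lemma pois_nonneg: "cmod z \<le> 1 \<Longrightarrow> pois z x \<ge> 0"
  by (simp add: pois_def power_le_one)

lemma pois_le:
  assumes "cmod x = 1" "cmod z \<le> \<rho>" "\<rho> < 1"
  shows "pois z x \<le> 1 / (1 - \<rho>)\<^sup>2"
proof -
  have "1 - \<rho> \<le> cmod (x - z)" using norm_triangle_ineq2[of x z] assms by simp
  then have "(1 - \<rho>)\<^sup>2 \<le> (cmod (x - z))\<^sup>2" using assms by (intro power_mono) auto
  moreover have "1 - (cmod z)\<^sup>2 \<le> 1" by simp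
  ultimately show ?thesis unfolding pois_def using assms by (intro frac_le) auto
qed

lemma pois_sym:
  assumes "cmod x = 1" "cmod y = 1"
  shows "pois (of_real r * x) y = pois (of_real r * y) x"
proof -
  have xx: "x * cnj x = 1" "y * cnj y = 1" using assms by (simp_all add: complex_norm_square[symmetric])
  have "(y - of_real r * x) * (cnj x * cnj y) = (y * cnj y) * cnj x - of_real r * cnj y * (x * cnj x)"
    by (simp add: algebra_simps)
  also have "\<dots> = cnj (x - of_real r * y)" by (simp add: xx)
  finally have "cmod ((y - of_real r * x) * (cnj x * cnj y)) = cmod (cnj (x - of_real r * y))"
    by (simp only:)
  then have "cmod (y - of_real r * x) = cmod (x - of_real r * y)"
    unfolding complex_mod_cnj norm_mult assms by simp
  then show ?thesis using assms by (simp add: pois_def norm_mult)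
qed

lemma pois_measurable [measurable]:
  assumes "f \<in> borel_measurable M" "g \<in> borel_measurable M"
  shows "(\<lambda>x. pois (f x) (g x)) \<in> borel_measurable M"
  unfolding pois_def using assms by measurable

lemma pois_integrable:
  assumes "cmod z < 1" shows "integrable circ (\<lambda>x. pois z x)"
proof (rule integrable_circ_bounded)
  show "pois z \<in> borel_measurable circ"
    by (rule circle_measurable_borel[OF sets_circ]) measurable
  show "norm (pois z x) \<le> 1 / (1 - cmod z)\<^sup>2" if "cmod x = 1" for x
    using pois_le[OF that order_refl assms] pois_nonneg[of z x] assms by simp
qed

lemma pois_integral:
  assumes f: "f holomorphic_on ball 0 1" and r: "0 \<le> r" "r < 1" and z: "cmod z < 1"
  shows "(\<integral>x. f (of_real r * x) * of_real (pois z x) \<partial>circ) = f (of_real r * z)"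
proof -
  let ?F = "\<lambda>x. f (of_real r * x)"
  have k: "(\<lambda>x. 1 / (1 - z * cnj x)) \<in> borel_measurable circ"
    by (rule circle_measurable_borel[OF sets_circ]) measurable
  have b: "cmod (1 / (1 - z * cnj x)) \<le> 1 / (1 - cmod z)" if "x \<in> space circ" for x
    using that z by (intro cauchy_kernel_bound) (auto simp: space_circ)
  have i1: "integrable circ (\<lambda>x. 1 / (1 - z * cnj x) * ?F x)"
    by (rule integrable_mult_bounded[OF dilate_integrable[OF f r] k b])
  have i2: "integrable circ (\<lambda>x. cnj (1 / (1 - z * cnj x)) * ?F x)"
    by (rule integrable_mult_bounded[OF dilate_integrable[OF f r], of _ "1 / (1 - cmod z)"])
      (use k b in \<open>auto intro!: borel_measurable_cnj simp del: complex_cnj_divide complex_cnj_diff complex_cnj_mult\<close>)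
  have "(\<integral>x. ?F x * of_real (pois z x) \<partial>circ)
     = (\<integral>x. 1 / (1 - z * cnj x) * ?F x + cnj (1 / (1 - z * cnj x)) * ?F x - ?F x \<partial>circ)"
  proof (intro Bochner_Integration.integral_cong refl)
    fix x assume "x \<in> space circ"
    then have "cmod x = 1" by (simp add: space_circ)
    from pois_eq[OF this z] show "?F x * of_real (pois z x) = 1 / (1 - z * cnj x) * ?F x + cnj (1 / (1 - z * cnj x)) * ?F x - ?F x"
      by (simp only:) (simp add: algebra_simps)
  qed
  also have "\<dots> = (\<integral>x. 1 / (1 - z * cnj x) * ?F x \<partial>circ) + (\<integral>x. cnj (1 / (1 - z * cnj x)) * ?F x \<partial>circ) - (\<integral>x. ?F x \<partial>circ)"
    using i1 i2 dilate_integrable[OF f r] by (subst Bochner_Integration.integral_diff) auto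
  also have "(\<integral>x. 1 / (1 - z * cnj x) * ?F x \<partial>circ) = f (of_real r * z)"
    using dilate_cauchy(1)[OF f r z] by simp
  also have "(\<integral>x. cnj (1 / (1 - z * cnj x)) * ?F x \<partial>circ) = f 0"
    using dilate_cauchy(2)[OF f r z] by (simp add: mult.commute)
  also have "(\<integral>x. ?F x \<partial>circ) = f 0"
    using dilate_coeff(1)[OF f r, of 0] by (simp add: taylor_0)
  finally show ?thesis by simp
qed

lemma pois_mass:
  assumes "cmod z < 1" shows "(\<integral>x. pois z x \<partial>circ) = 1"
proof -
  have "(\<integral>x. complex_of_real (pois z x) \<partial>circ) = 1"
    using pois_integral[of "\<lambda>_. 1" 0 z] assms by simp
  then show ?thesis by (simp only: integral_complex_of_real) simp
qed

text \<open>For fixed \<open>y\<close> the Poisson kernel is the real part of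
  \<open>f u = 2 / (1 - u * cnj y) - 1\<close>, analytic in the first argument. The Poisson formula
  at the point \<open>r x\<close>, applied to the dilation of \<open>f\<close> by \<open>s\<close>,
  is the semigroup law.\<close>

lemma pois_semigroup:
  assumes x: "cmod x = 1" "cmod y = 1" and r: "0 \<le> r" "r < 1" and s: "0 \<le> s" "s < 1"
  shows "(\<integral>t. pois (of_real r * x) t * pois (of_real s * y) t \<partial>circ) = pois (of_real (r * s) * x) y"
proof -
  define f where "f u = 2 / (1 - u * cnj y) - 1" for u
  have ne: "1 - u * cnj y \<noteq> 0" if "cmod u < 1" for u
    using that x by (intro one_minus_mult_ne) auto
  have f: "f holomorphic_on ball 0 1"
    unfolding f_def using ne by (intro holomorphic_intros) auto
  have Ref: "Re (f u) = pois u y" if "cmod u < 1" for u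
  proof -
    define p where "p = 1 / (1 - u * cnj y)"
    have "of_real (pois u y) = p + cnj p - 1"
      unfolding p_def by (rule pois_eq[OF x(2) that])
    moreover have "f u = p + p - 1" by (simp add: f_def p_def)
    moreover have "Re (p + cnj p - 1) = Re (p + p - 1)" by simp
    ultimately show ?thesis by (metis Re_complex_of_real)
  qed
  have rx: "cmod (of_real r * x) < 1" using r x by (simp add: norm_mult)
  have "pois (of_real (r * s) * x) y = Re (f (of_real s * (of_real r * x)))"
    using r s x mult_strict_mono'[of r 1 s 1] by (subst Ref) (auto simp: norm_mult mult_ac)
  also have "\<dots> = Re (\<integral>t. f (of_real s * t) * of_real (pois (of_real r * x) t) \<partial>circ)"
    using pois_integral[OF f s rx] by simp
  also have "\<dots> = (\<integral>t. Re (f (of_real s * t) * of_real (pois (of_real r * x) t)) \<partial>circ)"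
  proof (rule integral_Re[symmetric])
    have "(\<lambda>t. complex_of_real (pois (of_real r * x) t)) \<in> borel_measurable circ"
      by (rule circle_measurable_borel[OF sets_circ]) measurable
    moreover have "cmod (of_real (pois (of_real r * x) t)) \<le> 1 / (1 - r)\<^sup>2" if "t \<in> space circ" for t
      using that pois_le[of t "of_real r * x" r] pois_nonneg[of "of_real r * x" t] r rx x
      by (simp add: space_circ norm_mult)
    ultimately have "integrable circ (\<lambda>t. of_real (pois (of_real r * x) t) * f (of_real s * t))"
      by (rule integrable_mult_bounded[OF dilate_integrable[OF f s]])
    then show "integrable circ (\<lambda>t. f (of_real s * t) * of_real (pois (of_real r * x) t))"
      by (simp add: mult.commute)
  qed
  also have "\<dots> = (\<integral>t. pois (of_real r * x) t * pois (of_real s * y) t \<partial>circ)"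
  proof (intro Bochner_Integration.integral_cong refl)
    fix t assume "t \<in> space circ"
    then have t: "cmod t = 1" by (simp add: space_circ)
    then have "Re (f (of_real s * t)) = pois (of_real s * y) t"
      using s x by (subst Ref) (auto simp: norm_mult pois_sym)
    then show "Re (f (of_real s * t) * of_real (pois (of_real r * x) t)) = pois (of_real r * x) t * pois (of_real s * y) t"
      by simp
  qed
  finally show ?thesis by simp
qed

text \<open>The constant is 2 times 4. Since \<open>1 - q^2 \<le> 1 - r^4\<close>, the numerator at
  most doubles; moving from \<open>q x\<close> to \<open>r x\<close> at most doubles the distance to
  \<open>y\<close>, and the distance is squared. The condition \<open>r^2 \<le> q\<close> is made
  for a product \<open>q\<close> of two radii of which \<open>r\<close> is the smaller.\<close>

lemma pois_dominate:
  assumes x: "cmod x = 1" "cmod y = 1" and r: "0 \<le> r" "r < 1" and q: "r\<^sup>2 \<le> q" "q \<le> r"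
  shows "pois (of_real q * x) y \<le> 8 * pois (of_real r * x) y"
proof -
  have q0: "0 \<le> q" using q r by (meson order_trans zero_le_power2)
  have nx: "cmod (of_real r * x) = r" "cmod (of_real q * x) = q"
    using x r q0 by (simp_all add: norm_mult)
  have "r^4 \<le> q\<^sup>2" using power_mono[OF q(1), of 2] by simp
  moreover have "1 - r^4 = (1 - r\<^sup>2) * (1 + r\<^sup>2)" by (simp add: algebra_simps flip: power_add)
  moreover have "(1 - r\<^sup>2) * (1 + r\<^sup>2) \<le> (1 - r\<^sup>2) * 2"
    using r by (intro mult_left_mono) (auto simp: power_le_one)
  ultimately have num: "1 - q\<^sup>2 \<le> 2 * (1 - r\<^sup>2)" by linarith
  have "y - of_real r * x = (y - of_real q * x) + of_real (q - r) * x" by (simp add: algebra_simps)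
  then have "cmod (y - of_real r * x) \<le> cmod (y - of_real q * x) + cmod (of_real (q - r) * x)"
    by (metis norm_triangle_ineq)
  also have "cmod (of_real (q - r) * x) = r - q" using x q by (simp add: norm_mult del: of_real_diff)
  also have "r - q \<le> 1 - q" using r by simp
  also have "1 - q \<le> cmod (y - of_real q * x)"
    using norm_triangle_ineq2[of y "of_real q * x"] x nx by simp
  finally have "cmod (y - of_real r * x) \<le> 2 * cmod (y - of_real q * x)" by simp
  then have den: "(cmod (y - of_real r * x))\<^sup>2 \<le> 4 * (cmod (y - of_real q * x))\<^sup>2"
    using power_mono[of "cmod (y - of_real r * x)" "2 * cmod (y - of_real q * x)" 2]
    by (simp add: power_mult_distrib)
  have pos: "0 < cmod (y - of_real q * x)" "0 < cmod (y - of_real r * x)"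
    using norm_triangle_ineq2[of y "of_real q * x"] norm_triangle_ineq2[of y "of_real r * x"] x nx q r by auto
  have "(1 - q\<^sup>2) / (cmod (y - of_real q * x))\<^sup>2 \<le> (2 * (1 - r\<^sup>2)) / ((cmod (y - of_real r * x))\<^sup>2 / 4)"
    using num den pos r by (intro frac_le) (auto simp: power_le_one)
  then show ?thesis unfolding pois_def nx by simp
qed

section \<open>The maximal inequality in L^2\<close>

lemma circ_fubini:
  fixes f :: "complex \<Rightarrow> complex \<Rightarrow> real"
  assumes "(\<lambda>(x, y). f x y) \<in> borel_measurable (circ \<Otimes>\<^sub>M circ)"
    and "\<And>x y. cmod x = 1 \<Longrightarrow> cmod y = 1 \<Longrightarrow> \<bar>f x y\<bar> \<le> B"
  shows "(\<integral>x. (\<integral>y. f x y \<partial>circ) \<partial>circ) = (\<integral>y. (\<integral>x. f x y \<partial>circ) \<partial>circ)"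
proof -
  interpret P: pair_prob_space circ circ ..
  have "integrable (circ \<Otimes>\<^sub>M circ) (\<lambda>(x, y). f x y)"
    using assms by (intro P.integrable_const_bound[of _ B] AE_I2)
      (auto simp: space_pair_measure space_circ)
  from P.Fubini_integral[OF this] show ?thesis by simp
qed

lemma integrable_circ_real:
  fixes f :: "complex \<Rightarrow> real"
  assumes "f \<in> borel_measurable circ" "\<And>z. cmod z = 1 \<Longrightarrow> \<bar>f z\<bar> \<le> B"
  shows "integrable circ f"
  by (rule integrable_circ_bounded[OF assms(1), of B]) (use assms(2) in auto)

text \<open>The linearised maximal operator $T g(x) = \int P_{r(x)x}\, g$ satisfies, by the semigroup law,
  $T T^* \le 8 (T + T^*)$ on non-negative functions; hence $T$ is bounded on $L^2$
  independently of the choice of radii $r(x)$.\<close>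

lemma maximal_adjoint:
  fixes r h :: "complex \<Rightarrow> real"
  assumes [measurable]: "r \<in> borel_measurable circ" "h \<in> borel_measurable circ"
    and r: "\<And>x. cmod x = 1 \<Longrightarrow> 0 \<le> r x" "\<And>x. cmod x = 1 \<Longrightarrow> r x \<le> \<rho>" "\<rho> < 1"
    and h: "\<And>x. cmod x = 1 \<Longrightarrow> 0 \<le> h x" "\<And>x. cmod x = 1 \<Longrightarrow> h x \<le> B"
  shows "(\<integral>t. (\<integral>x. pois (of_real (r x) * x) t * h x \<partial>circ)\<^sup>2 \<partial>circ) \<le> 256 * (\<integral>x. (h x)\<^sup>2 \<partial>circ)"
proof -
  define K where "K = 1 / (1 - \<rho>)\<^sup>2"
  define k where "k x t = pois (of_real (r x) * x) t" for x t
  have K0: "K \<ge> 0" by (simp add: K_def)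
  have B0: "B \<ge> 0" using h[of 1] by simp
  have id_meas [measurable]: "(\<lambda>x. x) \<in> borel_measurable circ"
    by (rule circle_measurable_borel[OF sets_circ]) simp
  \<comment> \<open>Stated for \<open>k\<close> composed with measurable maps, so that measurability
    proofs on product spaces can use it as well.\<close>
  have km [measurable]: "(\<lambda>x. k (f x) (g x)) \<in> borel_measurable N"
    if [measurable]: "f \<in> measurable N circ" "g \<in> measurable N circ" for f g and N :: "'z measure"
  proof -
    have [measurable]: "(\<lambda>x. f x) \<in> borel_measurable N" "(\<lambda>x. g x) \<in> borel_measurable N"
      using measurable_compose[OF that(1) id_meas] measurable_compose[OF that(2) id_meas] by auto
    have [measurable]: "(\<lambda>x. r (f x)) \<in> borel_measurable N" by measurable
    show ?thesis unfolding k_def by measurable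
  qed
  have nr: "cmod (of_real (r x) * x) = r x" if "cmod x = 1" for x
    using that r by (simp add: norm_mult)
  have kb: "0 \<le> k x t" "k x t \<le> K" if "cmod x = 1" "cmod t = 1" for x t
    using that r nr[OF that(1)] pois_le[of t "of_real (r x) * x" \<rho>]
    by (auto simp: k_def K_def intro!: pois_nonneg intro: order.trans[of _ \<rho>])
  define S where "S t = (\<integral>x. k x t * h x \<partial>circ)" for t
  define T where "T x = (\<integral>t. k x t * h t \<partial>circ)" for x
  have Sm [measurable]: "S \<in> borel_measurable circ" unfolding S_def by measurable
  have Tm [measurable]: "T \<in> borel_measurable circ" unfolding T_def by measurable
  have khb: "0 \<le> k x t * h s" "k x t * h s \<le> K * B" "\<bar>k x t * h s\<bar> \<le> K * B"
    if "cmod x = 1" "cmod t = 1" "cmod s = 1" for x t s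
    using kb[OF that(1,2)] h[OF that(3)] mult_mono[of "k x t" K "h s" B] K0 by auto
  have int1: "integrable circ (\<lambda>x. k x t * h x)" if "cmod t = 1" for t
    by (rule integrable_circ_real[of _ "K * B"]) (use that khb in \<open>auto simp: space_circ\<close>)
  have int2: "integrable circ (\<lambda>t. k x t * h t)" if "cmod x = 1" for x
    by (rule integrable_circ_real[of _ "K * B"]) (use that khb in \<open>auto simp: space_circ\<close>)
  have Sb: "0 \<le> S t" "S t \<le> K * B" if "cmod t = 1" for t
  proof -
    show "0 \<le> S t" unfolding S_def using that khb by (intro integral_nonneg_AE AE_I2) (auto simp: space_circ)
    have "S t \<le> (\<integral>x. K * B \<partial>circ)" unfolding S_def using that khb int1
      by (intro integral_mono_AE AE_I2) (auto simp: space_circ)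
    then show "S t \<le> K * B" by (simp add: circ.prob_space)
  qed
  have Tb: "0 \<le> T t" "T t \<le> K * B" if "cmod t = 1" for t
  proof -
    show "0 \<le> T t" unfolding T_def using that khb by (intro integral_nonneg_AE AE_I2) (auto simp: space_circ)
    have "T t \<le> (\<integral>x. K * B \<partial>circ)" unfolding T_def using that khb int2
      by (intro integral_mono_AE AE_I2) (auto simp: space_circ)
    then show "T t \<le> K * B" by (simp add: circ.prob_space)
  qed
  \<comment> \<open>The left side is the kernel of the operator composed with its adjoint. By the
    semigroup law it is a Poisson kernel at radius \<open>r x * r y\<close>, which lies between the
    smaller radius and its square; hence it is dominated by whichever of \<open>k x y\<close> and
    \<open>k y x\<close> has the smaller radius.\<close>
  have kk: "(\<integral>t. k x t * k y t \<partial>circ) \<le> 8 * (k x y + k y x)" if xy: "cmod x = 1" "cmod y = 1" for x y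
  proof -
    have rx: "0 \<le> r x" "r x < 1" and ry: "0 \<le> r y" "r y < 1" using r xy by (auto intro: le_less_trans)
    have eq: "(\<integral>t. k x t * k y t \<partial>circ) = pois (of_real (r x * r y) * x) y"
      unfolding k_def by (rule pois_semigroup[OF xy rx ry])
    show ?thesis
    proof (cases "r x \<le> r y")
      case True
      have "pois (of_real (r x * r y) * x) y \<le> 8 * pois (of_real (r x) * x) y"
        using True rx ry mult_left_mono[OF True rx(1)] mult_left_le[of "r y" "r x"]
        by (intro pois_dominate xy rx) (auto simp: power2_eq_square)
      also have "\<dots> = 8 * k x y" by (simp add: k_def)
      finally show ?thesis using kb[OF xy(2,1)] eq by simp
    next
      case False
      have "pois (of_real (r x * r y) * x) y \<le> 8 * pois (of_real (r y) * x) y"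
        using False rx ry mult_right_mono[of "r y" "r x" "r y"] mult_right_mono[of "r x" 1 "r y"]
        by (intro pois_dominate xy ry) (auto simp: power2_eq_square)
      also have "\<dots> = 8 * k y x" by (simp add: k_def pois_sym[OF xy])
      finally show ?thesis using kb[OF xy] eq by simp
    qed
  qed
  have inner: "(\<integral>t. k x t * S t \<partial>circ) \<le> 8 * (T x + S x)" if x: "cmod x = 1" for x
  proof -
    have xs: "x \<in> space circ" using x by (simp add: space_circ)
    have bd: "\<bar>k x t * (k y t * h y)\<bar> \<le> K * (K * B)" if "cmod t = 1" "cmod y = 1" for t y
    proof -
      have "0 \<le> k x t * (k y t * h y)"
        using kb(1)[OF x that(1)] khb(1)[OF that(2,1,2)] by (rule mult_nonneg_nonneg)
      moreover have "k x t * (k y t * h y) \<le> K * (K * B)"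
        by (rule mult_mono[OF kb(2)[OF x that(1)] khb(2)[OF that(2,1,2)] K0 khb(1)[OF that(2,1,2)]])
      ultimately show ?thesis by (simp only: abs_of_nonneg)
    qed
    have "(\<integral>t. k x t * S t \<partial>circ) = (\<integral>t. (\<integral>y. k x t * (k y t * h y) \<partial>circ) \<partial>circ)"
      by (simp add: S_def)
    also have "\<dots> = (\<integral>y. (\<integral>t. k x t * (k y t * h y) \<partial>circ) \<partial>circ)"
      using xs by (intro circ_fubini[of _ "K * (K * B)"] bd) measurable
    also have "\<dots> = (\<integral>y. h y * (\<integral>t. k x t * k y t \<partial>circ) \<partial>circ)"
    proof -
      have "(\<lambda>t. k x t * (k y t * h y)) = (\<lambda>t. h y * (k x t * k y t))" for y by (auto simp: mult_ac)
      then show ?thesis by simp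
    qed
    also have "\<dots> \<le> (\<integral>y. 8 * (k x y * h y) + 8 * (k y x * h y) \<partial>circ)"
    proof (rule integral_mono_AE)
      have "\<bar>h y * (\<integral>t. k x t * k y t \<partial>circ)\<bar> \<le> B * (8 * (K + K))" if y: "cmod y = 1" for y
      proof -
        have "0 \<le> (\<integral>t. k x t * k y t \<partial>circ)"
          using kb x y by (intro integral_nonneg_AE AE_I2) (auto simp: space_circ)
        moreover have "(\<integral>t. k x t * k y t \<partial>circ) \<le> 8 * (K + K)"
          using kk[OF x y] kb[OF x y] kb[OF y x] by simp
        ultimately show ?thesis using h[OF y] B0 by (simp add: abs_mult mult_mono)
      qed
      then show "integrable circ (\<lambda>y. h y * (\<integral>t. k x t * k y t \<partial>circ))"
        using xs by (intro integrable_circ_real[of _ "B * (8 * (K + K))"]) measurable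
      show "integrable circ (\<lambda>y. 8 * (k x y * h y) + 8 * (k y x * h y))"
        using int1[OF x] int2[OF x] by auto
      show "AE y in circ. h y * (\<integral>t. k x t * k y t \<partial>circ) \<le> 8 * (k x y * h y) + 8 * (k y x * h y)"
      proof (rule AE_I2)
        fix y assume "y \<in> space circ"
        then have y: "cmod y = 1" by (simp add: space_circ)
        show "h y * (\<integral>t. k x t * k y t \<partial>circ) \<le> 8 * (k x y * h y) + 8 * (k y x * h y)"
          using mult_left_mono[OF kk[OF x y] h(1)[OF y]] by (simp add: algebra_simps)
      qed
    qed
    also have "\<dots> = 8 * (T x + S x)"
      using int1[OF x] int2[OF x] by (simp add: T_def S_def)
    finally show ?thesis .
  qed
  have hS: "integrable circ (\<lambda>x. h x * S x)"
    by (rule integrable_circ_real[of _ "B * (K * B)"])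
      (use h Sb B0 K0 in \<open>auto simp: abs_mult intro!: mult_mono\<close>)
  have hT: "integrable circ (\<lambda>x. h x * T x)"
    by (rule integrable_circ_real[of _ "B * (K * B)"])
      (use h Tb B0 K0 in \<open>auto simp: abs_mult intro!: mult_mono\<close>)
  have S2: "integrable circ (\<lambda>x. (S x)\<^sup>2)"
    by (rule integrable_circ_real[of _ "(K * B)\<^sup>2"]) (use Sb in \<open>auto intro!: power_mono\<close>)
  have h2: "integrable circ (\<lambda>x. (h x)\<^sup>2)"
    by (rule integrable_circ_real[of _ "B\<^sup>2"]) (use h in \<open>auto intro!: power_mono\<close>)
  have swap: "(\<integral>t. g t * S t \<partial>circ) = (\<integral>x. h x * (\<integral>t. k x t * g t \<partial>circ) \<partial>circ)"
    if [measurable]: "g \<in> borel_measurable circ" and g: "\<And>x. cmod x = 1 \<Longrightarrow> \<bar>g x\<bar> \<le> G" for g G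
  proof -
    have "G \<ge> 0" using g[of 1] by auto
    then have bd: "\<bar>g t * (k x t * h x)\<bar> \<le> G * (K * B)" if "cmod t = 1" "cmod x = 1" for t x
      using mult_mono[of "\<bar>g t\<bar>" G "\<bar>k x t * h x\<bar>" "K * B"] khb[OF that(2,1,2)] g[OF that(1)]
      by (simp add: abs_mult)
    have "(\<integral>t. g t * S t \<partial>circ) = (\<integral>t. (\<integral>x. g t * (k x t * h x) \<partial>circ) \<partial>circ)"
      by (simp add: S_def)
    also have "\<dots> = (\<integral>x. (\<integral>t. g t * (k x t * h x) \<partial>circ) \<partial>circ)"
      by (intro circ_fubini[of _ "G * (K * B)"] bd) measurable
    also have "\<dots> = (\<integral>x. (\<integral>t. h x * (k x t * g t) \<partial>circ) \<partial>circ)"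
      by (simp add: mult_ac)
    finally show ?thesis by simp
  qed
  have "(\<integral>t. (S t)\<^sup>2 \<partial>circ) = (\<integral>x. h x * (\<integral>t. k x t * S t \<partial>circ) \<partial>circ)"
    unfolding power2_eq_square by (rule swap[of S "K * B"]) (use Sb in auto)
  also have "\<dots> \<le> (\<integral>x. 8 * (h x * T x) + 8 * (h x * S x) \<partial>circ)"
  proof (rule integral_mono_AE)
    show "AE x in circ. h x * (\<integral>t. k x t * S t \<partial>circ) \<le> 8 * (h x * T x) + 8 * (h x * S x)"
    proof (rule AE_I2)
      fix x assume "x \<in> space circ"
      then have x: "cmod x = 1" by (simp add: space_circ)
      show "h x * (\<integral>t. k x t * S t \<partial>circ) \<le> 8 * (h x * T x) + 8 * (h x * S x)"
        using mult_left_mono[OF inner[OF x] h(1)[OF x]] by (simp add: algebra_simps)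
    qed
    have "\<bar>h x * (\<integral>t. k x t * S t \<partial>circ)\<bar> \<le> B * (8 * (K * B + K * B))" if x: "cmod x = 1" for x
    proof -
      have "0 \<le> (\<integral>t. k x t * S t \<partial>circ)"
        using kb Sb x by (intro integral_nonneg_AE AE_I2) (auto simp: space_circ)
      moreover have "(\<integral>t. k x t * S t \<partial>circ) \<le> 8 * (K * B + K * B)"
      proof -
        have "T x + S x \<le> K * B + K * B" using Sb[OF x] Tb[OF x] by (intro add_mono)
        then have "8 * (T x + S x) \<le> 8 * (K * B + K * B)" by (rule mult_left_mono) simp
        then show ?thesis using inner[OF x] by (rule order_trans[rotated])
      qed
      ultimately show ?thesis using h[OF x] B0 by (simp add: abs_mult mult_mono)
    qed
    then show "integrable circ (\<lambda>x. h x * (\<integral>t. k x t * S t \<partial>circ))"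
      by (intro integrable_circ_real[of _ "B * (8 * (K * B + K * B))"]) measurable
  qed (use hT hS in auto)
  also have "\<dots> = 8 * (\<integral>x. h x * T x \<partial>circ) + 8 * (\<integral>x. h x * S x \<partial>circ)"
    using hT hS by simp
  also have "(\<integral>x. h x * T x \<partial>circ) = (\<integral>x. h x * S x \<partial>circ)"
    using swap[of h B] h by (simp add: T_def)
  also have "8 * (\<integral>x. h x * S x \<partial>circ) + 8 * (\<integral>x. h x * S x \<partial>circ) = (\<integral>x. 16 * (h x * S x) \<partial>circ)"
    by simp
  \<comment> \<open>\<open>(16 * h x - S x)^2 \<ge> 0\<close> is weighted so that half of the
    integral of \<open>S^2\<close> can be moved to the left, where it is finite because
    \<open>S\<close> is bounded. Doubling 128 gives 256.\<close>
  also have "\<dots> \<le> (\<integral>x. 128 * (h x)\<^sup>2 + 1/2 * (S x)\<^sup>2 \<partial>circ)"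
  proof (rule integral_mono)
    fix x
    have "0 \<le> (16 * h x - S x)\<^sup>2" by simp
    then show "16 * (h x * S x) \<le> 128 * (h x)\<^sup>2 + 1/2 * (S x)\<^sup>2"
      by (simp add: power2_diff power_mult_distrib)
  qed (use hS h2 S2 in auto)
  also have "\<dots> = 128 * (\<integral>x. (h x)\<^sup>2 \<partial>circ) + 1/2 * (\<integral>x. (S x)\<^sup>2 \<partial>circ)"
    using h2 S2 by simp
  finally show ?thesis unfolding S_def k_def by simp
qed

text \<open>The bound passes from the adjoint to the operator: the integral of \<open>T^2\<close>
  equals that of \<open>g * S\<close>, where \<open>S\<close> is the adjoint applied to
  \<open>T\<close>, and \<open>maximal_adjoint\<close> controls \<open>S\<close> by
  \<open>T\<close>.\<close>

lemma maximal_operator: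
  fixes r g :: "complex \<Rightarrow> real"
  assumes [measurable]: "r \<in> borel_measurable circ" "g \<in> borel_measurable circ"
    and r: "\<And>x. cmod x = 1 \<Longrightarrow> 0 \<le> r x" "\<And>x. cmod x = 1 \<Longrightarrow> r x \<le> \<rho>" "\<rho> < 1"
    and g: "\<And>x. cmod x = 1 \<Longrightarrow> 0 \<le> g x" "\<And>x. cmod x = 1 \<Longrightarrow> g x \<le> B"
  shows "(\<integral>x. (\<integral>t. pois (of_real (r x) * x) t * g t \<partial>circ)\<^sup>2 \<partial>circ) \<le> 256 * (\<integral>x. (g x)\<^sup>2 \<partial>circ)"
    and "integrable circ (\<lambda>x. (\<integral>t. pois (of_real (r x) * x) t * g t \<partial>circ)\<^sup>2)"
proof -
  define K where "K = 1 / (1 - \<rho>)\<^sup>2"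
  define k where "k x t = pois (of_real (r x) * x) t" for x t
  have K0: "K \<ge> 0" by (simp add: K_def)
  have B0: "B \<ge> 0" using g[of 1] by simp
  have id_meas [measurable]: "(\<lambda>x. x) \<in> borel_measurable circ"
    by (rule circle_measurable_borel[OF sets_circ]) simp
  have km [measurable]: "(\<lambda>x. k (f x) (g x)) \<in> borel_measurable N"
    if [measurable]: "f \<in> measurable N circ" "g \<in> measurable N circ" for f g and N :: "'z measure"
  proof -
    have [measurable]: "(\<lambda>x. f x) \<in> borel_measurable N" "(\<lambda>x. g x) \<in> borel_measurable N"
      using measurable_compose[OF that(1) id_meas] measurable_compose[OF that(2) id_meas] by auto
    have [measurable]: "(\<lambda>x. r (f x)) \<in> borel_measurable N" by measurable
    show ?thesis unfolding k_def by measurable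
  qed
  have nr: "cmod (of_real (r x) * x) = r x" if "cmod x = 1" for x
    using that r by (simp add: norm_mult)
  have kb: "0 \<le> k x t" "k x t \<le> K" if "cmod x = 1" "cmod t = 1" for x t
    using that r nr[OF that(1)] pois_le[of t "of_real (r x) * x" \<rho>]
    by (auto simp: k_def K_def intro!: pois_nonneg intro: order.trans[of _ \<rho>])
  define T where "T x = (\<integral>t. k x t * g t \<partial>circ)" for x
  have Tm [measurable]: "T \<in> borel_measurable circ" unfolding T_def by measurable
  have kgb: "0 \<le> k x t * g s" "k x t * g s \<le> K * B"
    if "cmod x = 1" "cmod t = 1" "cmod s = 1" for x t s
    using kb[OF that(1,2)] g[OF that(3)] mult_mono[of "k x t" K "g s" B] K0 by auto
  have int2: "integrable circ (\<lambda>t. k x t * g t)" if "cmod x = 1" for x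
    by (rule integrable_circ_real[of _ "K * B"])
      (use that kgb in \<open>auto simp: space_circ\<close>)
  have Tb: "0 \<le> T t" "T t \<le> K * B" if "cmod t = 1" for t
  proof -
    show "0 \<le> T t" unfolding T_def using that kgb by (intro integral_nonneg_AE AE_I2) (auto simp: space_circ)
    have "T t \<le> (\<integral>x. K * B \<partial>circ)" unfolding T_def using that kgb int2
      by (intro integral_mono_AE AE_I2) (auto simp: space_circ)
    then show "T t \<le> K * B" by (simp add: circ.prob_space)
  qed
  define S where "S t = (\<integral>x. k x t * T x \<partial>circ)" for t
  have Sm [measurable]: "S \<in> borel_measurable circ" unfolding S_def by measurable
  have kTb: "0 \<le> k x t * T s" "k x t * T s \<le> K * (K * B)"
    if "cmod x = 1" "cmod t = 1" "cmod s = 1" for x t s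
    using kb[OF that(1,2)] Tb[OF that(3)] mult_mono[of "k x t" K "T s" "K * B"] K0 by auto
  have int1: "integrable circ (\<lambda>x. k x t * T x)" if "cmod t = 1" for t
    by (rule integrable_circ_real[of _ "K * (K * B)"])
      (use that kTb in \<open>auto simp: space_circ\<close>)
  have Sb: "0 \<le> S t" "S t \<le> K * (K * B)" if "cmod t = 1" for t
  proof -
    show "0 \<le> S t" unfolding S_def using that kTb by (intro integral_nonneg_AE AE_I2) (auto simp: space_circ)
    have "S t \<le> (\<integral>x. K * (K * B) \<partial>circ)" unfolding S_def using that kTb int1
      by (intro integral_mono_AE AE_I2) (auto simp: space_circ)
    then show "S t \<le> K * (K * B)" by (simp add: circ.prob_space)
  qed
  have S2: "integrable circ (\<lambda>x. (S x)\<^sup>2)"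
    by (rule integrable_circ_real[of _ "(K * (K * B))\<^sup>2"]) (use Sb in \<open>auto intro!: power_mono\<close>)
  have g2: "integrable circ (\<lambda>x. (g x)\<^sup>2)"
    by (rule integrable_circ_real[of _ "B\<^sup>2"]) (use g in \<open>auto intro!: power_mono\<close>)
  have gS: "integrable circ (\<lambda>x. g x * S x)"
    by (rule integrable_circ_real[of _ "B * (K * (K * B))"])
      (use g Sb B0 K0 in \<open>auto simp: abs_mult intro!: mult_mono\<close>)
  have bd: "\<bar>T x * (k x t * g t)\<bar> \<le> (K * B) * (K * B)" if "cmod x = 1" "cmod t = 1" for t x
  proof -
    have "0 \<le> T x * (k x t * g t)" using kgb[OF that(1,2,2)] Tb[OF that(1)] by (intro mult_nonneg_nonneg[OF _ kgb(1)[OF that(1,2,2)]]) auto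
    moreover have "T x * (k x t * g t) \<le> (K * B) * (K * B)"
      using K0 B0 by (intro mult_mono[OF Tb(2)[OF that(1)] kgb(2)[OF that(1,2,2)] _ kgb(1)[OF that(1,2,2)]]) auto
    ultimately show ?thesis by (simp only: abs_of_nonneg)
  qed
  have "(\<integral>x. (T x)\<^sup>2 \<partial>circ) = (\<integral>x. (\<integral>t. T x * (k x t * g t) \<partial>circ) \<partial>circ)"
    by (simp add: power2_eq_square) (simp add: T_def)
  also have "\<dots> = (\<integral>t. (\<integral>x. T x * (k x t * g t) \<partial>circ) \<partial>circ)"
    by (intro circ_fubini[of _ "(K * B) * (K * B)"] bd) measurable
  also have "\<dots> = (\<integral>t. (\<integral>x. g t * (k x t * T x) \<partial>circ) \<partial>circ)" by (simp add: mult_ac)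
  also have "\<dots> = (\<integral>t. g t * S t \<partial>circ)" by (simp add: S_def)
  \<comment> \<open>Here \<open>(256 * g x - S x)^2 \<ge> 0\<close> is used: the factor 1/512 times
    the adjoint constant 256 is again one half, absorbed into the left side.\<close>
  also have "\<dots> \<le> (\<integral>x. 128 * (g x)\<^sup>2 + 1/512 * (S x)\<^sup>2 \<partial>circ)"
  proof (rule integral_mono)
    fix x
    have "0 \<le> (256 * g x - S x)\<^sup>2" by simp
    then show "g x * S x \<le> 128 * (g x)\<^sup>2 + 1/512 * (S x)\<^sup>2"
      by (simp add: power2_diff power_mult_distrib)
  qed (use gS g2 S2 in auto)
  also have "\<dots> = 128 * (\<integral>x. (g x)\<^sup>2 \<partial>circ) + 1/512 * (\<integral>x. (S x)\<^sup>2 \<partial>circ)"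
    using g2 S2 by simp
  also have "(\<integral>x. (S x)\<^sup>2 \<partial>circ) \<le> 256 * (\<integral>x. (T x)\<^sup>2 \<partial>circ)"
    unfolding S_def k_def
    by (rule maximal_adjoint[where \<rho> = \<rho> and B = "K * B"]) (use r Tb in auto)
  finally show "(\<integral>x. (\<integral>t. pois (of_real (r x) * x) t * g t \<partial>circ)\<^sup>2 \<partial>circ) \<le> 256 * (\<integral>x. (g x)\<^sup>2 \<partial>circ)"
    unfolding T_def k_def by simp
  have "integrable circ (\<lambda>x. (T x)\<^sup>2)"
    by (rule integrable_circ_real[of _ "(K * B)\<^sup>2"]) (use Tb in \<open>auto intro!: power_mono\<close>)
  then show "integrable circ (\<lambda>x. (\<integral>t. pois (of_real (r x) * x) t * g t \<partial>circ)\<^sup>2)"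
    unfolding T_def k_def .
qed

section \<open>Radial limits\<close>

definition rad :: "nat \<Rightarrow> real" where "rad k = 1 - 1 / (real k + 1)"

lemma rad_bounds: "0 \<le> rad k" "rad k < 1"
  by (auto simp: rad_def field_simps)

lemma rad_mono: "j \<le> k \<Longrightarrow> rad j \<le> rad k"
  by (simp add: rad_def frac_le)

lemma rad_tendsto: "rad \<longlonglongrightarrow> 1"
proof -
  have "(\<lambda>k. 1 - inverse (real (Suc k))) \<longlonglongrightarrow> 1 - 0"
    by (intro tendsto_intros LIMSEQ_inverse_real_of_nat)
  then show ?thesis by (simp add: rad_def[abs_def] inverse_eq_divide add.commute)
qed

lemma rad_at_left: "filterlim rad (at_left 1) sequentially"
  unfolding filterlim_at using rad_tendsto
  by (auto simp: rad_bounds less_imp_neq[OF rad_bounds(2)] intro!: always_eventually)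

lemma taylor_diff_sums:
  assumes f: "f holomorphic_on ball 0 1" and r: "0 \<le> r" "r < 1" and s: "0 \<le> s" "s < 1"
  shows "(\<lambda>n. (cmod (taylor f n))\<^sup>2 * (r ^ n - s ^ n)\<^sup>2) sums
    (\<integral>x. (cmod (f (of_real r * x) - f (of_real s * x)))\<^sup>2 \<partial>circ)"
proof -
  define c where "c n = taylor f n * of_real (r ^ n - s ^ n)" for n
  have c_eq: "c n = taylor f n * of_real r ^ n - taylor f n * of_real s ^ n" for n
    by (simp add: c_def right_diff_distrib)
  have sm: "summable (\<lambda>n. cmod (c n))"
  proof (rule summable_comparison_test')
    show "summable (\<lambda>n. cmod (taylor f n * of_real r ^ n) + cmod (taylor f n * of_real s ^ n))"
      by (intro summable_add taylor_summable f r s)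
    show "norm (cmod (c n)) \<le> cmod (taylor f n * of_real r ^ n) + cmod (taylor f n * of_real s ^ n)" for n
      unfolding c_eq by (simp add: norm_triangle_ineq4)
  qed
  have "(\<integral>x. (cmod (\<Sum>n. c n * x ^ n))\<^sup>2 \<partial>circ) = (\<integral>x. (cmod (f (of_real r * x) - f (of_real s * x)))\<^sup>2 \<partial>circ)"
  proof (intro Bochner_Integration.integral_cong refl)
    fix x assume "x \<in> space circ"
    then have x: "cmod x = 1" by (simp add: space_circ)
    have S: "summable (\<lambda>n. (taylor f n * of_real q ^ n) * x ^ n)" if "0 \<le> q" "q < 1" for q
      using taylor_summable[OF f that] x
      by - (rule summable_norm_cancel, simp add: norm_mult norm_power)
    have "(\<Sum>n. c n * x ^ n) = (\<Sum>n. (taylor f n * of_real r ^ n) * x ^ n - (taylor f n * of_real s ^ n) * x ^ n)"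
      by (simp add: c_eq left_diff_distrib)
    also have "\<dots> = f (of_real r * x) - f (of_real s * x)"
      using suminf_diff[OF S[OF r] S[OF s]] holo_on_circle[OF f r x] holo_on_circle[OF f s x] by simp
    finally show "(cmod (\<Sum>n. c n * x ^ n))\<^sup>2 = (cmod (f (of_real r * x) - f (of_real s * x)))\<^sup>2" by simp
  qed
  moreover have "(\<lambda>n. (cmod (c n))\<^sup>2) = (\<lambda>n. (cmod (taylor f n))\<^sup>2 * (r ^ n - s ^ n)\<^sup>2)"
    by (simp add: c_def norm_mult power_mult_distrib flip: of_real_power of_real_diff)
  ultimately show ?thesis using parseval[OF sm] by simp
qed

lemma taylor_nsq_sums:
  assumes f: "f holomorphic_on ball 0 1" and r: "0 \<le> r" "r < 1"
  shows "(\<lambda>n. (cmod (taylor f n))\<^sup>2 * (r ^ n)\<^sup>2) sums (\<integral>x. (cmod (f (of_real r * x)))\<^sup>2 \<partial>circ)"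
proof -
  have "(\<integral>x. (cmod (\<Sum>n. (taylor f n * of_real r ^ n) * x ^ n))\<^sup>2 \<partial>circ) = (\<integral>x. (cmod (f (of_real r * x)))\<^sup>2 \<partial>circ)"
    by (intro Bochner_Integration.integral_cong refl) (simp add: space_circ holo_on_circle[OF f r])
  moreover have "(\<lambda>n. (cmod (taylor f n * of_real r ^ n))\<^sup>2) = (\<lambda>n. (cmod (taylor f n))\<^sup>2 * (r ^ n)\<^sup>2)"
    using r by (simp add: norm_mult norm_power power_mult_distrib)
  ultimately show ?thesis using parseval[OF taylor_summable[OF f r]] by simp
qed

text \<open>By Parseval the mean over the circle of radius \<open>r\<close> is the sum of
  \<open>|taylor f n|^2 * r^(2 n)\<close>, which increases to the sum of the squared
  coefficients.\<close>

lemma hardy2_iff: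
  "f \<in> hardy2 \<longleftrightarrow> f holomorphic_on ball 0 1 \<and> summable (\<lambda>n. (cmod (taylor f n))\<^sup>2)"
proof (intro iffI conjI; (elim conjE)?)
  assume "f \<in> hardy2"
  then show f: "f holomorphic_on ball 0 1" by (simp add: hardy2_def)
  from \<open>f \<in> hardy2\<close> obtain M where M: "\<forall>r\<in>{0..<1}. (\<integral>x. (cmod (f (of_real r * x)))\<^sup>2 \<partial>circ) \<le> M"
    unfolding hardy2_def by blast
  have le: "(\<Sum>n<N. (cmod (taylor f n))\<^sup>2 * (r ^ n)\<^sup>2) \<le> M" if r: "0 \<le> r" "r < 1" for r N
  proof -
    have "(\<Sum>n<N. (cmod (taylor f n))\<^sup>2 * (r ^ n)\<^sup>2) \<le> (\<integral>x. (cmod (f (of_real r * x)))\<^sup>2 \<partial>circ)"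
      using taylor_nsq_sums[OF f r] by (subst sums_unique[OF taylor_nsq_sums[OF f r]], intro sum_le_suminf) (auto simp: sums_iff)
    then show ?thesis using bspec[OF M, of r] r by simp
  qed
  have "(\<Sum>n<N. (cmod (taylor f n))\<^sup>2) \<le> M" for N
  proof (rule LIMSEQ_le_const2)
    have "(\<lambda>k. \<Sum>n<N. (cmod (taylor f n))\<^sup>2 * (rad k ^ n)\<^sup>2) \<longlonglongrightarrow> (\<Sum>n<N. (cmod (taylor f n))\<^sup>2 * (1 ^ n)\<^sup>2)"
      by (intro tendsto_intros rad_tendsto)
    then show "(\<lambda>k. \<Sum>n<N. (cmod (taylor f n))\<^sup>2 * (rad k ^ n)\<^sup>2) \<longlonglongrightarrow> (\<Sum>n<N. (cmod (taylor f n))\<^sup>2)" by simp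
    show "\<exists>N'. \<forall>k\<ge>N'. (\<Sum>n<N. (cmod (taylor f n))\<^sup>2 * (rad k ^ n)\<^sup>2) \<le> M"
      using le[OF rad_bounds] by blast
  qed
  then show "summable (\<lambda>n. (cmod (taylor f n))\<^sup>2)"
    by (intro summableI_nonneg_bounded[of _ M]) auto
next
  assume f: "f holomorphic_on ball 0 1" and s: "summable (\<lambda>n. (cmod (taylor f n))\<^sup>2)"
  have "(\<integral>x. (cmod (f (of_real r * x)))\<^sup>2 \<partial>circ) \<le> (\<Sum>n. (cmod (taylor f n))\<^sup>2)" if "0 \<le> r" "r < 1" for r
  proof (rule sums_le[OF _ taylor_nsq_sums[OF f that] summable_sums[OF s]])
    have "(r ^ n)\<^sup>2 \<le> 1" for n using that by (simp add: power_le_one)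
    then show "(cmod (taylor f n))\<^sup>2 * (r ^ n)\<^sup>2 \<le> (cmod (taylor f n))\<^sup>2" for n
      by (simp add: mult_left_le)
  qed
  then show "f \<in> hardy2" using f unfolding hardy2_def
    by (intro CollectI conjI exI[of _ "\<Sum>n. (cmod (taylor f n))\<^sup>2"] ballI) auto
qed

text \<open>The squared Hardy norm of the difference between \<open>f\<close> and its dilation by
  \<open>s\<close>. It bounds the mean square oscillation of \<open>f\<close> between any two radii
  beyond \<open>s\<close> (\<open>tail_bound\<close>) and tends to 0 along
  \<open>rad\<close>.\<close>

definition tail :: "(complex \<Rightarrow> complex) \<Rightarrow> real \<Rightarrow> real" where
  "tail f s = (\<Sum>n. (cmod (taylor f n))\<^sup>2 * (1 - s ^ n)\<^sup>2)"

lemma tail_summable: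
  assumes "f \<in> hardy2" "0 \<le> s" "s \<le> 1"
  shows "summable (\<lambda>n. (cmod (taylor f n))\<^sup>2 * (1 - s ^ n)\<^sup>2)"
proof (rule summable_comparison_test')
  show "summable (\<lambda>n. (cmod (taylor f n))\<^sup>2)" using assms by (simp add: hardy2_iff)
  fix n
  have "0 \<le> 1 - s ^ n" "1 - s ^ n \<le> 1" using assms by (simp_all add: power_le_one)
  then have "(1 - s ^ n)\<^sup>2 \<le> 1" by (simp add: power_le_one)
  then show "norm ((cmod (taylor f n))\<^sup>2 * (1 - s ^ n)\<^sup>2) \<le> (cmod (taylor f n))\<^sup>2"
    by (simp add: mult_left_le)
qed

lemma tail_tendsto:
  assumes "f \<in> hardy2" shows "(\<lambda>k. tail f (rad k)) \<longlonglongrightarrow> 0"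
proof -
  have "(\<lambda>k. tail f (rad k)) \<longlonglongrightarrow> (\<Sum>n::nat. 0::real)"
    unfolding tail_def
  proof (rule tannerys_theorem[THEN conjunct2, THEN conjunct2])
    show "(\<lambda>k. (cmod (taylor f n))\<^sup>2 * (1 - rad k ^ n)\<^sup>2) \<longlonglongrightarrow> 0" for n
    proof -
      have "(\<lambda>k. (cmod (taylor f n))\<^sup>2 * (1 - rad k ^ n)\<^sup>2) \<longlonglongrightarrow> (cmod (taylor f n))\<^sup>2 * (1 - 1 ^ n)\<^sup>2"
        by (intro tendsto_intros rad_tendsto)
      then show ?thesis by simp
    qed
    have "norm ((cmod (taylor f n))\<^sup>2 * (1 - rad k ^ n)\<^sup>2) \<le> (cmod (taylor f n))\<^sup>2" for n k
    proof -
      have "0 \<le> 1 - rad k ^ n" "1 - rad k ^ n \<le> 1"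
        using rad_bounds[of k] by (simp_all add: power_le_one)
      then have "(1 - rad k ^ n)\<^sup>2 \<le> 1" by (simp add: power_le_one)
      then show ?thesis by (simp add: mult_left_le)
    qed
    then show "\<forall>\<^sub>F (n, k) in sequentially \<times>\<^sub>F sequentially.
        norm ((cmod (taylor f n))\<^sup>2 * (1 - rad k ^ n)\<^sup>2) \<le> (cmod (taylor f n))\<^sup>2"
      by (intro always_eventually) auto
    show "summable (\<lambda>n. (cmod (taylor f n))\<^sup>2)" using assms by (simp add: hardy2_iff)
  qed simp
  then show ?thesis by simp
qed

lemma tail_bound:
  assumes f: "f \<in> hardy2" and r: "s \<le> r" "r < 1" and q: "s \<le> q" "q < 1" and s: "0 \<le> s"
  shows "(\<integral>x. (cmod (f (of_real r * x) - f (of_real q * x)))\<^sup>2 \<partial>circ) \<le> tail f s"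
proof -
  have h: "f holomorphic_on ball 0 1" using f by (simp add: hardy2_iff)
  have sums1: "(\<lambda>n. (cmod (taylor f n))\<^sup>2 * (r ^ n - q ^ n)\<^sup>2) sums
      (\<integral>x. (cmod (f (of_real r * x) - f (of_real q * x)))\<^sup>2 \<partial>circ)"
    using r q s by (intro taylor_diff_sums[OF h]) auto
  have sums2: "(\<lambda>n. (cmod (taylor f n))\<^sup>2 * (1 - s ^ n)\<^sup>2) sums tail f s"
    unfolding tail_def using f r s by (intro summable_sums tail_summable) auto
  show ?thesis
  proof (rule sums_le[OF _ sums1 sums2])
    fix n
    have "s ^ n \<le> r ^ n" "s ^ n \<le> q ^ n" "r ^ n \<le> 1" "q ^ n \<le> 1"
      using r q s by (auto intro!: power_mono power_le_one)
    then have "\<bar>r ^ n - q ^ n\<bar> \<le> 1 - s ^ n" by auto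
    then have "(r ^ n - q ^ n)\<^sup>2 \<le> (1 - s ^ n)\<^sup>2" by (rule abs_le_square_iff[THEN iffD1, OF order_trans[OF _ abs_ge_self]])
    then show "(cmod (taylor f n))\<^sup>2 * (r ^ n - q ^ n)\<^sup>2 \<le> (cmod (taylor f n))\<^sup>2 * (1 - s ^ n)\<^sup>2"
      by (intro mult_left_mono) auto
  qed
qed

text \<open>Linearises a maximal function: it selects, measurably in \<open>x\<close>, a radius
  where the maximum over a finite set is attained, so that the bounds for Poisson integrals with
  variable radius apply.\<close>

lemma measurable_argmax:
  fixes u :: "real \<Rightarrow> 'a \<Rightarrow> real"
  assumes "finite R" "R \<noteq> {}" "\<And>s. s \<in> R \<Longrightarrow> u s \<in> borel_measurable M"
  shows "\<exists>r \<in> borel_measurable M. (\<lambda>x. u (r x) x) \<in> borel_measurable M \<and> (\<forall>x. r x \<in> R \<and> (\<forall>s\<in>R. u s x \<le> u (r x) x))"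
  using assms
proof (induction R rule: finite_ne_induct)
  case (singleton s)
  then show ?case by (intro bexI[of _ "\<lambda>_. s"]) auto
next
  case (insert s F)
  then obtain r where r: "r \<in> borel_measurable M" "(\<lambda>x. u (r x) x) \<in> borel_measurable M"
    "\<And>x. r x \<in> F" "\<And>x s. s \<in> F \<Longrightarrow> u s x \<le> u (r x) x" by auto
  have us: "u s \<in> borel_measurable M" using insert by auto
  note [measurable] = r(1,2) us
  define r' where "r' x = (if u s x \<le> u (r x) x then r x else s)" for x
  have [measurable]: "r' \<in> borel_measurable M" unfolding r'_def by measurable
  have eq: "(\<lambda>x. u (r' x) x) = (\<lambda>x. if u s x \<le> u (r x) x then u (r x) x else u s x)"
    by (auto simp: r'_def)
  have "(\<lambda>x. u (r' x) x) \<in> borel_measurable M" unfolding eq by measurable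
  moreover have "r' x \<in> insert s F \<and> (\<forall>t\<in>insert s F. u t x \<le> u (r' x) x)" for x
  proof (cases "u s x \<le> u (r x) x")
    case False
    then have "u (r x) x \<le> u s x" by simp
    then have "u t x \<le> u s x" if "t \<in> F" for t using r(4)[OF that, of x] by simp
    then show ?thesis using False by (auto simp: r'_def)
  qed (use r(3)[of x] r(4)[of _ x] in \<open>auto simp: r'_def\<close>)
  ultimately show ?case by (intro bexI[of _ r']) auto
qed

text \<open>Chebyshev's inequality for the maximal operator. The value of \<open>f\<close> at the
  selected radius is a Poisson integral of the dilation by a larger radius \<open>\<sigma>\<close>,
  which keeps the data bounded and the final bound independent of \<open>R\<close>.\<close>

lemma maximal_finite:
  assumes f: "f holomorphic_on ball 0 1"
    and M: "\<And>s. 0 \<le> s \<Longrightarrow> s < 1 \<Longrightarrow> (\<integral>x. (cmod (f (of_real s * x)))\<^sup>2 \<partial>circ) \<le> M"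
    and R: "finite R" "R \<noteq> {}" "R \<subseteq> {0..<1}" and t: "t > 0"
  shows "measure circ (\<Union>s\<in>R. {x \<in> space circ. cmod (f (of_real s * x)) > t}) \<le> 256 * M / t\<^sup>2"
proof -
  define u where "u s x = cmod (f (of_real s * x))" for s :: real and x
  have um: "u s \<in> borel_measurable circ" if "s \<in> R" for s
  proof -
    have [measurable]: "(\<lambda>x. f (of_real s * x)) \<in> borel_measurable circ"
      using R that by (intro dilate_measurable[OF f]) auto
    show ?thesis unfolding u_def by measurable
  qed
  from measurable_argmax[of R u circ, OF R(1,2) um] obtain r where
    rm: "r \<in> borel_measurable circ" and rR: "\<And>x. r x \<in> R" and max: "\<And>s x. s \<in> R \<Longrightarrow> u s x \<le> u (r x) x" by auto
  define m where "m = Max R"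
  have m: "0 \<le> m" "m < 1" "\<And>s. s \<in> R \<Longrightarrow> s \<le> m"
  proof -
    have "Max R \<in> {0..<1}" using Max_in[OF R(1,2)] R(3) by blast
    then show "0 \<le> m" "m < 1" "\<And>s. s \<in> R \<Longrightarrow> s \<le> m" unfolding m_def using R(1) by auto
  qed
  \<comment> \<open>Strictly between the largest radius in \<open>R\<close> and 1, so that
    \<open>r x = \<sigma> * q x\<close> with \<open>q\<close> bounded away from 1.\<close>
  define \<sigma> where "\<sigma> = (1 + m) / 2"
  have \<sigma>: "0 < \<sigma>" "\<sigma> < 1" "m < \<sigma>" using m by (auto simp: \<sigma>_def)
  define g where "g x = cmod (f (of_real \<sigma> * x))" for x
  have gm: "g \<in> borel_measurable circ"
  proof -
    have [measurable]: "(\<lambda>x. f (of_real \<sigma> * x)) \<in> borel_measurable circ"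
      using \<sigma> by (intro dilate_measurable[OF f]) auto
    show ?thesis unfolding g_def by measurable
  qed
  have "compact ((\<lambda>x. f (of_real \<sigma> * x)) ` sphere 0 1)"
    using \<sigma> by (intro compact_continuous_image dilate_cont[OF f]) auto
  then obtain B where B: "\<And>x. cmod x = 1 \<Longrightarrow> g x \<le> B"
    using compact_imp_bounded bounded_iff unfolding g_def by (metis imageI mem_sphere_0)
  define q where "q x = r x / \<sigma>" for x
  have qm: "q \<in> borel_measurable circ" unfolding q_def using rm by simp
  have qb: "0 \<le> q x" "q x \<le> m / \<sigma>" for x
    using rR[of x] R(3) m(3)[of "r x"] \<sigma> by (auto simp: q_def field_simps)
  have ms: "m / \<sigma> < 1" using \<sigma> by simp
  define T where "T x = (\<integral>t. pois (of_real (q x) * x) t * g t \<partial>circ)" for x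
  have T2: "(\<integral>x. (T x)\<^sup>2 \<partial>circ) \<le> 256 * (\<integral>x. (g x)\<^sup>2 \<partial>circ)" and Ti: "integrable circ (\<lambda>x. (T x)\<^sup>2)"
    unfolding T_def using maximal_operator[OF qm gm qb ms _ B] by (auto simp: g_def)
  have uT: "u (r x) x \<le> T x" if x: "cmod x = 1" for x
  proof -
    have nq: "cmod (of_real (q x) * x) < 1" using qb[of x] ms x by (simp add: norm_mult)
    have "f (of_real (r x) * x) = f (of_real \<sigma> * (of_real (q x) * x))"
      using \<sigma> by (simp add: q_def)
    also have "\<dots> = (\<integral>t. f (of_real \<sigma> * t) * of_real (pois (of_real (q x) * x) t) \<partial>circ)"
      using \<sigma> nq by (intro pois_integral[OF f, symmetric]) auto
    finally have "u (r x) x = cmod (\<integral>t. f (of_real \<sigma> * t) * of_real (pois (of_real (q x) * x) t) \<partial>circ)"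
      by (simp add: u_def)
    also have "\<dots> \<le> (\<integral>t. cmod (f (of_real \<sigma> * t) * of_real (pois (of_real (q x) * x) t)) \<partial>circ)"
      by (rule integral_norm_bound)
    also have "\<dots> = T x" unfolding T_def g_def
      using pois_nonneg[of "of_real (q x) * x"] nq
      by (intro Bochner_Integration.integral_cong refl) (simp add: norm_mult mult.commute)
    finally show ?thesis .
  qed
  have "(\<Union>s\<in>R. {x \<in> space circ. cmod (f (of_real s * x)) > t}) \<subseteq> {x \<in> space circ. (T x)\<^sup>2 \<ge> t\<^sup>2}"
  proof safe
    fix s x assume "s \<in> R" "x \<in> space circ" "t < cmod (f (of_real s * x))"
    then have "t \<le> T x" using max[of s x] uT[of x] by (simp add: u_def space_circ)
    then show "t\<^sup>2 \<le> (T x)\<^sup>2" using t by (intro power_mono) auto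
  qed
  then have "measure circ (\<Union>s\<in>R. {x \<in> space circ. cmod (f (of_real s * x)) > t}) \<le> measure circ {x \<in> space circ. (T x)\<^sup>2 \<ge> t\<^sup>2}"
    using Ti by (intro circ.finite_measure_mono) auto
  also have "\<dots> \<le> (\<integral>x. (T x)\<^sup>2 \<partial>circ) / t\<^sup>2"
    using t Ti by (intro integral_Markov_inequality_measure[where A = "space circ"]) auto
  also have "(\<integral>x. (T x)\<^sup>2 \<partial>circ) \<le> 256 * M"
    using T2 M[of \<sigma>] \<sigma> unfolding g_def by simp
  finally show ?thesis using t by (simp add: divide_right_mono)
qed

lemma radius_cont:
  assumes f: "f holomorphic_on ball 0 1" and x: "cmod x = 1" and s: "\<bar>s\<bar> < 1"
  shows "isCont (\<lambda>q::real. f (of_real q * x)) s"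
proof -
  have "isCont f (of_real s * x)"
    using holomorphic_on_imp_continuous_on[OF f] s x
    by (simp add: continuous_on_eq_continuous_at norm_mult)
  then show ?thesis
    by (intro continuous_intros isCont_o2[where g = f and f = "\<lambda>q. of_real q * x"])
qed

lemma continuous_le_rational:
  fixes \<phi> :: "real \<Rightarrow> real"
  assumes "isCont \<phi> s" "s < b" "\<And>q. q \<in> \<rat> \<Longrightarrow> s < q \<Longrightarrow> q < b \<Longrightarrow> \<phi> q \<le> t"
  shows "\<phi> s \<le> t"
proof (rule ccontr)
  assume "\<not> \<phi> s \<le> t"
  moreover have "(\<phi> \<longlongrightarrow> \<phi> s) (at_right s)"
    using assms(1) by (simp add: isCont_def filterlim_at_split)
  ultimately have "\<forall>\<^sub>F q in at_right s. t < \<phi> q" by (intro order_tendstoD) auto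
  then obtain c where c: "c > s" "\<And>q. s < q \<Longrightarrow> q < c \<Longrightarrow> t < \<phi> q"
    unfolding eventually_at_right_field by auto
  obtain q where "q \<in> \<rat>" "s < q" "q < min b c" using Rats_dense_in_real[of s "min b c"] c assms(2) by auto
  then show False using assms(3)[of q] c(2)[of q] by auto
qed

text \<open>Finite sets of radii exhaust the rational radii along an enumeration, by continuity of
  the measure from below; continuity of \<open>f\<close> along each radius then covers the real
  ones.\<close>

lemma weak_type:
  assumes f: "f holomorphic_on ball 0 1"
    and M: "\<And>s. 0 \<le> s \<Longrightarrow> s < 1 \<Longrightarrow> (\<integral>x. (cmod (f (of_real s * x)))\<^sup>2 \<partial>circ) \<le> M" and t: "t > 0"
  obtains A where "A \<in> sets circ" "measure circ A \<le> 256 * M / t\<^sup>2"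
    "\<And>x s. x \<in> space circ \<Longrightarrow> x \<notin> A \<Longrightarrow> 0 \<le> s \<Longrightarrow> s < 1 \<Longrightarrow> cmod (f (of_real s * x)) \<le> t"
proof -
  define Q where "Q = (\<rat> \<inter> {0..<1} :: real set)"
  have Q: "countable Q" "Q \<noteq> {}" "Q \<subseteq> {0..<1}"
    unfolding Q_def using countable_rat by (auto intro: exI[of _ 0])
  define e where "e = from_nat_into Q"
  have eQ: "range e = Q" unfolding e_def using Q by (intro range_from_nat_into)
  define A where "A n = (\<Union>s\<in>e ` {..n}. {x \<in> space circ. cmod (f (of_real s * x)) > t})" for n
  have es: "{x \<in> space circ. cmod (f (of_real s * x)) > t} \<in> sets circ" if "s \<in> Q" for s
  proof -
    have [measurable]: "(\<lambda>x. f (of_real s * x)) \<in> borel_measurable circ"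
      using Q that by (intro dilate_measurable[OF f]) auto
    show ?thesis by measurable
  qed
  have As: "A n \<in> sets circ" for n unfolding A_def using es eQ by (intro sets.finite_UN) auto
  have inc: "incseq A" unfolding A_def by (intro monoI UN_mono image_mono) auto
  have "measure circ (A n) \<le> 256 * M / t\<^sup>2" for n
    unfolding A_def using Q eQ by (intro maximal_finite[OF f M _ _ _ t]) auto
  moreover have "(\<lambda>n. measure circ (A n)) \<longlonglongrightarrow> measure circ (\<Union>n. A n)"
    using As inc by (intro circ.finite_Lim_measure_incseq) auto
  ultimately have le: "measure circ (\<Union>n. A n) \<le> 256 * M / t\<^sup>2"
    by (intro LIMSEQ_le_const2) auto
  have bound: "cmod (f (of_real s * x)) \<le> t" if x: "x \<in> space circ" "x \<notin> (\<Union>n. A n)" and s: "0 \<le> s" "s < 1" for x s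
  proof -
    have q: "cmod (f (of_real q * x)) \<le> t" if qQ: "q \<in> Q" for q
    proof -
      obtain n where "q = e n" using qQ unfolding eQ[symmetric] by blast
      then show ?thesis using x by (force simp: A_def not_less)
    qed
    have x1: "cmod x = 1" using x by (simp add: space_circ)
    have "isCont (\<lambda>q. cmod (f (of_real q * x))) s"
      using radius_cont[OF f x1] s by (intro continuous_intros) auto
    then show ?thesis
      by (rule continuous_le_rational[where b = 1]) (use s q in \<open>auto simp: Q_def\<close>)
  qed
  have S: "(\<Union>n. A n) \<in> sets circ" using As by auto
  show ?thesis by (rule that[OF S le bound])
qed

text \<open>A Cauchy criterion for filters: the approximate centre \<open>c\<close> may depend on
  \<open>e\<close>. The sequence along \<open>r\<close> supplies the candidate for the
  limit.\<close>

lemma tendsto_of_oscillation: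
  fixes F :: "'a \<Rightarrow> 'b::complete_space"
  assumes lim: "filterlim r \<F> sequentially"
    and osc: "\<And>e. e > 0 \<Longrightarrow> \<exists>c. \<forall>\<^sub>F p in \<F>. dist (F p) c < e"
  shows "\<exists>l. (F \<longlongrightarrow> l) \<F>"
proof -
  have ev: "\<forall>\<^sub>F n in sequentially. P (r n)" if "\<forall>\<^sub>F p in \<F>. P p" for P
    using lim that by (rule eventually_compose_filterlim[rotated])
  have "Cauchy (\<lambda>n. F (r n))"
  proof (rule metric_CauchyI)
    fix e :: real assume "e > 0"
    then obtain c where "\<forall>\<^sub>F p in \<F>. dist (F p) c < e / 2" using osc[of "e/2"] by auto
    from ev[OF this] obtain N where N: "\<And>n. n \<ge> N \<Longrightarrow> dist (F (r n)) c < e / 2"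
      by (auto simp: eventually_sequentially)
    have "dist (F (r m)) (F (r n)) < e" if "m \<ge> N" "n \<ge> N" for m n
      using N[OF that(1)] N[OF that(2)] dist_triangle_half_l by blast
    then show "\<exists>M. \<forall>m\<ge>M. \<forall>n\<ge>M. dist (F (r m)) (F (r n)) < e" by blast
  qed
  then obtain l where l: "(\<lambda>n. F (r n)) \<longlonglongrightarrow> l" using Cauchy_convergent convergent_def by blast
  have "(F \<longlongrightarrow> l) \<F>"
  proof (rule tendstoI)
    fix e :: real assume e: "e > 0"
    then obtain c where c: "\<forall>\<^sub>F p in \<F>. dist (F p) c < e / 4" using osc[of "e/4"] by auto
    have "\<forall>\<^sub>F n in sequentially. dist (F (r n)) c < e / 4 \<and> dist (F (r n)) l < e / 4"
      using ev[OF c] tendstoD[OF l, of "e/4"] e by (auto intro: eventually_conj)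
    then obtain n where n: "dist (F (r n)) c < e / 4" "dist (F (r n)) l < e / 4"
      using eventually_happens'[OF sequentially_bot] by blast
    have cl: "dist c l < e / 2"
      using dist_triangle[of c l "F (r n)"] n by (simp add: dist_commute)
    show "\<forall>\<^sub>F p in \<F>. dist (F p) l < e"
      using c
    proof eventually_elim
      case (elim p)
      then show ?case using dist_triangle[of "F p" l c] cl e by linarith
    qed
  qed
  then show ?thesis by blast
qed

text \<open>Fatou: the dilations \<open>f (s \<cdot>)\<close> converge trivially, and the maximal inequality controls the
  difference, whose Hardy norm tends to \<open>0\<close>.\<close>

lemma fatou_radial:
  assumes f: "f \<in> hardy2"
  shows "AE x in circ. \<exists>l. ((\<lambda>r::real. f (of_real r * x)) \<longlongrightarrow> l) (at_left 1)"
proof -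
  have h: "f holomorphic_on ball 0 1" using f by (simp add: hardy2_iff)
  \<comment> \<open>\<open>A j k\<close> is to contain every point on whose radius \<open>f\<close>
    somewhere differs from its dilation by \<open>rad k\<close> by more than
    \<open>1 / (j + 1)\<close>. For fixed \<open>j\<close> its measure is controlled by
    \<open>tail f (rad k)\<close>, which tends to 0, so a point in \<open>A j k\<close> for all
    \<open>k\<close> is exceptional.\<close>
  define good where "good A j k \<longleftrightarrow> A \<in> sets circ \<and> measure circ A \<le> 256 * tail f (rad k) / (1 / (real j + 1))\<^sup>2 \<and>
    (\<forall>x s. x \<in> space circ \<longrightarrow> x \<notin> A \<longrightarrow> 0 \<le> s \<longrightarrow> s < 1 \<longrightarrow>
      cmod (f (of_real s * x) - f (of_real (rad k) * (of_real s * x))) \<le> 1 / (real j + 1))" for A j k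
  have "\<exists>A. good A j k" for j k
  proof -
    define F where "F z = f z - f (of_real (rad k) * z)" for z
    have "(\<lambda>z. f (of_real (rad k) * z)) holomorphic_on ball 0 1"
    proof (rule holomorphic_on_compose_gen[where g = f and f = "\<lambda>z. complex_of_real (rad k) * z", unfolded o_def])
      show "(\<lambda>z. complex_of_real (rad k) * z) ` ball 0 1 \<subseteq> ball 0 1"
      proof (rule image_subsetI)
        fix z :: complex assume "z \<in> ball 0 1"
        then show "of_real (rad k) * z \<in> ball 0 1"
          using rad_bounds[of k] mult_right_mono[of "rad k" 1 "cmod z"] by (simp add: norm_mult)
      qed
    qed (auto intro!: holomorphic_intros h)
    then have F: "F holomorphic_on ball 0 1" unfolding F_def by (intro holomorphic_intros h)
    have "(\<integral>x. (cmod (F (of_real s * x)))\<^sup>2 \<partial>circ) \<le> tail f (rad k)" if s: "0 \<le> s" "s < 1" for s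
    proof -
      have rs: "0 \<le> rad k * s" "rad k * s < 1"
        using s rad_bounds[of k] mult_right_mono[of "rad k" 1 s] by auto
      have "(\<lambda>n. (cmod (taylor f n))\<^sup>2 * (s ^ n - (rad k * s) ^ n)\<^sup>2) sums
          (\<integral>x. (cmod (f (of_real s * x) - f (of_real (rad k * s) * x)))\<^sup>2 \<partial>circ)"
        by (rule taylor_diff_sums[OF h s rs])
      moreover have "(\<lambda>n. (cmod (taylor f n))\<^sup>2 * (1 - rad k ^ n)\<^sup>2) sums tail f (rad k)"
        unfolding tail_def using rad_bounds[of k] by (intro summable_sums tail_summable f) auto
      ultimately have "(\<integral>x. (cmod (f (of_real s * x) - f (of_real (rad k * s) * x)))\<^sup>2 \<partial>circ) \<le> tail f (rad k)"
      proof (rule sums_le[rotated])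
        fix n
        have "s ^ n - (rad k * s) ^ n = s ^ n * (1 - rad k ^ n)"
          by (simp add: power_mult_distrib algebra_simps)
        then have "(s ^ n - (rad k * s) ^ n)\<^sup>2 = (s ^ n)\<^sup>2 * (1 - rad k ^ n)\<^sup>2"
          by (simp add: power_mult_distrib)
        also have "\<dots> \<le> 1 * (1 - rad k ^ n)\<^sup>2"
          using s by (intro mult_right_mono) (auto simp: power_le_one)
        finally show "(cmod (taylor f n))\<^sup>2 * (s ^ n - (rad k * s) ^ n)\<^sup>2 \<le> (cmod (taylor f n))\<^sup>2 * (1 - rad k ^ n)\<^sup>2"
          by (intro mult_left_mono) auto
      qed
      then show ?thesis by (simp add: F_def mult.assoc)
    qed
    then obtain A where "A \<in> sets circ" "measure circ A \<le> 256 * tail f (rad k) / (1 / (real j + 1))\<^sup>2"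
      "\<And>x s. x \<in> space circ \<Longrightarrow> x \<notin> A \<Longrightarrow> 0 \<le> s \<Longrightarrow> s < 1 \<Longrightarrow> cmod (F (of_real s * x)) \<le> 1 / (real j + 1)"
      using weak_type[OF F, of "tail f (rad k)" "1 / (real j + 1)"] by auto
    then show ?thesis by (intro exI[of _ A]) (auto simp: F_def good_def)
  qed
  then obtain A where "\<And>j k. good (A j k) j k" by metis
  then have As: "\<And>j k. A j k \<in> sets circ"
    and Am: "\<And>j k. measure circ (A j k) \<le> 256 * tail f (rad k) / (1 / (real j + 1))\<^sup>2"
    and A: "\<And>j k x s. x \<in> space circ \<Longrightarrow> x \<notin> A j k \<Longrightarrow> 0 \<le> s \<Longrightarrow> s < 1 \<Longrightarrow>
      cmod (f (of_real s * x) - f (of_real (rad k) * (of_real s * x))) \<le> 1 / (real j + 1)"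
    unfolding good_def by blast+
  have null: "(\<Inter>k. A j k) \<in> null_sets circ" for j
  proof -
    have S: "(\<Inter>k. A j k) \<in> sets circ" using As by (intro sets.countable_INT) auto
    have le: "measure circ (\<Inter>k. A j k) \<le> 256 * tail f (rad k) / (1 / (real j + 1))\<^sup>2" for k
      using circ.finite_measure_mono[of "\<Inter>k. A j k" "A j k"] As Am[of j k] by (meson INT_lower UNIV_I order_trans)
    have "(\<lambda>k. 256 * tail f (rad k) / (1 / (real j + 1))\<^sup>2) \<longlonglongrightarrow> 256 * 0 / (1 / (real j + 1))\<^sup>2"
      by (intro tendsto_intros tail_tendsto f) auto
    then have "measure circ (\<Inter>k. A j k) \<le> 256 * 0 / (1 / (real j + 1))\<^sup>2"
      using le by (intro LIMSEQ_le_const) blast+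
    then have "measure circ (\<Inter>k. A j k) = 0" by (simp add: measure_le_0_iff)
    then show ?thesis using S by (simp add: null_sets_def circ.emeasure_eq_measure)
  qed
  have "AE x in circ. \<forall>j. x \<notin> (\<Inter>k. A j k)"
    unfolding AE_all_countable using AE_not_in[OF null] by blast
  with AE_space[of circ] show ?thesis
  proof eventually_elim
    case (elim x)
    note x = elim(1) and gd = elim(2)
    have x1: "cmod x = 1" using x by (simp add: space_circ)
    show ?case
    proof (rule tendsto_of_oscillation[OF rad_at_left])
      fix e :: real assume e: "e > 0"
      obtain j where j: "inverse (real (Suc j)) < e / 2" using reals_Archimedean[of "e/2"] e by auto
      obtain k where k: "x \<notin> A j k" using gd by blast
      \<comment> \<open>The value of the dilation at the boundary point serves as centre: the
        dilation is continuous up to the circle, and off \<open>A j k\<close> it stays within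
        \<open>1 / (j + 1)\<close> of \<open>f\<close>.\<close>
      let ?s = "complex_of_real (rad k)"
      have "isCont f (?s * (of_real 1 * x))"
        using holomorphic_on_imp_continuous_on[OF h] rad_bounds[of k] x1
        by (simp add: continuous_on_eq_continuous_at norm_mult)
      then have "isCont (\<lambda>p::real. f (?s * (of_real p * x))) 1"
        by (intro continuous_intros isCont_o2[where g = f and f = "\<lambda>p. ?s * (of_real p * x)"])
      then have "((\<lambda>p::real. f (?s * (of_real p * x))) \<longlongrightarrow> f (?s * (of_real 1 * x))) (at_left 1)"
        by (simp add: isCont_def filterlim_at_split)
      then have "\<forall>\<^sub>F p in at_left 1. dist (f (?s * (of_real p * x))) (f (?s * (of_real 1 * x))) < e / 2"
        using e by (intro tendstoD) auto
      moreover have "\<forall>\<^sub>F p in at_left (1::real). p \<in> {0<..<1}"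
        using eventually_at_left[of 0 "1::real"] by (auto intro: exI[of _ 0])
      ultimately have "\<forall>\<^sub>F p in at_left 1. dist (f (of_real p * x)) (f (?s * (of_real 1 * x))) < e"
      proof eventually_elim
        case (elim p)
        have "dist (f (of_real p * x)) (f (?s * (of_real p * x))) \<le> 1 / (real j + 1)"
          unfolding dist_norm using elim by (intro A[OF x k]) auto
        also have "\<dots> < e / 2" using j by (simp add: inverse_eq_divide add.commute)
        finally have "dist (f (of_real p * x)) (f (?s * (of_real p * x))) < e / 2" .
        with elim(1) show ?case
          using dist_triangle[of "f (of_real p * x)" "f (?s * (of_real 1 * x))" "f (?s * (of_real p * x))"] by simp
      qed
      then show "\<exists>c. \<forall>\<^sub>F p in at_left 1. dist (f (of_real p * x)) c < e" by blast
    qed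
  qed
qed

section \<open>Poisson integrals determine measures\<close>

lemma pois_first_moment:
  assumes "cmod z < 1"
  shows "(\<integral>x. x * of_real (pois z x) \<partial>circ) = z"
proof -
  have "(\<integral>x. (of_real (1/2) * x) * of_real (pois z x) \<partial>circ) = of_real (1/2) * z"
    by (rule pois_integral[of "\<lambda>x. x"]) (use assms in \<open>auto intro: holomorphic_intros\<close>)
  then have "of_real (1/2) * (\<integral>x. x * of_real (pois z x) \<partial>circ) = of_real (1/2) * z"
    by (simp only: mult.assoc Bochner_Integration.integral_mult_right_zero)
  then show ?thesis by simp
qed

text \<open>On the circle \<open>|y - x|^2 = 2 - 2 Re (cnj x * y)\<close>, and the mean of
  \<open>y\<close> under the Poisson kernel at \<open>r x\<close> is \<open>r x\<close>. The
  variance measures how fast the kernel concentrates at \<open>x\<close>.\<close>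

lemma pois_variance:
  assumes x: "cmod x = 1" and r: "0 \<le> r" "r < 1"
  shows "integrable circ (\<lambda>y. (cmod (y - x))\<^sup>2 * pois (of_real r * x) y)"
    and "(\<integral>y. (cmod (y - x))\<^sup>2 * pois (of_real r * x) y \<partial>circ) = 2 - 2 * r"
proof -
  let ?P = "pois (of_real r * x)"
  have z: "cmod (of_real r * x) < 1" using x r by (simp add: norm_mult)
  have Pi: "integrable circ ?P" by (rule pois_integrable[OF z])
  have i1: "integrable circ (\<lambda>y. cnj x * y * of_real (?P y))"
  proof -
    have "integrable circ (\<lambda>y. complex_of_real (?P y))" using Pi by simp
    moreover have "(\<lambda>y. cnj x * y) \<in> borel_measurable circ"
      by (rule circle_measurable_borel[OF sets_circ]) measurable
    moreover have "cmod (cnj x * y) \<le> 1" if "y \<in> space circ" for y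
      using that x by (simp add: space_circ norm_mult)
    ultimately show ?thesis by (rule integrable_mult_bounded)
  qed
  have eq: "(cmod (y - x))\<^sup>2 * ?P y = 2 * ?P y - 2 * Re (cnj x * y * of_real (?P y))" if y: "cmod y = 1" for y
  proof -
    have "complex_of_real ((cmod (y - x))\<^sup>2) = (y - x) * (cnj y - cnj x)"
      unfolding complex_norm_square by simp
    also have "\<dots> = y * cnj y + x * cnj x - (cnj x * y + cnj (cnj x * y))" by (simp add: algebra_simps)
    also have "\<dots> = of_real (2 - 2 * Re (cnj x * y))"
      using x y by (simp only: complex_norm_square[symmetric] complex_add_cnj) simp
    finally have V: "(cmod (y - x))\<^sup>2 = 2 - 2 * Re (cnj x * y)" by (simp only: of_real_eq_iff)
    have R: "Re (w * of_real p) = Re w * p" for w p by simp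
    show ?thesis unfolding V R left_diff_distrib by (simp only: mult.assoc)
  qed
  have a: "integrable circ (\<lambda>y. 2 * ?P y)" using Pi by (intro Bochner_Integration.integrable_mult_right)
  have b: "integrable circ (\<lambda>y. 2 * Re (cnj x * y * of_real (?P y)))"
    using i1 by (intro Bochner_Integration.integrable_mult_right integrable_Re)
  have i2: "integrable circ (\<lambda>y. 2 * ?P y - 2 * Re (cnj x * y * of_real (?P y)))"
    by (rule Bochner_Integration.integrable_diff[OF a b])
  show "integrable circ (\<lambda>y. (cmod (y - x))\<^sup>2 * ?P y)"
    by (rule Bochner_Integration.integrable_cong[THEN iffD2, OF refl _ i2]) (simp add: eq space_circ)
  have "(\<integral>y. (cmod (y - x))\<^sup>2 * ?P y \<partial>circ) = (\<integral>y. 2 * ?P y - 2 * Re (cnj x * y * of_real (?P y)) \<partial>circ)"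
    by (intro Bochner_Integration.integral_cong refl) (simp add: eq space_circ)
  also have "\<dots> = 2 * (\<integral>y. ?P y \<partial>circ) - 2 * (\<integral>y. Re (cnj x * y * of_real (?P y)) \<partial>circ)"
    by (simp only: Bochner_Integration.integral_diff[OF a b] Bochner_Integration.integral_mult_right_zero)
  also have "(\<integral>y. Re (cnj x * y * of_real (?P y)) \<partial>circ) = Re (\<integral>y. cnj x * y * of_real (?P y) \<partial>circ)"
    by (rule integral_Re[OF i1])
  also have "(\<integral>y. cnj x * y * of_real (?P y) \<partial>circ) = cnj x * (of_real r * x)"
    using pois_first_moment[OF z] by (simp only: mult.assoc Bochner_Integration.integral_mult_right_zero)
  also have "\<dots> = of_real r * (x * cnj x)" by (simp add: mult_ac)
  also have "\<dots> = of_real r" using x by (simp add: complex_norm_square[symmetric])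
  finally show "(\<integral>y. (cmod (y - x))\<^sup>2 * ?P y \<partial>circ) = 2 - 2 * r" using pois_mass[OF z] by simp
qed

lemma pois_lipschitz:
  fixes \<phi> :: "complex \<Rightarrow> real"
  assumes lip: "\<And>x y. \<bar>\<phi> x - \<phi> y\<bar> \<le> L * cmod (x - y)" and bnd: "\<And>x. \<bar>\<phi> x\<bar> \<le> B"
    and [measurable]: "\<phi> \<in> borel_measurable borel"
    and x: "cmod x = 1" and r: "0 \<le> r" "r < 1"
  shows "\<bar>(\<integral>y. \<phi> y * pois (of_real r * y) x \<partial>circ) - \<phi> x\<bar> \<le> 2 * L * sqrt (1 - r)"
proof -
  let ?P = "pois (of_real r * x)"
  have z: "cmod (of_real r * x) < 1" using x r by (simp add: norm_mult)
  have P0: "?P y \<ge> 0" for y using z by (intro pois_nonneg) simp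
  have Pi: "integrable circ ?P" by (rule pois_integrable[OF z])
  have L0: "L \<ge> 0" using lip[of 1 0] abs_ge_zero[of "\<phi> 1 - \<phi> 0"] by simp
  have B0: "B \<ge> 0" using bnd[of 0] by simp
  have pm: "\<phi> \<in> borel_measurable circ" by (rule circle_measurable_borel[OF sets_circ]) measurable
  have Pm: "?P \<in> borel_measurable circ" using Pi by (rule borel_measurable_integrable)
  have phP: "integrable circ (\<lambda>y. \<phi> y * ?P y)"
  proof (rule Bochner_Integration.integrable_bound)
    show "integrable circ (\<lambda>y. B * ?P y)" using Pi by simp
    show "(\<lambda>y. \<phi> y * ?P y) \<in> borel_measurable circ" using pm Pm by measurable
    show "AE y in circ. norm (\<phi> y * ?P y) \<le> norm (B * ?P y)"
      using bnd P0 B0 by (intro AE_I2) (simp add: abs_mult mult_right_mono)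
  qed
  \<comment> \<open>Balances the two terms of \<open>|y - x| \<le> e/2 + |y - x|^2 / (2 e)\<close>:
    with variance \<open>2 e^2\<close> their Poisson means add up to \<open>3 e / 2\<close>, which
    the bound rounds up to \<open>2 e\<close>.\<close>
  define e where "e = sqrt (1 - r)"
  have e: "e > 0" "e\<^sup>2 = 1 - r" using r by (auto simp: e_def)
  have "(\<integral>y. \<phi> y * pois (of_real r * y) x \<partial>circ) = (\<integral>y. \<phi> y * ?P y \<partial>circ)"
    by (intro Bochner_Integration.integral_cong refl) (simp add: space_circ pois_sym x)
  moreover have "\<phi> x = (\<integral>y. \<phi> x * ?P y \<partial>circ)" by (simp add: pois_mass[OF z])
  ultimately have "(\<integral>y. \<phi> y * pois (of_real r * y) x \<partial>circ) - \<phi> x = (\<integral>y. \<phi> y * ?P y - \<phi> x * ?P y \<partial>circ)"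
    using phP Pi by simp
  also have "\<bar>\<dots>\<bar> \<le> (\<integral>y. \<bar>\<phi> y * ?P y - \<phi> x * ?P y\<bar> \<partial>circ)"
    by (rule integral_abs_bound)
  also have "\<dots> \<le> (\<integral>y. L * (e / 2 * ?P y + 1 / (2 * e) * ((cmod (y - x))\<^sup>2 * ?P y)) \<partial>circ)"
  proof (rule integral_mono)
    show "integrable circ (\<lambda>y. \<bar>\<phi> y * ?P y - \<phi> x * ?P y\<bar>)" using phP Pi by auto
    show "integrable circ (\<lambda>y. L * (e / 2 * ?P y + 1 / (2 * e) * ((cmod (y - x))\<^sup>2 * ?P y)))"
      using Pi pois_variance(1)[OF x r]
      by (intro Bochner_Integration.integrable_mult_right Bochner_Integration.integrable_add)
    fix y
    let ?d = "cmod (y - x)"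
    have "0 \<le> (e - ?d)\<^sup>2" by simp
    then have "2 * e * ?d \<le> e\<^sup>2 + ?d\<^sup>2" by (simp add: power2_diff)
    then have d: "?d \<le> e / 2 + 1 / (2 * e) * ?d\<^sup>2"
      using e by (simp add: field_simps power2_eq_square)
    have "\<bar>\<phi> y * ?P y - \<phi> x * ?P y\<bar> = \<bar>\<phi> y - \<phi> x\<bar> * ?P y"
      using P0[of y] by (simp add: abs_mult flip: left_diff_distrib)
    also have "\<dots> \<le> (L * ?d) * ?P y" using lip P0 by (intro mult_right_mono)
    also have "\<dots> \<le> (L * (e / 2 + 1 / (2 * e) * ?d\<^sup>2)) * ?P y"
      using d L0 P0 by (intro mult_right_mono mult_left_mono)
    finally show "\<bar>\<phi> y * ?P y - \<phi> x * ?P y\<bar> \<le> L * (e / 2 * ?P y + 1 / (2 * e) * (?d\<^sup>2 * ?P y))"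
      by (simp add: algebra_simps)
  qed
  also have "\<dots> = L * (e / 2 * 1 + 1 / (2 * e) * (2 - 2 * r))"
    using Pi pois_variance[OF x r] pois_mass[OF z]
    by (simp only: Bochner_Integration.integral_mult_right_zero Bochner_Integration.integral_add
        Bochner_Integration.integrable_mult_right)
  also have "2 - 2 * r = 2 * e\<^sup>2" using e by simp
  also have "L * (e / 2 * 1 + 1 / (2 * e) * (2 * e\<^sup>2)) = L * (3 / 2 * e)"
    using e(1) by (simp add: power2_eq_square)
  also have "\<dots> \<le> 2 * L * e" using L0 e by simp
  finally show ?thesis by (simp add: e_def)
qed

lemma integrable_pair_fst:
  fixes k :: "'a \<Rightarrow> real"
  assumes k: "integrable M k"
    and h: "h \<in> borel_measurable (M \<Otimes>\<^sub>M circ)" "\<And>x y. x \<in> space M \<Longrightarrow> cmod y = 1 \<Longrightarrow> \<bar>h (x, y)\<bar> \<le> B"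
  shows "integrable (M \<Otimes>\<^sub>M circ) (\<lambda>(x, y). h (x, y) * k x)"
proof (rule Bochner_Integration.integrable_bound)
  have [measurable]: "k \<in> borel_measurable M" using k by (rule borel_measurable_integrable)
  note [measurable] = h(1)
  have "integrable (distr (M \<Otimes>\<^sub>M circ) M fst) k" using k by (simp add: circ.distr_pair_fst)
  then have "integrable (M \<Otimes>\<^sub>M circ) (\<lambda>p. k (fst p))" by (subst (asm) integrable_distr_eq) auto
  then show "integrable (M \<Otimes>\<^sub>M circ) (\<lambda>p. B * k (fst p))" by simp
  have "(\<lambda>p. h p * k (fst p)) \<in> borel_measurable (M \<Otimes>\<^sub>M circ)" by measurable
  then show "(\<lambda>(x, y). h (x, y) * k x) \<in> borel_measurable (M \<Otimes>\<^sub>M circ)"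
    by (simp add: case_prod_beta')
  show "AE p in M \<Otimes>\<^sub>M circ. norm (case p of (x, y) \<Rightarrow> h (x, y) * k x) \<le> norm (B * k (fst p))"
  proof (intro AE_I2)
    fix p assume "p \<in> space (M \<Otimes>\<^sub>M circ)"
    then obtain x y where p: "p = (x, y)" "x \<in> space M" "cmod y = 1"
      by (auto simp: space_pair_measure space_circ)
    from h(2)[OF p(2,3)] have "\<bar>h (x, y)\<bar> * \<bar>k x\<bar> \<le> \<bar>B\<bar> * \<bar>k x\<bar>" by (intro mult_right_mono) auto
    then show "norm (case p of (x, y) \<Rightarrow> h (x, y) * k x) \<le> norm (B * k (fst p))"
      by (simp add: p abs_mult)
  qed
qed

text \<open>Fubini moves the Poisson kernel from \<open>k\<close> onto \<open>\<phi>\<close>; the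
  Poisson integrals of \<open>\<phi>\<close> converge pointwise by \<open>pois_lipschitz\<close> and
  are bounded by \<open>B\<close>. Hence the Poisson integrals of the measure with density
  \<open>k\<close> determine its integrals against bounded Lipschitz functions.\<close>

lemma lipschitz_limit:
  fixes \<phi> k :: "complex \<Rightarrow> real"
  assumes M: "finite_measure M" "sets M = sets (restrict_space borel (sphere 0 1))" and k: "integrable M k"
    and lip: "\<And>x y. \<bar>\<phi> x - \<phi> y\<bar> \<le> L * cmod (x - y)" and bnd: "\<And>x. \<bar>\<phi> x\<bar> \<le> B"
    and [measurable]: "\<phi> \<in> borel_measurable borel"
  shows "(\<lambda>n. \<integral>y. \<phi> y * (\<integral>x. pois (of_real (rad n) * y) x * k x \<partial>M) \<partial>circ) \<longlonglongrightarrow> (\<integral>x. \<phi> x * k x \<partial>M)"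
proof -
  interpret M: finite_measure M by (rule M)
  interpret PP: pair_sigma_finite M circ ..
  have sp: "space M = sphere 0 1" by (rule circle_space[OF M(2)])
  have [measurable]: "k \<in> borel_measurable M" using k by (rule borel_measurable_integrable)
  have [measurable]: "\<phi> \<in> borel_measurable M" "\<phi> \<in> borel_measurable circ"
    by (rule circle_measurable_borel[OF M(2)] circle_measurable_borel[OF sets_circ], measurable)+
  have idM [measurable]: "(\<lambda>x. x) \<in> measurable M borel" by (rule circle_measurable_borel[OF M(2)]) simp
  have idc [measurable]: "(\<lambda>x. x) \<in> measurable circ borel" by (rule circle_measurable_borel[OF sets_circ]) simp
  have fstm [measurable]: "(\<lambda>p. fst p) \<in> borel_measurable (M \<Otimes>\<^sub>M circ)"
    using measurable_compose[OF measurable_fst idM] by simp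
  have sndm [measurable]: "(\<lambda>p. snd p) \<in> borel_measurable (M \<Otimes>\<^sub>M circ)"
    using measurable_compose[OF measurable_snd idc] by simp
  have L0: "L \<ge> 0" using lip[of 1 0] abs_ge_zero[of "\<phi> 1 - \<phi> 0"] by simp
  have B0: "B \<ge> 0" using bnd[of 0] by simp
  define u where "u n x = (\<integral>y. \<phi> y * pois (of_real (rad n) * y) x \<partial>circ)" for n x
  have pb: "0 \<le> pois (of_real (rad n) * y) x" "pois (of_real (rad n) * y) x \<le> 1 / (1 - rad n)\<^sup>2"
    if "cmod x = 1" "cmod y = 1" for n x y
    using that rad_bounds[of n] by (auto intro!: pois_nonneg pois_le simp: norm_mult)
  have swap: "(\<integral>y. \<phi> y * (\<integral>x. pois (of_real (rad n) * y) x * k x \<partial>M) \<partial>circ) = (\<integral>x. u n x * k x \<partial>M)" for n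
  proof -
    have "integrable (M \<Otimes>\<^sub>M circ) (\<lambda>(x, y). (\<phi> (snd (x, y)) * pois (of_real (rad n) * snd (x, y)) (fst (x, y))) * k x)"
    proof (rule integrable_pair_fst[OF k])
      show "(\<lambda>p. \<phi> (snd p) * pois (of_real (rad n) * snd p) (fst p)) \<in> borel_measurable (M \<Otimes>\<^sub>M circ)"
        by measurable
      show "\<bar>\<phi> (snd (x, y)) * pois (of_real (rad n) * snd (x, y)) (fst (x, y))\<bar> \<le> B * (1 / (1 - rad n)\<^sup>2)"
        if "x \<in> space M" "cmod y = 1" for x y
        unfolding abs_mult using bnd pb[of x y n] that sp B0 by (intro mult_mono) auto
    qed
    from PP.Fubini_integral[OF this[unfolded fst_conv snd_conv]]
    have "(\<integral>y. (\<integral>x. \<phi> y * pois (of_real (rad n) * y) x * k x \<partial>M) \<partial>circ)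
        = (\<integral>x. (\<integral>y. \<phi> y * pois (of_real (rad n) * y) x * k x \<partial>circ) \<partial>M)" .
    moreover have "(\<integral>y. \<phi> y * pois (of_real (rad n) * y) x * k x \<partial>circ) = u n x * k x" for x
      by (simp only: u_def Bochner_Integration.integral_mult_left_zero)
    moreover have "(\<integral>x. \<phi> y * pois (of_real (rad n) * y) x * k x \<partial>M) = \<phi> y * (\<integral>x. pois (of_real (rad n) * y) x * k x \<partial>M)" for y
      by (simp only: mult.assoc Bochner_Integration.integral_mult_right_zero)
    ultimately show ?thesis by (simp only:)
  qed
  have "(\<lambda>n. \<integral>x. u n x * k x \<partial>M) \<longlonglongrightarrow> (\<integral>x. \<phi> x * k x \<partial>M)"
  proof (rule integral_dominated_convergence)
    show "(\<lambda>x. \<phi> x * k x) \<in> borel_measurable M" by measurable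
    have um: "u n \<in> borel_measurable M" for n
    proof -
      have "(\<lambda>x. \<integral>y. (\<lambda>p. \<phi> (snd p) * pois (of_real (rad n) * snd p) (fst p)) (x, y) \<partial>circ) \<in> borel_measurable M"
        by (intro circ.borel_measurable_lebesgue_integral) measurable
      then show ?thesis by (simp add: u_def[abs_def])
    qed
    then show "(\<lambda>x. u n x * k x) \<in> borel_measurable M" for n by measurable
    show "integrable M (\<lambda>x. B * \<bar>k x\<bar>)" using k by simp
    show "AE x in M. (\<lambda>n. u n x * k x) \<longlonglongrightarrow> \<phi> x * k x"
    proof (intro AE_I2)
      fix x assume "x \<in> space M"
      then have x: "cmod x = 1" by (simp add: sp)
      have "(\<lambda>n. u n x - \<phi> x) \<longlonglongrightarrow> 0"
      proof (rule Lim_null_comparison)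
        show "\<forall>\<^sub>F n in sequentially. norm (u n x - \<phi> x) \<le> 2 * L * sqrt (1 - rad n)"
          unfolding u_def real_norm_def
          by (intro always_eventually allI pois_lipschitz[OF lip bnd _ x rad_bounds]) measurable
        have "(\<lambda>n. 2 * L * sqrt (1 - rad n)) \<longlonglongrightarrow> 2 * L * sqrt (1 - 1)"
          by (intro tendsto_intros rad_tendsto)
        then show "(\<lambda>n. 2 * L * sqrt (1 - rad n)) \<longlonglongrightarrow> 0" by simp
      qed
      then show "(\<lambda>n. u n x * k x) \<longlonglongrightarrow> \<phi> x * k x"
        by (intro tendsto_intros) (simp add: LIM_zero_iff)
    qed
    show "AE x in M. norm (u n x * k x) \<le> B * \<bar>k x\<bar>" for n
    proof (intro AE_I2)
      fix x assume "x \<in> space M"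
      then have x: "cmod x = 1" by (simp add: sp)
      have z: "cmod (of_real (rad n) * x) < 1" using x rad_bounds[of n] by (simp add: norm_mult)
      have "\<bar>u n x\<bar> \<le> (\<integral>y. \<bar>\<phi> y * pois (of_real (rad n) * y) x\<bar> \<partial>circ)"
        unfolding u_def by (rule integral_abs_bound)
      also have "\<dots> \<le> (\<integral>y. B * pois (of_real (rad n) * x) y \<partial>circ)"
      proof (rule integral_mono_AE)
        have xs: "x \<in> space M" using x sp by simp
        show "integrable circ (\<lambda>y. \<bar>\<phi> y * pois (of_real (rad n) * y) x\<bar>)"
        proof (rule integrable_circ_real[of _ "B * (1 / (1 - rad n)\<^sup>2)"])
          show "\<bar>\<bar>\<phi> y * pois (of_real (rad n) * y) x\<bar>\<bar> \<le> B * (1 / (1 - rad n)\<^sup>2)" if "cmod y = 1" for y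
            unfolding abs_abs abs_mult using bnd pb[OF x that, of n] B0 by (intro mult_mono) auto
        qed measurable
        show "integrable circ (\<lambda>y. B * pois (of_real (rad n) * x) y)" using pois_integrable[OF z] by simp
        show "AE y in circ. \<bar>\<phi> y * pois (of_real (rad n) * y) x\<bar> \<le> B * pois (of_real (rad n) * x) y"
        proof (intro AE_I2)
          fix y assume "y \<in> space circ"
          then have y: "cmod y = 1" by (simp add: space_circ)
          show "\<bar>\<phi> y * pois (of_real (rad n) * y) x\<bar> \<le> B * pois (of_real (rad n) * x) y"
            using bnd[of y] pb[OF x y, of n] pois_sym[OF x y] by (simp add: abs_mult mult_right_mono)
        qed
      qed
      also have "\<dots> = B" using pois_mass[OF z] by simp
      finally show "norm (u n x * k x) \<le> B * \<bar>k x\<bar>" by (simp add: abs_mult mult_right_mono)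
    qed
  qed
  then show ?thesis unfolding swap .
qed

text \<open>Lipschitz functions decreasing to the indicator of a closed set \<open>S\<close>. For
  \<open>S = {}\<close>, \<open>infdist\<close> is 0 and the bump is constantly 1, hence the
  nonemptiness conditions below.\<close>

definition bump :: "complex set \<Rightarrow> nat \<Rightarrow> complex \<Rightarrow> real" where
  "bump S n x = max 0 (1 - real n * infdist x S)"

lemma bump_lipschitz: "\<bar>bump S n x - bump S n y\<bar> \<le> real n * cmod (x - y)"
proof -
  have 1: "infdist x S \<le> infdist y S + dist x y" "infdist y S \<le> infdist x S + dist x y"
    using infdist_triangle[of x S y] infdist_triangle[of y S x] by (auto simp: dist_commute)
  have "\<bar>bump S n x - bump S n y\<bar> \<le> \<bar>real n * infdist x S - real n * infdist y S\<bar>"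
    by (auto simp: bump_def max_def)
  also have "\<dots> = real n * \<bar>infdist x S - infdist y S\<bar>"
    by (simp add: abs_mult flip: right_diff_distrib)
  also have "\<dots> \<le> real n * cmod (x - y)" using 1 by (intro mult_left_mono) (auto simp: dist_norm)
  finally show ?thesis .
qed

lemma bump_bounds: "0 \<le> bump S n x" "\<bar>bump S n x\<bar> \<le> 1"
  using infdist_nonneg[of x S] by (auto simp: bump_def)

lemma bump_measurable: "bump S n \<in> borel_measurable borel"
  unfolding bump_def[abs_def] by (intro borel_measurable_continuous_onI continuous_intros)

lemma bump_tendsto:
  assumes "closed S" "S \<noteq> {}"
  shows "(\<lambda>n. bump S n x) \<longlonglongrightarrow> indicator S x"
proof (cases "x \<in> S")
  case True
  then show ?thesis by (simp add: bump_def)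
next
  case False
  then have pos: "infdist x S > 0" using assms by (simp add: infdist_pos_not_in_closed)
  obtain N :: nat where N: "1 < real N * infdist x S" using reals_Archimedean3[OF pos] by auto
  have "bump S n x = 0" if "n \<ge> N" for n
  proof -
    have "real N * infdist x S \<le> real n * infdist x S" using that pos by (intro mult_right_mono) auto
    then show ?thesis using N by (simp add: bump_def)
  qed
  then have "\<forall>\<^sub>F n in sequentially. bump S n x = 0" by (rule eventually_sequentiallyI)
  then show ?thesis using False by (simp add: tendsto_eventually)
qed

lemma bump_integral_limit:
  fixes k :: "complex \<Rightarrow> real"
  assumes M: "sets M = sets (restrict_space borel (sphere 0 1))" and k: "integrable M k"
    and S: "closed S" "S \<noteq> {}"
  shows "(\<lambda>n. \<integral>x. bump S n x * k x \<partial>M) \<longlonglongrightarrow> (\<integral>x. indicator S x * k x \<partial>M)"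
proof (rule integral_dominated_convergence)
  have [measurable]: "k \<in> borel_measurable M" using k by (rule borel_measurable_integrable)
  have [measurable]: "bump S n \<in> borel_measurable M" for n
    by (rule circle_measurable_borel[OF M bump_measurable])
  have "(indicator S :: complex \<Rightarrow> real) \<in> borel_measurable M"
    using S by (intro circle_measurable_borel[OF M]) simp
  then show "(\<lambda>x. indicator S x * k x) \<in> borel_measurable M" by measurable
  show "(\<lambda>x. bump S n x * k x) \<in> borel_measurable M" for n by measurable
  show "integrable M (\<lambda>x. \<bar>k x\<bar>)" using k by simp
  show "AE x in M. (\<lambda>n. bump S n x * k x) \<longlonglongrightarrow> indicator S x * k x"
    by (intro AE_I2 tendsto_intros bump_tendsto S)
  show "AE x in M. norm (bump S n x * k x) \<le> \<bar>k x\<bar>" for n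
    using bump_bounds[of S n] by (intro AE_I2) (simp add: abs_mult mult_left_le_one_le)
qed

text \<open>Nonnegativity passes from Poisson integrals to Lipschitz bumps, then to closed sets,
  then by inner regularity to the set where \<open>k\<close> is negative. Applied to functions and
  their negatives it gives uniqueness; applied to \<open>M^2 - |h|^2\<close> it gives essential
  bounds.\<close>

lemma pois_positive:
  fixes k :: "complex \<Rightarrow> real"
  assumes M: "finite_measure M" "sets M = sets (restrict_space borel (sphere 0 1))" and k: "integrable M k"
    and pos: "\<And>z. cmod z < 1 \<Longrightarrow> (\<integral>x. pois z x * k x \<partial>M) \<ge> 0"
  shows "AE x in M. k x \<ge> 0"
proof -
  interpret M: finite_measure M by (rule M)
  have sp: "space M = sphere 0 1" by (rule circle_space[OF M(2)])
  have km [measurable]: "k \<in> borel_measurable M" using k by (rule borel_measurable_integrable)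
  have bump_pos: "(\<integral>x. bump S n x * k x \<partial>M) \<ge> 0" for S n
  proof (rule LIMSEQ_le_const[OF lipschitz_limit[OF M k bump_lipschitz bump_bounds(2) bump_measurable]])
    have "(\<integral>y. bump S n y * (\<integral>x. pois (of_real (rad m) * y) x * k x \<partial>M) \<partial>circ) \<ge> 0" for m
    proof (intro integral_nonneg_AE AE_I2)
      fix y assume "y \<in> space circ"
      then have "cmod (of_real (rad m) * y) < 1" using rad_bounds[of m] by (simp add: space_circ norm_mult)
      then show "0 \<le> bump S n y * (\<integral>x. pois (of_real (rad m) * y) x * k x \<partial>M)"
        by (rule mult_nonneg_nonneg[OF bump_bounds(1) pos])
    qed
    then show "\<exists>N. \<forall>m\<ge>N. 0 \<le> (\<integral>y. bump S n y * (\<integral>x. pois (of_real (rad m) * y) x * k x \<partial>M) \<partial>circ)"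
      by blast
  qed
  have closed_pos: "(\<integral>x. indicator S x * k x \<partial>M) \<ge> 0" if "closed S" for S
  proof (cases "S = {}")
    case False
    show ?thesis
      by (rule LIMSEQ_le_const[OF bump_integral_limit[OF M(2) k that False]]) (use bump_pos in blast)
  qed simp
  define A where "A = {x \<in> space M. k x < 0}"
  have A: "A \<in> sets M" unfolding A_def by measurable
  \<comment> \<open>The negative part of the measure with density \<open>k\<close>, regarded as a
    Borel measure on the plane, where inner regularity by compact sets is available.\<close>
  define N where "N = distr (density M (\<lambda>x. ennreal (- k x) * indicator A x)) borel (\<lambda>x. x)"
  have idM: "(\<lambda>x. x) \<in> measurable M borel" by (rule circle_measurable_borel[OF M(2)]) simp
  have em: "emeasure N B = ennreal (\<integral>x. indicator (A \<inter> B) x * (- k x) \<partial>M)" if B: "B \<in> sets borel" for B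
  proof -
    have BM: "B \<inter> space M \<in> sets M" using measurable_sets[OF idM B] by (simp add: vimage_def Int_def conj_commute)
    have "emeasure N B = emeasure (density M (\<lambda>x. ennreal (- k x) * indicator A x)) (B \<inter> space M)"
      unfolding N_def using idM B by (subst emeasure_distr) (auto simp: vimage_def Int_def)
    also have "\<dots> = (\<integral>\<^sup>+x. ennreal (- k x) * indicator A x * indicator (B \<inter> space M) x \<partial>M)"
      using A BM by (subst emeasure_density) auto
    also have "\<dots> = (\<integral>\<^sup>+x. ennreal (indicator (A \<inter> B) x * (- k x)) \<partial>M)"
      by (intro nn_integral_cong) (auto simp: A_def split: split_indicator)
    also have "\<dots> = ennreal (\<integral>x. indicator (A \<inter> B) x * (- k x) \<partial>M)"
    proof (rule nn_integral_eq_integral)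
      have "A \<inter> B = A \<inter> (B \<inter> space M)" by (auto simp: A_def)
      then have "A \<inter> B \<in> sets M" using A BM by auto
      then show "integrable M (\<lambda>x. indicator (A \<inter> B) x * (- k x))"
        using k by (intro integrable_mult_indicator[where 'b = real, unfolded real_scaleR_def]) auto
      show "AE x in M. 0 \<le> indicator (A \<inter> B) x * (- k x)"
        by (intro AE_I2) (auto simp: A_def split: split_indicator)
    qed
    finally show ?thesis .
  qed
  have A': "A \<in> sets borel"
    using A M(2) by (auto simp: sets_restrict_space)
  have "emeasure N A = (SUP K \<in> {K. K \<subseteq> A \<and> compact K}. emeasure N K)"
    by (rule inner_regular) (use em[of UNIV] A' in \<open>auto simp: N_def\<close>)
  also have "\<dots> \<le> 0"
  proof (rule SUP_least)
    fix K assume K: "K \<in> {K. K \<subseteq> A \<and> compact K}"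
    then have "closed K" "K \<subseteq> A" by (auto intro: compact_imp_closed)
    then have "A \<inter> K = K" by auto
    then have "emeasure N K = ennreal (\<integral>x. indicator K x * (- k x) \<partial>M)"
      using em[of K] \<open>closed K\<close> by simp
    also have "(\<integral>x. indicator K x * (- k x) \<partial>M) = - (\<integral>x. indicator K x * k x \<partial>M)" by simp
    also have "ennreal (- (\<integral>x. indicator K x * k x \<partial>M)) = 0"
      using closed_pos[OF \<open>closed K\<close>] by (simp add: ennreal_neg)
    finally show "emeasure N K \<le> 0" by simp
  qed
  finally have "emeasure N A = 0" by simp
  then have "(\<integral>x. indicator (A \<inter> A) x * (- k x) \<partial>M) \<le> 0" using em[OF A'] by (simp add: ennreal_eq_0_iff)
  then have I0: "(\<integral>x. indicator A x * (- k x) \<partial>M) \<le> 0" by simp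
  have int: "integrable M (\<lambda>x. indicator A x * (- k x))"
    using k A by (intro integrable_mult_indicator[where 'b = real, unfolded real_scaleR_def]) auto
  have nn: "AE x in M. 0 \<le> indicator A x * (- k x)"
    by (intro AE_I2) (auto simp: A_def split: split_indicator)
  have "AE x in M. indicator A x * (- k x) = 0"
    using integral_nonneg_eq_0_iff_AE[OF int nn] integral_nonneg_AE[OF nn] I0 by simp
  with AE_space show ?thesis
    by eventually_elim (auto simp: A_def split: split_indicator_asm)
qed

text \<open>By \<open>pois_eq\<close> the two vanishing conditions, together with the first at
  \<open>z = 0\<close> for the mean, make every Poisson integral of \<open>g\<close> vanish;
  \<open>pois_positive\<close> then applies to the real and imaginary parts and their
  negatives.\<close>

lemma cauchy_null:
  fixes g :: "complex \<Rightarrow> complex"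
  assumes M: "finite_measure M" "sets M = sets (restrict_space borel (sphere 0 1))" and g: "integrable M g"
    and 1: "\<And>z. cmod z < 1 \<Longrightarrow> (\<integral>x. g x / (1 - z * cnj x) \<partial>M) = 0"
    and 2: "\<And>z. cmod z < 1 \<Longrightarrow> (\<integral>x. g x * cnj (1 / (1 - z * cnj x)) \<partial>M) = 0"
  shows "AE x in M. g x = 0"
proof -
  have sp: "space M = sphere 0 1" by (rule circle_space[OF M(2)])
  have P: "(\<integral>x. of_real (pois z x) * g x \<partial>M) = 0" and Pi: "integrable M (\<lambda>x. of_real (pois z x) * g x)"
    if z: "cmod z < 1" for z
  proof -
    have k: "(\<lambda>x. 1 / (1 - z * cnj x)) \<in> borel_measurable M"
      by (rule circle_measurable_borel[OF M(2)]) measurable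
    have b: "cmod (1 / (1 - z * cnj x)) \<le> 1 / (1 - cmod z)" if "x \<in> space M" for x
      using that z by (intro cauchy_kernel_bound) (auto simp: sp)
    have i1: "integrable M (\<lambda>x. 1 / (1 - z * cnj x) * g x)"
      by (rule integrable_mult_bounded[OF g k b])
    have i2: "integrable M (\<lambda>x. cnj (1 / (1 - z * cnj x)) * g x)"
      by (rule integrable_mult_bounded[OF g, of _ "1 / (1 - cmod z)"])
        (use k b in \<open>auto intro!: borel_measurable_cnj simp del: complex_cnj_divide complex_cnj_diff complex_cnj_mult\<close>)
    have eq: "of_real (pois z x) * g x = 1 / (1 - z * cnj x) * g x + cnj (1 / (1 - z * cnj x)) * g x - g x"
      if "x \<in> space M" for x
    proof -
      have "cmod x = 1" using that by (simp add: sp)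
      from pois_eq[OF this z] show ?thesis by (simp only:) (simp add: algebra_simps)
    qed
    have i3: "integrable M (\<lambda>x. 1 / (1 - z * cnj x) * g x + cnj (1 / (1 - z * cnj x)) * g x - g x)"
      using i1 i2 g by (intro Bochner_Integration.integrable_diff Bochner_Integration.integrable_add)
    show "integrable M (\<lambda>x. of_real (pois z x) * g x)"
      by (rule Bochner_Integration.integrable_cong[THEN iffD2, OF refl _ i3]) (rule eq)
    have "(\<integral>x. of_real (pois z x) * g x \<partial>M)
      = (\<integral>x. 1 / (1 - z * cnj x) * g x + cnj (1 / (1 - z * cnj x)) * g x - g x \<partial>M)"
      by (intro Bochner_Integration.integral_cong refl eq)
    also have "\<dots> = (\<integral>x. 1 / (1 - z * cnj x) * g x \<partial>M) + (\<integral>x. cnj (1 / (1 - z * cnj x)) * g x \<partial>M) - (\<integral>x. g x \<partial>M)"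
      using i1 i2 g by (subst Bochner_Integration.integral_diff) auto
    also have "\<dots> = 0" using 1[OF z] 2[OF z] 1[of 0] by (simp add: mult.commute)
    finally show "(\<integral>x. of_real (pois z x) * g x \<partial>M) = 0" .
  qed
  have Re0: "(\<integral>x. pois z x * Re (g x) \<partial>M) = 0" if z: "cmod z < 1" for z
  proof -
    have "(\<integral>x. Re (of_real (pois z x) * g x) \<partial>M) = Re (\<integral>x. of_real (pois z x) * g x \<partial>M)"
      by (rule integral_Re[OF Pi[OF z]])
    then show ?thesis using P[OF z] by simp
  qed
  have Im0: "(\<integral>x. pois z x * Im (g x) \<partial>M) = 0" if z: "cmod z < 1" for z
  proof -
    have "(\<integral>x. Im (of_real (pois z x) * g x) \<partial>M) = Im (\<integral>x. of_real (pois z x) * g x \<partial>M)"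
      by (rule integral_Im[OF Pi[OF z]])
    then show ?thesis using P[OF z] by simp
  qed
  have "AE x in M. Re (g x) \<ge> 0" using g Re0 by (intro pois_positive[OF M]) auto
  moreover have "AE x in M. - Re (g x) \<ge> 0" using g Re0 by (intro pois_positive[OF M]) auto
  moreover have "AE x in M. Im (g x) \<ge> 0" using g Im0 by (intro pois_positive[OF M]) auto
  moreover have "AE x in M. - Im (g x) \<ge> 0" using g Im0 by (intro pois_positive[OF M]) auto
  ultimately show ?thesis by eventually_elim (simp add: complex_eq_iff)
qed

lemma fourier_null:
  fixes g :: "complex \<Rightarrow> complex"
  assumes g: "integrable circ g" and 1: "\<And>n. (\<integral>x. g x * cnj x ^ n \<partial>circ) = 0"
    and 2: "\<And>n. (\<integral>x. g x * x ^ Suc n \<partial>circ) = 0"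
  shows "AE x in circ. g x = 0"
proof (rule cauchy_null[OF _ sets_circ g])
  show "finite_measure circ" by unfold_locales
  fix z :: complex assume z: "cmod z < 1"
  have "(\<lambda>n. z ^ n * 0) sums (\<integral>x. g x / (1 - z * cnj x) \<partial>circ)"
    using cauchy_transform_sums[OF sets_circ g z] unfolding 1 .
  then have "(\<lambda>n. 0) sums (\<integral>x. g x / (1 - z * cnj x) \<partial>circ)" by (simp only: mult_zero_right)
  then show "(\<integral>x. g x / (1 - z * cnj x) \<partial>circ) = 0" by (rule sums_unique2[OF _ sums_zero])
  have c: "(\<integral>x. cnj (g x) * cnj x ^ n \<partial>circ) = 0" for n
  proof -
    have "(\<integral>x. g x * x ^ n \<partial>circ) = 0" using 1[of 0] 2[of "n - 1"] by (cases n) auto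
    then have "cnj (\<integral>x. g x * x ^ n \<partial>circ) = 0" by simp
    then show ?thesis by (simp flip: Bochner_Integration.integral_cnj)
  qed
  have "(\<lambda>n. z ^ n * 0) sums (\<integral>x. cnj (g x) / (1 - z * cnj x) \<partial>circ)"
    using cauchy_transform_sums[OF sets_circ _ z, of "\<lambda>x. cnj (g x)"] g unfolding c by simp
  then have "(\<lambda>n. 0) sums (\<integral>x. cnj (g x) / (1 - z * cnj x) \<partial>circ)" by (simp only: mult_zero_right)
  then have "(\<integral>x. cnj (g x) / (1 - z * cnj x) \<partial>circ) = 0" by (rule sums_unique2[OF _ sums_zero])
  then have "cnj (\<integral>x. cnj (g x) / (1 - z * cnj x) \<partial>circ) = 0" by simp
  then show "(\<integral>x. g x * cnj (1 / (1 - z * cnj x)) \<partial>circ) = 0"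
    unfolding Bochner_Integration.integral_cnj[symmetric] by simp
qed

text \<open>Equal Poisson integrals give equal integrals of bumps and hence equal measures of closed
  sets, which generate the Borel sets and are stable under intersection. This is the uniqueness of
  Clark measures.\<close>

lemma circle_measure_eqI:
  assumes M: "finite_measure M" "sets M = sets (restrict_space borel (sphere 0 1))"
    and N: "finite_measure N" "sets N = sets (restrict_space borel (sphere 0 1))"
    and eq: "\<And>z. cmod z < 1 \<Longrightarrow> (\<integral>x. pois z x \<partial>M) = (\<integral>x. pois z x \<partial>N)"
  shows "M = N"
proof -
  interpret M: finite_measure M by (rule M)
  interpret N: finite_measure N by (rule N)
  have sp: "space M = sphere 0 1" "space N = sphere 0 1" by (rule circle_space[OF M(2)] circle_space[OF N(2)])+
  have 1: "integrable M (\<lambda>x. 1::real)" "integrable N (\<lambda>x. 1::real)" by simp_all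
  have bump_eq: "(\<integral>x. bump S n x * 1 \<partial>M) = (\<integral>x. bump S n x * 1 \<partial>N)" for S n
  proof (rule LIMSEQ_unique)
    show "(\<lambda>m. \<integral>y. bump S n y * (\<integral>x. pois (of_real (rad m) * y) x * 1 \<partial>M) \<partial>circ) \<longlonglongrightarrow> (\<integral>x. bump S n x * 1 \<partial>M)"
      by (rule lipschitz_limit[OF M 1(1) bump_lipschitz bump_bounds(2) bump_measurable])
    have "(\<integral>y. bump S n y * (\<integral>x. pois (of_real (rad m) * y) x * 1 \<partial>M) \<partial>circ)
        = (\<integral>y. bump S n y * (\<integral>x. pois (of_real (rad m) * y) x * 1 \<partial>N) \<partial>circ)" for m
      using eq rad_bounds[of m] by (intro Bochner_Integration.integral_cong refl) (auto simp: space_circ norm_mult)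
    then show "(\<lambda>m. \<integral>y. bump S n y * (\<integral>x. pois (of_real (rad m) * y) x * 1 \<partial>M) \<partial>circ) \<longlonglongrightarrow> (\<integral>x. bump S n x * 1 \<partial>N)"
      using lipschitz_limit[OF N 1(2) bump_lipschitz bump_bounds(2) bump_measurable] by simp
  qed
  have closed_eq: "measure M S = measure N S" if S: "closed S" "S \<subseteq> sphere 0 1" for S
  proof (cases "S = {}")
    case False
    have SM: "S \<in> sets M" "S \<in> sets N"
      using S unfolding M(2) N(2) sets_restrict_space by (auto intro!: image_eqI[of _ _ S])
    have "(\<integral>x. indicator S x * 1 \<partial>M) = (\<integral>x. indicator S x * (1::real) \<partial>N)"
      by (rule LIMSEQ_unique[OF bump_integral_limit[OF M(2) 1(1) S(1) False]])
        (use bump_integral_limit[OF N(2) 1(2) S(1) False] bump_eq in simp)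
    then show ?thesis using SM by simp
  qed simp
  define E where "E = {S. closed S \<and> S \<subseteq> sphere (0::complex) 1}"
  have gen: "sets (restrict_space borel (sphere (0::complex) 1)) = sigma_sets (sphere 0 1) E"
  proof -
    have "sets (restrict_space (sigma UNIV (Collect closed)) (sphere (0::complex) 1)) = sigma_sets (sphere 0 1) ((\<inter>) (sphere 0 1) ` Collect closed)"
      by (subst sets_restrict_space, subst sets_measure_of, simp, rule restricted_sigma) auto
    moreover have "(\<inter>) (sphere 0 1) ` Collect closed = E"
      by (auto simp: E_def intro!: image_eqI)
    ultimately show ?thesis by (simp add: borel_eq_closed)
  qed
  show ?thesis
  proof (rule measure_eqI_generator_eq[where E = E and \<Omega> = "sphere 0 1" and A = "\<lambda>_. sphere 0 1"])
    show "Int_stable E" by (auto simp: Int_stable_def E_def)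
    show "sets M = sigma_sets (sphere 0 1) E" "sets N = sigma_sets (sphere 0 1) E"
      using M N gen by auto
    show "emeasure M X = emeasure N X" if "X \<in> E" for X
      using that closed_eq[of X] by (simp add: E_def M.emeasure_eq_measure N.emeasure_eq_measure)
  qed (auto simp: E_def)
qed

section \<open>Boundary functions and the space \<open>H2\<close>\<close>

lemma abs_l2_eq_iff: "sqi circ f \<Longrightarrow> sqi circ g \<Longrightarrow> abs_l2 f = abs_l2 g \<longleftrightarrow> (AE x in circ. f x = g x)"
  using Quotient3_rel[OF Quotient3_l2, of f g] by (simp add: square_integrable_iff)

lemma rep_l2_sqi: "sqi circ (rep_l2 x)"
  using Quotient3_rep_reflp[OF Quotient3_l2, of x] by (simp add: square_integrable_iff)

lemma abs_rep_l2: "abs_l2 (rep_l2 x) = x"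
  by (rule Quotient3_abs_rep[OF Quotient3_l2])

lemma rep_abs_l2: "sqi circ f \<Longrightarrow> AE x in circ. rep_l2 (abs_l2 f) x = f x"
  using abs_l2_eq_iff[OF rep_l2_sqi] abs_rep_l2 by metis

lemma l2_inner_abs: "sqi circ f \<Longrightarrow> sqi circ g \<Longrightarrow> l2_inner (abs_l2 f) (abs_l2 g) = ip circ f g"
  by (simp add: l2_inner.abs_eq square_integrable_iff ip_def)

lemma l2_inner_rep: "l2_inner x y = ip circ (rep_l2 x) (rep_l2 y)"
  using l2_inner_abs[OF rep_l2_sqi rep_l2_sqi, of x y] by (simp add: abs_rep_l2)

lemma l2_add_abs: "sqi circ f \<Longrightarrow> sqi circ g \<Longrightarrow> abs_l2 f + abs_l2 g = abs_l2 (\<lambda>x. f x + g x)"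
  by (simp add: plus_l2.abs_eq square_integrable_iff)

lemma l2_scale_abs: "sqi circ f \<Longrightarrow> c *\<^sub>C abs_l2 f = abs_l2 (\<lambda>x. c * f x)"
  by (simp add: l2_scale.abs_eq square_integrable_iff)

lemma l2_diff_abs: "sqi circ f \<Longrightarrow> sqi circ g \<Longrightarrow> abs_l2 f - abs_l2 g = abs_l2 (\<lambda>x. f x - g x)"
  by (simp add: minus_l2_def uminus_l2_def l2_scale_abs l2_add_abs sqi_scale[of _ _ "-1", simplified])

lemma l2_cnj_abs: "sqi circ f \<Longrightarrow> l2_cnj (abs_l2 f) = abs_l2 (\<lambda>x. cnj (f x))"
  by (simp add: l2_cnj.abs_eq square_integrable_iff)

lemma l2_mult_abs:
  "sqi circ f \<Longrightarrow> sqi circ g \<Longrightarrow> sqi circ (\<lambda>x. f x * g x) \<Longrightarrow> abs_l2 f \<odot> abs_l2 g = abs_l2 (\<lambda>x. f x * g x)"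
  by (simp add: l2_mult.abs_eq square_integrable_iff)

lemma l2_norm_abs: "sqi circ f \<Longrightarrow> (norm (abs_l2 f))\<^sup>2 = nsq circ f"
  by (simp add: norm_l2_def inner_l2_def l2_inner_abs ip_self)

lemma l2_norm_rep: "(norm x)\<^sup>2 = nsq circ (rep_l2 x)"
  using l2_norm_abs[OF rep_l2_sqi, of x] by (simp add: abs_rep_l2)

lemma rep_l2_add: "AE t in circ. rep_l2 (x + y) t = rep_l2 x t + rep_l2 y t"
  using rep_abs_l2[OF sqi_add[OF rep_l2_sqi rep_l2_sqi], of x y]
    l2_add_abs[OF rep_l2_sqi rep_l2_sqi, of x y] by (simp add: abs_rep_l2)

lemma rep_l2_scale: "AE t in circ. rep_l2 (c *\<^sub>C x) t = c * rep_l2 x t"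
  using rep_abs_l2[OF sqi_scale[OF rep_l2_sqi], of c x] l2_scale_abs[OF rep_l2_sqi, of c x]
  by (simp add: abs_rep_l2)

lemma l2_inner_add: "l2_inner (x + y) z = l2_inner x z + l2_inner y z"
proof -
  have "l2_inner (abs_l2 (rep_l2 x) + abs_l2 (rep_l2 y)) (abs_l2 (rep_l2 z)) =
      l2_inner (abs_l2 (rep_l2 x)) (abs_l2 (rep_l2 z)) + l2_inner (abs_l2 (rep_l2 y)) (abs_l2 (rep_l2 z))"
    by (simp add: l2_add_abs l2_inner_abs rep_l2_sqi sqi_add ip_add_left)
  then show ?thesis by (simp only: abs_rep_l2)
qed

lemma l2_inner_scale: "l2_inner (c *\<^sub>C x) z = c * l2_inner x z"
proof -
  have "l2_inner (c *\<^sub>C abs_l2 (rep_l2 x)) (abs_l2 (rep_l2 z)) = c * l2_inner (abs_l2 (rep_l2 x)) (abs_l2 (rep_l2 z))"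
    by (simp add: l2_scale_abs l2_inner_abs rep_l2_sqi sqi_scale ip_scale_left)
  then show ?thesis by (simp only: abs_rep_l2)
qed

lemma l2_inner_diff: "l2_inner (x - y) z = l2_inner x z - l2_inner y z"
  by (simp add: minus_l2_def uminus_l2_def l2_inner_add l2_inner_scale)

lemma l2_inner_cnj: "cnj (l2_inner x y) = l2_inner y x"
  by (simp add: l2_inner_rep ip_cnj)

lemma l2_inner_self_eq_0: "l2_inner x x = 0 \<longleftrightarrow> x = 0"
proof
  assume "l2_inner x x = 0"
  then have "inner x x = 0" by (simp add: inner_l2_def)
  then show "x = 0" by simp
next
  assume "x = 0"
  then have "l2_inner x x = l2_inner (0 *\<^sub>C x) x"
    by (metis of_real_0 scaleR_l2_def scaleR_zero_left)
  then show "l2_inner x x = 0" by (simp only: l2_inner_scale mult_zero_left)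
qed

section \<open>Radial boundary functions\<close>

definition bd :: "(complex \<Rightarrow> complex) \<Rightarrow> complex \<Rightarrow> complex" where
  "bd f x = Lim (at_left 1) (\<lambda>r::real. f (of_real r * x))"

lemma boundary_eq: "boundary f = abs_l2 (bd f)"
  by (simp add: boundary_def bd_def[abs_def])

lemma bd_eqI: "((\<lambda>r::real. f (of_real r * x)) \<longlongrightarrow> l) (at_left 1) \<Longrightarrow> bd f x = l"
  unfolding bd_def by (rule tendsto_Lim) auto

text \<open>Existence of a radial limit is expressed by countably many conditions: for every
  \<open>j\<close> there is a \<open>rad k\<close> beyond which all rational radii give values
  within \<open>1 / (j + 1)\<close> of the value at \<open>rad k\<close>. Continuity along the
  radius turns this into the Cauchy criterion.\<close>

lemma bd_measurable:
  assumes f: "f holomorphic_on ball 0 1"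
  shows "bd f \<in> borel_measurable circ"
proof -
  define G where "G k j q x \<longleftrightarrow> (rad k < of_rat q \<and> of_rat q < (1::real) \<longrightarrow>
    cmod (f (of_real (of_rat q) * x) - f (of_real (rad k) * x)) \<le> 1 / (real j + 1))" for k j q x
  define E where "E = {x \<in> space circ. \<forall>j. \<exists>k. \<forall>q. G k j q x}"
  have Gm: "{x \<in> space circ. G k j q x} \<in> sets circ" for k j q
  proof (cases "rad k < of_rat q \<and> of_rat q < (1::real)")
    case True
    then have "0 \<le> (of_rat q :: real)" "of_rat q < (1::real)" using rad_bounds(1)[of k] by linarith+
    from dilate_measurable[OF f this]
    have [measurable]: "(\<lambda>x. f (of_real (of_rat q) * x)) \<in> borel_measurable circ" .
    have [measurable]: "(\<lambda>x. f (of_real (rad k) * x)) \<in> borel_measurable circ"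
      by (intro dilate_measurable[OF f] rad_bounds)
    have "{x \<in> space circ. G k j q x} = {x \<in> space circ. cmod (f (of_real (of_rat q) * x) - f (of_real (rad k) * x)) \<le> 1 / (real j + 1)}"
      using True by (auto simp: G_def)
    also have "\<dots> \<in> sets circ" by measurable
    finally show ?thesis .
  next
    case False
    then have "{x \<in> space circ. G k j q x} = space circ" by (auto simp: G_def)
    then show ?thesis by simp
  qed
  have Em: "E \<in> sets circ"
    unfolding E_def
    by (intro sets.sets_Collect_countable_All sets.sets_Collect_countable_Ex Gm)
  have conv: "(\<exists>l. ((\<lambda>r::real. f (of_real r * x)) \<longlongrightarrow> l) (at_left 1)) \<longleftrightarrow> x \<in> E" if x: "x \<in> space circ" for x
  proof
    have x1: "cmod x = 1" using x by (simp add: space_circ)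
    {
      assume "\<exists>l. ((\<lambda>r::real. f (of_real r * x)) \<longlongrightarrow> l) (at_left 1)"
      then obtain l where l: "((\<lambda>r::real. f (of_real r * x)) \<longlongrightarrow> l) (at_left 1)" by blast
      have "\<exists>k. \<forall>q. G k j q x" for j
      proof -
        have "\<forall>\<^sub>F r in at_left (1::real). dist (f (of_real r * x)) l < 1 / (2 * (real j + 1))"
          by (rule tendstoD[OF l]) simp
        then obtain b where b: "b < 1" "\<And>r. b < r \<Longrightarrow> r < 1 \<Longrightarrow> dist (f (of_real r * x)) l < 1 / (2 * (real j + 1))"
          unfolding eventually_at_left_field by auto
        obtain k where k: "b < rad k"
          using order_tendstoD(1)[OF rad_tendsto b(1)] by (auto simp: eventually_sequentially)
        have "G k j q x" for q
          unfolding G_def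
        proof
          assume q: "rad k < of_rat q \<and> of_rat q < (1::real)"
          have "dist (f (of_real (of_rat q) * x)) (f (of_real (rad k) * x)) < 1 / (2 * (real j + 1)) + 1 / (2 * (real j + 1))"
            using b(2)[of "of_rat q"] b(2)[of "rad k"] q k rad_bounds[of k]
              dist_triangle2[of "f (of_real (of_rat q) * x)" "f (of_real (rad k) * x)" l] by auto
          also have "1 / (2 * (real j + 1)) + 1 / (2 * (real j + 1)) = 1 / (real j + 1)"
            by (simp add: field_simps)
          finally show "cmod (f (of_real (of_rat q) * x) - f (of_real (rad k) * x)) \<le> 1 / (real j + 1)"
            by (simp add: dist_norm)
        qed
        then show ?thesis by blast
      qed
      then show "x \<in> E" using x by (simp add: E_def)
    }
    assume "x \<in> E"
    then have E: "\<And>j. \<exists>k. \<forall>q. G k j q x" by (simp add: E_def)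
    show "\<exists>l. ((\<lambda>r::real. f (of_real r * x)) \<longlongrightarrow> l) (at_left 1)"
    proof (rule tendsto_of_oscillation[OF rad_at_left])
      fix e :: real assume e: "e > 0"
      obtain j where j: "inverse (real (Suc j)) < e" using reals_Archimedean[OF e] by auto
      obtain k where k: "\<And>q. G k j q x" using E by blast
      have "cmod (f (of_real p * x) - f (of_real (rad k) * x)) \<le> 1 / (real j + 1)"
        if p: "rad k < p" "p < 1" for p
      proof (rule continuous_le_rational[where b = 1 and \<phi> = "\<lambda>p. cmod (f (of_real p * x) - f (of_real (rad k) * x))"])
        show "isCont (\<lambda>p. cmod (f (of_real p * x) - f (of_real (rad k) * x))) p"
          using p rad_bounds[of k] by (intro continuous_intros radius_cont[OF f x1]) auto
        fix q :: real assume q: "q \<in> \<rat>" "p < q" "q < 1"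
        then obtain q' where "q = of_rat q'" by (auto elim: Rats_cases)
        then show "cmod (f (of_real q * x) - f (of_real (rad k) * x)) \<le> 1 / (real j + 1)"
          using k[of q'] q p by (simp add: G_def)
      qed (use p in auto)
      moreover have "1 / (real j + 1) < e" using j by (simp add: inverse_eq_divide add.commute)
      ultimately have "dist (f (of_real p * x)) (f (of_real (rad k) * x)) < e" if "rad k < p" "p < 1" for p
        using that unfolding dist_norm by (meson le_less_trans)
      then show "\<exists>c. \<forall>\<^sub>F p in at_left 1. dist (f (of_real p * x)) c < e"
        using rad_bounds[of k] eventually_at_left_real[of "rad k" 1]
        by (intro exI[of _ "f (of_real (rad k) * x)"]) (auto elim!: eventually_mono)
    qed
  qed
  \<comment> \<open>Where no limit exists, \<open>Lim\<close> unfolds to \<open>THE\<close> of an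
    unsatisfiable predicate, the same value at all such points.\<close>
  define c0 where "c0 = (THE l::complex. False)"
  have eq: "bd f x = (if x \<in> E then lim (\<lambda>n. f (of_real (rad n) * x)) else c0)" if x: "x \<in> space circ" for x
  proof (cases "x \<in> E")
    case True
    then obtain l where l: "((\<lambda>r::real. f (of_real r * x)) \<longlongrightarrow> l) (at_left 1)" using conv[OF x] by blast
    then have "(\<lambda>n. f (of_real (rad n) * x)) \<longlonglongrightarrow> l" by (rule filterlim_compose[OF _ rad_at_left])
    then show ?thesis using bd_eqI[OF l] True by (simp add: limI)
  next
    case False
    then have "\<And>l. \<not> ((\<lambda>r::real. f (of_real r * x)) \<longlongrightarrow> l) (at_left 1)" using conv[OF x] by blast
    then show ?thesis using False by (simp add: bd_def t2_space_class.Lim_def c0_def)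
  qed
  have [measurable]: "(\<lambda>x. f (of_real (rad n) * x)) \<in> borel_measurable circ" for n
    by (intro dilate_measurable[OF f] rad_bounds)
  have "(\<lambda>x. lim (\<lambda>n. f (of_real (rad n) * x))) \<in> borel_measurable circ"
    by (rule borel_measurable_lim_metric) measurable
  then have "(\<lambda>x. if x \<in> E then lim (\<lambda>n. f (of_real (rad n) * x)) else c0) \<in> borel_measurable circ"
    using Em by (intro measurable_If_set) (auto simp: Int_def)
  then show ?thesis using eq by (simp cong: measurable_cong)
qed

text \<open>Riesz--Fischer gives an L^2 limit of the dilations and almost everywhere convergence of
  a subsequence; the latter identifies the limit with the radial boundary function supplied by
  Fatou's theorem.\<close>

lemma hardy2_bd:
  assumes f: "f \<in> hardy2"
  shows "sqi circ (bd f)"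
    and "AE x in circ. ((\<lambda>r::real. f (of_real r * x)) \<longlongrightarrow> bd f x) (at_left 1)"
    and "(\<lambda>n. nsq circ (\<lambda>x. f (of_real (rad n) * x) - bd f x)) \<longlonglongrightarrow> 0"
    and "\<And>n. sqi circ (\<lambda>x. f (of_real (rad n) * x))"
proof -
  have h: "f holomorphic_on ball 0 1" using f by (simp add: hardy2_iff)
  have s: "sqi circ (\<lambda>x. f (of_real (rad n) * x))" for n
  proof -
    have "integrable circ (\<lambda>x. (cmod (f (of_real (rad n) * x)))\<^sup>2)"
      by (intro integrable_circ_cont continuous_intros dilate_cont[OF h] rad_bounds)
    then show ?thesis unfolding sqi_def using dilate_measurable[OF h rad_bounds] by simp
  qed
  show "\<And>n. sqi circ (\<lambda>x. f (of_real (rad n) * x))" by (rule s)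
  show ae: "AE x in circ. ((\<lambda>r::real. f (of_real r * x)) \<longlongrightarrow> bd f x) (at_left 1)"
    using fatou_radial[OF f] by eventually_elim (auto dest: bd_eqI)
  have C: "\<exists>N. \<forall>m\<ge>N. \<forall>n\<ge>N. nsq circ (\<lambda>x. f (of_real (rad m) * x) - f (of_real (rad n) * x)) < e" if e: "e > 0" for e
  proof -
    obtain N where N: "tail f (rad N) < e"
      using order_tendstoD(2)[OF tail_tendsto[OF f] e] by (auto simp: eventually_sequentially)
    have "nsq circ (\<lambda>x. f (of_real (rad m) * x) - f (of_real (rad n) * x)) < e" if "m \<ge> N" "n \<ge> N" for m n
      unfolding nsq_def
      by (rule le_less_trans[OF tail_bound[OF f rad_mono[OF that(1)] rad_bounds(2) rad_mono[OF that(2)] rad_bounds(2) rad_bounds(1)] N])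
    then show ?thesis by blast
  qed
  obtain G s' where G: "sqi circ G" "(\<lambda>n. nsq circ (\<lambda>x. f (of_real (rad n) * x) - G x)) \<longlonglongrightarrow> 0"
    "strict_mono s'" "AE x in circ. (\<lambda>k. f (of_real (rad (s' k)) * x)) \<longlonglongrightarrow> G x"
    by (rule riesz_fischer[where M = circ and g = "\<lambda>n x. f (of_real (rad n) * x)", OF s C])
  have eq: "AE x in circ. G x = bd f x"
    using ae G(4)
  proof eventually_elim
    case (elim x)
    have "filterlim (\<lambda>k. rad (s' k)) (at_left 1) sequentially"
      by (rule filterlim_compose[OF rad_at_left filterlim_subseq[OF G(3)]])
    from filterlim_compose[OF elim(1) this] show ?case using elim(2) by (rule LIMSEQ_unique[rotated])
  qed
  show sb: "sqi circ (bd f)" by (rule sqi_cong_AE[OF G(1) bd_measurable[OF h] eq])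
  have "nsq circ (\<lambda>x. f (of_real (rad n) * x) - G x) = nsq circ (\<lambda>x. f (of_real (rad n) * x) - bd f x)" for n
    by (rule nsq_cong_AE[OF sqi_diff[OF s G(1)] sqi_diff[OF s sb]]) (use eq in eventually_elim, simp)
  then show "(\<lambda>n. nsq circ (\<lambda>x. f (of_real (rad n) * x) - bd f x)) \<longlonglongrightarrow> 0" using G(2) by simp
qed

section \<open>Fourier coefficients and the Hardy space on the circle\<close>

lemma sqi_circ_cont:
  assumes "continuous_on (sphere 0 1) f" shows "sqi circ f"
  unfolding sqi_def using assms
  by (intro conjI circle_measurable_cont[OF sets_circ] integrable_circ_cont continuous_intros)

lemma sqi_power: "sqi circ (\<lambda>x. x ^ n)" "sqi circ (\<lambda>x. cnj x ^ n)"
  by (intro sqi_circ_cont continuous_intros)+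

lemma hardy2_coeff:
  assumes f: "f \<in> hardy2"
  shows "(\<integral>x. bd f x * cnj x ^ n \<partial>circ) = taylor f n"
    and "(\<integral>x. bd f x * x ^ Suc n \<partial>circ) = 0"
proof -
  have h: "f holomorphic_on ball 0 1" using f by (simp add: hardy2_iff)
  note b = hardy2_bd[OF f]
  have "(\<lambda>k. ip circ (\<lambda>x. f (of_real (rad k) * x)) (\<lambda>x. x ^ n)) \<longlonglongrightarrow> ip circ (bd f) (\<lambda>x. x ^ n)"
    by (rule ip_tendsto[OF b(4) b(1) b(3) sqi_power(1)])
  moreover have "ip circ (\<lambda>x. f (of_real (rad k) * x)) (\<lambda>x. x ^ n) = taylor f n * of_real (rad k) ^ n" for k
    using dilate_coeff(1)[OF h rad_bounds(1)[of k] rad_bounds(2)[of k], of n] by (simp add: ip_def)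
  moreover have "(\<lambda>k. taylor f n * of_real (rad k) ^ n) \<longlonglongrightarrow> taylor f n * of_real 1 ^ n"
    by (intro tendsto_intros rad_tendsto)
  ultimately have "ip circ (bd f) (\<lambda>x. x ^ n) = taylor f n * of_real 1 ^ n"
    by (simp only:) (rule LIMSEQ_unique)
  then show "(\<integral>x. bd f x * cnj x ^ n \<partial>circ) = taylor f n" by (simp add: ip_def)
  have "(\<lambda>k. ip circ (\<lambda>x. f (of_real (rad k) * x)) (\<lambda>x. cnj x ^ Suc n)) \<longlonglongrightarrow> ip circ (bd f) (\<lambda>x. cnj x ^ Suc n)"
    by (rule ip_tendsto[OF b(4) b(1) b(3) sqi_power(2)])
  moreover have "ip circ (\<lambda>x. f (of_real (rad k) * x)) (\<lambda>x. cnj x ^ Suc n) = 0" for k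
    using dilate_coeff(2)[OF h rad_bounds(1)[of k] rad_bounds(2)[of k], of n] by (simp add: ip_def)
  ultimately have "(\<lambda>k. 0) \<longlonglongrightarrow> ip circ (bd f) (\<lambda>x. cnj x ^ Suc n)" by simp
  then have "ip circ (bd f) (\<lambda>x. cnj x ^ Suc n) = 0" by (rule LIMSEQ_unique[OF _ tendsto_const])
  then show "(\<integral>x. bd f x * x ^ Suc n \<partial>circ) = 0" by (simp add: ip_def)
qed

text \<open>The Cauchy transform, which is the value of an \<open>H2\<close> function at a point of the disc.\<close>

definition ev :: "(complex \<Rightarrow> complex) \<Rightarrow> complex \<Rightarrow> complex" where
  "ev g z = (\<integral>x. g x / (1 - z * cnj x) \<partial>circ)"

text \<open>The Hardy space described on the circle, by vanishing Fourier coefficients of negative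
  index; \<open>abs_H2_iff\<close> identifies it with the boundary values in \<open>H2\<close>.
  Membership and orthogonality are easiest to check in this form.\<close>

definition H2f :: "(complex \<Rightarrow> complex) set" where
  "H2f = {g. sqi circ g \<and> (\<forall>n. (\<integral>x. g x * x ^ Suc n \<partial>circ) = 0)}"

lemma H2f_sqi: "g \<in> H2f \<Longrightarrow> sqi circ g" by (simp add: H2f_def)

lemma sqi_circ_integrable: "sqi circ g \<Longrightarrow> integrable circ g"
  by (rule sqi_integrable) unfold_locales

lemma ev_sums: "sqi circ g \<Longrightarrow> cmod z < 1 \<Longrightarrow> (\<lambda>n. z ^ n * (\<integral>x. g x * cnj x ^ n \<partial>circ)) sums ev g z"
  unfolding ev_def by (intro cauchy_transform_sums[OF sets_circ] sqi_circ_integrable)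

lemma ev_taylor:
  assumes g: "sqi circ g"
  shows "ev g holomorphic_on ball 0 1" and "taylor (ev g) n = (\<integral>x. g x * cnj x ^ n \<partial>circ)"
proof -
  define a where "a n = (\<integral>x. g x * cnj x ^ n \<partial>circ)" for n
  have s: "(\<lambda>n. a n * z ^ n) sums ev g z" if "cmod z < 1" for z
    using ev_sums[OF g that] by (simp add: a_def mult.commute)
  show h: "ev g holomorphic_on ball 0 1"
    by (rule power_series_holomorphic[of 0 1 a]) (use s in simp)
  \<comment> \<open>Coefficients may be compared at any positive radius below 1; convergence at the
    larger radius 3/4 ensures absolute convergence at 1/2.\<close>
  define r :: real where "r = 1/2"
  then have r: "0 \<le> r" "r < 1" "r < 3/4" "r \<noteq> 0" by auto
  have "summable (\<lambda>n. a n * (of_real (3/4)) ^ n)"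
    by (rule sums_summable[OF s]) simp
  then have "summable (\<lambda>n. cmod (a n * of_real r ^ n))"
    by (rule powser_insidea) (use r in simp)
  from power_series_coeff(1)[OF this, of n]
  have "(\<integral>x. (\<Sum>n. a n * of_real r ^ n * x ^ n) * cnj x ^ n \<partial>circ) = a n * of_real r ^ n" .
  moreover have "(\<integral>x. (\<Sum>n. a n * of_real r ^ n * x ^ n) * cnj x ^ n \<partial>circ) = (\<integral>x. ev g (of_real r * x) * cnj x ^ n \<partial>circ)"
  proof (intro Bochner_Integration.integral_cong refl)
    fix x assume "x \<in> space circ"
    then have "cmod (of_real r * x) < 1" using r by (simp add: space_circ norm_mult)
    from s[OF this] show "(\<Sum>n. a n * of_real r ^ n * x ^ n) * cnj x ^ n = ev g (of_real r * x) * cnj x ^ n"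
      by (simp add: sums_iff power_mult_distrib mult.assoc)
  qed
  moreover have "(\<integral>x. ev g (of_real r * x) * cnj x ^ n \<partial>circ) = taylor (ev g) n * of_real r ^ n"
    by (rule dilate_coeff(1)[OF h r(1,2)])
  ultimately have "taylor (ev g) n * of_real r ^ n = a n * of_real r ^ n" by (simp only:)
  then show "taylor (ev g) n = (\<integral>x. g x * cnj x ^ n \<partial>circ)" using r by (simp add: a_def)
qed

text \<open>For the partial Fourier sum \<open>p\<close>, the products of \<open>g\<close> with
  \<open>p\<close> and of \<open>p\<close> with itself coincide, so the squared distance from
  \<open>g\<close> to \<open>p\<close> is the squared norm of \<open>g\<close> minus the partial
  sum.\<close>

lemma bessel:
  assumes g: "sqi circ g"
  shows "summable (\<lambda>n. (cmod (\<integral>x. g x * cnj x ^ n \<partial>circ))\<^sup>2)"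
proof (rule summableI_nonneg_bounded)
  fix N
  define a where "a n = (\<integral>x. g x * cnj x ^ n \<partial>circ)" for n
  define p where "p x = (\<Sum>n<N. a n * x ^ n)" for x
  have ps: "sqi circ p" unfolding p_def by (intro sqi_circ_cont continuous_intros)
  have ip_p: "ip circ f p = (\<Sum>n<N. cnj (a n) * (\<integral>x. f x * cnj x ^ n \<partial>circ))" if f: "sqi circ f" for f
  proof -
    have "ip circ f p = (\<integral>x. (\<Sum>n<N. cnj (a n) * (f x * cnj x ^ n)) \<partial>circ)"
      by (simp add: ip_def p_def sum_distrib_left mult_ac)
    also have "\<dots> = (\<Sum>n<N. \<integral>x. cnj (a n) * (f x * cnj x ^ n) \<partial>circ)"
      by (intro Bochner_Integration.integral_sum Bochner_Integration.integrable_mult_right sqi_integrable_mult f sqi_power)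
    finally show ?thesis by simp
  qed
  have coef: "(\<integral>x. p x * cnj x ^ m \<partial>circ) = a m" if "m < N" for m
  proof -
    have "(\<integral>x. p x * cnj x ^ m \<partial>circ) = (\<integral>x. (\<Sum>n<N. a n * (x ^ n * cnj x ^ m)) \<partial>circ)"
      by (simp add: p_def sum_distrib_right mult.assoc)
    also have "\<dots> = (\<Sum>n<N. \<integral>x. a n * (x ^ n * cnj x ^ m) \<partial>circ)"
      by (intro Bochner_Integration.integral_sum Bochner_Integration.integrable_mult_right sqi_integrable_mult sqi_power)
    also have "\<dots> = (\<Sum>n<N. if n = m then a n else 0)" by (intro sum.cong refl) (simp add: circ_orthonormal)
    also have "\<dots> = a m" using that by simp
    finally show ?thesis .
  qed
  have sq: "cnj (a n) * a n = of_real ((cmod (a n))\<^sup>2)" for n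
    unfolding complex_norm_square by (simp add: mult.commute)
  have "ip circ g p = of_real (\<Sum>n<N. (cmod (a n))\<^sup>2)"
    unfolding ip_p[OF g] a_def[symmetric] sq by simp
  moreover have "ip circ p p = of_real (\<Sum>n<N. (cmod (a n))\<^sup>2)"
    unfolding ip_p[OF ps] by (simp add: coef sq)
  then have "nsq circ p = (\<Sum>n<N. (cmod (a n))\<^sup>2)"
    unfolding ip_self by (simp only: of_real_eq_iff)
  ultimately have "nsq circ (\<lambda>x. g x - p x) = nsq circ g - (\<Sum>n<N. (cmod (a n))\<^sup>2)"
    using nsq_diff_expand[OF g ps] by simp
  then show "(\<Sum>n<N. (cmod (\<integral>x. g x * cnj x ^ n \<partial>circ))\<^sup>2) \<le> nsq circ g"
    using nsq_nonneg[of circ "\<lambda>x. g x - p x"] unfolding a_def by linarith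
qed simp

lemma ev_hardy2: "sqi circ g \<Longrightarrow> ev g \<in> hardy2"
  using bessel[of g] by (simp add: hardy2_iff ev_taylor)

lemma bd_H2f: "f \<in> hardy2 \<Longrightarrow> bd f \<in> H2f"
  using hardy2_bd(1)[of f] hardy2_coeff(2)[of f] by (simp add: H2f_def)

text \<open>Both sides have the same Fourier coefficients: those of nonnegative index are the Taylor
  coefficients of \<open>ev g\<close>, the others vanish.\<close>

lemma H2f_bd_ev:
  assumes g: "g \<in> H2f" shows "AE x in circ. g x = bd (ev g) x"
proof -
  have gs: "sqi circ g" using g by (rule H2f_sqi)
  have b: "sqi circ (bd (ev g))" by (intro hardy2_bd ev_hardy2 gs)
  have "AE x in circ. g x - bd (ev g) x = 0"
  proof (rule fourier_null)
    show "integrable circ (\<lambda>x. g x - bd (ev g) x)" by (intro sqi_circ_integrable sqi_diff gs b)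
    show "(\<integral>x. (g x - bd (ev g) x) * cnj x ^ n \<partial>circ) = 0" for n
      using hardy2_coeff(1)[OF ev_hardy2[OF gs], of n] ev_taylor(2)[OF gs, of n]
      by (simp add: left_diff_distrib sqi_integrable_mult[OF gs sqi_power(2)] sqi_integrable_mult[OF b sqi_power(2)])
    have "integrable circ (\<lambda>x. g x * x ^ Suc n)" "integrable circ (\<lambda>x. bd (ev g) x * x ^ Suc n)" for n
      by (rule sqi_integrable_mult[OF gs sqi_power(1)] sqi_integrable_mult[OF b sqi_power(1)])+
    then show "(\<integral>x. (g x - bd (ev g) x) * x ^ Suc n \<partial>circ) = 0" for n
      using hardy2_coeff(2)[OF ev_hardy2[OF gs], of n] g unfolding H2f_def
      by (simp del: power_Suc add: left_diff_distrib)
  qed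
  then show ?thesis by eventually_elim simp
qed

lemma ev_bd:
  assumes f: "f \<in> hardy2" and z: "cmod z < 1" shows "ev (bd f) z = f z"
proof -
  have "(\<lambda>n. z ^ n * taylor f n) sums ev (bd f) z"
    using ev_sums[OF hardy2_bd(1)[OF f] z] by (simp add: hardy2_coeff(1)[OF f])
  moreover have "(\<lambda>n. z ^ n * taylor f n) sums f z"
    using taylor_sums[of f z] f z by (simp add: hardy2_iff mult.commute)
  ultimately show ?thesis by (rule sums_unique2)
qed

lemma ev_cong_AE:
  assumes "AE x in circ. f x = g x" "f \<in> borel_measurable circ" "g \<in> borel_measurable circ"
  shows "ev f z = ev g z"
proof -
  have k: "(\<lambda>x. 1 - z * cnj x) \<in> borel_measurable circ"
    by (rule circle_measurable_borel[OF sets_circ]) measurable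
  show ?thesis unfolding ev_def
    by (rule integral_cong_AE) (use assms k in \<open>auto elim!: eventually_mono\<close>)
qed

lemma H2f_cong_AE:
  assumes "f \<in> H2f" "g \<in> borel_measurable circ" "AE x in circ. f x = g x"
  shows "g \<in> H2f"
proof -
  have g: "sqi circ g" using sqi_cong_AE[OF H2f_sqi] assms by auto
  have "(\<integral>x. g x * x ^ Suc n \<partial>circ) = (\<integral>x. f x * x ^ Suc n \<partial>circ)" for n
    by (rule integral_cong_AE)
      (use borel_measurable_integrable[OF sqi_integrable_mult[OF g sqi_power(1)]]
        borel_measurable_integrable[OF sqi_integrable_mult[OF H2f_sqi[OF assms(1)] sqi_power(1)]] assms(3)
        in \<open>auto elim!: eventually_mono simp del: power_Suc\<close>)
  then show ?thesis using assms(1) g by (simp add: H2f_def del: power_Suc)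
qed

lemma abs_H2_iff:
  assumes "sqi circ g" shows "abs_l2 g \<in> H2 \<longleftrightarrow> g \<in> H2f"
proof
  assume "abs_l2 g \<in> H2"
  then obtain f where f: "f \<in> hardy2" "abs_l2 g = abs_l2 (bd f)" by (auto simp: H2_def boundary_eq)
  then have "AE x in circ. bd f x = g x" using abs_l2_eq_iff[OF hardy2_bd(1)[OF f(1)] assms] by simp
  then show "g \<in> H2f" using bd_H2f[OF f(1)] assms by (intro H2f_cong_AE[of "bd f" g]) (auto simp: sqi_def)
next
  assume g: "g \<in> H2f"
  then have "abs_l2 g = abs_l2 (bd (ev g))"
    using abs_l2_eq_iff[OF assms hardy2_bd(1)[OF ev_hardy2[OF assms]]] H2f_bd_ev by simp
  then show "abs_l2 g \<in> H2" using ev_hardy2[OF assms] by (auto simp: H2_def boundary_eq)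
qed

lemma H2_iff: "x \<in> H2 \<longleftrightarrow> rep_l2 x \<in> H2f"
  using abs_H2_iff[OF rep_l2_sqi, of x] by (simp add: abs_rep_l2)

text \<open>Dilations of \<open>ev g\<close> have absolutely convergent series whose monomials are
  all orthogonal to \<open>f\<close>; their L^2 limit is \<open>g\<close>.\<close>

lemma H2f_orthogonal:
  assumes f: "sqi circ f" "\<And>n. (\<integral>x. f x * cnj x ^ n \<partial>circ) = 0" and g: "g \<in> H2f"
  shows "ip circ f g = 0"
proof -
  have gs: "sqi circ g" using g by (rule H2f_sqi)
  have e: "ev g \<in> hardy2" by (rule ev_hardy2[OF gs])
  have h: "ev g holomorphic_on ball 0 1" using e by (simp add: hardy2_iff)
  note b = hardy2_bd[OF e]
  have "ip circ (\<lambda>x. ev g (of_real (rad k) * x)) f = 0" for k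
  proof -
    have c: "summable (\<lambda>n. cmod (taylor (ev g) n * of_real (rad k) ^ n))"
      by (rule taylor_summable[OF h rad_bounds])
    have "(\<lambda>n. \<integral>x. (taylor (ev g) n * of_real (rad k) ^ n * x ^ n) * cnj (f x) \<partial>circ) sums
        (\<integral>x. (\<Sum>n. (taylor (ev g) n * of_real (rad k) ^ n * x ^ n) * cnj (f x)) \<partial>circ)"
    proof (rule sums_integral)
      have cf: "integrable circ (\<lambda>x. cnj (f x))" by (intro sqi_circ_integrable sqi_cnj f)
      show "integrable circ (\<lambda>x. (taylor (ev g) n * of_real (rad k) ^ n * x ^ n) * cnj (f x))" for n
        by (intro sqi_integrable_mult sqi_scale sqi_power sqi_cnj f)
      show "AE x in circ. summable (\<lambda>n. norm ((taylor (ev g) n * of_real (rad k) ^ n * x ^ n) * cnj (f x)))"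
        using summable_mult2[OF c] by (intro AE_I2) (simp add: space_circ norm_mult norm_power)
      have "(\<integral>x. norm ((taylor (ev g) n * of_real (rad k) ^ n * x ^ n) * cnj (f x)) \<partial>circ)
          = cmod (taylor (ev g) n * of_real (rad k) ^ n) * (\<integral>x. cmod (f x) \<partial>circ)" for n
      proof -
        have "(\<integral>x. norm ((taylor (ev g) n * of_real (rad k) ^ n * x ^ n) * cnj (f x)) \<partial>circ)
          = (\<integral>x. cmod (taylor (ev g) n * of_real (rad k) ^ n) * cmod (f x) \<partial>circ)"
          by (intro Bochner_Integration.integral_cong) (auto simp: space_circ norm_mult norm_power)
        then show ?thesis by simp
      qed
      then show "summable (\<lambda>n. \<integral>x. norm ((taylor (ev g) n * of_real (rad k) ^ n * x ^ n) * cnj (f x)) \<partial>circ)"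
        using summable_mult2[OF c] by simp
    qed
    moreover have "(\<integral>x. (taylor (ev g) n * of_real (rad k) ^ n * x ^ n) * cnj (f x) \<partial>circ) = 0" for n
    proof -
      have "(\<integral>x. x ^ n * cnj (f x) \<partial>circ) = cnj (\<integral>x. f x * cnj x ^ n \<partial>circ)"
        by (simp add: mult.commute flip: Bochner_Integration.integral_cnj)
      then show ?thesis using f(2) by (simp add: mult.assoc)
    qed
    ultimately have "(\<lambda>n. 0) sums (\<integral>x. (\<Sum>n. (taylor (ev g) n * of_real (rad k) ^ n * x ^ n) * cnj (f x)) \<partial>circ)"
      by simp
    then have "(\<integral>x. (\<Sum>n. (taylor (ev g) n * of_real (rad k) ^ n * x ^ n) * cnj (f x)) \<partial>circ) = 0"
      by (rule sums_unique2[OF _ sums_zero])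
    moreover have "(\<Sum>n. (taylor (ev g) n * of_real (rad k) ^ n * x ^ n) * cnj (f x)) = ev g (of_real (rad k) * x) * cnj (f x)"
      if "x \<in> space circ" for x
    proof -
      have x: "cmod x = 1" using that by (simp add: space_circ)
      have "summable (\<lambda>n. taylor (ev g) n * of_real (rad k) ^ n * x ^ n)"
        using c x by - (rule summable_norm_cancel, simp add: norm_mult norm_power)
      from suminf_mult2[OF this, of "cnj (f x)"] show ?thesis
        using holo_on_circle[OF h rad_bounds x] by simp
    qed
    ultimately show ?thesis unfolding ip_def by (simp cong: Bochner_Integration.integral_cong)
  qed
  then have "(\<lambda>k. 0) \<longlonglongrightarrow> ip circ (bd (ev g)) f"
    using ip_tendsto[OF b(4) b(1) b(3) f(1)] by simp
  then have "ip circ (bd (ev g)) f = 0" by (rule LIMSEQ_unique[OF _ tendsto_const])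
  moreover have "ip circ g f = ip circ (bd (ev g)) f"
    using H2f_bd_ev[OF g] by (intro ip_cong_AE gs b f(1)) auto
  ultimately show ?thesis by (metis ip_cnj complex_cnj_zero)
qed

lemma H2f_lin: "f \<in> H2f \<Longrightarrow> g \<in> H2f \<Longrightarrow> (\<lambda>x. f x + c * g x) \<in> H2f"
proof -
  assume f: "f \<in> H2f" and g: "g \<in> H2f"
  then have s: "sqi circ f" "sqi circ g" by (auto simp: H2f_sqi)
  have "(\<integral>x. (f x + c * g x) * x ^ Suc n \<partial>circ) = (\<integral>x. f x * x ^ Suc n \<partial>circ) + c * (\<integral>x. g x * x ^ Suc n \<partial>circ)" for n
    using sqi_integrable_mult[OF s(1) sqi_power(1)[of "Suc n"]] sqi_integrable_mult[OF s(2) sqi_power(1)[of "Suc n"]]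
    by (simp add: distrib_right mult.assoc del: power_Suc)
  then show "(\<lambda>x. f x + c * g x) \<in> H2f"
    using f g s by (simp add: H2f_def sqi_add sqi_scale del: power_Suc)
qed

lemma H2f_closed:
  assumes f: "\<And>n. f n \<in> H2f" "sqi circ f0" "(\<lambda>n. nsq circ (\<lambda>x. f n x - f0 x)) \<longlonglongrightarrow> 0"
  shows "f0 \<in> H2f"
proof -
  have "(\<integral>x. f0 x * x ^ Suc m \<partial>circ) = 0" for m
  proof -
    have "ip circ (f n) (\<lambda>x. cnj x ^ Suc m) = 0" for n using f(1)[of n] by (simp add: H2f_def ip_def)
    then have "(\<lambda>n. 0) \<longlonglongrightarrow> ip circ f0 (\<lambda>x. cnj x ^ Suc m)"
      using ip_tendsto[OF H2f_sqi[OF f(1)] f(2,3) sqi_power(2)[of "Suc m"]] by simp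
    then have "ip circ f0 (\<lambda>x. cnj x ^ Suc m) = 0" by (rule LIMSEQ_unique[OF _ tendsto_const])
    then show ?thesis by (simp add: ip_def)
  qed
  then show ?thesis using f(2) by (simp add: H2f_def)
qed

section \<open>Bounded analytic functions as multipliers\<close>

lemma hardy_inf_bound:
  assumes "f \<in> hardy_inf" shows "\<exists>B. \<forall>z. cmod z < 1 \<longrightarrow> cmod (f z) \<le> B"
proof -
  have "bounded (f ` ball 0 1)" using assms by (simp add: hardy_inf_def)
  then obtain B where "\<forall>w\<in>f ` ball 0 1. cmod w \<le> B" unfolding bounded_iff by blast
  then have "\<forall>z. cmod z < 1 \<longrightarrow> cmod (f z) \<le> B" by auto
  then show ?thesis ..
qed

lemma hardy_inf_hardy2:
  assumes "f \<in> hardy_inf" shows "f \<in> hardy2"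
proof -
  obtain B where B: "\<And>z. cmod z < 1 \<Longrightarrow> cmod (f z) \<le> B" using hardy_inf_bound[OF assms] by blast
  have h: "f holomorphic_on ball 0 1" using assms by (simp add: hardy_inf_def)
  have "(\<integral>x. (cmod (f (of_real r * x)))\<^sup>2 \<partial>circ) \<le> B\<^sup>2" if "r \<in> {0..<1}" for r
  proof -
    have "(\<integral>x. (cmod (f (of_real r * x)))\<^sup>2 \<partial>circ) \<le> (\<integral>x. B\<^sup>2 \<partial>circ)"
    proof (rule integral_mono_AE)
      show "integrable circ (\<lambda>x. (cmod (f (of_real r * x)))\<^sup>2)"
        using that by (intro integrable_circ_cont continuous_intros dilate_cont[OF h]) auto
      show "AE x in circ. (cmod (f (of_real r * x)))\<^sup>2 \<le> B\<^sup>2"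
        using that by (intro AE_I2 power_mono B) (auto simp: space_circ norm_mult)
    qed simp
    then show ?thesis by (simp add: circ.prob_space)
  qed
  then show ?thesis using h unfolding hardy2_def by (intro CollectI conjI exI[of _ "B\<^sup>2"]) auto
qed

lemma hardy2_mult:
  assumes f: "f \<in> hardy_inf" and g: "g \<in> hardy2"
  shows "(\<lambda>z. f z * g z) \<in> hardy2" and "AE x in circ. bd (\<lambda>z. f z * g z) x = bd f x * bd g x"
proof -
  obtain B where B: "\<And>z. cmod z < 1 \<Longrightarrow> cmod (f z) \<le> B" using hardy_inf_bound[OF f] by blast
  have hf: "f holomorphic_on ball 0 1" using f by (simp add: hardy_inf_def)
  have hg: "g holomorphic_on ball 0 1" using g by (simp add: hardy2_iff)
  obtain M where M: "\<forall>r\<in>{0..<1}. (\<integral>x. (cmod (g (of_real r * x)))\<^sup>2 \<partial>circ) \<le> M"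
    using g unfolding hardy2_def by blast
  have "(\<integral>x. (cmod (f (of_real r * x) * g (of_real r * x)))\<^sup>2 \<partial>circ) \<le> B\<^sup>2 * M" if r: "r \<in> {0..<1}" for r
  proof -
    have "(\<integral>x. (cmod (f (of_real r * x) * g (of_real r * x)))\<^sup>2 \<partial>circ) \<le> (\<integral>x. B\<^sup>2 * (cmod (g (of_real r * x)))\<^sup>2 \<partial>circ)"
    proof (rule integral_mono_AE)
      show "integrable circ (\<lambda>x. (cmod (f (of_real r * x) * g (of_real r * x)))\<^sup>2)"
        using r by (intro integrable_circ_cont continuous_intros dilate_cont[OF hf] dilate_cont[OF hg]) auto
      show "integrable circ (\<lambda>x. B\<^sup>2 * (cmod (g (of_real r * x)))\<^sup>2)"
        using r by (intro integrable_circ_cont continuous_intros dilate_cont[OF hg]) auto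
      show "AE x in circ. (cmod (f (of_real r * x) * g (of_real r * x)))\<^sup>2 \<le> B\<^sup>2 * (cmod (g (of_real r * x)))\<^sup>2"
      proof (intro AE_I2)
        fix x assume "x \<in> space circ"
        then have "cmod (f (of_real r * x)) \<le> B" using r by (intro B) (simp add: space_circ norm_mult)
        then have "(cmod (f (of_real r * x)))\<^sup>2 \<le> B\<^sup>2" by (intro power_mono) auto
        then show "(cmod (f (of_real r * x) * g (of_real r * x)))\<^sup>2 \<le> B\<^sup>2 * (cmod (g (of_real r * x)))\<^sup>2"
          by (simp add: norm_mult power_mult_distrib mult_right_mono)
      qed
    qed
    also have "\<dots> = B\<^sup>2 * (\<integral>x. (cmod (g (of_real r * x)))\<^sup>2 \<partial>circ)" by simp
    also have "\<dots> \<le> B\<^sup>2 * M" using bspec[OF M r] by (intro mult_left_mono) auto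
    finally show ?thesis .
  qed
  then show "(\<lambda>z. f z * g z) \<in> hardy2"
    unfolding hardy2_def using hf hg by (intro CollectI conjI exI[of _ "B\<^sup>2 * M"] holomorphic_intros) auto
  show "AE x in circ. bd (\<lambda>z. f z * g z) x = bd f x * bd g x"
    using hardy2_bd(2)[OF hardy_inf_hardy2[OF f]] hardy2_bd(2)[OF g]
    by eventually_elim (intro bd_eqI tendsto_mult)
qed

section \<open>Model spaces\<close>

text \<open>The conjugate kernel is a power series in \<open>x\<close> with constant term 1, and the
  integrals of \<open>g x * x ^ n\<close> with positive \<open>n\<close> vanish.\<close>

lemma H2f_conj_kernel:
  assumes g: "g \<in> H2f" and z: "cmod z < 1"
  shows "(\<integral>x. g x * cnj (1 / (1 - z * cnj x)) \<partial>circ) = (\<integral>x. g x \<partial>circ)"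
proof -
  have gi: "integrable circ (\<lambda>x. cnj (g x))" by (intro sqi_circ_integrable sqi_cnj H2f_sqi g)
  have c: "(\<integral>x. cnj (g x) * cnj x ^ n \<partial>circ) = (if n = 0 then cnj (\<integral>x. g x \<partial>circ) else 0)" for n
  proof (cases n)
    case (Suc m)
    have "(\<integral>x. cnj (g x) * cnj x ^ n \<partial>circ) = cnj (\<integral>x. g x * x ^ Suc m \<partial>circ)"
      by (simp add: Suc flip: Bochner_Integration.integral_cnj)
    also have "\<dots> = 0" using g by (simp add: H2f_def del: power_Suc)
    finally show ?thesis by (simp add: Suc)
  qed (simp flip: Bochner_Integration.integral_cnj)
  have "(\<lambda>n. z ^ n * (if n = 0 then cnj (\<integral>x. g x \<partial>circ) else 0)) sums (\<integral>x. cnj (g x) / (1 - z * cnj x) \<partial>circ)"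
    using cauchy_transform_sums[OF sets_circ gi z] unfolding c .
  moreover have "(\<lambda>n. z ^ n * (if n = 0 then cnj (\<integral>x. g x \<partial>circ) else 0)) = (\<lambda>n. if n = 0 then cnj (\<integral>x. g x \<partial>circ) else 0)"
    by auto
  ultimately have "(\<lambda>n. if n = 0 then cnj (\<integral>x. g x \<partial>circ) else 0) sums (\<integral>x. cnj (g x) / (1 - z * cnj x) \<partial>circ)"
    by (simp only:)
  then have "(\<integral>x. cnj (g x) / (1 - z * cnj x) \<partial>circ) = cnj (\<integral>x. g x \<partial>circ)"
    by (rule sums_unique2[OF _ sums_single])
  then have "cnj (\<integral>x. cnj (g x) / (1 - z * cnj x) \<partial>circ) = (\<integral>x. g x \<partial>circ)" by simp
  then show ?thesis unfolding Bochner_Integration.integral_cnj[symmetric] by simp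
qed

lemma ev_0: "ev g 0 = (\<integral>x. g x \<partial>circ)"
  by (simp add: ev_def)

text \<open>\<open>u\<close> may be any measurable version of the boundary values of
  \<open>F\<close>, so that a version of modulus 1 everywhere can be used for an inner
  function.\<close>

lemma H2f_mult:
  assumes F: "F \<in> hardy_inf" and u: "u \<in> borel_measurable circ" "AE x in circ. u x = bd F x" and g: "g \<in> H2f"
  shows "(\<lambda>x. u x * g x) \<in> H2f" and "cmod z < 1 \<Longrightarrow> ev (\<lambda>x. u x * g x) z = F z * ev g z"
proof -
  have e: "ev g \<in> hardy2" by (rule ev_hardy2[OF H2f_sqi[OF g]])
  have [measurable]: "g \<in> borel_measurable circ" using H2f_sqi[OF g] by (simp add: sqi_def)
  note [measurable] = u(1)
  have m: "(\<lambda>x. u x * g x) \<in> borel_measurable circ" by measurable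
  have h: "(\<lambda>z. F z * ev g z) \<in> hardy2" by (rule hardy2_mult(1)[OF F e])
  have ae: "AE x in circ. bd (\<lambda>z. F z * ev g z) x = u x * g x"
    using hardy2_mult(2)[OF F e] u(2) H2f_bd_ev[OF g] by eventually_elim simp
  show "(\<lambda>x. u x * g x) \<in> H2f" by (rule H2f_cong_AE[OF bd_H2f[OF h] m ae])
  have "ev (\<lambda>x. u x * g x) z = ev (bd (\<lambda>z. F z * ev g z)) z"
    by (rule ev_cong_AE) (use ae m hardy2_bd(1)[OF h] in \<open>auto simp: sqi_def elim: eventually_mono\<close>)
  then show "cmod z < 1 \<Longrightarrow> ev (\<lambda>x. u x * g x) z = F z * ev g z"
    using ev_bd[OF h] by simp
qed

lemma hardy_inf_cont:
  assumes "continuous_on (cball 0 1) F" "F holomorphic_on ball 0 1"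
  shows "F \<in> hardy_inf"
proof -
  have "bounded (F ` cball 0 1)"
    using assms by (intro compact_imp_bounded compact_continuous_image) auto
  then have "bounded (F ` ball 0 1)" by (rule bounded_subset) auto
  then show ?thesis using assms by (simp add: hardy_inf_def)
qed

lemma bd_cont:
  assumes F: "continuous_on (cball 0 1) F" and x: "cmod x = 1"
  shows "bd F x = F x"
proof (rule bd_eqI)
  have "continuous_on {0..1} (\<lambda>r::real. F (of_real r * x))"
    by (rule continuous_on_compose2[OF F]) (use x in \<open>auto intro!: continuous_intros simp: norm_mult\<close>)
  then have "((\<lambda>r::real. F (of_real r * x)) \<longlongrightarrow> F (of_real 1 * x)) (at 1 within {0..1})"
    unfolding continuous_on_def by (rule bspec) simp
  moreover have "at 1 within {0..1} = at_left (1::real)"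
    by (simp add: at_within_Icc_at_left)
  ultimately show "((\<lambda>r::real. F (of_real r * x)) \<longlongrightarrow> F x) (at_left 1)" by simp
qed

lemma H2f_mult_cont:
  assumes F: "continuous_on (cball 0 1) F" "F holomorphic_on ball 0 1" and g: "g \<in> H2f"
  shows "(\<lambda>x. F x * g x) \<in> H2f" and "cmod z < 1 \<Longrightarrow> ev (\<lambda>x. F x * g x) z = F z * ev g z"
proof -
  have "F \<in> borel_measurable circ"
    using continuous_on_subset[OF F(1)] by (intro circle_measurable_cont[OF sets_circ]) auto
  moreover have "AE x in circ. F x = bd F x"
    using bd_cont[OF F(1)] by (intro AE_I2) (simp add: space_circ)
  ultimately show "(\<lambda>x. F x * g x) \<in> H2f" "cmod z < 1 \<Longrightarrow> ev (\<lambda>x. F x * g x) z = F z * ev g z"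
    by (rule H2f_mult[OF hardy_inf_cont[OF F] _ _ g])+
qed

lemma H2f_const: "(\<lambda>_. c) \<in> H2f" and ev_const: "cmod z < 1 \<Longrightarrow> ev (\<lambda>_. c) z = c"
proof -
  have "(\<lambda>_. c) \<in> hardy2" by (intro hardy_inf_hardy2 hardy_inf_cont) (auto intro!: continuous_intros)
  moreover have "AE x in circ. bd (\<lambda>_. c) x = c" by (intro AE_I2) (simp add: space_circ bd_cont)
  ultimately show "(\<lambda>_. c) \<in> H2f" by (intro H2f_cong_AE[OF bd_H2f]) auto
  have "ev (\<lambda>_. c) z = ev (bd (\<lambda>_. c)) z"
    by (rule ev_cong_AE) (use \<open>AE x in circ. bd (\<lambda>_. c) x = c\<close> hardy2_bd(1)[OF \<open>(\<lambda>_. c) \<in> hardy2\<close>] in \<open>auto simp: sqi_def elim: eventually_mono\<close>)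
  then show "cmod z < 1 \<Longrightarrow> ev (\<lambda>_. c) z = c" using ev_bd[OF \<open>(\<lambda>_. c) \<in> hardy2\<close>] by simp
qed

lemma ev_lin:
  assumes "sqi circ f" "sqi circ g" "cmod z < 1"
  shows "ev (\<lambda>x. f x + c * g x) z = ev f z + c * ev g z"
proof -
  have i: "integrable circ (\<lambda>x. h x / (1 - z * cnj x))" if "sqi circ h" for h
  proof -
    have "integrable circ (\<lambda>x. 1 / (1 - z * cnj x) * h x)"
    proof (rule integrable_mult_bounded[OF sqi_circ_integrable[OF that]])
      show "(\<lambda>x. 1 / (1 - z * cnj x)) \<in> borel_measurable circ"
        by (rule circle_measurable_borel[OF sets_circ]) measurable
      show "cmod (1 / (1 - z * cnj x)) \<le> 1 / (1 - cmod z)" if "x \<in> space circ" for x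
        using that assms(3) by (intro cauchy_kernel_bound) (auto simp: space_circ)
    qed
    then show ?thesis by simp
  qed
  have "ev (\<lambda>x. f x + c * g x) z = (\<integral>x. f x / (1 - z * cnj x) + c * (g x / (1 - z * cnj x)) \<partial>circ)"
    by (simp add: ev_def add_divide_distrib)
  also have "\<dots> = ev f z + c * ev g z"
    unfolding ev_def
    by (simp only: Bochner_Integration.integral_mult_right_zero
        Bochner_Integration.integral_add[OF i[OF assms(1)] Bochner_Integration.integrable_mult_right[OF i[OF assms(2)]]])
  finally show ?thesis .
qed

definition szego :: "complex \<Rightarrow> complex \<Rightarrow> complex" where "szego w x = 1 / (1 - cnj w * x)"

lemma szego_H2f:
  assumes w: "cmod w < 1"
  shows "continuous_on (cball 0 1) (szego w)" "szego w holomorphic_on ball 0 1" "szego w \<in> H2f"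
proof -
  have ne: "1 - cnj w * x \<noteq> 0" if "cmod x \<le> 1" for x
  proof
    assume "1 - cnj w * x = 0"
    then have "cmod (cnj w * x) = 1" by (metis eq_iff_diff_eq_0 norm_one)
    moreover have "cmod w * cmod x \<le> cmod w * 1" using that by (intro mult_left_mono) auto
    ultimately show False using w by (simp add: norm_mult)
  qed
  show c: "continuous_on (cball 0 1) (szego w)" "szego w holomorphic_on ball 0 1"
    unfolding szego_def[abs_def] using ne by (auto intro!: continuous_intros holomorphic_intros)
  from H2f_mult_cont(1)[OF c H2f_const[of 1]] show "szego w \<in> H2f" by simp
qed

lemma szego_cnj: "cnj (szego w x) = 1 / (1 - w * cnj x)"
  by (simp add: szego_def)

locale inner_fn =
  fixes \<Theta> :: "complex \<Rightarrow> complex"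
  assumes inner: "inner_function \<Theta>"
begin

text \<open>The boundary function, corrected on a null set so as to be unimodular everywhere.\<close>

definition th :: "complex \<Rightarrow> complex" where "th x = (if cmod (bd \<Theta> x) = 1 then bd \<Theta> x else 1)"

lemma Theta_hardy: "\<Theta> \<in> hardy_inf" "\<Theta> \<in> hardy2" "\<Theta> holomorphic_on ball 0 1"
  using inner hardy_inf_hardy2 by (auto simp: inner_function_def hardy_inf_def)

lemma th_norm [simp]: "cmod (th x) = 1" by (simp add: th_def)

lemma th_cnj [simp]: "th x * cnj (th x) = 1" "cnj (th x) * th x = 1"
  by (simp_all add: complex_norm_square[symmetric] mult.commute)

lemma th_cnj_mult [simp]: "th x * (cnj (th x) * y) = y" "cnj (th x) * (th x * y) = y"
  by (simp_all flip: mult.assoc)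

lemma th_measurable [measurable]: "th \<in> borel_measurable circ"
proof -
  have [measurable]: "bd \<Theta> \<in> borel_measurable circ" by (rule bd_measurable[OF Theta_hardy(3)])
  show ?thesis unfolding th_def[abs_def] by measurable
qed

lemma th_AE: "AE x in circ. th x = bd \<Theta> x"
proof -
  have "AE x in circ. \<exists>w. cmod w = 1 \<and> ((\<lambda>r::real. \<Theta> (of_real r * x)) \<longlongrightarrow> w) (at_left 1)"
    using inner by (simp add: inner_function_def)
  then show ?thesis by eventually_elim (auto simp: th_def dest: bd_eqI)
qed

lemma H2f_th:
  assumes "g \<in> H2f"
  shows "(\<lambda>x. th x * g x) \<in> H2f" and "cmod z < 1 \<Longrightarrow> ev (\<lambda>x. th x * g x) z = \<Theta> z * ev g z"
  using H2f_mult[OF Theta_hardy(1) th_measurable th_AE assms] by auto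

lemma th_H2f: "th \<in> H2f" and ev_th: "cmod z < 1 \<Longrightarrow> ev th z = \<Theta> z"
  using H2f_th[OF H2f_const[of 1]] ev_const[of z 1] by auto

lemma th_sqi: "sqi circ th" by (rule H2f_sqi[OF th_H2f])

lemma sqi_th: "sqi circ f \<Longrightarrow> sqi circ (\<lambda>x. th x * f x)"
  by (rule sqi_mult_bounded[where B = 1]) auto

lemma sqi_cnj_th: "sqi circ f \<Longrightarrow> sqi circ (\<lambda>x. cnj (th x) * f x)"
  by (rule sqi_mult_bounded[where B = 1]) auto

lemma ip_th: "ip circ f (\<lambda>x. th x * g x) = ip circ (\<lambda>x. cnj (th x) * f x) g"
  by (simp add: ip_def mult_ac)

lemma ip_th_th: "ip circ (\<lambda>x. th x * f x) (\<lambda>x. th x * g x) = ip circ f g"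
  by (simp add: ip_th)

lemma boundary_Theta: "boundary \<Theta> = abs_l2 th"
  unfolding boundary_eq using abs_l2_eq_iff[OF th_sqi hardy2_bd(1)[OF Theta_hardy(2)]] th_AE by simp

text \<open>\<open>\<Theta> z\<close> is the Poisson integral of the unimodular function
  \<open>th\<close>, so its modulus is at most 1; the maximum principle excludes equality for a
  nonconstant function.\<close>

lemma Theta_lt_1:
  assumes "cmod z < 1" shows "cmod (\<Theta> z) < 1"
proof -
  have le: "cmod (\<Theta> z) \<le> 1" if z: "cmod z < 1" for z
  proof -
    have k: "(\<lambda>x. 1 / (1 - z * cnj x)) \<in> borel_measurable circ"
      by (rule circle_measurable_borel[OF sets_circ]) measurable
    have b: "cmod (1 / (1 - z * cnj x)) \<le> 1 / (1 - cmod z)" if "x \<in> space circ" for x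
      using that z by (intro cauchy_kernel_bound) (auto simp: space_circ)
    have ti: "integrable circ th" by (rule sqi_circ_integrable[OF th_sqi])
    have i1: "integrable circ (\<lambda>x. 1 / (1 - z * cnj x) * th x)"
      by (rule integrable_mult_bounded[OF ti k b])
    have i2: "integrable circ (\<lambda>x. cnj (1 / (1 - z * cnj x)) * th x)"
      by (rule integrable_mult_bounded[OF ti borel_measurable_cnj[OF k], of "1 / (1 - cmod z)"])
        (simp only: complex_mod_cnj, rule b)
    have eq: "1 / (1 - z * cnj x) * th x + cnj (1 / (1 - z * cnj x)) * th x - th x = of_real (pois z x) * th x"
      if "x \<in> space circ" for x
    proof -
      have "cmod x = 1" using that by (simp add: space_circ)
      from pois_eq[OF this z] show ?thesis by (simp only:) (simp add: algebra_simps)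
    qed
    have "\<Theta> z = (\<integral>x. 1 / (1 - z * cnj x) * th x \<partial>circ)"
      using ev_th[OF z] by (simp add: ev_def)
    also have "\<dots> = (\<integral>x. 1 / (1 - z * cnj x) * th x \<partial>circ) + (\<integral>x. cnj (1 / (1 - z * cnj x)) * th x \<partial>circ) - (\<integral>x. th x \<partial>circ)"
      using H2f_conj_kernel[OF th_H2f z] by (simp add: mult.commute)
    also have "\<dots> = (\<integral>x. 1 / (1 - z * cnj x) * th x + cnj (1 / (1 - z * cnj x)) * th x - th x \<partial>circ)"
      by (simp only: Bochner_Integration.integral_diff[OF Bochner_Integration.integrable_add[OF i1 i2] ti]
          Bochner_Integration.integral_add[OF i1 i2])
    also have "\<dots> = (\<integral>x. of_real (pois z x) * th x \<partial>circ)"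
      by (intro Bochner_Integration.integral_cong refl eq)
    finally have "cmod (\<Theta> z) \<le> (\<integral>x. cmod (of_real (pois z x) * th x) \<partial>circ)"
      by (simp only: integral_norm_bound)
    also have "\<dots> = (\<integral>x. pois z x \<partial>circ)"
      using pois_nonneg[of z] z by (intro Bochner_Integration.integral_cong refl) (simp add: norm_mult)
    finally show ?thesis using pois_mass[OF z] by simp
  qed
  show ?thesis
  proof (rule ccontr)
    assume "\<not> cmod (\<Theta> z) < 1"
    then have "cmod (\<Theta> z) = 1" using le[OF assms] by simp
    then have "\<Theta> constant_on ball 0 1"
      using le assms
      by (intro maximum_modulus_principle[OF Theta_hardy(3), of "ball 0 1" z]) auto
    then show False using inner by (simp add: inner_function_def)
  qed
qed

section \<open>The model space, its conjugation and its reproducing kernels\<close>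

definition KF :: "(complex \<Rightarrow> complex) set" where
  "KF = {f \<in> H2f. \<forall>g\<in>H2f. ip circ f (\<lambda>x. th x * g x) = 0}"

lemma KF_H2f: "f \<in> KF \<Longrightarrow> f \<in> H2f" and KF_sqi: "f \<in> KF \<Longrightarrow> sqi circ f"
  by (auto simp: KF_def H2f_sqi)

lemma abs_model_iff:
  assumes f: "sqi circ f" shows "abs_l2 f \<in> model_space \<Theta> \<longleftrightarrow> f \<in> KF"
proof -
  have "(\<forall>y\<in>H2. l2_inner (abs_l2 f) (boundary \<Theta> \<odot> y) = 0) \<longleftrightarrow> (\<forall>g\<in>H2f. ip circ f (\<lambda>x. th x * g x) = 0)"
  proof safe
    fix g assume a: "\<forall>y\<in>H2. l2_inner (abs_l2 f) (boundary \<Theta> \<odot> y) = 0" and g: "g \<in> H2f"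
    have gs: "sqi circ g" by (rule H2f_sqi[OF g])
    have "l2_inner (abs_l2 f) (boundary \<Theta> \<odot> abs_l2 g) = 0" using a abs_H2_iff[OF gs] g by blast
    then show "ip circ f (\<lambda>x. th x * g x) = 0"
      by (simp add: boundary_Theta l2_mult_abs th_sqi gs sqi_th l2_inner_abs f)
  next
    fix y assume a: "\<forall>g\<in>H2f. ip circ f (\<lambda>x. th x * g x) = 0" and y: "y \<in> H2"
    have "ip circ f (\<lambda>x. th x * rep_l2 y x) = 0" using a y H2_iff by blast
    moreover have "l2_inner (abs_l2 f) (abs_l2 th \<odot> abs_l2 (rep_l2 y)) = ip circ f (\<lambda>x. th x * rep_l2 y x)"
      by (simp add: l2_mult_abs th_sqi rep_l2_sqi sqi_th l2_inner_abs f)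
    ultimately show "l2_inner (abs_l2 f) (boundary \<Theta> \<odot> y) = 0"
      by (simp add: boundary_Theta abs_rep_l2)
  qed
  then show ?thesis by (simp add: model_space_def KF_def abs_H2_iff[OF f])
qed

lemma model_iff: "x \<in> model_space \<Theta> \<longleftrightarrow> rep_l2 x \<in> KF"
  using abs_model_iff[OF rep_l2_sqi, of x] by (simp add: abs_rep_l2)

lemma KF_cong_AE:
  assumes "f \<in> KF" "g \<in> borel_measurable circ" "AE x in circ. f x = g x"
  shows "g \<in> KF"
proof -
  have g: "sqi circ g" using sqi_cong_AE[OF KF_sqi] assms by auto
  then have "abs_l2 f = abs_l2 g" using abs_l2_eq_iff[OF KF_sqi[OF assms(1)] g] assms(3) by simp
  then show ?thesis using abs_model_iff[OF KF_sqi[OF assms(1)]] abs_model_iff[OF g] assms(1) by simp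
qed

lemma KF_lin:
  assumes f: "f \<in> KF" and g: "g \<in> KF" shows "(\<lambda>x. f x + c * g x) \<in> KF"
proof -
  have "ip circ (\<lambda>x. f x + c * g x) (\<lambda>x. th x * h x) = 0" if h: "h \<in> H2f" for h
  proof -
    have "ip circ (\<lambda>x. f x + c * g x) (\<lambda>x. th x * h x) = ip circ f (\<lambda>x. th x * h x) + ip circ (\<lambda>x. c * g x) (\<lambda>x. th x * h x)"
      by (intro ip_add_left sqi_scale KF_sqi f g H2f_sqi H2f_th h)
    then show ?thesis using f g h by (simp add: ip_scale_left KF_def)
  qed
  then show ?thesis using f g by (simp add: KF_def H2f_lin)
qed

lemma KF_zero: "(\<lambda>_. 0) \<in> KF"
  using H2f_const[of 0] by (simp add: KF_def ip_def)

lemma KF_closed: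
  assumes f: "\<And>n. f n \<in> KF" "sqi circ f0" "(\<lambda>n. nsq circ (\<lambda>x. f n x - f0 x)) \<longlonglongrightarrow> 0"
  shows "f0 \<in> KF"
proof -
  have "ip circ f0 (\<lambda>x. th x * g x) = 0" if g: "g \<in> H2f" for g
  proof -
    have "(\<lambda>n. ip circ (f n) (\<lambda>x. th x * g x)) \<longlonglongrightarrow> ip circ f0 (\<lambda>x. th x * g x)"
      by (rule ip_tendsto[OF KF_sqi[OF f(1)] f(2,3) H2f_sqi[OF H2f_th(1)[OF g]]])
    moreover have "ip circ (f n) (\<lambda>x. th x * g x) = 0" for n using f(1)[of n] g by (simp add: KF_def)
    ultimately have "(\<lambda>n. 0) \<longlonglongrightarrow> ip circ f0 (\<lambda>x. th x * g x)" by simp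
    then show ?thesis by (rule LIMSEQ_unique[OF _ tendsto_const])
  qed
  moreover have "f0 \<in> H2f" by (rule H2f_closed[OF KF_H2f[OF f(1)] f(2,3)])
  ultimately show ?thesis by (simp add: KF_def)
qed

text \<open>The conjugation \<open>C\<close> on the level of functions;
  \<open>model_conj_abs\<close> matches it with \<open>model_conj\<close>.\<close>

definition cj :: "(complex \<Rightarrow> complex) \<Rightarrow> complex \<Rightarrow> complex" where
  "cj f x = cnj (x * f x) * th x"

lemma id_circ [measurable]: "(\<lambda>x. x) \<in> borel_measurable circ"
  by (rule circle_measurable_borel[OF sets_circ]) simp

lemma cj_sqi:
  assumes "sqi circ f" shows "sqi circ (cj f)"
proof -
  have "sqi circ (\<lambda>x. x * f x)"
    by (rule sqi_mult_bounded[OF assms, where B = 1]) (auto simp: space_circ)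
  from sqi_th[OF sqi_cnj[OF this]] show ?thesis by (simp add: cj_def[abs_def] mult.commute)
qed

lemma cj_cj: "cmod x = 1 \<Longrightarrow> cj (cj f) x = f x"
proof -
  assume "cmod x = 1"
  then have "x * cnj x = 1" by (simp add: complex_norm_square[symmetric])
  then show ?thesis unfolding cj_def complex_cnj_mult complex_cnj_cnj
    by (metis mult.commute mult.left_commute mult.right_neutral th_cnj(1))
qed

text \<open>Orthogonality of \<open>f\<close> to all \<open>th * g\<close> means that
  \<open>cnj th * f\<close> has only Fourier coefficients of negative index; after conjugation and a
  shift by one power of \<open>x\<close> this is analyticity of \<open>cj f\<close>. In this form
  the model space is visibly invariant under \<open>cj\<close>.\<close>

lemma KF_cj_iff: "f \<in> KF \<longleftrightarrow> f \<in> H2f \<and> cj f \<in> H2f"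
proof -
  have key: "(\<integral>x. cj f x * x ^ Suc n \<partial>circ) = cnj (\<integral>x. cnj (th x) * f x * cnj x ^ n \<partial>circ)" for n
  proof -
    have "cj f x * x ^ Suc n = cnj (cnj (th x) * f x * cnj x ^ n)" if "x \<in> space circ" for x
    proof -
      have "cnj x * x = 1" using that by (simp add: space_circ complex_norm_square[symmetric] mult.commute)
      then have "cnj x * x * (cnj (f x) * th x * x ^ n) = cnj (f x) * th x * x ^ n" by simp
      then show ?thesis by (simp add: cj_def mult_ac)
    qed
    then have "(\<integral>x. cj f x * x ^ Suc n \<partial>circ) = (\<integral>x. cnj (cnj (th x) * f x * cnj x ^ n) \<partial>circ)"
      by (intro Bochner_Integration.integral_cong refl)
    then show ?thesis by (simp only: Bochner_Integration.integral_cnj)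
  qed
  have pw: "(\<lambda>x. x ^ n) \<in> H2f" for n
    using H2f_mult_cont(1)[of "\<lambda>x. x ^ n", OF _ _ H2f_const[of 1]] by (simp add: continuous_intros holomorphic_intros)
  show ?thesis
  proof
    assume f: "f \<in> KF"
    have "(\<integral>x. cnj (th x) * f x * cnj x ^ n \<partial>circ) = 0" for n
    proof -
      have "ip circ f (\<lambda>x. th x * x ^ n) = 0" using f pw by (simp add: KF_def)
      then show ?thesis unfolding ip_th by (simp add: ip_def)
    qed
    then show "f \<in> H2f \<and> cj f \<in> H2f"
      using f KF_H2f cj_sqi[OF KF_sqi[OF f]] by (simp add: H2f_def[of] key del: power_Suc)
  next
    assume a: "f \<in> H2f \<and> cj f \<in> H2f"
    have "(\<integral>x. cnj (th x) * f x * cnj x ^ n \<partial>circ) = 0" for n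
    proof -
      have "cnj (\<integral>x. cnj (th x) * f x * cnj x ^ n \<partial>circ) = 0" using a unfolding key[symmetric] by (simp add: H2f_def del: power_Suc)
      then show ?thesis by (simp only: complex_cnj_zero_iff)
    qed
    then have "ip circ (\<lambda>x. cnj (th x) * f x) g = 0" if "g \<in> H2f" for g
      using a that by (intro H2f_orthogonal sqi_cnj_th H2f_sqi) auto
    then show "f \<in> KF" using a by (simp add: KF_def ip_th)
  qed
qed

lemma KF_cj: assumes f: "f \<in> KF" shows "cj f \<in> KF"
proof -
  have "f \<in> H2f" "cj f \<in> H2f" using f by (auto simp: KF_cj_iff)
  moreover have "cj (cj f) \<in> H2f"
  proof (rule H2f_cong_AE[OF \<open>f \<in> H2f\<close>])
    show "cj (cj f) \<in> borel_measurable circ" using cj_sqi[OF cj_sqi[OF KF_sqi[OF f]]] by (simp add: sqi_def)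
    show "AE x in circ. f x = cj (cj f) x" by (intro AE_I2) (simp add: space_circ cj_cj)
  qed
  ultimately show ?thesis by (simp add: KF_cj_iff)
qed

lemma ip_cj: "ip circ (cj f) (cj g) = ip circ g f"
  unfolding ip_def
proof (intro Bochner_Integration.integral_cong refl)
  fix x assume "x \<in> space circ"
  then have "cnj x * x = 1" by (simp add: space_circ complex_norm_square[symmetric] mult.commute)
  then have "(cnj x * x) * (th x * cnj (th x)) * (cnj (f x) * g x) = g x * cnj (f x)" by simp
  then show "cj f x * cnj (cj g x) = g x * cnj (f x)" by (simp add: cj_def mult_ac)
qed

text \<open>The reproducing kernel of the model space at \<open>w\<close>; see
  \<open>KF_repro\<close>.\<close>

definition kw :: "complex \<Rightarrow> complex \<Rightarrow> complex" where
  "kw w x = (1 - cnj (\<Theta> w) * th x) / (1 - cnj w * x)"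

lemma kw_eq: "kw w x = szego w x + (- cnj (\<Theta> w)) * (th x * szego w x)"
  by (simp add: kw_def szego_def diff_divide_distrib)

lemma kw_H2f: "cmod w < 1 \<Longrightarrow> kw w \<in> H2f"
  using H2f_lin[OF szego_H2f(3) H2f_th(1)[OF szego_H2f(3)], of w w "- cnj (\<Theta> w)"]
  by (simp add: kw_eq[abs_def])

text \<open>The conjugate kernel is a difference quotient of \<open>\<Theta>\<close>; the second
  form displays a Cauchy kernel, ready for evaluation by \<open>ev\<close>.\<close>

lemma cj_kw:
  assumes "cmod x = 1" "cmod w < 1"
  shows "cj (kw w) x = (th x - \<Theta> w) / (x - w)" and "cj (kw w) x = (th x - \<Theta> w) * cnj x / (1 - w * cnj x)"
proof -
  have xx: "x * cnj x = 1" using assms by (simp add: complex_norm_square[symmetric])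
  have ne: "1 - w * cnj x \<noteq> 0" using assms by (intro one_minus_mult_ne) auto
  have "cj (kw w) x = cnj x * ((1 - \<Theta> w * cnj (th x)) / (1 - w * cnj x)) * th x"
    by (simp add: cj_def kw_def)
  also have "\<dots> = cnj x * (th x - \<Theta> w * (cnj (th x) * th x)) / (1 - w * cnj x)"
    by (simp add: algebra_simps del: th_cnj)
  finally show 2: "cj (kw w) x = (th x - \<Theta> w) * cnj x / (1 - w * cnj x)" by (simp add: mult.commute)
  have "1 - w * cnj x = cnj x * (x - w)" using xx by (simp add: algebra_simps)
  moreover have "cnj x \<noteq> 0" using xx by auto
  ultimately show "cj (kw w) x = (th x - \<Theta> w) / (x - w)" unfolding 2 by simp
qed

text \<open>The moments of \<open>cj (kw w)\<close> that must vanish are the values at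
  \<open>w\<close> of the analytic functions with boundary values
  \<open>x ^ n * (th x - \<Theta> w)\<close>, and these are zero.\<close>

lemma kw_KF:
  assumes w: "cmod w < 1" shows "kw w \<in> KF"
proof -
  have tw: "(\<lambda>x. th x + (-1) * (\<lambda>_. \<Theta> w) x) \<in> H2f"
    by (rule H2f_lin[OF th_H2f H2f_const])
  have "(\<integral>x. cj (kw w) x * x ^ Suc n \<partial>circ) = 0" for n
  proof -
    have "cj (kw w) x * x ^ Suc n = x ^ n * (th x + (-1) * \<Theta> w) / (1 - w * cnj x)" if "x \<in> space circ" for x
    proof -
      have x: "cmod x = 1" using that by (simp add: space_circ)
      have xx: "cnj x * x = 1" using x by (simp add: complex_norm_square[symmetric] mult.commute)
      have "cj (kw w) x * x ^ Suc n = (cnj x * x) * (x ^ n * (th x - \<Theta> w)) / (1 - w * cnj x)"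
        unfolding cj_kw(2)[OF x w] by (simp add: mult_ac)
      then show ?thesis unfolding xx by simp
    qed
    then have "(\<integral>x. cj (kw w) x * x ^ Suc n \<partial>circ) = ev (\<lambda>x. x ^ n * (th x + (-1) * \<Theta> w)) w"
      unfolding ev_def by (intro Bochner_Integration.integral_cong refl)
    also have "\<dots> = w ^ n * ev (\<lambda>x. th x + (-1) * \<Theta> w) w"
      by (rule H2f_mult_cont(2)[OF _ _ tw w]) (auto intro!: continuous_intros holomorphic_intros)
    also have "ev (\<lambda>x. th x + (-1) * \<Theta> w) w = 0"
      using ev_lin[OF th_sqi H2f_sqi[OF H2f_const] w, of "-1" "\<Theta> w"] ev_th[OF w] ev_const[OF w] by simp
    finally show ?thesis by simp
  qed
  then have "cj (kw w) \<in> H2f" using cj_sqi[OF H2f_sqi[OF kw_H2f[OF w]]] by (simp add: H2f_def del: power_Suc)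
  then show ?thesis using kw_H2f[OF w] by (simp add: KF_cj_iff)
qed

lemma H2f_szego_ip: "ip circ f (szego w) = ev f w"
  by (simp add: ip_def ev_def szego_cnj)

lemma KF_repro:
  assumes f: "f \<in> KF" and w: "cmod w < 1" shows "ip circ f (kw w) = ev f w"
proof -
  have s: "sqi circ (szego w)" "sqi circ (\<lambda>x. th x * szego w x)"
    using szego_H2f(3)[OF w] by (auto intro: H2f_sqi H2f_th)
  have "ip circ f (kw w) = ip circ f (szego w) + ip circ f (\<lambda>x. (- cnj (\<Theta> w)) * (th x * szego w x))"
    unfolding kw_eq[abs_def] by (intro ip_add_right s sqi_scale KF_sqi f)
  also have "ip circ f (\<lambda>x. (- cnj (\<Theta> w)) * (th x * szego w x)) = 0"
    unfolding ip_scale_right using f szego_H2f(3)[OF w] by (simp add: KF_def)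
  finally show ?thesis by (simp add: H2f_szego_ip)
qed

lemma KF_total:
  assumes f: "f \<in> KF" and 0: "\<And>w. cmod w < 1 \<Longrightarrow> ev f w = 0" shows "AE x in circ. f x = 0"
  using AE_space H2f_bd_ev[OF KF_H2f[OF f]]
proof eventually_elim
  case (elim x)
  have "\<forall>\<^sub>F r in at_left (1::real). r \<in> {0<..<1}" by (rule eventually_at_left_real) simp
  then have "\<forall>\<^sub>F r in at_left (1::real). ev f (of_real r * x) = 0"
    by eventually_elim (use elim in \<open>auto intro!: 0 simp: space_circ norm_mult\<close>)
  then have "((\<lambda>r::real. ev f (of_real r * x)) \<longlongrightarrow> 0) (at_left 1)" by (rule tendsto_eventually)
  then show ?case using elim bd_eqI by auto
qed

lemma KF_ev_cj: "f \<in> KF \<Longrightarrow> cmod w < 1 \<Longrightarrow> ip circ f (cj (kw w)) = cnj (ev (cj f) w)"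
proof -
  assume f: "f \<in> KF" and w: "cmod w < 1"
  have "ip circ (cj f) (kw w) = ip circ (cj f) (cj (cj (kw w)))"
    unfolding ip_def by (intro Bochner_Integration.integral_cong refl) (simp add: space_circ cj_cj)
  also have "\<dots> = ip circ (cj (kw w)) f" by (rule ip_cj)
  finally show ?thesis using KF_repro[OF KF_cj[OF f] w] by (metis ip_cnj)
qed

section \<open>The orthogonal projection onto the model space\<close>

definition Pp :: "(complex \<Rightarrow> complex) \<Rightarrow> complex \<Rightarrow> complex" where "Pp u = bd (ev u)"

lemma Pp_H2f: "sqi circ u \<Longrightarrow> Pp u \<in> H2f"
  unfolding Pp_def by (intro bd_H2f ev_hardy2)

lemma Pp_ip:
  assumes u: "sqi circ u" and g: "g \<in> H2f" shows "ip circ (Pp u) g = ip circ u g"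
proof -
  have p: "sqi circ (Pp u)" by (rule H2f_sqi[OF Pp_H2f[OF u]])
  have "ip circ (\<lambda>x. u x - Pp u x) g = 0"
  proof (rule H2f_orthogonal[OF sqi_diff[OF u p] _ g])
    show "(\<integral>x. (u x - Pp u x) * cnj x ^ n \<partial>circ) = 0" for n
      using hardy2_coeff(1)[OF ev_hardy2[OF u], of n] ev_taylor(2)[OF u, of n]
      by (simp add: Pp_def left_diff_distrib sqi_integrable_mult[OF u sqi_power(2)]
          sqi_integrable_mult[OF p[unfolded Pp_def] sqi_power(2)])
  qed
  then show ?thesis using ip_diff_left[OF u p H2f_sqi[OF g]] by simp
qed

text \<open>With the Riesz projection \<open>P\<close> this is
  \<open>P u - \<Theta> P (cnj \<Theta> u)\<close>, the usual formula for the projection onto the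
  model space. It furnishes the witness that the description in \<open>orth_proj\<close> asks
  for.\<close>

definition PK :: "(complex \<Rightarrow> complex) \<Rightarrow> complex \<Rightarrow> complex" where
  "PK u x = Pp u x - th x * Pp (\<lambda>x. cnj (th x) * u x) x"

lemma PK_KF:
  assumes u: "sqi circ u" shows "PK u \<in> KF"
proof -
  let ?v = "\<lambda>x. cnj (th x) * u x"
  have v: "sqi circ ?v" by (rule sqi_cnj_th[OF u])
  have tp: "(\<lambda>x. th x * Pp ?v x) \<in> H2f" by (rule H2f_th(1)[OF Pp_H2f[OF v]])
  have "(\<lambda>x. Pp u x + (-1) * (th x * Pp ?v x)) \<in> H2f" by (rule H2f_lin[OF Pp_H2f[OF u] tp])
  then have H: "PK u \<in> H2f" by (simp add: PK_def[abs_def])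
  have "ip circ (PK u) (\<lambda>x. th x * g x) = 0" if g: "g \<in> H2f" for g
  proof -
    have "ip circ (PK u) (\<lambda>x. th x * g x) = ip circ (Pp u) (\<lambda>x. th x * g x) - ip circ (\<lambda>x. th x * Pp ?v x) (\<lambda>x. th x * g x)"
      unfolding PK_def[abs_def] by (intro ip_diff_left H2f_sqi Pp_H2f u tp H2f_th g)
    also have "\<dots> = ip circ u (\<lambda>x. th x * g x) - ip circ ?v g"
      by (simp add: Pp_ip[OF u H2f_th(1)[OF g]] ip_th_th Pp_ip[OF v g])
    finally show ?thesis by (simp add: ip_th)
  qed
  then show ?thesis using H by (simp add: KF_def)
qed

lemma PK_ip:
  assumes u: "sqi circ u" and k: "k \<in> KF" shows "ip circ (PK u) k = ip circ u k"
proof -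
  let ?v = "\<lambda>x. cnj (th x) * u x"
  have v: "sqi circ ?v" by (rule sqi_cnj_th[OF u])
  have tp: "(\<lambda>x. th x * Pp ?v x) \<in> H2f" by (rule H2f_th(1)[OF Pp_H2f[OF v]])
  have "ip circ (PK u) k = ip circ (Pp u) k - ip circ (\<lambda>x. th x * Pp ?v x) k"
    unfolding PK_def[abs_def] by (intro ip_diff_left H2f_sqi Pp_H2f u tp KF_H2f k)
  also have "ip circ (\<lambda>x. th x * Pp ?v x) k = cnj (ip circ k (\<lambda>x. th x * Pp ?v x))" by (simp add: ip_cnj)
  also have "ip circ k (\<lambda>x. th x * Pp ?v x) = 0" using k Pp_H2f[OF v] by (simp add: KF_def)
  finally show ?thesis using Pp_ip[OF u KF_H2f[OF k]] by simp
qed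

abbreviation "KK \<equiv> model_space \<Theta>"

lemma KK_lin: "x \<in> KK \<Longrightarrow> y \<in> KK \<Longrightarrow> x + y \<in> KK" "x \<in> KK \<Longrightarrow> c *\<^sub>C x \<in> KK"
  "x \<in> KK \<Longrightarrow> y \<in> KK \<Longrightarrow> x - y \<in> KK"
proof -
  show add: "x + y \<in> KK" if "x \<in> KK" "y \<in> KK" for x y
  proof -
    have "(\<lambda>t. rep_l2 x t + 1 * rep_l2 y t) \<in> KF" using that by (intro KF_lin) (simp_all add: model_iff)
    then have "abs_l2 (\<lambda>t. rep_l2 x t + 1 * rep_l2 y t) \<in> KK"
      by (subst abs_model_iff) (auto intro: KF_sqi)
    moreover have "x + y = abs_l2 (\<lambda>t. rep_l2 x t + 1 * rep_l2 y t)"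
      using l2_add_abs[OF rep_l2_sqi rep_l2_sqi, of x y] by (simp add: abs_rep_l2)
    ultimately show ?thesis by simp
  qed
  show scale: "c *\<^sub>C x \<in> KK" if "x \<in> KK" for x c
  proof -
    have "(\<lambda>t. 0 + c * rep_l2 x t) \<in> KF" using that KF_lin[OF KF_zero, of "rep_l2 x" c] by (simp add: model_iff)
    then have "abs_l2 (\<lambda>t. 0 + c * rep_l2 x t) \<in> KK"
      by (subst abs_model_iff) (auto intro: KF_sqi)
    moreover have "c *\<^sub>C x = abs_l2 (\<lambda>t. 0 + c * rep_l2 x t)"
      using l2_scale_abs[OF rep_l2_sqi, of c x] by (simp add: abs_rep_l2)
    ultimately show ?thesis by simp
  qed
  show "x - y \<in> KK" if "x \<in> KK" "y \<in> KK" for x y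
    unfolding minus_l2_def uminus_l2_def by (intro add scale that)
qed

lemma KK_eqI:
  assumes "x \<in> KK" "y \<in> KK" "\<And>k. k \<in> KK \<Longrightarrow> l2_inner x k = l2_inner y k"
  shows "x = y"
proof -
  have "l2_inner (x - y) (x - y) = 0" using assms KK_lin(3) by (simp add: l2_inner_diff)
  then show ?thesis by (simp add: l2_inner_self_eq_0)
qed

lemma orth_proj_ex1: "\<exists>!h. h \<in> KK \<and> (\<forall>k\<in>KK. l2_inner (x - h) k = 0)"
proof (rule ex_ex1I)
  let ?h = "abs_l2 (PK (rep_l2 x))"
  have s: "sqi circ (PK (rep_l2 x))" by (rule KF_sqi[OF PK_KF[OF rep_l2_sqi]])
  have "?h \<in> KK" using abs_model_iff[OF s] PK_KF[OF rep_l2_sqi] by simp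
  moreover have "l2_inner (x - ?h) k = 0" if "k \<in> KK" for k
  proof -
    have "l2_inner ?h (abs_l2 (rep_l2 k)) = ip circ (rep_l2 x) (rep_l2 k)"
      using that by (subst l2_inner_abs[OF s rep_l2_sqi]) (simp add: PK_ip[OF rep_l2_sqi] model_iff)
    then show ?thesis by (simp add: l2_inner_diff abs_rep_l2 l2_inner_rep[of x k])
  qed
  ultimately show "\<exists>h. h \<in> KK \<and> (\<forall>k\<in>KK. l2_inner (x - h) k = 0)" by blast
next
  fix h h' assume "h \<in> KK \<and> (\<forall>k\<in>KK. l2_inner (x - h) k = 0)" "h' \<in> KK \<and> (\<forall>k\<in>KK. l2_inner (x - h') k = 0)"
  then show "h = h'" by (intro KK_eqI) (auto simp: l2_inner_diff)
qed

lemma orth_proj_KK: "orth_proj KK x \<in> KK"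
  and orth_proj_inner: "k \<in> KK \<Longrightarrow> l2_inner (orth_proj KK x) k = l2_inner x k"
  using theI'[OF orth_proj_ex1[of x]] unfolding orth_proj_def by (auto simp: l2_inner_diff)

lemma orth_proj_eqI:
  assumes "h \<in> KK" "\<And>k. k \<in> KK \<Longrightarrow> l2_inner h k = l2_inner x k" shows "orth_proj KK x = h"
  by (rule KK_eqI) (use assms orth_proj_KK orth_proj_inner in auto)

definition kl :: "complex \<Rightarrow> l2" where "kl w = abs_l2 (kw w)"

lemma kl_KK: "cmod w < 1 \<Longrightarrow> kl w \<in> KK"
  using abs_model_iff[OF KF_sqi[OF kw_KF]] kw_KF by (simp add: kl_def)

lemma kl_inner:
  assumes "f \<in> KF" "cmod w < 1" shows "l2_inner (abs_l2 f) (kl w) = ev f w"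
  using KF_repro[OF assms] l2_inner_abs[OF KF_sqi[OF assms(1)] KF_sqi[OF kw_KF[OF assms(2)]]] by (simp add: kl_def)

lemma kl_total:
  assumes "x \<in> KK" "\<And>w. cmod w < 1 \<Longrightarrow> l2_inner x (kl w) = 0" shows "x = 0"
proof -
  have f: "rep_l2 x \<in> KF" using assms(1) by (simp add: model_iff)
  have "ev (rep_l2 x) w = 0" if "cmod w < 1" for w
    using kl_inner[OF f that] assms(2)[OF that] by (simp add: abs_rep_l2)
  then have "AE t in circ. rep_l2 x t = 0" by (rule KF_total[OF f])
  then have "nsq circ (rep_l2 x) = 0" by (simp add: nsq_eq_0[OF rep_l2_sqi])
  then have "norm x = 0" using l2_norm_rep[of x] by simp
  then show ?thesis by simp
qed

lemma KK_eqI_kl: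
  assumes "x \<in> KK" "y \<in> KK" "\<And>w. cmod w < 1 \<Longrightarrow> l2_inner x (kl w) = l2_inner y (kl w)"
  shows "x = y"
proof -
  have "x - y = 0" by (rule kl_total[OF KK_lin(3)[OF assms(1,2)]]) (simp add: l2_inner_diff assms(3))
  then show ?thesis by simp
qed

text \<open>A truncated Toeplitz operator is prescribed only on \<open>KK \<inter> Hinf\<close>;
  this puts the kernels within reach of that prescription.\<close>

lemma kl_Hinf:
  assumes w: "cmod w < 1" shows "kl w \<in> Hinf"
proof -
  define F where "F z = (1 - cnj (\<Theta> w) * \<Theta> z) * szego w z" for z
  have s: "szego w \<in> hardy_inf" by (rule hardy_inf_cont[OF szego_H2f(1,2)[OF w]])
  obtain B where B: "\<And>z. cmod z < 1 \<Longrightarrow> cmod (szego w z) \<le> B" using hardy_inf_bound[OF s] by blast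
  have "bounded (F ` ball 0 1)"
    unfolding bounded_iff
  proof (intro exI[of _ "2 * B"] ballI)
    fix y assume "y \<in> F ` ball 0 1"
    then obtain z where z: "cmod z < 1" "y = F z" by auto
    have "cmod (1 - cnj (\<Theta> w) * \<Theta> z) \<le> 1 + cmod (\<Theta> w) * cmod (\<Theta> z)"
      using norm_triangle_ineq4[of 1 "cnj (\<Theta> w) * \<Theta> z"] by (simp add: norm_mult)
    also have "\<dots> \<le> 1 + 1 * 1" using Theta_lt_1[OF w] Theta_lt_1[OF z(1)] by (intro add_left_mono mult_mono) auto
    finally show "cmod y \<le> 2 * B"
      unfolding z(2) F_def norm_mult using B[OF z(1)] by (intro mult_mono) auto
  qed
  moreover have "F holomorphic_on ball 0 1"
    unfolding F_def by (intro holomorphic_intros Theta_hardy szego_H2f w)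
  ultimately have F: "F \<in> hardy_inf" by (simp add: hardy_inf_def)
  have "AE x in circ. bd F x = kw w x"
    using AE_space th_AE hardy2_bd(2)[OF Theta_hardy(2)] hardy2_bd(2)[OF hardy_inf_hardy2[OF s]]
  proof eventually_elim
    case (elim x)
    have "bd F x = (1 - cnj (\<Theta> w) * bd \<Theta> x) * bd (szego w) x"
      unfolding F_def by (intro bd_eqI tendsto_intros elim)
    also have "bd (szego w) x = szego w x"
      using elim(1) by (intro bd_cont szego_H2f w) (simp add: space_circ)
    finally show ?case using elim(2) by (simp add: kw_def szego_def)
  qed
  then have "boundary F = kl w"
    unfolding boundary_eq kl_def using abs_l2_eq_iff[OF hardy2_bd(1)[OF hardy_inf_hardy2[OF F]] KF_sqi[OF kw_KF[OF w]]] by simp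
  then show ?thesis using F unfolding Hinf_def by (intro image_eqI[of _ _ F]) simp_all
qed

text \<open>Chooses a representative bounded everywhere, so that its product with a
  square-integrable symbol is square integrable and \<open>\<odot>\<close> does not fall back to its
  dummy value 0.\<close>

lemma Hinf_bounded:
  assumes "x \<in> Hinf"
  obtains f B where "x = abs_l2 f" "sqi circ f" "\<And>t. cmod (f t) \<le> B"
proof -
  obtain F where F: "F \<in> hardy_inf" "x = boundary F" using assms by (auto simp: Hinf_def)
  obtain B where B: "\<And>z. cmod z < 1 \<Longrightarrow> cmod (F z) \<le> B" using hardy_inf_bound[OF F(1)] by blast
  have B0: "0 \<le> B" using B[of 0] norm_ge_zero[of "F 0"] by (auto intro: order_trans[OF norm_ge_zero])
  note b = hardy2_bd[OF hardy_inf_hardy2[OF F(1)]]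
  have [measurable]: "bd F \<in> borel_measurable circ" using b(1) by (simp add: sqi_def)
  define f where "f t = (if cmod (bd F t) \<le> B then bd F t else 0)" for t
  have m: "f \<in> borel_measurable circ" unfolding f_def by measurable
  have ae: "AE t in circ. bd F t = f t"
    using AE_space b(2)
  proof eventually_elim
    case (elim t)
    have "\<forall>\<^sub>F r in at_left (1::real). r \<in> {0<..<1}" by (rule eventually_at_left_real) simp
    then have "\<forall>\<^sub>F r in at_left (1::real). cmod (F (of_real r * t)) \<le> B"
      by eventually_elim (use elim in \<open>auto intro!: B simp: space_circ norm_mult\<close>)
    then have "cmod (bd F t) \<le> B"
      by (intro tendsto_upperbound[OF tendsto_norm[OF elim(2)]]) auto
    then show ?case by (simp add: f_def)
  qed
  have "sqi circ f" by (rule sqi_cong_AE[OF b(1) m ae])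
  moreover have "x = abs_l2 f"
    unfolding F(2) boundary_eq using abs_l2_eq_iff[OF b(1) \<open>sqi circ f\<close>] ae by simp
  moreover have "cmod (f t) \<le> B" for t using B0 by (simp add: f_def)
  ultimately show ?thesis using that by blast
qed

text \<open>The set where the two operators agree is a subspace containing the total family of
  kernels, hence dense; the operator bounds extend the agreement to limits.\<close>

lemma bounded_operator_eqI:
  assumes T: "T \<in> bounded_operators KK" "T' \<in> bounded_operators KK"
    and eq: "\<And>w. cmod w < 1 \<Longrightarrow> T (kl w) = T' (kl w)"
  shows "T = T'"
proof (rule extensionalityI[of _ KK])
  show "T \<in> extensional KK" "T' \<in> extensional KK" using T by (auto simp: bounded_operators_def PiE_def)
  fix x assume x: "x \<in> KK"
  define S where "S = {p \<in> KF. T (abs_l2 p) = T' (abs_l2 p)}"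
  have lin: "U (u + v) = U u + U v" "U (c *\<^sub>C u) = c *\<^sub>C U u"
    if "U \<in> {T, T'}" "u \<in> KK" "v \<in> KK" for U u v c
    using T that by (auto simp: bounded_operators_def complex_linear_on_def)
  have absK: "abs_l2 p \<in> KK" if "p \<in> KF" for p using that abs_model_iff[OF KF_sqi[OF that]] by simp
  obtain M1 where M1: "\<And>u. u \<in> KK \<Longrightarrow> norm (T u) \<le> M1 * norm u"
    using T(1) unfolding bounded_operators_def by blast
  obtain M2 where M2: "\<And>u. u \<in> KK \<Longrightarrow> norm (T' u) \<le> M2 * norm u"
    using T(2) unfolding bounded_operators_def by blast
  have fx: "rep_l2 x \<in> KF" using x by (simp add: model_iff)
  obtain p where p: "\<And>n. p n \<in> S" "(\<lambda>n. nsq circ (\<lambda>t. p n t - rep_l2 x t)) \<longlonglongrightarrow> 0"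
  proof (rule total_dense[where H = KF and S = S and M = circ and x = "rep_l2 x"])
    show "S \<subseteq> KF" by (auto simp: S_def)
    have z: "U 0 = 0" if "U \<in> {T, T'}" for U
    proof -
      have "U (0 *\<^sub>C x) = 0 *\<^sub>C U x" by (rule lin(2)[OF that x x])
      moreover have "0 *\<^sub>C y = 0" for y :: l2 by (metis of_real_0 scaleR_l2_def scaleR_zero_left)
      ultimately show ?thesis by simp
    qed
    have "abs_l2 (\<lambda>_. 0) = 0" by (simp add: zero_l2_def)
    then show "(\<lambda>_. 0) \<in> S" using z[of T] z[of T'] KF_zero by (simp add: S_def)
    fix f g c assume fg: "f \<in> S" "g \<in> S"
    then have K: "abs_l2 f \<in> KK" "abs_l2 g \<in> KK" "f \<in> KF" "g \<in> KF" using absK by (auto simp: S_def)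
    have "abs_l2 (\<lambda>x. f x + c * g x) = abs_l2 f + c *\<^sub>C abs_l2 g"
      by (simp add: l2_scale_abs l2_add_abs KF_sqi K sqi_scale)
    then show "(\<lambda>x. f x + c * g x) \<in> S"
      using fg K KK_lin by (simp add: S_def KF_lin lin)
  next
    fix f assume f: "f \<in> KF" and o: "\<And>p. p \<in> S \<Longrightarrow> ip circ f p = 0"
    have "ev f w = 0" if "cmod w < 1" for w
    proof -
      have "kw w \<in> S" using eq[OF that] kw_KF[OF that] by (simp add: S_def kl_def)
      then show ?thesis using o KF_repro[OF f that] by metis
    qed
    then show "nsq circ f = 0" using KF_total[OF f] nsq_eq_0[OF KF_sqi[OF f]] by blast
  qed (use KF_sqi KF_lin KF_closed fx in blast)+
  have "norm (T x - T' x) \<le> (\<bar>M1\<bar> + \<bar>M2\<bar>) * sqrt (nsq circ (\<lambda>t. p n t - rep_l2 x t))" for n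
  proof -
    have pn: "p n \<in> KF" "T (abs_l2 (p n)) = T' (abs_l2 (p n))" using p(1)[of n] by (auto simp: S_def)
    let ?y = "abs_l2 (p n)"
    have yK: "?y \<in> KK" using absK[OF pn(1)] .
    have ny: "norm (?y - x) = sqrt (nsq circ (\<lambda>t. p n t - rep_l2 x t))"
    proof -
      have "?y - abs_l2 (rep_l2 x) = abs_l2 (\<lambda>t. p n t - rep_l2 x t)" by (intro l2_diff_abs KF_sqi pn rep_l2_sqi)
      then have "(norm (?y - x))\<^sup>2 = nsq circ (\<lambda>t. p n t - rep_l2 x t)"
        using l2_norm_abs[OF sqi_diff[OF KF_sqi[OF pn(1)] rep_l2_sqi], of x] by (simp add: abs_rep_l2)
      then show ?thesis by (metis norm_ge_zero real_sqrt_unique)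
    qed
    have diff: "U (?y - x) = U ?y - U x" if "U \<in> {T, T'}" for U
      unfolding minus_l2_def uminus_l2_def using lin[OF that] yK x KK_lin by simp
    have "T x - T' x = T' (?y - x) - T (?y - x)" using diff[of T] diff[of T'] pn by simp
    then have "norm (T x - T' x) \<le> norm (T' (?y - x)) + norm (T (?y - x))" by (metis norm_triangle_ineq4)
    also have "\<dots> \<le> M2 * norm (?y - x) + M1 * norm (?y - x)" using M1 M2 KK_lin(3)[OF yK x] by (intro add_mono)
    also have "\<dots> \<le> \<bar>M2\<bar> * norm (?y - x) + \<bar>M1\<bar> * norm (?y - x)" by (intro add_mono mult_right_mono) auto
    finally show ?thesis unfolding ny by (simp add: algebra_simps)
  qed
  moreover have "(\<lambda>n. (\<bar>M1\<bar> + \<bar>M2\<bar>) * sqrt (nsq circ (\<lambda>t. p n t - rep_l2 x t))) \<longlonglongrightarrow> (\<bar>M1\<bar> + \<bar>M2\<bar>) * sqrt 0"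
    by (intro tendsto_intros p)
  ultimately have "norm (T x - T' x) \<le> (\<bar>M1\<bar> + \<bar>M2\<bar>) * sqrt 0" by (intro LIMSEQ_le_const) blast+
  then show "T x = T' x" by simp
qed

end

section \<open>Clark's unitary operator\<close>

text \<open>A closed subspace of L^2 on the level of functions. Both Clark's operator and its
  inverse are obtained from \<open>isometry_extend\<close>, with the model space on one side and all
  of L^2(\<mu>) on the other.\<close>

definition hilb :: "'a measure \<Rightarrow> ('a \<Rightarrow> complex) set \<Rightarrow> bool" where
  "hilb M H \<longleftrightarrow> (\<forall>f\<in>H. sqi M f) \<and> (\<forall>f g c. f \<in> H \<longrightarrow> g \<in> H \<longrightarrow> (\<lambda>x. f x + c * g x) \<in> H) \<and>
     (\<forall>f f0. (\<forall>n. f n \<in> H) \<longrightarrow> sqi M f0 \<longrightarrow> (\<lambda>n::nat. nsq M (\<lambda>x. f n x - f0 x)) \<longlonglongrightarrow> 0 \<longrightarrow> f0 \<in> H)"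

lemma hilb_sqi: "hilb M {f. sqi M f}"
  by (auto simp: hilb_def intro: sqi_add sqi_scale)

text \<open>\<open>G\<close> is the graph of a densely defined isometry; the lemma extends it by continuity.\<close>

lemma isometry_extend:
  assumes HA: "hilb M1 HA" and HB: "hilb M2 HB"
    and G: "\<And>p q. (p, q) \<in> G \<Longrightarrow> p \<in> HA \<and> q \<in> HB" "((\<lambda>_. 0), (\<lambda>_. 0)) \<in> G"
      "\<And>p q p' q' c. (p, q) \<in> G \<Longrightarrow> (p', q') \<in> G \<Longrightarrow> ((\<lambda>x. p x + c * p' x), (\<lambda>x. q x + c * q' x)) \<in> G"
      "\<And>p q p' q'. (p, q) \<in> G \<Longrightarrow> (p', q') \<in> G \<Longrightarrow> ip M1 p p' = ip M2 q q'"
    and total: "\<And>f. f \<in> HA \<Longrightarrow> (\<And>p q. (p, q) \<in> G \<Longrightarrow> ip M1 f p = 0) \<Longrightarrow> nsq M1 f = 0"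
    and x: "x \<in> HA"
  obtains y p q where "y \<in> HB" "\<And>n. (p n, q n) \<in> G" "(\<lambda>n. nsq M1 (\<lambda>t. p n t - x t)) \<longlonglongrightarrow> 0"
    "(\<lambda>n. nsq M2 (\<lambda>t. q n t - y t)) \<longlonglongrightarrow> 0" "\<And>p q. (p, q) \<in> G \<Longrightarrow> ip M1 x p = ip M2 y q"
proof -
  have s1: "sqi M1 f" if "f \<in> HA" for f using HA that unfolding hilb_def by blast
  have s2: "sqi M2 f" if "f \<in> HB" for f using HB that unfolding hilb_def by blast
  obtain p where p: "\<And>n. p n \<in> fst ` G" "(\<lambda>n. nsq M1 (\<lambda>t. p n t - x t)) \<longlonglongrightarrow> 0"
  proof (rule total_dense[where H = HA and S = "fst ` G" and M = M1 and x = x])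
    show "sqi M1 f" if "f \<in> HA" for f by (rule s1[OF that])
    show "(\<lambda>x. f x + c * g x) \<in> HA" if "f \<in> HA" "g \<in> HA" for f g c using HA that unfolding hilb_def by blast
    show "f0 \<in> HA" if "\<And>n. f n \<in> HA" "sqi M1 f0" "(\<lambda>n. nsq M1 (\<lambda>x. f n x - f0 x)) \<longlonglongrightarrow> 0" for f f0
      using HA that unfolding hilb_def by blast
    show "fst ` G \<subseteq> HA" using G(1) by force
    show "(\<lambda>_. 0) \<in> fst ` G" using G(2) by force
    show "(\<lambda>x. f x + c * g x) \<in> fst ` G" if fg: "f \<in> fst ` G" "g \<in> fst ` G" for f g c
    proof -
      obtain f' g' where "(f, f') \<in> G" "(g, g') \<in> G" using fg by force
      from G(3)[OF this, of c] show ?thesis by force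
    qed
    show "nsq M1 f = 0" if "f \<in> HA" "\<And>p. p \<in> fst ` G \<Longrightarrow> ip M1 f p = 0" for f
    proof (rule total[OF that(1)])
      fix p q assume "(p, q) \<in> G"
      then show "ip M1 f p = 0" by (intro that(2)) force
    qed
  qed (rule x, blast)
  have "\<forall>n. \<exists>q. (p n, q) \<in> G" using p(1) by force
  then obtain q where q: "\<And>n. (p n, q n) \<in> G" by metis
  have pH: "p n \<in> HA" and qH: "q n \<in> HB" for n using G(1)[OF q] by auto
  have iso: "nsq M2 (\<lambda>t. q m t - q n t) = nsq M1 (\<lambda>t. p m t - p n t)" for m n
  proof -
    have "((\<lambda>t. p m t + (-1) * p n t), (\<lambda>t. q m t + (-1) * q n t)) \<in> G" by (intro G(3) q)
    from G(4)[OF this this] show ?thesis by (simp add: ip_self)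
  qed
  have "\<exists>N. \<forall>m\<ge>N. \<forall>n\<ge>N. nsq M2 (\<lambda>t. q m t - q n t) < e" if e: "e > 0" for e
  proof -
    obtain N where N: "\<And>n. n \<ge> N \<Longrightarrow> nsq M1 (\<lambda>t. p n t - x t) < e / 4"
      using order_tendstoD(2)[OF p(2), of "e / 4"] e by (auto simp: eventually_sequentially)
    have "nsq M2 (\<lambda>t. q m t - q n t) < e" if mn: "m \<ge> N" "n \<ge> N" for m n
    proof -
      have "nsq M1 (\<lambda>t. p m t - p n t) = nsq M1 (\<lambda>t. (p m t - x t) + (x t - p n t))" by simp
      also have "\<dots> \<le> 2 * nsq M1 (\<lambda>t. p m t - x t) + 2 * nsq M1 (\<lambda>t. x t - p n t)"
        by (intro nsq_add_le sqi_diff s1 pH x)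
      also have "nsq M1 (\<lambda>t. x t - p n t) = nsq M1 (\<lambda>t. p n t - x t)" by (rule nsq_minus_commute)
      finally show ?thesis using N[OF mn(1)] N[OF mn(2)] iso by simp
    qed
    then show ?thesis by blast
  qed
  then obtain y where y: "sqi M2 y" "(\<lambda>n. nsq M2 (\<lambda>t. q n t - y t)) \<longlonglongrightarrow> 0"
    using riesz_fischer[where M = M2 and g = q, OF s2[OF qH]] by blast
  have yH: "y \<in> HB" using HB qH y unfolding hilb_def by blast
  have "ip M1 x p' = ip M2 y q'" if g: "(p', q') \<in> G" for p' q'
  proof -
    have "(\<lambda>n. ip M1 (p n) p') \<longlonglongrightarrow> ip M1 x p'"
      using G(1)[OF g] by (intro ip_tendsto s1 pH x p(2)) auto
    moreover have "(\<lambda>n. ip M2 (q n) q') \<longlonglongrightarrow> ip M2 y q'"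
      using G(1)[OF g] by (intro ip_tendsto s2 qH yH y(2)) auto
    moreover have "ip M1 (p n) p' = ip M2 (q n) q'" for n by (rule G(4)[OF q g])
    ultimately show ?thesis by (simp add: LIMSEQ_unique)
  qed
  then show ?thesis using that[OF yH q p(2) y(2)] by blast
qed

lemma isometry_ip:
  assumes s: "\<And>n. sqi M1 (p n)" "\<And>n. sqi M2 (q n)" "sqi M1 x" "sqi M2 y" "sqi M1 x'" "sqi M2 y'"
    and lim: "(\<lambda>n. nsq M1 (\<lambda>t. p n t - x t)) \<longlonglongrightarrow> 0" "(\<lambda>n. nsq M2 (\<lambda>t. q n t - y t)) \<longlonglongrightarrow> 0"
    and eq: "\<And>n. ip M1 x' (p n) = ip M2 y' (q n)"
  shows "ip M1 x x' = ip M2 y y'"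
proof -
  have "(\<lambda>n. ip M1 (p n) x') \<longlonglongrightarrow> ip M1 x x'" by (rule ip_tendsto[OF s(1,3) lim(1) s(5)])
  moreover have "(\<lambda>n. ip M2 (q n) y') \<longlonglongrightarrow> ip M2 y y'" by (rule ip_tendsto[OF s(2,4) lim(2) s(6)])
  moreover have "ip M1 (p n) x' = ip M2 (q n) y'" for n using eq by (metis ip_cnj)
  ultimately show ?thesis by (simp add: LIMSEQ_unique)
qed

lemma circle_inv: "cmod x = 1 \<Longrightarrow> cnj x * x = 1" "cmod x = 1 \<Longrightarrow> x * cnj x = 1"
  by (simp_all add: complex_norm_square[symmetric] mult.commute)

text \<open>The last assumption is the full Herglotz formula, whereas a Clark measure is defined by
  the real part of it: the Gram matrices below are complex identities. The imaginary constant is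
  left unspecified. \<open>clark_clark_measure\<close> provides the assumptions for every unimodular
  \<open>a\<close>.\<close>

locale clark = inner_fn +
  fixes a :: complex and \<mu> :: "complex measure"
  assumes a1: "cmod a = 1"
    and mu: "finite_measure \<mu>" "sets \<mu> = sets (restrict_space borel (sphere 0 1))"
    and herglotz: "\<exists>t::real. \<forall>z. cmod z < 1 \<longrightarrow>
      (a + \<Theta> z) / (a - \<Theta> z) = (\<integral>x. (x + z) / (x - z) \<partial>\<mu>) + \<i> * of_real t"
begin

lemma space_mu: "space \<mu> = sphere 0 1" by (rule circle_space[OF mu(2)])

lemma aa: "a * cnj a = 1" "cnj a * a = 1" using circle_inv[OF a1] by auto

lemma a_ne: "cmod w < 1 \<Longrightarrow> a - \<Theta> w \<noteq> 0" "cmod w < 1 \<Longrightarrow> 1 - a * cnj (\<Theta> w) \<noteq> 0" "cmod w < 1 \<Longrightarrow> cnj a - cnj (\<Theta> w) \<noteq> 0"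
proof -
  assume "cmod w < 1"
  then have T: "cmod (\<Theta> w) < 1" by (rule Theta_lt_1)
  show 1: "a - \<Theta> w \<noteq> 0" using T a1 by auto
  then show "cnj a - cnj (\<Theta> w) \<noteq> 0" by (metis complex_cnj_cancel_iff eq_iff_diff_eq_0)
  then have "a * (cnj a - cnj (\<Theta> w)) \<noteq> 0" using a1 by auto
  then show "1 - a * cnj (\<Theta> w) \<noteq> 0" by (simp add: right_diff_distrib aa)
qed

lemma circle_ne: "cmod w < 1 \<Longrightarrow> cmod x = 1 \<Longrightarrow> x - w \<noteq> 0" "cmod w < 1 \<Longrightarrow> cmod x = 1 \<Longrightarrow> 1 - cnj w * x \<noteq> 0"
    "cmod w < 1 \<Longrightarrow> cmod x = 1 \<Longrightarrow> 1 - w * cnj x \<noteq> 0"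
  using one_minus_mult_ne[of "cnj w" x] one_minus_mult_ne[of w "cnj x"] by auto

lemma mu_borel: "f \<in> borel_measurable borel \<Longrightarrow> f \<in> borel_measurable \<mu>"
  by (rule circle_measurable_borel[OF mu(2)])

lemma mu_integrable_bounded:
  fixes f :: "complex \<Rightarrow> complex"
  assumes "f \<in> borel_measurable borel" "\<And>x. cmod x = 1 \<Longrightarrow> cmod (f x) \<le> B"
  shows "integrable \<mu> f"
proof (rule finite_measure.integrable_const_bound[OF mu(1), of f B])
  show "AE x in \<mu>. cmod (f x) \<le> B" by (intro AE_I2 assms(2)) (simp add: space_mu)
qed (rule mu_borel[OF assms(1)])

section \<open>Herglotz kernels and Gram matrices on the Clark side\<close>

definition H :: "complex \<Rightarrow> complex" where "H z = (a + \<Theta> z) / (a - \<Theta> z)"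

lemma kernel_bound:
  assumes "cmod w < 1" "cmod x = 1" shows "1 - cmod w \<le> cmod (x - w)"
  using norm_triangle_ineq2[of x w] assms by simp

lemma herglotz_integrable:
  assumes "cmod z < 1" shows "integrable \<mu> (\<lambda>x. (x + z) / (x - z))"
proof (rule mu_integrable_bounded)
  show "cmod ((x + z) / (x - z)) \<le> 2 / (1 - cmod z)" if x: "cmod x = 1" for x
  proof -
    have "cmod (x + z) \<le> 2" using norm_triangle_ineq[of x z] x assms by simp
    then show ?thesis unfolding norm_divide using kernel_bound[OF assms x] assms by (intro frac_le) auto
  qed
qed measurable

text \<open>The unknown imaginary constant cancels against its conjugate; in the difference treated
  next it cancels against itself.\<close>

lemma herglotz_plus:
  assumes w: "cmod w < 1" and u: "cmod u < 1"
  shows "(\<integral>x. (x + w) / (x - w) + cnj ((x + u) / (x - u)) \<partial>\<mu>) = H w + cnj (H u)"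
proof -
  obtain t where t: "\<And>z. cmod z < 1 \<Longrightarrow> H z = (\<integral>x. (x + z) / (x - z) \<partial>\<mu>) + \<i> * of_real t"
    using herglotz unfolding H_def by blast
  have "integrable \<mu> (\<lambda>x. cnj ((x + u) / (x - u)))"
    using integrable_bounded_linear[OF bounded_linear_cnj herglotz_integrable[OF u]] .
  then have "(\<integral>x. (x + w) / (x - w) + cnj ((x + u) / (x - u)) \<partial>\<mu>)
     = (\<integral>x. (x + w) / (x - w) \<partial>\<mu>) + (\<integral>x. cnj ((x + u) / (x - u)) \<partial>\<mu>)"
    by (intro Bochner_Integration.integral_add herglotz_integrable w)
  also have "(\<integral>x. cnj ((x + u) / (x - u)) \<partial>\<mu>) = cnj (\<integral>x. (x + u) / (x - u) \<partial>\<mu>)"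
    by (rule Bochner_Integration.integral_cnj)
  finally show ?thesis using t[OF w] t[OF u] by simp
qed

lemma herglotz_minus:
  assumes w: "cmod w < 1" and u: "cmod u < 1"
  shows "(\<integral>x. (x + w) / (x - w) - (x + u) / (x - u) \<partial>\<mu>) = H w - H u"
proof -
  obtain t where t: "\<And>z. cmod z < 1 \<Longrightarrow> H z = (\<integral>x. (x + z) / (x - z) \<partial>\<mu>) + \<i> * of_real t"
    using herglotz unfolding H_def by blast
  have "(\<integral>x. (x + w) / (x - w) - (x + u) / (x - u) \<partial>\<mu>) = (\<integral>x. (x + w) / (x - w) \<partial>\<mu>) - (\<integral>x. (x + u) / (x - u) \<partial>\<mu>)"
    by (intro Bochner_Integration.integral_diff herglotz_integrable w u)
  then show ?thesis using t[OF w] t[OF u] by simp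
qed

text \<open>\<open>vk w\<close> and \<open>vc w\<close> are the Clark transforms of
  \<open>kw w\<close> and \<open>cj (kw w)\<close>: in the formulas for the latter, the boundary
  value \<open>th x\<close> is replaced by \<open>a\<close>.\<close>

definition vk :: "complex \<Rightarrow> complex \<Rightarrow> complex" where "vk w x = (1 - a * cnj (\<Theta> w)) / (1 - cnj w * x)"
definition vc :: "complex \<Rightarrow> complex \<Rightarrow> complex" where "vc w x = (a - \<Theta> w) / (x - w)"

lemma vk_bound:
  assumes "cmod w < 1" "cmod x = 1" shows "cmod (vk w x) \<le> cmod (1 - a * cnj (\<Theta> w)) / (1 - cmod w)"
proof -
  have "cmod (1 / (1 - cnj w * x)) \<le> 1 / (1 - cmod w)" using cauchy_kernel_bound[of "cnj w" x] assms by simp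
  then have "cmod (1 - a * cnj (\<Theta> w)) * cmod (1 / (1 - cnj w * x)) \<le> cmod (1 - a * cnj (\<Theta> w)) * (1 / (1 - cmod w))"
    by (intro mult_left_mono) auto
  then show ?thesis by (simp add: vk_def norm_divide)
qed

lemma vk_meas: "vk w \<in> borel_measurable \<mu>"
  unfolding vk_def[abs_def] by (rule mu_borel) measurable

lemma vk_sqi: "cmod w < 1 \<Longrightarrow> sqi \<mu> (vk w)"
  by (rule sqi_bounded[OF mu(1) vk_meas vk_bound]) (auto simp: space_mu)

lemma vc_eq: "cmod w < 1 \<Longrightarrow> cmod x = 1 \<Longrightarrow> vc w x = a * cnj (x * vk w x)"
  and vk_eq: "cmod w < 1 \<Longrightarrow> cmod x = 1 \<Longrightarrow> x * vk w x = a * cnj (vc w x)"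
proof -
  assume w: "cmod w < 1" and x: "cmod x = 1"
  have "1 - w * cnj x = cnj x * (x - w)" using circle_inv[OF x] by (simp add: algebra_simps)
  moreover have "cnj x \<noteq> 0" using x by auto
  ultimately have "cnj x / (1 - w * cnj x) = 1 / (x - w)" by simp
  moreover have "a * cnj (x * vk w x) = (a * (1 - cnj a * \<Theta> w)) * (cnj x / (1 - w * cnj x))"
    by (simp add: vk_def)
  ultimately have "a * cnj (x * vk w x) = (a - (a * cnj a) * \<Theta> w) / (x - w)"
    by (simp add: right_diff_distrib)
  then show 1: "vc w x = a * cnj (x * vk w x)" unfolding aa by (simp add: vc_def)
  have "a * cnj (vc w x) = (a * cnj a) * (x * vk w x)" unfolding 1 by simp
  then show "x * vk w x = a * cnj (vc w x)" unfolding aa by simp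
qed

lemma vc_meas: "vc w \<in> borel_measurable \<mu>"
  unfolding vc_def[abs_def] by (rule mu_borel) measurable

lemma vc_sqi: "cmod w < 1 \<Longrightarrow> sqi \<mu> (vc w)"
proof (rule sqi_bounded[OF mu(1) vc_meas])
  fix x assume w: "cmod w < 1" and "x \<in> space \<mu>"
  then have x: "cmod x = 1" by (simp add: space_mu)
  show "cmod (vc w x) \<le> cmod (a - \<Theta> w) / (1 - cmod w)"
    unfolding vc_def norm_divide using kernel_bound[OF w x] w by (intro frac_le) auto
qed

lemma kk_gram:
  assumes u: "cmod u < 1" and w: "cmod w < 1"
  shows "ip circ (kw u) (kw w) = (1 - cnj (\<Theta> u) * \<Theta> w) / (1 - cnj u * w)"
proof -
  have es: "ev (szego u) w = szego u w"
    using H2f_mult_cont(2)[OF szego_H2f(1,2)[OF u] H2f_const[of 1] w] ev_const[OF w] by simp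
  have "ip circ (kw u) (kw w) = ev (kw u) w" by (rule KF_repro[OF kw_KF[OF u] w])
  also have "\<dots> = ev (szego u) w + (- cnj (\<Theta> u)) * ev (\<lambda>x. th x * szego u x) w"
    unfolding kw_eq[abs_def] by (rule ev_lin[OF H2f_sqi[OF szego_H2f(3)[OF u]] H2f_sqi[OF H2f_th(1)[OF szego_H2f(3)[OF u]]] w])
  also have "\<dots> = (1 - cnj (\<Theta> u) * \<Theta> w) / (1 - cnj u * w)"
    using H2f_th(2)[OF szego_H2f(3)[OF u] w] es by (simp add: szego_def diff_divide_distrib)
  finally show ?thesis .
qed

text \<open>A product of two Cauchy kernels is a constant times the sum of a Herglotz kernel and a
  conjugate one, whose integral is known from \<open>herglotz_plus\<close>. The value is the Gram
  entry of the reproducing kernels in \<open>kk_gram\<close>.\<close>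

lemma vk_gram:
  assumes u: "cmod u < 1" and w: "cmod w < 1"
  shows "ip \<mu> (vk u) (vk w) = (1 - cnj (\<Theta> u) * \<Theta> w) / (1 - cnj u * w)"
proof -
  have uw: "1 - cnj u * w \<noteq> 0"
  proof
    assume "1 - cnj u * w = 0"
    then have "cmod (cnj u * w) = 1" by (metis eq_iff_diff_eq_0 norm_one)
    moreover have "cmod u * cmod w < 1 * 1" using u w by (intro mult_strict_mono') auto
    ultimately show False by (simp add: norm_mult)
  qed
  define K where "K = (1 - a * cnj (\<Theta> u)) * (1 - cnj a * \<Theta> w) / (2 * (1 - cnj u * w))"
  have eq: "vk u x * cnj (vk w x) = K * ((x + w) / (x - w) + cnj ((x + u) / (x - u)))" if "x \<in> space \<mu>" for x
  proof -
    have x: "cmod x = 1" using that by (simp add: space_mu)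
    define y where "y = cnj x"
    have xy: "x * y = 1" using circle_inv(2)[OF x] by (simp add: y_def)
    have ne: "1 - cnj u * x \<noteq> 0" "1 - w * y \<noteq> 0" "x - w \<noteq> 0" "y - cnj u \<noteq> 0"
      using circle_ne[OF u x] circle_ne[OF w x] unfolding y_def
      by (auto simp flip: complex_cnj_diff)
    have 1: "(x + w) / (x - w) = (1 + w * y) / (1 - w * y)"
    proof -
      have "(x + w) * (1 - w * y) = (1 + w * y) * (x - w)" using xy by (simp add: algebra_simps)
      then show ?thesis using ne by (simp add: frac_eq_eq)
    qed
    have 2: "cnj ((x + u) / (x - u)) = (1 + cnj u * x) / (1 - cnj u * x)"
    proof -
      have "(y + cnj u) * (1 - cnj u * x) = (1 + cnj u * x) * (y - cnj u)" using xy by (simp add: algebra_simps)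
      then show ?thesis using ne by (simp add: y_def frac_eq_eq)
    qed
    have "(1 + w * y) * (1 - cnj u * x) + (1 + cnj u * x) * (1 - w * y) = 2 * (1 - cnj u * w * (x * y))"
      by (simp add: algebra_simps)
    then have 3: "(1 + w * y) / (1 - w * y) + (1 + cnj u * x) / (1 - cnj u * x) = 2 * (1 - cnj u * w) / ((1 - w * y) * (1 - cnj u * x))"
      using ne unfolding xy by (simp add: add_frac_eq)
    have "K * (2 * (1 - cnj u * w) / ((1 - w * y) * (1 - cnj u * x))) = (1 - a * cnj (\<Theta> u)) * (1 - cnj a * \<Theta> w) / ((1 - w * y) * (1 - cnj u * x))"
      using uw by (simp add: K_def)
    also have "\<dots> = vk u x * cnj (vk w x)" by (simp add: vk_def y_def)
    finally show ?thesis unfolding 1 2 3 by simp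
  qed
  have "ip \<mu> (vk u) (vk w) = (\<integral>x. K * ((x + w) / (x - w) + cnj ((x + u) / (x - u))) \<partial>\<mu>)"
    unfolding ip_def by (intro Bochner_Integration.integral_cong refl eq)
  also have "\<dots> = K * (H w + cnj (H u))"
    by (simp only: Bochner_Integration.integral_mult_right_zero herglotz_plus[OF w u])
  also have "H w + cnj (H u) = 2 * (1 - cnj (\<Theta> u) * \<Theta> w) / ((a - \<Theta> w) * (cnj a - cnj (\<Theta> u)))"
  proof -
    have "(a + \<Theta> w) * (cnj a - cnj (\<Theta> u)) + (cnj a + cnj (\<Theta> u)) * (a - \<Theta> w) = 2 * (a * cnj a - cnj (\<Theta> u) * \<Theta> w)"
      by (simp add: algebra_simps)
    then show ?thesis unfolding H_def using a_ne[OF w] a_ne[OF u] by (simp add: add_frac_eq aa)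
  qed
  also have "K = (cnj a - cnj (\<Theta> u)) * (a - \<Theta> w) / (2 * (1 - cnj u * w))"
  proof -
    have "(1 - a * cnj (\<Theta> u)) * (1 - cnj a * \<Theta> w) = (a * cnj a - a * cnj (\<Theta> u)) * (cnj a * a - cnj a * \<Theta> w)"
      by (simp add: aa)
    also have "\<dots> = (a * cnj a) * ((cnj a - cnj (\<Theta> u)) * (a - \<Theta> w))" by (simp add: algebra_simps)
    finally show ?thesis by (simp add: K_def aa)
  qed
  also have "(cnj a - cnj (\<Theta> u)) * (a - \<Theta> w) / (2 * (1 - cnj u * w)) *
      (2 * (1 - cnj (\<Theta> u) * \<Theta> w) / ((a - \<Theta> w) * (cnj a - cnj (\<Theta> u)))) = (1 - cnj (\<Theta> u) * \<Theta> w) / (1 - cnj u * w)"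
  proof -
    have "p * q / (2 * d) * (2 * n / (q * p)) = n / d" if "p \<noteq> 0" "q \<noteq> 0" "d \<noteq> 0" for p q d n :: complex
      using that by (simp add: field_simps)
    then show ?thesis using a_ne(1)[OF w] a_ne(3)[OF u] uw by blast
  qed
  finally show ?thesis .
qed

text \<open>Multiplication by \<open>w - u\<close> removes the denominator of the difference
  quotient and avoids a case distinction at \<open>w = u\<close>; \<open>vck_gram\<close> has the
  same shape.\<close>

lemma ck_ev:
  assumes u: "cmod u < 1" and w: "cmod w < 1"
  shows "(w - u) * ev (cj (kw u)) w = \<Theta> w - \<Theta> u"
proof -
  have c: "cj (kw u) \<in> H2f" using KF_cj[OF kw_KF[OF u]] by (rule KF_H2f)
  have "(w - u) * ev (cj (kw u)) w = ev (\<lambda>x. (x - u) * cj (kw u) x) w"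
    by (rule H2f_mult_cont(2)[OF _ _ c w, symmetric]) (auto intro!: continuous_intros holomorphic_intros)
  also have "\<dots> = ev (\<lambda>x. th x + (-1) * \<Theta> u) w"
    unfolding ev_def
  proof (intro Bochner_Integration.integral_cong refl)
    fix x assume "x \<in> space circ"
    then have x: "cmod x = 1" by (simp add: space_circ)
    show "(x - u) * cj (kw u) x / (1 - w * cnj x) = (th x + (-1) * \<Theta> u) / (1 - w * cnj x)"
      using cj_kw(1)[OF x u] circle_ne(1)[OF u x] by simp
  qed
  also have "\<dots> = \<Theta> w - \<Theta> u"
    using ev_lin[OF th_sqi H2f_sqi[OF H2f_const] w, of "-1" "\<Theta> u"] ev_th[OF w] ev_const[OF w] by simp
  finally show ?thesis .
qed

text \<open>Partial fractions write the product of the kernels, times \<open>w - u\<close>, as a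
  multiple of a difference of two Herglotz kernels.\<close>

lemma vck_gram:
  assumes u: "cmod u < 1" and w: "cmod w < 1"
  shows "(w - u) * ip \<mu> (vc u) (vk w) = \<Theta> w - \<Theta> u"
proof -
  have eq: "(w - u) * (vc u x * cnj (vk w x)) = (a - \<Theta> u) * (1 - cnj a * \<Theta> w) / 2 * ((x + w) / (x - w) - (x + u) / (x - u))"
    if "x \<in> space \<mu>" for x
  proof -
    have x: "cmod x = 1" using that by (simp add: space_mu)
    have ne: "x - u \<noteq> 0" "x - w \<noteq> 0" "1 - w * cnj x \<noteq> 0" "x \<noteq> 0" using circle_ne[OF u x] circle_ne[OF w x] x by auto
    have "(x - w) = x * (1 - w * cnj x)" using circle_inv[OF x] by (simp add: algebra_simps)
    then have 1: "1 / (1 - w * cnj x) = x / (x - w)" using ne by simp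
    have "(x + w) * (x - u) - (x + u) * (x - w) = 2 * x * (w - u)" by (simp add: algebra_simps)
    then have "(x + w) / (x - w) - (x + u) / (x - u) = 2 * x * (w - u) / ((x - w) * (x - u))"
      using ne by (simp add: diff_frac_eq)
    moreover have "A * B / 2 * (2 * x * d / (p * q)) = d * (A / q * (B * (x / p)))"
      if "p \<noteq> 0" "q \<noteq> 0" for A B d p q :: complex using that by (simp add: field_simps)
    ultimately have "(a - \<Theta> u) * (1 - cnj a * \<Theta> w) / 2 * ((x + w) / (x - w) - (x + u) / (x - u))
      = (w - u) * ((a - \<Theta> u) / (x - u) * ((1 - cnj a * \<Theta> w) * (x / (x - w))))"
      using ne by (simp only:)
    also have "\<dots> = (w - u) * (vc u x * cnj (vk w x))" unfolding 1[symmetric] by (simp add: vc_def vk_def)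
    finally show ?thesis by simp
  qed
  have "(w - u) * ip \<mu> (vc u) (vk w) = (\<integral>x. (w - u) * (vc u x * cnj (vk w x)) \<partial>\<mu>)"
    unfolding ip_def by simp
  also have "\<dots> = (\<integral>x. (a - \<Theta> u) * (1 - cnj a * \<Theta> w) / 2 * ((x + w) / (x - w) - (x + u) / (x - u)) \<partial>\<mu>)"
    by (intro Bochner_Integration.integral_cong refl eq)
  also have "\<dots> = (a - \<Theta> u) * (1 - cnj a * \<Theta> w) / 2 * (H w - H u)"
    by (simp only: Bochner_Integration.integral_mult_right_zero herglotz_minus[OF w u])
  also have "H w - H u = 2 * a * (\<Theta> w - \<Theta> u) / ((a - \<Theta> w) * (a - \<Theta> u))"
  proof -
    have "(a + \<Theta> w) * (a - \<Theta> u) - (a + \<Theta> u) * (a - \<Theta> w) = 2 * a * (\<Theta> w - \<Theta> u)" by (simp add: algebra_simps)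
    then show ?thesis unfolding H_def using a_ne[OF w] a_ne[OF u] by (simp add: diff_frac_eq)
  qed
  also have "(a - \<Theta> u) * (1 - cnj a * \<Theta> w) / 2 * (2 * a * (\<Theta> w - \<Theta> u) / ((a - \<Theta> w) * (a - \<Theta> u)))
      = ((1 - cnj a * \<Theta> w) * a) * (\<Theta> w - \<Theta> u) / (a - \<Theta> w)"
    using a_ne[OF u] by simp
  also have "(1 - cnj a * \<Theta> w) * a = a - (a * cnj a) * \<Theta> w" by (simp add: algebra_simps)
  finally show ?thesis unfolding aa using a_ne[OF w] by simp
qed

text \<open>On the diagonal the Gram entry is a derivative of \<open>\<Theta>\<close>; it is obtained by continuity.\<close>

lemma mixed_gram:
  assumes u: "cmod u < 1" and w: "cmod w < 1"
  shows "ip circ (cj (kw u)) (kw w) = ip \<mu> (vc u) (vk w)"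
proof -
  have off: "ip circ (cj (kw u)) (kw z) = ip \<mu> (vc u) (vk z)" if z: "cmod z < 1" "z \<noteq> u" for z
  proof -
    have "(z - u) * ip circ (cj (kw u)) (kw z) = (z - u) * ip \<mu> (vc u) (vk z)"
      using ck_ev[OF u z(1)] vck_gram[OF u z(1)] KF_repro[OF KF_cj[OF kw_KF[OF u]] z(1)] by simp
    then show ?thesis using z by simp
  qed
  show ?thesis
  proof (cases "w = u")
    case True
    have c: "cj (kw u) \<in> KF" by (rule KF_cj[OF kw_KF[OF u]])
    have vi: "integrable \<mu> (vc u)" by (rule sqi_integrable[OF mu(1) vc_sqi[OF u]])
    have h1: "ev (cj (kw u)) holomorphic_on ball 0 1" by (rule ev_taylor(1)[OF KF_sqi[OF c]])
    define F where "F z = (1 - cnj a * \<Theta> z) * (\<integral>x. vc u x / (1 - z * cnj x) \<partial>\<mu>)" for z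
    have "(\<lambda>z. \<integral>x. vc u x / (1 - z * cnj x) \<partial>\<mu>) holomorphic_on ball 0 1"
    proof (rule power_series_holomorphic[of 0 1 "\<lambda>n. \<integral>x. vc u x * cnj x ^ n \<partial>\<mu>"])
      fix z :: complex assume "z \<in> ball 0 1"
      then have "(\<lambda>n. z ^ n * (\<integral>x. vc u x * cnj x ^ n \<partial>\<mu>)) sums (\<integral>x. vc u x / (1 - z * cnj x) \<partial>\<mu>)"
        by (intro cauchy_transform_sums[OF mu(2) vi]) simp
      then show "(\<lambda>n. (\<integral>x. vc u x * cnj x ^ n \<partial>\<mu>) * (z - 0) ^ n) sums (\<integral>x. vc u x / (1 - z * cnj x) \<partial>\<mu>)"
        by (simp add: mult.commute)
    qed
    then have h2: "F holomorphic_on ball 0 1" unfolding F_def by (intro holomorphic_intros Theta_hardy)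
    have F: "F z = ip \<mu> (vc u) (vk z)" for z
    proof -
      have "F z = (\<integral>x. (1 - cnj a * \<Theta> z) * (vc u x / (1 - z * cnj x)) \<partial>\<mu>)"
        by (simp only: F_def Bochner_Integration.integral_mult_right_zero)
      also have "\<dots> = ip \<mu> (vc u) (vk z)" unfolding ip_def
        by (intro Bochner_Integration.integral_cong refl) (simp add: vk_def)
      finally show ?thesis .
    qed
    have c1: "((\<lambda>z. ev (cj (kw u)) z) \<longlongrightarrow> ev (cj (kw u)) u) (at u)" and c2: "(F \<longlongrightarrow> F u) (at u)"
      using holomorphic_on_imp_continuous_on[OF h1] holomorphic_on_imp_continuous_on[OF h2] u
      by (auto simp: continuous_on_eq_continuous_at isCont_def)
    have "\<forall>\<^sub>F z in at u. z \<in> ball 0 1 - {u}"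
      using u by (intro eventually_at_in_open) auto
    then have "\<forall>\<^sub>F z in at u. ev (cj (kw u)) z = F z"
    proof eventually_elim
      case (elim z)
      then show ?case using off[of z] KF_repro[OF c, of z] F by simp
    qed
    from tendsto_cong[OF this] c1 have "(F \<longlongrightarrow> ev (cj (kw u)) u) (at u)" by simp
    then have "ev (cj (kw u)) u = F u" using c2 by (intro tendsto_unique[of "at u" F]) auto
    then show ?thesis using KF_repro[OF c w] F True by simp
  qed (use off w in auto)
qed

text \<open>\<open>g\<close> is a Clark transform of \<open>f\<close> when their inner products with
  the two kernel families match. As a relation it requires no choice of representatives on either
  side.\<close>

definition R :: "(complex \<Rightarrow> complex) \<Rightarrow> (complex \<Rightarrow> complex) \<Rightarrow> bool" where
  "R f g \<longleftrightarrow> f \<in> KF \<and> sqi \<mu> g \<and> (\<forall>w. cmod w < 1 \<longrightarrow> ip circ f (kw w) = ip \<mu> g (vk w)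
      \<and> ip circ f (cj (kw w)) = ip \<mu> g (vc w))"

lemma R_k: assumes w: "cmod w < 1" shows "R (kw w) (vk w)"
  unfolding R_def
proof (intro conjI allI impI)
  fix z :: complex assume z: "cmod z < 1"
  show "ip circ (kw w) (kw z) = ip \<mu> (vk w) (vk z)" using kk_gram[OF w z] vk_gram[OF w z] by simp
  show "ip circ (kw w) (cj (kw z)) = ip \<mu> (vk w) (vc z)" using mixed_gram[OF z w] by (metis ip_cnj)
qed (use w kw_KF vk_sqi in auto)

lemma R_c: assumes w: "cmod w < 1" shows "R (cj (kw w)) (vc w)"
  unfolding R_def
proof (intro conjI allI impI)
  fix z :: complex assume z: "cmod z < 1"
  show "ip circ (cj (kw w)) (kw z) = ip \<mu> (vc w) (vk z)" by (rule mixed_gram[OF w z])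
  have "ip \<mu> (vc w) (vc z) = ip \<mu> (vk z) (vk w)"
    unfolding ip_def
  proof (intro Bochner_Integration.integral_cong refl)
    fix x assume "x \<in> space \<mu>"
    then have x: "cmod x = 1" by (simp add: space_mu)
    have "vc w x * cnj (vc z x) = (a * cnj a) * (cnj x * x) * (vk z x * cnj (vk w x))"
      by (simp add: vc_eq[OF w x] vc_eq[OF z x] mult_ac)
    then show "vc w x * cnj (vc z x) = vk z x * cnj (vk w x)" unfolding aa circle_inv[OF x] by simp
  qed
  then show "ip circ (cj (kw w)) (cj (kw z)) = ip \<mu> (vc w) (vc z)"
    using kk_gram[OF z w] vk_gram[OF z w] by (simp add: ip_cj)
qed (use w kw_KF vc_sqi KF_cj in auto)

text \<open>The linear span of the pairs of a kernel and its transform. With pairs instead of a map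
  on linear combinations there is no well-definedness to check; equality of the Gram matrices is
  enough.\<close>

inductive_set G :: "((complex \<Rightarrow> complex) \<times> (complex \<Rightarrow> complex)) set" where
  zero: "((\<lambda>_. 0), (\<lambda>_. 0)) \<in> G"
| k: "(p, q) \<in> G \<Longrightarrow> cmod w < 1 \<Longrightarrow> ((\<lambda>x. p x + c * kw w x), (\<lambda>x. q x + c * vk w x)) \<in> G"
| c: "(p, q) \<in> G \<Longrightarrow> cmod w < 1 \<Longrightarrow> ((\<lambda>x. p x + c * cj (kw w) x), (\<lambda>x. q x + c * vc w x)) \<in> G"

lemma R_zero: "R (\<lambda>_. 0) (\<lambda>_. 0)"
  by (simp add: R_def KF_zero ip_def)

lemma R_lin: assumes "R f g" "R f' g'" shows "R (\<lambda>x. f x + c * f' x) (\<lambda>x. g x + c * g' x)"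
  unfolding R_def
proof (intro conjI allI impI)
  show "(\<lambda>x. f x + c * f' x) \<in> KF" "sqi \<mu> (\<lambda>x. g x + c * g' x)"
    using assms by (auto simp: R_def intro!: KF_lin sqi_add sqi_scale)
  have s: "sqi circ f" "sqi circ f'" "sqi \<mu> g" "sqi \<mu> g'" using assms by (auto simp: R_def KF_sqi)
  fix w :: complex assume w: "cmod w < 1"
  have k: "sqi circ (kw w)" "sqi circ (cj (kw w))" "sqi \<mu> (vk w)" "sqi \<mu> (vc w)"
    using w by (auto intro!: KF_sqi kw_KF KF_cj vk_sqi vc_sqi)
  show "ip circ (\<lambda>x. f x + c * f' x) (kw w) = ip \<mu> (\<lambda>x. g x + c * g' x) (vk w)"
    "ip circ (\<lambda>x. f x + c * f' x) (cj (kw w)) = ip \<mu> (\<lambda>x. g x + c * g' x) (vc w)"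
    using assms w by (simp_all add: ip_add_left ip_scale_left s k sqi_scale R_def)
qed

lemma G_R: "(p, q) \<in> G \<Longrightarrow> R p q"
  by (induction rule: G.induct) (auto intro: R_zero R_lin R_k R_c)

lemma G_add:
  assumes "(p', q') \<in> G" "(p, q) \<in> G"
  shows "((\<lambda>x. p x + d * p' x), (\<lambda>x. q x + d * q' x)) \<in> G"
  using assms
proof (induction arbitrary: rule: G.induct)
  case zero
  then show ?case by simp
next
  case (k p' q' w c)
  from G.k[OF k.IH[OF k.prems] k.hyps(2), of "d * c"] show ?case by (simp add: algebra_simps)
next
  case (c p' q' w c)
  from G.c[OF c.IH[OF c.prems] c.hyps(2), of "d * c"] show ?case by (simp add: algebra_simps)
qed

lemma R_G:
  assumes r: "R f g" and "(p, q) \<in> G" shows "ip circ f p = ip \<mu> g q"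
  using assms(2)
proof (induction rule: G.induct)
  case zero
  show ?case by (simp add: ip_def)
next
  case (k p q w c)
  have s: "sqi circ f" "sqi circ p" "sqi \<mu> g" "sqi \<mu> q" "sqi circ (kw w)" "sqi \<mu> (vk w)"
    using r G_R[OF k.hyps(1)] k.hyps(2) by (auto simp: R_def KF_sqi kw_KF vk_sqi)
  show ?case using r k by (simp add: ip_add_right ip_scale_right s sqi_scale R_def)
next
  case (c p q w c)
  have s: "sqi circ f" "sqi circ p" "sqi \<mu> g" "sqi \<mu> q" "sqi circ (cj (kw w))" "sqi \<mu> (vc w)"
    using r G_R[OF c.hyps(1)] c.hyps(2) by (auto simp: R_def KF_sqi kw_KF KF_cj vc_sqi)
  show ?case using r c by (simp add: ip_add_right ip_scale_right s sqi_scale R_def)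
qed

lemma G_k: "cmod w < 1 \<Longrightarrow> (kw w, vk w) \<in> G" and G_c: "cmod w < 1 \<Longrightarrow> (cj (kw w), vc w) \<in> G"
  using G.k[OF G.zero, of w 1] G.c[OF G.zero, of w 1] by simp_all

text \<open>Pairing with \<open>vk\<close> yields the Cauchy transform of \<open>g\<close>, pairing
  with \<open>vc\<close> its conjugate counterpart, up to nonzero factors and the mean, so that
  \<open>cauchy_null\<close> applies. This is the purpose of the second kernel family.\<close>

lemma mu_total:
  assumes g: "sqi \<mu> g" and 1: "\<And>w. cmod w < 1 \<Longrightarrow> ip \<mu> g (vk w) = 0" and 2: "\<And>w. cmod w < 1 \<Longrightarrow> ip \<mu> g (vc w) = 0"
  shows "AE x in \<mu>. g x = 0"
proof (rule cauchy_null[OF mu sqi_integrable[OF mu(1) g]])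
  fix z :: complex assume z: "cmod z < 1"
  have "ip \<mu> g (vk w) = (1 - cnj a * \<Theta> w) * (\<integral>x. g x / (1 - w * cnj x) \<partial>\<mu>)" for w
  proof -
    have "(1 - cnj a * \<Theta> w) * (\<integral>x. g x / (1 - w * cnj x) \<partial>\<mu>) = (\<integral>x. (1 - cnj a * \<Theta> w) * (g x / (1 - w * cnj x)) \<partial>\<mu>)"
      by (simp only: Bochner_Integration.integral_mult_right_zero)
    also have "\<dots> = ip \<mu> g (vk w)"
      unfolding ip_def by (intro Bochner_Integration.integral_cong refl) (simp add: vk_def)
    finally show ?thesis by simp
  qed
  moreover have "1 - cnj a * \<Theta> w \<noteq> 0" if "cmod w < 1" for w
    using a_ne(2)[OF that] by (metis complex_cnj_cnj complex_cnj_diff complex_cnj_mult complex_cnj_one complex_cnj_zero)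
  ultimately have A: "(\<integral>x. g x / (1 - w * cnj x) \<partial>\<mu>) = 0" if "cmod w < 1" for w
    using 1[OF that] that by simp
  show "(\<integral>x. g x / (1 - z * cnj x) \<partial>\<mu>) = 0" by (rule A[OF z])
  have vci: "integrable \<mu> (\<lambda>x. g x * cnj (vc z x))" by (rule sqi_integrable_ip[OF g vc_sqi[OF z]])
  \<comment> \<open>From \<open>1 / (1 - q) = 1 + q / (1 - q)\<close> with
    \<open>q = cnj z * x\<close>. The last fraction is \<open>cnj (vc z x)\<close> up to a factor,
    and the summand 1 contributes the mean of \<open>g\<close>, which is its Cauchy transform at
    0.\<close>
  have eq: "g x * cnj (1 / (1 - z * cnj x)) = g x + cnj z / (cnj a - cnj (\<Theta> z)) * (g x * cnj (vc z x))" if "x \<in> space \<mu>" for x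
  proof -
    have x: "cmod x = 1" using that by (simp add: space_mu)
    have ne: "1 - cnj z * x \<noteq> 0" "cnj x - cnj z \<noteq> 0" "x \<noteq> 0"
      using circle_ne[OF z x] x by (auto simp flip: complex_cnj_diff)
    have "1 - cnj z * x = x * (cnj x - cnj z)" using circle_inv[OF x] by (simp add: algebra_simps)
    then have "1 / (cnj x - cnj z) = x / (1 - cnj z * x)" using ne by simp
    then have v: "cnj (vc z x) = (cnj a - cnj (\<Theta> z)) * (x / (1 - cnj z * x))"
      by (simp add: vc_def divide_inverse)
    have "1 / (1 - cnj z * x) = 1 + cnj z * (x / (1 - cnj z * x))"
      using ne by (simp add: field_simps)
    then have "g x * cnj (1 / (1 - z * cnj x)) = g x * (1 + cnj z * (x / (1 - cnj z * x)))" by simp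
    then show ?thesis unfolding v using a_ne(3)[OF z] by (simp add: distrib_left mult_ac)
  qed
  have "(\<integral>x. g x * cnj (1 / (1 - z * cnj x)) \<partial>\<mu>) = (\<integral>x. g x + cnj z / (cnj a - cnj (\<Theta> z)) * (g x * cnj (vc z x)) \<partial>\<mu>)"
    by (intro Bochner_Integration.integral_cong refl eq)
  also have "\<dots> = (\<integral>x. g x \<partial>\<mu>) + cnj z / (cnj a - cnj (\<Theta> z)) * ip \<mu> g (vc z)"
    unfolding ip_def
    by (simp only: Bochner_Integration.integral_mult_right_zero
        Bochner_Integration.integral_add[OF sqi_integrable[OF mu(1) g] Bochner_Integration.integrable_mult_right[OF vci]])
  also have "\<dots> = 0" using 2[OF z] A[of 0] by simp
  finally show "(\<integral>x. g x * cnj (1 / (1 - z * cnj x)) \<partial>\<mu>) = 0" .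
qed

section \<open>Extension of the kernel correspondence to a unitary operator\<close>

lemma hilb_KF: "hilb circ KF"
  unfolding hilb_def using KF_sqi KF_lin KF_closed by blast

lemma G_iso: "(p, q) \<in> G \<Longrightarrow> (p', q') \<in> G \<Longrightarrow> ip circ p p' = ip \<mu> q q'"
  by (rule R_G[OF G_R])

text \<open>Besides the transform it returns approximating pairs from \<open>G\<close>, through
  which \<open>R_ip\<close> passes inner products to the limit.\<close>

lemma R_ex:
  assumes f: "f \<in> KF"
  obtains g p q where "R f g" "\<And>n. (p n, q n) \<in> G" "(\<lambda>n. nsq circ (\<lambda>t. p n t - f t)) \<longlonglongrightarrow> 0" "(\<lambda>n. nsq \<mu> (\<lambda>t. q n t - g t)) \<longlonglongrightarrow> 0"
proof (rule isometry_extend[OF hilb_KF hilb_sqi[of \<mu>], of G f])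
  show "p \<in> KF \<and> q \<in> {f. sqi \<mu> f}" if "(p, q) \<in> G" for p q using G_R[OF that] by (simp add: R_def)
  show "nsq circ f = 0" if "f \<in> KF" "\<And>p q. (p, q) \<in> G \<Longrightarrow> ip circ f p = 0" for f
  proof -
    have "ev f w = 0" if "cmod w < 1" for w
      using \<open>\<And>p q. (p, q) \<in> G \<Longrightarrow> ip circ f p = 0\<close>[OF G_k[OF that]] KF_repro[OF \<open>f \<in> KF\<close> that] by simp
    then show ?thesis using KF_total[OF \<open>f \<in> KF\<close>] nsq_eq_0[OF KF_sqi[OF \<open>f \<in> KF\<close>]] by blast
  qed
  fix y p q assume y: "y \<in> {f. sqi \<mu> f}" "\<And>n. (p n, q n) \<in> G" "(\<lambda>n. nsq circ (\<lambda>t. p n t - f t)) \<longlonglongrightarrow> 0"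
    "(\<lambda>n. nsq \<mu> (\<lambda>t. q n t - y t)) \<longlonglongrightarrow> 0" "\<And>p q. (p, q) \<in> G \<Longrightarrow> ip circ f p = ip \<mu> y q"
  have "R f y" using f y(1) y(5)[OF G_k] y(5)[OF G_c] by (simp add: R_def)
  then show thesis using that y(2-4) by blast
qed (use G.zero G_add G_iso f in auto)

lemma R_ex_inv:
  assumes g: "sqi \<mu> g" obtains f where "R f g"
proof -
  let ?G = "{(q, p). (p, q) \<in> G}"
  show ?thesis
  proof (rule isometry_extend[OF hilb_sqi[of \<mu>] hilb_KF, of ?G g])
    show "p \<in> {f. sqi \<mu> f} \<and> q \<in> KF" if "(p, q) \<in> ?G" for p q using that G_R[of q p] by (simp add: R_def)
    show "nsq \<mu> f = 0" if f: "f \<in> {f. sqi \<mu> f}" and o: "\<And>p q. (p, q) \<in> ?G \<Longrightarrow> ip \<mu> f p = 0" for f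
    proof -
      have fs: "sqi \<mu> f" using f by simp
      have "AE x in \<mu>. f x = 0"
      proof (rule mu_total[OF fs])
        show "ip \<mu> f (vk w) = 0" if "cmod w < 1" for w using o[of "vk w" "kw w"] G_k[OF that] by simp
        show "ip \<mu> f (vc w) = 0" if "cmod w < 1" for w using o[of "vc w" "cj (kw w)"] G_c[OF that] by simp
      qed
      then show ?thesis using nsq_eq_0[OF fs] by simp
    qed
    fix y and p q :: "nat \<Rightarrow> complex \<Rightarrow> complex"
    assume y: "y \<in> KF" and i: "\<And>p q. (p, q) \<in> ?G \<Longrightarrow> ip \<mu> g p = ip circ y q"
    have "ip \<mu> g (vk w) = ip circ y (kw w)" "ip \<mu> g (vc w) = ip circ y (cj (kw w))" if "cmod w < 1" for w
      using i[of "vk w" "kw w"] i[of "vc w" "cj (kw w)"] G_k[OF that] G_c[OF that] by simp_all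
    then have "R y g" unfolding R_def using g y by simp
    then show thesis by (rule that)
  qed (use G.zero G_add G_iso g in auto)
qed

lemma R_unique:
  assumes "R f g" "R f g'" shows "AE x in \<mu>. g x = g' x"
proof -
  have s: "sqi \<mu> g" "sqi \<mu> g'" using assms by (auto simp: R_def)
  have "AE x in \<mu>. g x - g' x = 0"
    by (rule mu_total[OF sqi_diff[OF s]])
      (use assms in \<open>auto simp: R_def ip_diff_left s vk_sqi vc_sqi\<close>)
  then show ?thesis by eventually_elim simp
qed

lemma R_ip:
  assumes r: "R f g" "R f' g'" shows "ip circ f f' = ip \<mu> g g'"
proof -
  have s: "sqi circ f" "sqi circ f'" "sqi \<mu> g" "sqi \<mu> g'" using r by (auto simp: R_def KF_sqi)
  have fK: "f \<in> KF" using r(1) by (simp add: R_def)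
  obtain g0 p q where 0: "R f g0" "\<And>n. (p n, q n) \<in> G" "(\<lambda>n. nsq circ (\<lambda>t. p n t - f t)) \<longlonglongrightarrow> 0"
    "(\<lambda>n. nsq \<mu> (\<lambda>t. q n t - g0 t)) \<longlonglongrightarrow> 0"
    by (rule R_ex[OF fK], blast)
  have s0: "sqi \<mu> g0" using 0(1) by (simp add: R_def)
  have pq: "sqi circ (p n)" "sqi \<mu> (q n)" for n using G_R[OF 0(2)] by (auto simp: R_def KF_sqi)
  have "ip circ f f' = ip \<mu> g0 g'"
    by (rule isometry_ip[OF pq s(1) s0 s(2,4) 0(3,4) R_G[OF r(2) 0(2)]])
  also have "\<dots> = ip \<mu> g g'" using R_unique[OF 0(1) r(1)] by (intro ip_cong_AE s0 s) auto
  finally show ?thesis .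
qed

text \<open>Clark's operator and its inverse. \<open>V\<close> yields a function by choice,
  determined only up to null sets of \<mu>, while \<open>W\<close> yields a class; values of
  \<open>W\<close> are compared by equality, values of \<open>V\<close> almost everywhere.\<close>

definition V :: "l2 \<Rightarrow> complex \<Rightarrow> complex" where "V x = (SOME g. R (rep_l2 x) g)"
definition W :: "(complex \<Rightarrow> complex) \<Rightarrow> l2" where "W g = abs_l2 (SOME f. R f g)"

lemma R_cong_left:
  assumes "R f g" "sqi circ f'" "AE x in circ. f x = f' x" shows "R f' g"
  unfolding R_def
proof (intro conjI allI impI)
  show "f' \<in> KF" using assms by (intro KF_cong_AE[of f f']) (auto simp: R_def sqi_def)
  show "sqi \<mu> g" using assms by (simp add: R_def)
  have s: "sqi circ f" using assms by (auto simp: R_def KF_sqi)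
  fix w :: complex assume w: "cmod w < 1"
  have k: "sqi circ (kw w)" "sqi circ (cj (kw w))" using w by (auto intro!: KF_sqi kw_KF KF_cj)
  have "ip circ f' (kw w) = ip circ f (kw w)" "ip circ f' (cj (kw w)) = ip circ f (cj (kw w))"
    using assms(3) by (auto intro!: ip_cong_AE assms(2) s k)
  then show "ip circ f' (kw w) = ip \<mu> g (vk w)" "ip circ f' (cj (kw w)) = ip \<mu> g (vc w)"
    using assms(1) w by (auto simp: R_def)
qed

lemma V_R: assumes "x \<in> KK" shows "R (rep_l2 x) (V x)"
proof -
  have "rep_l2 x \<in> KF" using assms by (simp add: model_iff)
  then obtain g where "R (rep_l2 x) g" using R_ex by blast
  then show ?thesis unfolding V_def by (rule someI[of "\<lambda>g. R (rep_l2 x) g"])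
qed

lemma V_sqi: "x \<in> KK \<Longrightarrow> sqi \<mu> (V x)"
  using V_R by (simp add: R_def)

lemma V_ip: "x \<in> KK \<Longrightarrow> y \<in> KK \<Longrightarrow> ip \<mu> (V x) (V y) = l2_inner x y"
  unfolding l2_inner_rep by (rule R_ip[OF V_R V_R, symmetric])

lemma V_abs: "R f g \<Longrightarrow> AE x in \<mu>. V (abs_l2 f) x = g x"
proof -
  assume r: "R f g"
  then have s: "sqi circ f" "f \<in> KF" by (auto simp: R_def KF_sqi)
  have "R (rep_l2 (abs_l2 f)) g"
    by (rule R_cong_left[OF r rep_l2_sqi]) (use rep_abs_l2[OF s(1)] in eventually_elim, simp)
  moreover have "abs_l2 f \<in> KK" using abs_model_iff[OF s(1)] s(2) by simp
  ultimately show ?thesis using V_R R_unique by blast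
qed

lemma W_R:
  assumes g: "sqi \<mu> g" obtains f where "R f g" "W g = abs_l2 f"
proof -
  obtain f where "R f g" using R_ex_inv[OF g] by blast
  then have "R (SOME f. R f g) g" by (rule someI[of "\<lambda>f. R f g"])
  then show ?thesis using that by (simp add: W_def)
qed

lemma W_KK: "sqi \<mu> g \<Longrightarrow> W g \<in> KK"
proof -
  assume "sqi \<mu> g"
  then obtain f where "R f g" "W g = abs_l2 f" by (rule W_R)
  then show ?thesis using abs_model_iff[OF KF_sqi] by (auto simp: R_def)
qed

lemma V_W: "sqi \<mu> g \<Longrightarrow> AE x in \<mu>. V (W g) x = g x"
proof -
  assume "sqi \<mu> g"
  then obtain f where "R f g" "W g = abs_l2 f" by (rule W_R)
  then show ?thesis using V_abs by simp
qed

lemma W_inner: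
  assumes g: "sqi \<mu> g" and x: "x \<in> KK" shows "l2_inner (W g) x = ip \<mu> g (V x)"
proof -
  have "l2_inner (W g) x = ip \<mu> (V (W g)) (V x)" by (rule V_ip[OF W_KK[OF g] x, symmetric])
  also have "\<dots> = ip \<mu> g (V x)"
    using V_W[OF g] by (intro ip_cong_AE V_sqi W_KK g x) auto
  finally show ?thesis .
qed

lemma W_V: "x \<in> KK \<Longrightarrow> W (V x) = x"
  by (rule KK_eqI) (simp_all add: W_KK V_sqi W_inner V_ip)

lemma W_cong: "sqi \<mu> g \<Longrightarrow> sqi \<mu> h \<Longrightarrow> AE x in \<mu>. g x = h x \<Longrightarrow> W g = W h"
  by (rule KK_eqI) (auto simp: W_KK W_inner intro!: ip_cong_AE V_sqi)

lemma W_lin: "sqi \<mu> g \<Longrightarrow> sqi \<mu> h \<Longrightarrow> W (\<lambda>x. g x + h x) = W g + W h"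
  by (rule KK_eqI) (auto simp: W_KK W_inner sqi_add KK_lin l2_inner_add ip_add_left V_sqi)

lemma W_scale: "sqi \<mu> g \<Longrightarrow> W (\<lambda>x. c * g x) = c *\<^sub>C W g"
  by (rule KK_eqI) (auto simp: W_KK W_inner sqi_scale KK_lin l2_inner_scale ip_scale_left V_sqi)

lemma W_eq_iff: "sqi \<mu> g \<Longrightarrow> sqi \<mu> h \<Longrightarrow> W g = W h \<longleftrightarrow> (AE x in \<mu>. g x = h x)"
proof
  assume gh: "sqi \<mu> g" "sqi \<mu> h" "W g = W h"
  have "AE x in \<mu>. V (W g) x = g x" "AE x in \<mu>. V (W g) x = h x"
    using V_W[OF gh(1)] V_W[OF gh(2)] gh(3) by auto
  then show "AE x in \<mu>. g x = h x" by eventually_elim simp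
qed (rule W_cong)

lemma W_ip: "sqi \<mu> g \<Longrightarrow> sqi \<mu> h \<Longrightarrow> l2_inner (W g) (W h) = ip \<mu> g h"
  unfolding W_inner[OF _ W_KK] by (intro ip_cong_AE V_sqi W_KK V_W) auto

lemma V_kl: "cmod w < 1 \<Longrightarrow> AE x in \<mu>. V (kl w) x = vk w x"
  unfolding kl_def by (rule V_abs[OF R_k])

end

section \<open>Sedlock algebras as multiplication algebras\<close>

lemma l2_id_mult: "l2_id \<odot> y = abs_l2 (\<lambda>x. x * rep_l2 y x)"
  and l2_id_sqi: "sqi circ (\<lambda>x. x * rep_l2 y x)"
proof -
  have i: "(\<lambda>x. x) \<in> borel_measurable circ" by (rule circle_measurable_borel[OF sets_circ]) simp
  show s: "sqi circ (\<lambda>x. x * rep_l2 y x)"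
    by (rule sqi_mult_bounded[OF rep_l2_sqi i, of 1]) (simp add: space_circ)
  have "sqi circ (\<lambda>x. x)" by (intro sqi_circ_cont continuous_intros)
  from l2_mult_abs[OF this rep_l2_sqi s] show "l2_id \<odot> y = abs_l2 (\<lambda>x. x * rep_l2 y x)"
    by (simp add: l2_id_def abs_rep_l2)
qed

lemma l2_inner_le: "Re (l2_inner x y) \<le> norm x * norm y"
  using Cauchy_Schwarz_ineq2[of x y] by (simp add: inner_l2_def)

context inner_fn
begin

lemma orth_proj_norm: "norm (orth_proj KK x) \<le> norm x"
proof -
  let ?p = "orth_proj KK x"
  have "(norm ?p)\<^sup>2 = Re (l2_inner ?p ?p)" by (simp add: power2_norm_eq_inner inner_l2_def)
  also have "\<dots> = Re (l2_inner x ?p)" by (simp add: orth_proj_inner orth_proj_KK)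
  also have "\<dots> \<le> norm x * norm ?p" by (rule l2_inner_le)
  finally have "norm ?p * norm ?p \<le> norm x * norm ?p" by (simp add: power2_eq_square)
  then show ?thesis by (cases "norm ?p = 0") (auto simp: mult_le_cancel_right)
qed

text \<open>The compressed shift; it is a contraction because multiplication by \<open>x\<close> is
  isometric. It exhibits the operator that \<open>tto \<Theta> l2_id\<close> describes.\<close>

lemma shift_operator: "restrict (\<lambda>y. orth_proj KK (l2_id \<odot> y)) KK \<in> bounded_operators KK"
proof -
  have lin: "orth_proj KK (l2_id \<odot> (x + y)) = orth_proj KK (l2_id \<odot> x) + orth_proj KK (l2_id \<odot> y)" for x y
  proof -
    have "l2_id \<odot> (x + y) = l2_id \<odot> x + l2_id \<odot> y"
      unfolding l2_id_mult l2_add_abs[OF l2_id_sqi l2_id_sqi]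
      using rep_l2_add[of x y]
      by (subst abs_l2_eq_iff[OF l2_id_sqi sqi_add[OF l2_id_sqi l2_id_sqi]]) (auto elim!: eventually_mono simp: distrib_left)
    then show ?thesis
      by (intro orth_proj_eqI KK_lin orth_proj_KK) (simp add: l2_inner_add orth_proj_inner)
  qed
  have scale: "orth_proj KK (l2_id \<odot> (c *\<^sub>C x)) = c *\<^sub>C orth_proj KK (l2_id \<odot> x)" for c x
  proof -
    have "l2_id \<odot> (c *\<^sub>C x) = c *\<^sub>C (l2_id \<odot> x)"
      unfolding l2_id_mult l2_scale_abs[OF l2_id_sqi]
      using rep_l2_scale[of c x]
      by (subst abs_l2_eq_iff[OF l2_id_sqi sqi_scale[OF l2_id_sqi]]) (auto elim!: eventually_mono)
    then show ?thesis
      by (intro orth_proj_eqI KK_lin orth_proj_KK) (simp add: l2_inner_scale orth_proj_inner)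
  qed
  have "norm (orth_proj KK (l2_id \<odot> x)) \<le> 1 * norm x" for x
  proof -
    have "(norm (l2_id \<odot> x))\<^sup>2 = nsq circ (\<lambda>t. t * rep_l2 x t)"
      unfolding l2_id_mult by (rule l2_norm_abs[OF l2_id_sqi])
    also have "\<dots> = nsq circ (rep_l2 x)"
      unfolding nsq_def by (intro Bochner_Integration.integral_cong refl) (simp add: space_circ norm_mult)
    also have "\<dots> = (norm x)\<^sup>2" by (simp add: l2_norm_rep)
    finally have "norm (l2_id \<odot> x) = norm x" by (simp add: power2_eq_iff_nonneg)
    then show ?thesis using orth_proj_norm[of "l2_id \<odot> x"] by simp
  qed
  then have "\<exists>M. \<forall>f\<in>KK. norm (restrict (\<lambda>y. orth_proj KK (l2_id \<odot> y)) KK f) \<le> M * norm f" by (intro exI[of _ 1]) simp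
  then show ?thesis
    using KK_lin orth_proj_KK by (auto simp: bounded_operators_def complex_linear_on_def lin scale)
qed

lemma tto_shift: assumes y: "y \<in> KK" shows "tto \<Theta> l2_id y = orth_proj KK (l2_id \<odot> y)"
proof -
  let ?T = "restrict (\<lambda>y. orth_proj KK (l2_id \<odot> y)) KK"
  have T0: "is_tto \<Theta> l2_id ?T" using shift_operator by (simp add: is_tto_def)
  have "T = ?T" if "is_tto \<Theta> l2_id T" for T
  proof (rule bounded_operator_eqI)
    show "T \<in> bounded_operators KK" using that by (simp add: is_tto_def)
    show "?T \<in> bounded_operators KK" by (rule shift_operator)
    show "T (kl w) = ?T (kl w)" if "cmod w < 1" for w
      using \<open>is_tto \<Theta> l2_id T\<close> kl_KK[OF that] kl_Hinf[OF that] by (simp add: is_tto_def)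
  qed
  then have "tto \<Theta> l2_id = ?T" unfolding tto_def using T0 by (intro the_equality)
  then show ?thesis using y by simp
qed

lemma model_conj_abs: "model_conj \<Theta> x = abs_l2 (cj (rep_l2 x))"
proof -
  have s: "sqi circ (\<lambda>t. cnj (t * rep_l2 x t))" by (intro sqi_cnj l2_id_sqi)
  have c: "sqi circ (\<lambda>t. cnj (t * rep_l2 x t) * th t)"
    using cj_sqi[OF rep_l2_sqi, of x] by (simp add: cj_def[abs_def])
  show ?thesis
    unfolding model_conj_def l2_id_mult l2_cnj_abs[OF l2_id_sqi] boundary_Theta l2_mult_abs[OF s th_sqi c]
    by (simp add: cj_def[abs_def])
qed

text \<open>A closed form of \<open>A_z C f\<close>: multiplication by \<open>x\<close> takes
  \<open>cj f\<close> out of the model space by a multiple of \<open>th\<close> only, with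
  coefficient \<open>cnj (ev f 0)\<close>.\<close>

definition sh :: "(complex \<Rightarrow> complex) \<Rightarrow> complex \<Rightarrow> complex" where
  "sh f x = x * cj f x - cnj (ev f 0) * th x"

lemma mult_id_H2f:
  assumes "g \<in> H2f" shows "(\<lambda>x. x * g x) \<in> H2f" and "cmod z < 1 \<Longrightarrow> ev (\<lambda>x. x * g x) z = z * ev g z"
  using H2f_mult_cont[of "\<lambda>x. x", OF _ _ assms] by (auto intro: holomorphic_intros)

text \<open>On the circle \<open>cnj (sh f) * th = f - ev f 0\<close>. Hence
  \<open>cj (sh f)\<close> is the backward shift of \<open>f\<close>, which is analytic.\<close>

lemma sh_KF:
  assumes f: "f \<in> KF"
  shows "sh f \<in> KF" and "cmod z < 1 \<Longrightarrow> ev (sh f) z = z * ev (cj f) z - cnj (ev f 0) * \<Theta> z"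
    and "cmod z < 1 \<Longrightarrow> z * ev (cj (sh f)) z = ev f z - ev f 0"
    and "AE x in circ. cnj (sh f x) = (f x - ev f 0) * cnj (th x)"
proof -
  have c: "cj f \<in> H2f" using KF_cj[OF f] by (rule KF_H2f)
  have xc: "(\<lambda>x. x * cj f x) \<in> H2f" by (rule mult_id_H2f(1)[OF c])
  have eq: "sh f = (\<lambda>x. x * cj f x + (- cnj (ev f 0)) * th x)" by (simp add: sh_def[abs_def])
  have H: "sh f \<in> H2f" unfolding eq by (rule H2f_lin[OF xc th_H2f])
  show "cmod z < 1 \<Longrightarrow> ev (sh f) z = z * ev (cj f) z - cnj (ev f 0) * \<Theta> z"
    using ev_lin[OF H2f_sqi[OF xc] th_sqi, of z "- cnj (ev f 0)"] mult_id_H2f(2)[OF c, of z] ev_th[of z]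
    unfolding eq by simp
  have cn: "cnj (sh f x) = (f x - ev f 0) * cnj (th x)" if "cmod x = 1" for x
  proof -
    have "cnj (sh f x) = (cnj x * x) * f x * cnj (th x) - ev f 0 * cnj (th x)"
      by (simp add: sh_def cj_def mult_ac)
    then show ?thesis using circle_inv[OF that] by (simp add: left_diff_distrib)
  qed
  then show "AE x in circ. cnj (sh f x) = (f x - ev f 0) * cnj (th x)"
    by (intro AE_I2) (simp add: space_circ)
  have fl: "(\<lambda>x. f x + (-1) * ev f 0) \<in> H2f" by (rule H2f_lin[OF KF_H2f[OF f] H2f_const])
  have xcj: "x * cj (sh f) x = f x + (-1) * ev f 0" if "cmod x = 1" for x
  proof -
    have "x * cj (sh f) x = (x * cnj x) * (f x - ev f 0) * (cnj (th x) * th x)"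
      using cn[OF that] by (simp add: cj_def mult_ac del: th_cnj th_cnj_mult)
    then show ?thesis using circle_inv[OF that] by simp
  qed
  have cs: "sqi circ (cj (sh f))" by (rule cj_sqi[OF H2f_sqi[OF H]])
  have "(\<integral>x. cj (sh f) x * x ^ Suc n \<partial>circ) = 0" for n
  proof -
    have "(\<integral>x. cj (sh f) x * x ^ Suc n \<partial>circ) = (\<integral>x. (f x + (-1) * ev f 0) * x ^ n \<partial>circ)"
    proof (intro Bochner_Integration.integral_cong refl)
      fix x assume "x \<in> space circ"
      then have x: "cmod x = 1" by (simp add: space_circ)
      have "cj (sh f) x * x ^ Suc n = (x * cj (sh f) x) * x ^ n" by (simp add: mult_ac)
      then show "cj (sh f) x * x ^ Suc n = (f x + (-1) * ev f 0) * x ^ n" unfolding xcj[OF x] .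
    qed
    also have "\<dots> = 0"
    proof (cases n)
      case 0
      have "(\<integral>x. f x + (-1) * ev f 0 \<partial>circ) = ev (\<lambda>x. f x + (-1) * ev f 0) 0" by (simp add: ev_0)
      also have "\<dots> = 0" using ev_lin[OF KF_sqi[OF f] H2f_sqi[OF H2f_const], of 0 "-1" "ev f 0"] ev_const[of 0] by simp
      finally show ?thesis by (simp add: 0)
    next
      case (Suc m)
      then show ?thesis using fl by (simp add: H2f_def del: power_Suc)
    qed
    finally show ?thesis .
  qed
  then have cH: "cj (sh f) \<in> H2f" using cs by (simp add: H2f_def del: power_Suc)
  then show "sh f \<in> KF" using H by (simp add: KF_cj_iff)
  assume z: "cmod z < 1"
  have "z * ev (cj (sh f)) z = ev (\<lambda>x. x * cj (sh f) x) z" by (rule mult_id_H2f(2)[OF cH z, symmetric])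
  also have "\<dots> = ev (\<lambda>x. f x + (-1) * ev f 0) z"
    unfolding ev_def[of "\<lambda>x. x * cj (sh f) x"] ev_def[of "\<lambda>x. f x + (-1) * ev f 0"]
    by (intro Bochner_Integration.integral_cong refl) (simp only: xcj space_circ mem_sphere_0)
  also have "\<dots> = ev f z - ev f 0"
    using ev_lin[OF KF_sqi[OF f] H2f_sqi[OF H2f_const] z, of "-1" "ev f 0"] ev_const[OF z] by simp
  finally show "z * ev (cj (sh f)) z = ev f z - ev f 0" .
qed

text \<open>Each kernel has two terms. Of the four resulting products the two containing
  \<open>cnj (\<Theta> l)\<close> cancel, because multiplication by \<open>th\<close> in both
  arguments is isometric, while in the first alone it produces the factor
  \<open>\<Theta> w\<close>.\<close>

lemma KF_kernel_product:
  assumes f: "f \<in> KF" and l: "cmod l < 1" and w: "cmod w < 1"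
  shows "ip circ (\<lambda>x. f x * kw l x) (kw w) = (ev f w - \<Theta> w * (cnj l * cnj (ev (cj f) l))) / (1 - cnj l * w)"
proof -
  define p where "p x = szego l x * f x" for x
  have p: "p \<in> H2f" "ev p w = ev f w / (1 - cnj l * w)"
    using H2f_mult_cont[OF szego_H2f(1,2)[OF l] KF_H2f[OF f]] w unfolding p_def by (auto simp: szego_def)
  note tp = H2f_th[OF p(1)]
  have ps: "sqi circ p" "sqi circ (\<lambda>x. th x * p x)" by (intro H2f_sqi p tp(1))+
  have sw: "sqi circ (szego w)" "sqi circ (\<lambda>x. th x * szego w x)"
    using szego_H2f(3)[OF w] by (auto intro: H2f_sqi H2f_th)
  have eq: "(\<lambda>x. f x * kw l x) = (\<lambda>x. p x + (- cnj (\<Theta> l)) * (th x * p x))"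
    by (simp add: fun_eq_iff p_def kw_eq algebra_simps)
  have s: "sqi circ (\<lambda>x. p x + (- cnj (\<Theta> l)) * (th x * p x))" by (intro sqi_add sqi_scale ps)
  \<comment> \<open>The remaining cross term. Conjugated, it is the value at \<open>l\<close> of the
    analytic function with boundary values \<open>szego w x * (x * cj f x)\<close>, which is how
    \<open>cj f\<close> enters the result.\<close>
  define J where "J = ip circ p (\<lambda>x. th x * szego w x)"
  have cf: "cj f \<in> H2f" using KF_cj[OF f] by (rule KF_H2f)
  have xs: "(\<lambda>x. x * szego w x) \<in> H2f" by (rule mult_id_H2f(1)[OF szego_H2f(3)[OF w]])
  have "cnj J = ev (\<lambda>x. szego w x * (x * cj f x)) l"
    unfolding J_def ip_def ev_def Bochner_Integration.integral_cnj[symmetric]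
  proof (intro Bochner_Integration.integral_cong refl)
    fix x assume "x \<in> space circ"
    then have x: "cmod x = 1" by (simp add: space_circ)
    have "szego w x * (x * cj f x) / (1 - l * cnj x) = (x * cnj x) * (szego w x * cnj (f x) * th x * cnj (szego l x))"
      by (simp add: cj_def szego_cnj mult_ac)
    also have "\<dots> = cnj (p x * cnj (th x * szego w x))"
      unfolding circle_inv[OF x] by (simp add: p_def mult_ac)
    finally show "cnj (p x * cnj (th x * szego w x)) = szego w x * (x * cj f x) / (1 - l * cnj x)" by simp
  qed
  also have "\<dots> = szego w l * (l * ev (cj f) l)"
    using H2f_mult_cont(2)[OF szego_H2f(1,2)[OF w] mult_id_H2f(1)[OF cf] l] mult_id_H2f(2)[OF cf l] by simp
  finally have "J = cnj (szego w l * (l * ev (cj f) l))" by (metis complex_cnj_cnj)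
  then have J: "J = cnj l * cnj (ev (cj f) l) / (1 - cnj l * w)"
    by (simp add: szego_def mult.commute)
  have "ip circ (\<lambda>x. f x * kw l x) (kw w) = ip circ (\<lambda>x. p x + (- cnj (\<Theta> l)) * (th x * p x)) (szego w)
     + ip circ (\<lambda>x. p x + (- cnj (\<Theta> l)) * (th x * p x)) (\<lambda>x. (- cnj (\<Theta> w)) * (th x * szego w x))"
  proof -
    have "kw w = (\<lambda>x. szego w x + (- cnj (\<Theta> w)) * (th x * szego w x))" by (rule ext, rule kw_eq)
    then show ?thesis unfolding eq by (simp only:) (intro ip_add_right s sw sqi_scale)
  qed
  also have "\<dots> = (ip circ p (szego w) - cnj (\<Theta> l) * ip circ (\<lambda>x. th x * p x) (szego w))
     - \<Theta> w * (J - cnj (\<Theta> l) * ip circ (\<lambda>x. th x * p x) (\<lambda>x. th x * szego w x))"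
    unfolding ip_scale_right J_def
    by (simp only: ip_add_left[OF ps(1) sqi_scale[OF ps(2)] sw(1)] ip_add_left[OF ps(1) sqi_scale[OF ps(2)] sw(2)] ip_scale_left)
      (simp add: algebra_simps)
  also have "\<dots> = ev p w - \<Theta> w * J"
    unfolding ip_th_th H2f_szego_ip tp(2)[OF w] by (simp add: algebra_simps)
  finally show ?thesis unfolding J p(2) by (simp add: diff_divide_distrib)
qed

lemma kw_bound:
  assumes "cmod w < 1" "cmod x = 1" shows "cmod (kw w x) \<le> 2 / (1 - cmod w)"
proof -
  have "cmod (1 - cnj (\<Theta> w) * th x) \<le> 1 + cmod (\<Theta> w)"
    using norm_triangle_ineq4[of 1 "cnj (\<Theta> w) * th x"] by (simp add: norm_mult)
  then have "cmod (1 - cnj (\<Theta> w) * th x) \<le> 2" using Theta_lt_1[OF assms(1)] by simp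
  moreover have "1 - cmod w \<le> cmod (1 - cnj w * x)"
    using norm_triangle_ineq2[of 1 "cnj w * x"] assms by (simp add: norm_mult)
  ultimately show ?thesis unfolding kw_def norm_divide using assms by (intro frac_le) auto
qed

lemma sqi_kw:
  assumes f: "sqi circ f" and w: "cmod w < 1" shows "sqi circ (\<lambda>x. f x * kw w x)"
proof -
  have "sqi circ (\<lambda>x. kw w x * f x)"
    by (rule sqi_mult_bounded[OF f sqi_measurable[OF KF_sqi[OF kw_KF[OF w]]], of "2 / (1 - cmod w)"])
      (simp add: space_circ kw_bound w)
  then show ?thesis by (simp add: mult.commute)
qed

end

context clark
begin

section \<open>Symbols, multipliers and the Sedlock algebra\<close>

definition sym :: "(complex \<Rightarrow> complex) \<Rightarrow> complex \<Rightarrow> complex \<Rightarrow> complex" where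
  "sym f c x = f x + a * cnj (sh f x) + c"

lemma sym_sqi: "f \<in> KF \<Longrightarrow> sqi circ (sym f c)"
proof -
  assume f: "f \<in> KF"
  have "sqi circ (\<lambda>_. c)" by (rule H2f_sqi[OF H2f_const])
  then show ?thesis unfolding sym_def[abs_def]
    using KF_sqi[OF f] KF_sqi[OF sh_KF(1)[OF f]] by (intro sqi_add sqi_scale sqi_cnj)
qed

lemma sedlock_symbol_abs:
  assumes x: "x \<in> KK" shows "sedlock_symbol \<Theta> a x c = abs_l2 (sym (rep_l2 x) c)"
proof -
  define f where "f = rep_l2 x"
  have f: "f \<in> KF" using x by (simp add: f_def model_iff)
  note fs = KF_sqi[OF f]
  have cK: "abs_l2 (cj f) \<in> KK" using abs_model_iff[OF cj_sqi[OF fs]] KF_cj[OF f] by simp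
  have shs: "sqi circ (sh f)" by (rule KF_sqi[OF sh_KF(1)[OF f]])
  have cs: "sqi circ (cj f)" by (rule cj_sqi[OF fs])
  have xcs: "sqi circ (\<lambda>t. t * cj f t)" by (rule H2f_sqi[OF mult_id_H2f(1)[OF KF_H2f[OF KF_cj[OF f]]]])
  have "l2_id \<odot> abs_l2 (cj f) = abs_l2 (\<lambda>t. t * cj f t)"
    unfolding l2_id_mult using rep_abs_l2[OF cs]
    by (subst abs_l2_eq_iff[OF l2_id_sqi xcs]) (auto elim!: eventually_mono)
  then have "tto \<Theta> l2_id (abs_l2 (cj f)) = orth_proj KK (abs_l2 (\<lambda>t. t * cj f t))"
    by (simp add: tto_shift[OF cK])
  also have "\<dots> = abs_l2 (sh f)"
  proof (rule orth_proj_eqI)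
    show "abs_l2 (sh f) \<in> KK" using abs_model_iff[OF shs] sh_KF(1)[OF f] by simp
    fix k assume k: "k \<in> KK"
    have kf: "rep_l2 k \<in> KF" using k by (simp add: model_iff)
    have "\<forall>g\<in>H2f. ip circ (rep_l2 k) (\<lambda>x. th x * g x) = 0" using kf by (simp add: KF_def)
    from bspec[OF this H2f_const[of 1]] have "ip circ (rep_l2 k) th = 0" by simp
    then have "ip circ th (rep_l2 k) = 0" by (simp add: ip_cnj[of circ "rep_l2 k" th, symmetric])
    then have "ip circ (sh f) (rep_l2 k) = ip circ (\<lambda>t. t * cj f t) (rep_l2 k)"
      unfolding sh_def[abs_def]
      by (subst ip_diff_left[OF xcs sqi_scale[OF th_sqi] rep_l2_sqi]) (simp add: ip_scale_left)
    then have "l2_inner (abs_l2 (sh f)) (abs_l2 (rep_l2 k)) = l2_inner (abs_l2 (\<lambda>t. t * cj f t)) (abs_l2 (rep_l2 k))"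
      by (simp only: l2_inner_abs[OF shs rep_l2_sqi] l2_inner_abs[OF xcs rep_l2_sqi])
    then show "l2_inner (abs_l2 (sh f)) k = l2_inner (abs_l2 (\<lambda>t. t * cj f t)) k" by (simp only: abs_rep_l2)
  qed
  finally have t: "tto \<Theta> l2_id (model_conj \<Theta> x) = abs_l2 (sh f)" by (simp add: model_conj_abs f_def)
  have c: "sqi circ (\<lambda>_. c)" by (rule H2f_sqi[OF H2f_const])
  have "sedlock_symbol \<Theta> a x c = abs_l2 f + a *\<^sub>C abs_l2 (\<lambda>t. cnj (sh f t)) + abs_l2 (\<lambda>_. c)"
    unfolding sedlock_symbol_def t l2_const_def l2_cnj_abs[OF shs] by (simp add: f_def abs_rep_l2)
  also have "\<dots> = abs_l2 (sym f c)"
    by (simp add: l2_scale_abs l2_add_abs fs shs c sqi_cnj sqi_scale sqi_add sym_def[abs_def])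
  finally show ?thesis by (simp add: f_def)
qed

text \<open>On the circle \<open>1 - cnj l * w = p + cnj l * x * q\<close> for the two kernel
  denominators \<open>p\<close> and \<open>q\<close>. This splits the product of kernels into one
  term from each family, so that pairing a transform \<open>v\<close> of \<open>f\<close> with it
  only involves values of \<open>f\<close> and \<open>cj f\<close>.\<close>

lemma szego_pair:
  assumes l: "cmod l < 1" and w: "cmod w < 1" and x: "cmod x = 1"
  shows "vk l x * cnj (vk w x) * (1 - cnj l * w) =
    (1 - a * cnj (\<Theta> l)) * cnj (vk w x) + (1 - cnj a * \<Theta> w) * cnj l * a * cnj (vc l x)"
proof -
  have ne: "1 - cnj l * x \<noteq> 0" "1 - w * cnj x \<noteq> 0" using circle_ne[OF l x] circle_ne[OF w x] by auto
  define p where "p = 1 - cnj l * x"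
  define q where "q = 1 - w * cnj x"
  have "1 - cnj l * w = p + cnj l * x * q"
  proof -
    have "p + cnj l * x * q = 1 - cnj l * w * (x * cnj x)" by (simp add: p_def q_def algebra_simps)
    then show ?thesis unfolding circle_inv[OF x] by simp
  qed
  then have "1 / (p * q) * (1 - cnj l * w) = 1 / q + cnj l * x / p"
    using ne unfolding p_def[symmetric] q_def[symmetric] by (simp add: field_simps)
  then have "((1 - a * cnj (\<Theta> l)) * (1 - cnj a * \<Theta> w)) * (1 / (p * q) * (1 - cnj l * w)) =
      ((1 - a * cnj (\<Theta> l)) * (1 - cnj a * \<Theta> w)) * (1 / q + cnj l * x / p)" by simp
  moreover have "vk l x * cnj (vk w x) = ((1 - a * cnj (\<Theta> l)) * (1 - cnj a * \<Theta> w)) * (1 / (p * q))"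
    by (simp add: vk_def p_def q_def)
  ultimately have "vk l x * cnj (vk w x) * (1 - cnj l * w) =
      ((1 - a * cnj (\<Theta> l)) * (1 - cnj a * \<Theta> w)) * (1 / q + cnj l * x / p)" by (simp add: mult.assoc)
  also have "\<dots> = (1 - a * cnj (\<Theta> l)) * ((1 - cnj a * \<Theta> w) / q) + (1 - cnj a * \<Theta> w) * cnj l * (x * ((1 - a * cnj (\<Theta> l)) / p))"
    by (simp add: distrib_left mult_ac)
  also have "(1 - cnj a * \<Theta> w) / q = cnj (vk w x)" by (simp add: vk_def q_def)
  also have "x * ((1 - a * cnj (\<Theta> l)) / p) = x * vk l x" by (simp add: vk_def p_def)
  also have "\<dots> = a * cnj (vc l x)" by (rule vk_eq[OF l x])
  finally show ?thesis by (simp add: mult_ac)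
qed

lemma mu_sqi_mult_vk:
  assumes "sqi \<mu> g" "cmod w < 1" shows "sqi \<mu> (\<lambda>x. g x * vk w x)"
proof -
  have "sqi \<mu> (\<lambda>x. vk w x * g x)"
    by (rule sqi_mult_bounded[OF assms(1) vk_meas]) (use vk_bound[OF assms(2)] in \<open>auto simp: space_mu\<close>)
  then show ?thesis by (simp add: mult.commute)
qed

text \<open>The symbol \<open>sym f c\<close> and the multiplier \<open>v + c\<close>, where \<open>v\<close> is the Clark transform of \<open>f\<close>,
  define the same sesquilinear form on kernels.\<close>

lemma symbol_form:
  assumes r: "R f v" and l: "cmod l < 1" and w: "cmod w < 1"
  shows "ip circ (\<lambda>x. sym f c x * kw l x) (kw w) = ip \<mu> (\<lambda>x. (v x + c) * vk l x) (vk w)"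
proof -
  have f: "f \<in> KF" and v: "sqi \<mu> v" using r by (auto simp: R_def)
  note fs = KF_sqi[OF f]
  have k: "sqi circ (kw l)" "sqi circ (kw w)" using l w by (auto intro: KF_sqi kw_KF)
  have shs: "sqi circ (\<lambda>x. cnj (sh f x))" by (intro sqi_cnj KF_sqi sh_KF f)
  have lw: "1 - cnj l * w \<noteq> 0"
  proof
    assume "1 - cnj l * w = 0"
    then have "cmod (cnj l * w) = 1" by (metis eq_iff_diff_eq_0 norm_one)
    moreover have "cmod l * cmod w < 1 * 1" using l w by (intro mult_strict_mono') auto
    ultimately show False by (simp add: norm_mult)
  qed
  have eq: "(\<lambda>x. sym f c x * kw l x) = (\<lambda>x. (f x * kw l x + a * (cnj (sh f x) * kw l x)) + c * kw l x)"
    by (simp add: fun_eq_iff sym_def algebra_simps)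
  have "ip circ (\<lambda>x. sym f c x * kw l x) (kw w) = ip circ (\<lambda>x. f x * kw l x) (kw w)
      + a * ip circ (\<lambda>x. cnj (sh f x) * kw l x) (kw w) + c * ip circ (kw l) (kw w)"
    unfolding eq
    by (simp add: ip_add_left ip_scale_left sqi_add sqi_scale sqi_kw[OF fs l] sqi_kw[OF shs l] k)
  also have "ip circ (\<lambda>x. cnj (sh f x) * kw l x) (kw w) = cnj (ip circ (\<lambda>x. sh f x * kw w x) (kw l))"
    unfolding ip_def Bochner_Integration.integral_cnj[symmetric] by (simp add: mult_ac)
  also have "ip circ (\<lambda>x. sh f x * kw w x) (kw l) =
      (l * ev (cj f) l - cnj (ev f 0) * \<Theta> l - \<Theta> l * cnj (ev f w - ev f 0)) / (1 - cnj w * l)"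
    unfolding KF_kernel_product[OF sh_KF(1)[OF f] w l] sh_KF(2)[OF f l] sh_KF(3)[OF f w, symmetric] by simp
  also have "cnj \<dots> = (cnj l * cnj (ev (cj f) l) - cnj (\<Theta> l) * ev f w) / (1 - cnj l * w)"
    by (simp add: algebra_simps)
  also have "ip circ (\<lambda>x. f x * kw l x) (kw w) = (ev f w - \<Theta> w * (cnj l * cnj (ev (cj f) l))) / (1 - cnj l * w)"
    by (rule KF_kernel_product[OF f l w])
  \<comment> \<open>Both sides of the claim are brought, after multiplication by
    \<open>1 - cnj l * w\<close>, to the same expression in \<open>ev f w\<close> and
    \<open>ev (cj f) l\<close>. The coefficient \<open>ev f 0\<close> introduced by
    \<open>sh\<close> has cancelled.\<close>
  finally have "ip circ (\<lambda>x. sym f c x * kw l x) (kw w) * (1 - cnj l * w) =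
      (ev f w - \<Theta> w * (cnj l * cnj (ev (cj f) l))) + a * (cnj l * cnj (ev (cj f) l) - cnj (\<Theta> l) * ev f w)
      + c * ip circ (kw l) (kw w) * (1 - cnj l * w)"
    using lw by (simp add: distrib_right)
  also have "\<dots> = (1 - a * cnj (\<Theta> l)) * ev f w + (a - \<Theta> w) * cnj l * cnj (ev (cj f) l)
      + c * ip circ (kw l) (kw w) * (1 - cnj l * w)"
    by (simp add: algebra_simps)
  finally have L: "ip circ (\<lambda>x. sym f c x * kw l x) (kw w) * (1 - cnj l * w) =
      (1 - a * cnj (\<Theta> l)) * ev f w + (a - \<Theta> w) * cnj l * cnj (ev (cj f) l)
      + c * ip circ (kw l) (kw w) * (1 - cnj l * w)" .
  have vs: "sqi \<mu> (vk l)" "sqi \<mu> (vk w)" "sqi \<mu> (vc l)" using l w by (auto intro: vk_sqi vc_sqi)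
  have i: "integrable \<mu> (\<lambda>x. v x * cnj (vk w x))" "integrable \<mu> (\<lambda>x. v x * cnj (vc l x))"
    by (intro sqi_integrable_ip v vs)+
  have "ip \<mu> (\<lambda>x. v x * vk l x) (vk w) * (1 - cnj l * w)
     = (\<integral>x. (1 - a * cnj (\<Theta> l)) * (v x * cnj (vk w x)) + ((1 - cnj a * \<Theta> w) * cnj l * a) * (v x * cnj (vc l x)) \<partial>\<mu>)"
    unfolding ip_def Bochner_Integration.integral_mult_left_zero[symmetric]
  proof (intro Bochner_Integration.integral_cong refl)
    fix x assume "x \<in> space \<mu>"
    then have x: "cmod x = 1" by (simp add: space_mu)
    have "v x * vk l x * cnj (vk w x) * (1 - cnj l * w) = v x * (vk l x * cnj (vk w x) * (1 - cnj l * w))"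
      by (simp add: mult_ac)
    also have "\<dots> = (1 - a * cnj (\<Theta> l)) * (v x * cnj (vk w x)) + ((1 - cnj a * \<Theta> w) * cnj l * a) * (v x * cnj (vc l x))"
      unfolding szego_pair[OF l w x] by (simp add: algebra_simps)
    finally show "v x * vk l x * cnj (vk w x) * (1 - cnj l * w) = (1 - a * cnj (\<Theta> l)) * (v x * cnj (vk w x)) + ((1 - cnj a * \<Theta> w) * cnj l * a) * (v x * cnj (vc l x))" .
  qed
  also have "\<dots> = (1 - a * cnj (\<Theta> l)) * ip \<mu> v (vk w) + ((1 - cnj a * \<Theta> w) * cnj l * a) * ip \<mu> v (vc l)"
    unfolding ip_def
    by (simp only: Bochner_Integration.integral_mult_right_zero
        Bochner_Integration.integral_add[OF Bochner_Integration.integrable_mult_right[OF i(1)] Bochner_Integration.integrable_mult_right[OF i(2)]])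
  also have "ip \<mu> v (vk w) = ev f w" using r w KF_repro[OF f w] by (simp add: R_def)
  also have "ip \<mu> v (vc l) = cnj (ev (cj f) l)" using r l KF_ev_cj[OF f l] by (simp add: R_def)
  also have "((1 - cnj a * \<Theta> w) * cnj l * a) = (a - \<Theta> w) * cnj l"
  proof -
    have "((1 - cnj a * \<Theta> w) * cnj l * a) = (a - (a * cnj a) * \<Theta> w) * cnj l" by (simp add: algebra_simps)
    then show ?thesis unfolding aa by simp
  qed
  finally have Mv: "ip \<mu> (\<lambda>x. v x * vk l x) (vk w) * (1 - cnj l * w) =
      (1 - a * cnj (\<Theta> l)) * ev f w + (a - \<Theta> w) * cnj l * cnj (ev (cj f) l)" .
  have "ip \<mu> (\<lambda>x. (v x + c) * vk l x) (vk w) = ip \<mu> (\<lambda>x. v x * vk l x) (vk w) + c * ip \<mu> (vk l) (vk w)"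
    by (simp add: distrib_right ip_add_left ip_scale_left mu_sqi_mult_vk[OF v l] vs sqi_scale)
  moreover have "ip \<mu> (vk l) (vk w) = ip circ (kw l) (kw w)" using kk_gram[OF l w] vk_gram[OF l w] by simp
  moreover have "(p + c * q) * d = p * d + c * q * d" for p q d by (rule distrib_right)
  ultimately have "ip \<mu> (\<lambda>x. (v x + c) * vk l x) (vk w) * (1 - cnj l * w) = ip circ (\<lambda>x. sym f c x * kw l x) (kw w) * (1 - cnj l * w)"
    by (simp only: L Mv)
  then show ?thesis using lw by simp
qed

text \<open>Multiplication by \<open>h\<close> on L^2(\<mu>), carried to the model space by Clark's
  operator and made extensional to match \<open>bounded_operators\<close>.\<close>

definition MO :: "(complex \<Rightarrow> complex) \<Rightarrow> l2 \<Rightarrow> l2" where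
  "MO h = restrict (\<lambda>x. W (\<lambda>t. h t * V x t)) KK"

text \<open>The bound is asked everywhere, not almost everywhere; an essentially bounded multiplier
  is first truncated.\<close>

definition bdd :: "(complex \<Rightarrow> complex) \<Rightarrow> bool" where
  "bdd h \<longleftrightarrow> h \<in> borel_measurable \<mu> \<and> (\<exists>B. \<forall>x. cmod (h x) \<le> B)"

lemma bdd_sqi: "bdd h \<Longrightarrow> sqi \<mu> g \<Longrightarrow> sqi \<mu> (\<lambda>t. h t * g t)"
  unfolding bdd_def by (blast intro: sqi_mult_bounded)

lemma bdd_imp_sqi: "bdd h \<Longrightarrow> sqi \<mu> h"
  unfolding bdd_def by (blast intro: sqi_bounded[OF mu(1)])

lemma MO_W:
  assumes h: "bdd h" and g: "sqi \<mu> g" shows "MO h (W g) = W (\<lambda>t. h t * g t)"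
proof -
  have "MO h (W g) = W (\<lambda>t. h t * V (W g) t)" by (simp add: MO_def W_KK g)
  also have "\<dots> = W (\<lambda>t. h t * g t)"
    using V_W[OF g] by (intro W_cong bdd_sqi h V_sqi W_KK g) (auto elim: eventually_mono)
  finally show ?thesis .
qed

lemma W_norm: "sqi \<mu> g \<Longrightarrow> (norm (W g))\<^sup>2 = nsq \<mu> g"
proof -
  assume g: "sqi \<mu> g"
  have "(norm (W g))\<^sup>2 = Re (l2_inner (W g) (W g))" by (simp add: power2_norm_eq_inner inner_l2_def)
  then show ?thesis by (simp add: W_ip g ip_self)
qed

lemma MO_bounded:
  assumes h: "bdd h" shows "MO h \<in> bounded_operators KK"
proof -
  obtain B where B: "\<And>x. cmod (h x) \<le> B" using h by (auto simp: bdd_def)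
  have B0: "B \<ge> 0" using B[of 0] norm_ge_zero order_trans by blast
  have K: "MO h x \<in> KK" if "x \<in> KK" for x using that by (simp add: MO_def W_KK bdd_sqi[OF h] V_sqi)
  have "MO h (x + y) = MO h x + MO h y" if "x \<in> KK" "y \<in> KK" for x y
  proof -
    have "MO h (W (\<lambda>t. V x t + V y t)) = W (\<lambda>t. h t * V x t + h t * V y t)"
      using that by (subst MO_W[OF h]) (auto simp: distrib_left intro: sqi_add V_sqi)
    also have "\<dots> = MO h (W (V x)) + MO h (W (V y))"
      using that by (simp add: W_lin bdd_sqi[OF h] V_sqi MO_W[OF h])
    finally show ?thesis using that by (simp add: W_lin V_sqi W_V)
  qed
  moreover have "MO h (c *\<^sub>C x) = c *\<^sub>C MO h x" if "x \<in> KK" for x c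
  proof -
    have "MO h (W (\<lambda>t. c * V x t)) = W (\<lambda>t. c * (h t * V x t))"
      using that by (subst MO_W[OF h]) (auto simp: mult_ac intro: sqi_scale V_sqi)
    also have "\<dots> = c *\<^sub>C MO h (W (V x))"
      using that by (simp add: W_scale bdd_sqi[OF h] V_sqi MO_W[OF h])
    finally show ?thesis using that by (simp add: W_scale V_sqi W_V)
  qed
  moreover have "norm (MO h x) \<le> B * norm x" if x: "x \<in> KK" for x
  proof -
    have "(norm (MO h x))\<^sup>2 = nsq \<mu> (\<lambda>t. h t * V x t)"
      using x by (simp add: MO_def W_norm bdd_sqi[OF h] V_sqi)
    also have "\<dots> \<le> (\<integral>t. B\<^sup>2 * (cmod (V x t))\<^sup>2 \<partial>\<mu>)"
      unfolding nsq_def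
    proof (rule integral_mono)
      show "integrable \<mu> (\<lambda>t. (cmod (h t * V x t))\<^sup>2)" using bdd_sqi[OF h V_sqi[OF x]] by (simp add: sqi_def)
      show "integrable \<mu> (\<lambda>t. B\<^sup>2 * (cmod (V x t))\<^sup>2)" using V_sqi[OF x] by (simp add: sqi_def)
      show "(cmod (h t * V x t))\<^sup>2 \<le> B\<^sup>2 * (cmod (V x t))\<^sup>2" for t
        using B[of t] by (simp add: norm_mult power_mult_distrib mult_right_mono power_mono)
    qed
    also have "\<dots> = B\<^sup>2 * nsq \<mu> (V x)" by (simp add: nsq_def)
    also have "nsq \<mu> (V x) = (norm x)\<^sup>2" using W_norm[OF V_sqi[OF x]] W_V[OF x] by simp
    finally have "(norm (MO h x))\<^sup>2 \<le> (B * norm x)\<^sup>2" by (simp add: power_mult_distrib)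
    then show ?thesis by (rule power2_le_imp_le) (simp add: B0)
  qed
  then have "\<exists>M. \<forall>x\<in>KK. norm (MO h x) \<le> M * norm x" by blast
  moreover have "MO h \<in> KK \<rightarrow>\<^sub>E KK" using K by (simp add: PiE_def MO_def[of h])
  ultimately show ?thesis
    by (simp add: bounded_operators_def complex_linear_on_def)
qed

text \<open>Norm estimates on kernels thereby become estimates of Poisson integrals of the
  multiplier.\<close>

lemma vk_one: "cmod l < 1 \<Longrightarrow> cmod x = 1 \<Longrightarrow> (cmod (vk l x))\<^sup>2 = (cmod (1 - a * cnj (\<Theta> l)))\<^sup>2 / (1 - (cmod l)\<^sup>2) * pois l x"
proof -
  assume l: "cmod l < 1" and x: "cmod x = 1"
  have "cmod (1 - cnj l * x) = cmod (cnj (1 - cnj l * x))" by (simp only: complex_mod_cnj)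
  also have "\<dots> = cmod (x - l)" using cmod_diff_circle[OF x, of l] by simp
  finally have "cmod (1 - cnj l * x) = cmod (x - l)" .
  moreover have "(cmod l)\<^sup>2 < 1" using l by (simp add: power_less_one_iff abs_square_less_1)
  ultimately show ?thesis by (simp add: vk_def norm_divide power_divide pois_def)
qed

lemma symbol_on_kernel:
  assumes x: "x \<in> KK" and l: "cmod l < 1" and w: "cmod w < 1"
  shows "l2_inner (sedlock_symbol \<Theta> a x c \<odot> kl l) (kl w) = ip \<mu> (\<lambda>t. (V x t + c) * vk l t) (vk w)"
proof -
  have f: "rep_l2 x \<in> KF" using x by (simp add: model_iff)
  have ks: "sqi circ (kw l)" "sqi circ (kw w)" using l w by (auto intro: KF_sqi kw_KF)
  have s: "sqi circ (sym (rep_l2 x) c)" by (rule sym_sqi[OF f])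
  show ?thesis
    unfolding sedlock_symbol_abs[OF x] kl_def l2_mult_abs[OF s ks(1) sqi_kw[OF s l]] l2_inner_abs[OF sqi_kw[OF s l] ks(2)]
    by (rule symbol_form[OF V_R[OF x] l w])
qed

text \<open>On kernels \<open>T\<close> acts as multiplication by \<open>V x + c\<close>, which so
  far is only square integrable. The operator bound tested on kernels gives an essential bound
  through \<open>pois_positive\<close>; then two bounded operators agree because they agree on
  kernels.\<close>

lemma sedlock_imp_MO:
  assumes T: "T \<in> sedlock \<Theta> a" shows "\<exists>h. bdd h \<and> T = MO h"
proof -
  obtain x c where x: "x \<in> KK" and t: "is_tto \<Theta> (sedlock_symbol \<Theta> a x c) T"
    using T by (auto simp: sedlock_def)
  define h where "h t = V x t + c" for t
  have cs: "sqi \<mu> (\<lambda>_. c)" by (rule sqi_bounded[OF mu(1), of _ "cmod c"]) auto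
  have hs: "sqi \<mu> h" unfolding h_def by (rule sqi_add[OF V_sqi[OF x] cs])
  have Tb: "T \<in> bounded_operators KK" using t by (simp add: is_tto_def)
  have TK: "T (kl l) \<in> KK" if "cmod l < 1" for l
    using Tb kl_KK[OF that] by (auto simp: bounded_operators_def)
  have Tkl: "T (kl l) = W (\<lambda>t. h t * vk l t)" if l: "cmod l < 1" for l
  proof (rule KK_eqI_kl[OF TK[OF l] W_KK[OF mu_sqi_mult_vk[OF hs l]]])
    fix w :: complex assume w: "cmod w < 1"
    have "T (kl l) = orth_proj KK (sedlock_symbol \<Theta> a x c \<odot> kl l)"
      using t kl_KK[OF l] kl_Hinf[OF l] by (simp add: is_tto_def)
    then have "l2_inner (T (kl l)) (kl w) = ip \<mu> (\<lambda>t. h t * vk l t) (vk w)"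
      using symbol_on_kernel[OF x l w, of c] kl_KK[OF w] by (simp add: orth_proj_inner h_def)
    also have "\<dots> = ip \<mu> (\<lambda>t. h t * vk l t) (V (kl w))"
      using V_kl[OF w] by (intro ip_cong_AE mu_sqi_mult_vk hs l vk_sqi w V_sqi kl_KK) (auto elim: eventually_mono)
    also have "\<dots> = l2_inner (W (\<lambda>t. h t * vk l t)) (kl w)"
      by (rule W_inner[OF mu_sqi_mult_vk[OF hs l] kl_KK[OF w], symmetric])
    finally show "l2_inner (T (kl l)) (kl w) = l2_inner (W (\<lambda>t. h t * vk l t)) (kl w)" .
  qed
  have klW: "kl l = W (vk l)" if "cmod l < 1" for l
    using W_V[OF kl_KK[OF that]] W_cong[OF V_sqi[OF kl_KK[OF that]] vk_sqi[OF that] V_kl[OF that]] by simp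
  obtain M where M: "\<And>f. f \<in> KK \<Longrightarrow> norm (T f) \<le> M * norm f"
    using Tb unfolding bounded_operators_def by blast
  have hint: "integrable \<mu> (\<lambda>t. (cmod (h t))\<^sup>2)" and hm: "h \<in> borel_measurable \<mu>" using hs by (auto simp: sqi_def)
  have "AE t in \<mu>. M\<^sup>2 - (cmod (h t))\<^sup>2 \<ge> 0"
  proof (rule pois_positive[OF mu])
    interpret mu: finite_measure \<mu> by (rule mu(1))
    show "integrable \<mu> (\<lambda>t. M\<^sup>2 - (cmod (h t))\<^sup>2)" using hint by simp
    fix l :: complex assume l: "cmod l < 1"
    define K where "K = (cmod (1 - a * cnj (\<Theta> l)))\<^sup>2 / (1 - (cmod l)\<^sup>2)"
    have "(cmod l)\<^sup>2 < 1" using l by (simp add: power_less_one_iff abs_square_less_1)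
    then have K: "K > 0" using a_ne(2)[OF l] by (simp add: K_def)
    have pm: "pois l \<in> borel_measurable \<mu>" by (rule mu_borel) measurable
    have "norm (T (kl l)) \<le> \<bar>M\<bar> * norm (kl l)"
      using M[OF kl_KK[OF l]] mult_right_mono[OF abs_ge_self norm_ge_zero, of M "kl l"] by linarith
    then have "(norm (T (kl l)))\<^sup>2 \<le> (\<bar>M\<bar> * norm (kl l))\<^sup>2" by (rule power_mono) simp
    then have "nsq \<mu> (\<lambda>t. h t * vk l t) \<le> M\<^sup>2 * nsq \<mu> (vk l)"
      unfolding Tkl[OF l] unfolding klW[OF l] by (simp add: power_mult_distrib W_norm mu_sqi_mult_vk[OF hs l] vk_sqi[OF l])
    moreover have "nsq \<mu> (\<lambda>t. h t * vk l t) = (\<integral>t. K * (pois l t * (cmod (h t))\<^sup>2) \<partial>\<mu>)"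
      unfolding nsq_def
      by (intro Bochner_Integration.integral_cong refl)
        (simp add: norm_mult power_mult_distrib vk_one[OF l] space_mu K_def)
    moreover have "nsq \<mu> (vk l) = (\<integral>t. K * pois l t \<partial>\<mu>)"
      unfolding nsq_def by (intro Bochner_Integration.integral_cong refl) (simp add: vk_one[OF l] space_mu K_def)
    ultimately have "K * (\<integral>t. pois l t * (cmod (h t))\<^sup>2 \<partial>\<mu>) \<le> K * (M\<^sup>2 * (\<integral>t. pois l t \<partial>\<mu>))" by (simp add: mult_ac)
    then have le: "(\<integral>t. pois l t * (cmod (h t))\<^sup>2 \<partial>\<mu>) \<le> M\<^sup>2 * (\<integral>t. pois l t \<partial>\<mu>)"
      using K by (simp add: mult_le_cancel_left_pos)
    have pb: "\<bar>pois l t\<bar> \<le> 1 / (1 - cmod l)\<^sup>2" if "t \<in> space \<mu>" for t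
      using pois_le[of t l "cmod l"] pois_nonneg[of l t] l that by (simp add: space_mu)
    have i1: "integrable \<mu> (pois l)"
      by (rule mu.integrable_const_bound[of _ "1 / (1 - cmod l)\<^sup>2"]) (use pb pm in auto)
    have i2: "integrable \<mu> (\<lambda>t. pois l t * (cmod (h t))\<^sup>2)"
    proof (rule Bochner_Integration.integrable_bound)
      show "integrable \<mu> (\<lambda>t. 1 / (1 - cmod l)\<^sup>2 * (cmod (h t))\<^sup>2)" using hint by simp
      show "(\<lambda>t. pois l t * (cmod (h t))\<^sup>2) \<in> borel_measurable \<mu>" using pm hm by measurable
      show "AE t in \<mu>. norm (pois l t * (cmod (h t))\<^sup>2) \<le> norm (1 / (1 - cmod l)\<^sup>2 * (cmod (h t))\<^sup>2)"
      proof (intro AE_I2)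
        fix t assume "t \<in> space \<mu>"
        from mult_right_mono[OF pb[OF this], of "(cmod (h t))\<^sup>2"]
        show "norm (pois l t * (cmod (h t))\<^sup>2) \<le> norm (1 / (1 - cmod l)\<^sup>2 * (cmod (h t))\<^sup>2)"
          by (simp add: abs_mult)
      qed
    qed
    have "(\<integral>t. pois l t * (M\<^sup>2 - (cmod (h t))\<^sup>2) \<partial>\<mu>) = (\<integral>t. M\<^sup>2 * pois l t - pois l t * (cmod (h t))\<^sup>2 \<partial>\<mu>)"
      by (simp add: right_diff_distrib mult.commute)
    also have "\<dots> = M\<^sup>2 * (\<integral>t. pois l t \<partial>\<mu>) - (\<integral>t. pois l t * (cmod (h t))\<^sup>2 \<partial>\<mu>)"
      using i1 i2 by simp
    finally show "(\<integral>t. pois l t * (M\<^sup>2 - (cmod (h t))\<^sup>2) \<partial>\<mu>) \<ge> 0" using le by simp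
  qed
  then have hb: "AE t in \<mu>. cmod (h t) \<le> \<bar>M\<bar>"
    by eventually_elim (simp add: abs_le_square_iff[symmetric, of "cmod _" M])
  \<comment> \<open>The truncation turns the essential bound into a bound everywhere, as
    \<open>bdd\<close> demands.\<close>
  define h' where "h' t = (if cmod (h t) \<le> \<bar>M\<bar> then h t else 0)" for t
  have h'm: "h' \<in> borel_measurable \<mu>" unfolding h'_def using hm by measurable
  have h': "bdd h'" unfolding bdd_def using h'm by (intro conjI exI[of _ "\<bar>M\<bar>"]) (auto simp: h'_def)
  have ae: "AE t in \<mu>. h' t = h t" using hb by eventually_elim (simp add: h'_def)
  have "T = MO h'"
  proof (rule bounded_operator_eqI[OF Tb MO_bounded[OF h']])
    fix l :: complex assume l: "cmod l < 1"
    have "MO h' (kl l) = W (\<lambda>t. h' t * vk l t)" unfolding klW[OF l] by (rule MO_W[OF h' vk_sqi[OF l]])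
    also have "\<dots> = W (\<lambda>t. h t * vk l t)"
      using ae by (intro W_cong bdd_sqi[OF h'] vk_sqi l mu_sqi_mult_vk hs) (auto elim: eventually_mono)
    finally show "T (kl l) = MO h' (kl l)" using Tkl[OF l] by simp
  qed
  then show ?thesis using h' by blast
qed

text \<open>The symbol comes from the vector \<open>W h\<close> and the constant 0. The identity of
  forms is known on pairs of kernels, whereas a truncated Toeplitz operator is tested on all of
  \<open>KK \<inter> Hinf\<close>; passing to the adjoint side bridges the gap.\<close>

lemma MO_sedlock:
  assumes h: "bdd h" shows "MO h \<in> sedlock \<Theta> a"
proof -
  define x where "x = W h"
  have hs: "sqi \<mu> h" by (rule bdd_imp_sqi[OF h])
  have x: "x \<in> KK" unfolding x_def by (rule W_KK[OF hs])
  have Vx: "AE t in \<mu>. V x t = h t" unfolding x_def by (rule V_W[OF hs])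
  have f: "rep_l2 x \<in> KF" using x by (simp add: model_iff)
  let ?s = "sym (rep_l2 x) 0"
  have ss: "sqi circ ?s" by (rule sym_sqi[OF f])
  have cnh: "bdd (\<lambda>t. cnj (h t))" using h by (auto simp: bdd_def)
  have "is_tto \<Theta> (sedlock_symbol \<Theta> a x 0) (MO h)"
    unfolding is_tto_def
  proof (intro conjI ballI)
    show "MO h \<in> bounded_operators KK" by (rule MO_bounded[OF h])
    fix y assume "y \<in> KK \<inter> Hinf"
    then have y: "y \<in> KK" "y \<in> Hinf" by auto
    obtain F B where F: "y = abs_l2 F" "sqi circ F" "\<And>t. cmod (F t) \<le> B" using Hinf_bounded[OF y(2)] by blast
    have sF: "sqi circ (\<lambda>t. ?s t * F t)"
      using sqi_mult_bounded[OF ss sqi_measurable[OF F(2)], of B] F(3) by (simp add: mult.commute)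
    have mult: "sedlock_symbol \<Theta> a x 0 \<odot> y = abs_l2 (\<lambda>t. ?s t * F t)"
      unfolding sedlock_symbol_abs[OF x] F(1) by (rule l2_mult_abs[OF ss F(2) sF])
    show "MO h y = orth_proj KK (sedlock_symbol \<Theta> a x 0 \<odot> y)"
    proof (rule KK_eqI_kl)
      show "MO h y \<in> KK" using y(1) by (simp add: MO_def W_KK bdd_sqi[OF h] V_sqi)
      show "orth_proj KK (sedlock_symbol \<Theta> a x 0 \<odot> y) \<in> KK" by (rule orth_proj_KK)
      fix w :: complex assume w: "cmod w < 1"
      have ks: "sqi circ (kw w)" by (rule KF_sqi[OF kw_KF[OF w]])
      have sk: "sqi circ (\<lambda>t. cnj (?s t) * kw w t)" by (rule sqi_kw[OF sqi_cnj[OF ss] w])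
      \<comment> \<open>The conjugate symbol times \<open>kw w\<close>, projected to the model
        space. The vector \<open>q\<close> is identified by its products with kernels, after which
        an arbitrary bounded \<open>y\<close> can be paired with it.\<close>
      define q where "q = orth_proj KK (abs_l2 (\<lambda>t. cnj (?s t) * kw w t))"
      have hv: "sqi \<mu> (\<lambda>t. cnj (h t) * vk w t)" by (rule bdd_sqi[OF cnh vk_sqi[OF w]])
      have q: "q = W (\<lambda>t. cnj (h t) * vk w t)"
      proof (rule KK_eqI_kl)
        show "q \<in> KK" unfolding q_def by (rule orth_proj_KK)
        show "W (\<lambda>t. cnj (h t) * vk w t) \<in> KK" by (rule W_KK[OF hv])
        fix l :: complex assume l: "cmod l < 1"
        have "l2_inner q (kl l) = ip circ (\<lambda>t. cnj (?s t) * kw w t) (kw l)"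
          unfolding q_def orth_proj_inner[OF kl_KK[OF l]] unfolding kl_def by (rule l2_inner_abs[OF sk KF_sqi[OF kw_KF[OF l]]])
        also have "\<dots> = cnj (ip circ (\<lambda>t. ?s t * kw l t) (kw w))"
          unfolding ip_def Bochner_Integration.integral_cnj[symmetric] by (simp add: mult_ac)
        also have "\<dots> = cnj (ip \<mu> (\<lambda>t. (V x t + 0) * vk l t) (vk w))" by (simp only: symbol_form[OF V_R[OF x] l w])
        also have "\<dots> = cnj (ip \<mu> (\<lambda>t. h t * vk l t) (vk w))"
          using Vx by (intro arg_cong[of _ _ cnj] ip_cong_AE)
            (auto simp: mu_sqi_mult_vk V_sqi x l hs vk_sqi w elim: eventually_mono)
        also have "\<dots> = ip \<mu> (\<lambda>t. cnj (h t) * vk w t) (vk l)"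
          unfolding ip_def Bochner_Integration.integral_cnj[symmetric] by (simp add: mult_ac)
        also have "\<dots> = ip \<mu> (\<lambda>t. cnj (h t) * vk w t) (V (kl l))"
          using V_kl[OF l] by (intro ip_cong_AE hv vk_sqi l V_sqi kl_KK) (auto elim: eventually_mono)
        also have "\<dots> = l2_inner (W (\<lambda>t. cnj (h t) * vk w t)) (kl l)" by (rule W_inner[OF hv kl_KK[OF l], symmetric])
        finally show "l2_inner q (kl l) = l2_inner (W (\<lambda>t. cnj (h t) * vk w t)) (kl l)" .
      qed
      have "l2_inner (orth_proj KK (sedlock_symbol \<Theta> a x 0 \<odot> y)) (kl w) = ip circ (\<lambda>t. ?s t * F t) (kw w)"
        unfolding orth_proj_inner[OF kl_KK[OF w]] mult unfolding kl_def by (rule l2_inner_abs[OF sF ks])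
      also have "\<dots> = ip circ F (\<lambda>t. cnj (?s t) * kw w t)" unfolding ip_def by (simp add: mult_ac)
      also have "\<dots> = l2_inner y (abs_l2 (\<lambda>t. cnj (?s t) * kw w t))" unfolding F(1) by (rule l2_inner_abs[OF F(2) sk, symmetric])
      also have "\<dots> = l2_inner y q"
        using orth_proj_inner[OF y(1), of "abs_l2 (\<lambda>t. cnj (?s t) * kw w t)"] unfolding q_def by (metis l2_inner_cnj)
      also have "\<dots> = cnj (ip \<mu> (\<lambda>t. cnj (h t) * vk w t) (V y))"
        unfolding q by (simp add: W_inner[OF hv y(1), symmetric] l2_inner_cnj)
      also have "\<dots> = ip \<mu> (\<lambda>t. h t * V y t) (vk w)"
        unfolding ip_def Bochner_Integration.integral_cnj[symmetric] by (simp add: mult_ac)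
      also have "\<dots> = ip \<mu> (\<lambda>t. h t * V y t) (V (kl w))"
        using V_kl[OF w] y(1) by (intro ip_cong_AE bdd_sqi[OF h] vk_sqi w V_sqi kl_KK) (auto elim: eventually_mono)
      also have "\<dots> = l2_inner (MO h y) (kl w)"
        using y(1) W_inner[OF bdd_sqi[OF h V_sqi[OF y(1)]] kl_KK[OF w]] by (simp add: MO_def)
      finally show "l2_inner (MO h y) (kl w) = l2_inner (orth_proj KK (sedlock_symbol \<Theta> a x 0 \<odot> y)) (kl w)" by simp
    qed
  qed
  then show ?thesis using x by (auto simp: sedlock_def ttos_def)
qed

lemma sedlock_eq: "sedlock \<Theta> a = MO ` {h. bdd h}"
  using sedlock_imp_MO MO_sedlock by blast

end

section \<open>Existence and uniqueness of the Clark measure\<close>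

lemma herglotz_kernel:
  assumes "cmod x = 1" "cmod z < 1"
  shows "(x + z) / (x - z) = 2 * (1 / (1 - z * cnj x)) - 1" "Re ((x + z) / (x - z)) = pois z x"
proof -
  have ne: "1 - z * cnj x \<noteq> 0" using assms by (intro one_minus_mult_ne) auto
  have xx: "x * cnj x = 1" using assms by (simp add: complex_norm_square[symmetric])
  then have x0: "cnj x \<noteq> 0" by auto
  have "(x + z) / (x - z) = ((x + z) * cnj x) / ((x - z) * cnj x)" using x0 by simp
  also have "\<dots> = (1 + z * cnj x) / (1 - z * cnj x)" using xx by (simp add: distrib_right left_diff_distrib)
  also have "\<dots> = 2 * (1 / (1 - z * cnj x)) - 1" using ne by (simp add: divide_simps)
  finally show *: "(x + z) / (x - z) = 2 * (1 / (1 - z * cnj x)) - 1" .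
  define k where "k = 1 / (1 - z * cnj x)"
  have "Re (complex_of_real (pois z x)) = Re (k + cnj k - 1)"
    by (simp only: pois_eq[OF assms] k_def)
  then show "Re ((x + z) / (x - z)) = pois z x" unfolding * k_def[symmetric] by simp
qed

text \<open>The Herglotz kernel is twice the Cauchy kernel minus 1, and the Cauchy kernel reproduces
  \<open>f\<close> while it sends the conjugate of \<open>f\<close> to the constant
  \<open>cnj (f 0)\<close>. The real part thus recovers \<open>f\<close> up to an imaginary
  constant.\<close>

lemma schwarz_formula:
  assumes f: "f holomorphic_on ball 0 1" and r: "0 \<le> r" "r < 1" and z: "cmod z < 1"
  shows "(\<integral>x. (x + z) / (x - z) * of_real (Re (f (of_real r * x))) \<partial>circ) = f (of_real r * z) - \<i> * of_real (Im (f 0))"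
proof -
  let ?F = "\<lambda>x. f (of_real r * x)"
  let ?K = "\<lambda>x. 1 / (1 - z * cnj x)"
  have k: "?K \<in> borel_measurable circ"
    by (rule circle_measurable_borel[OF sets_circ]) measurable
  have b: "cmod (?K x) \<le> 1 / (1 - cmod z)" if "x \<in> space circ" for x
    using that z by (intro cauchy_kernel_bound) (auto simp: space_circ)
  have F: "integrable circ ?F" by (rule dilate_integrable[OF f r])
  have F': "integrable circ (\<lambda>x. cnj (?F x))" using F by simp
  have i1: "integrable circ (\<lambda>x. ?K x * ?F x)" by (rule integrable_mult_bounded[OF F k b])
  have i2: "integrable circ (\<lambda>x. ?K x * cnj (?F x))" by (rule integrable_mult_bounded[OF F' k b])
  have v1: "(\<integral>x. ?K x * ?F x \<partial>circ) = f (of_real r * z)"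
    using dilate_cauchy(1)[OF f r z] by simp
  have "(\<integral>x. ?K x * cnj (?F x) \<partial>circ) = (\<integral>x. cnj (?F x * cnj (?K x)) \<partial>circ)"
    by (intro Bochner_Integration.integral_cong refl) (simp add: mult.commute)
  also have "\<dots> = cnj (f 0)" by (simp only: Bochner_Integration.integral_cnj dilate_cauchy(2)[OF f r z])
  finally have v2: "(\<integral>x. ?K x * cnj (?F x) \<partial>circ) = cnj (f 0)" .
  have v3: "(\<integral>x. ?F x \<partial>circ) = f 0" using dilate_cauchy(1)[OF f r, of 0] by simp
  then have v4: "(\<integral>x. cnj (?F x) \<partial>circ) = cnj (f 0)" by simp
  have "(\<integral>x. (x + z) / (x - z) * of_real (Re (?F x)) \<partial>circ)
      = (\<integral>x. (?K x * ?F x + ?K x * cnj (?F x)) - (?F x + cnj (?F x)) / 2 \<partial>circ)"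
  proof (intro Bochner_Integration.integral_cong refl)
    fix x assume "x \<in> space circ"
    then have "(x + z) / (x - z) = 2 * ?K x - 1" using herglotz_kernel(1)[OF _ z] by (simp add: space_circ)
    moreover have "complex_of_real (Re (?F x)) = (?F x + cnj (?F x)) / 2" by (simp add: complex_add_cnj)
    moreover have "(2 * k - 1) * ((w + w') / 2) = (k * w + k * w') - (w + w') / 2" for k w w' :: complex
      by (simp add: field_simps)
    ultimately show "(x + z) / (x - z) * of_real (Re (?F x)) = (?K x * ?F x + ?K x * cnj (?F x)) - (?F x + cnj (?F x)) / 2"
      by (simp only:)
  qed
  also have "\<dots> = (f (of_real r * z) + cnj (f 0)) - (f 0 + cnj (f 0)) / 2"
  proof -
    have "integrable circ (\<lambda>x. (?F x + cnj (?F x)) / 2)" using F F' by simp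
    from Bochner_Integration.integral_diff[OF Bochner_Integration.integrable_add[OF i1 i2] this]
    show ?thesis
      by (simp only: Bochner_Integration.integral_add[OF i1 i2] Bochner_Integration.integral_add[OF F F']
        integral_divide_zero v1 v2 v3 v4)
  qed
  also have "\<dots> = f (of_real r * z) - \<i> * of_real (Im (f 0))"
    by (simp add: complex_eq_iff field_simps)
  finally show ?thesis .
qed

text \<open>The measures with density \<open>Re H\<close> on circles of radius tending to 1 have a
  weak limit along a subsequence. Compactness is taken from tight families of distributions on the
  line, so the densities are placed on the angle interval and the limit is pushed to the circle by
  \<open>cis\<close>.\<close>

lemma herglotz_measure:
  assumes H: "H holomorphic_on ball 0 1" and pos: "\<And>z. cmod z < 1 \<Longrightarrow> Re (H z) > 0"
  obtains \<mu> where "finite_measure \<mu>" "sets \<mu> = sets (restrict_space borel (sphere 0 1))"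
    "\<And>z. cmod z < 1 \<Longrightarrow> H z = (\<integral>x. (x + z) / (x - z) \<partial>\<mu>) + \<i> * of_real (Im (H 0))"
proof -
  define c where "c = Re (H 0)"
  have c: "c > 0" using pos[of 0] by (simp add: c_def)
  define U where "U = uniform_measure lborel {0..2 * pi}"
  have sU: "sets U = sets borel" by (simp add: U_def)
  have cU: "circ = distr U (restrict_space borel (sphere 0 1)) cis" by (simp add: circ_def U_def)
  have cisU: "cis \<in> measurable U (restrict_space borel (sphere 0 1))" by (rule measurable_cis_circle[OF sU])
  define \<rho> where "\<rho> n x = Re (H (of_real (rad n) * x)) / c" for n and x :: complex
  have rm: "\<rho> n \<in> borel_measurable circ" for n
    unfolding \<rho>_def using dilate_measurable[OF H, of "rad n"] rad_bounds[of n] by simp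
  have rmU: "(\<lambda>t. \<rho> n (cis t)) \<in> borel_measurable U" for n
    using measurable_compose[OF cisU, of "\<rho> n" borel] rm[of n]
    by (simp add: sets_circ cong: measurable_cong_sets)
  have r0: "\<rho> n x \<ge> 0" if "cmod x = 1" for n x
  proof -
    have "cmod (of_real (rad n) * x) < 1" using that rad_bounds[of n] by (simp add: norm_mult)
    from pos[OF this] show ?thesis using c by (simp add: \<rho>_def)
  qed
  define M where "M n = density U (\<lambda>t. ennreal (\<rho> n (cis t)))" for n
  have MI: "(\<integral>t. f (cis t) \<partial>M n) = (\<integral>x. f x * of_real (\<rho> n x) \<partial>circ)"
    if f: "f \<in> borel_measurable circ" for f :: "complex \<Rightarrow> complex" and n
  proof -
    have fU: "(\<lambda>t. f (cis t)) \<in> borel_measurable U"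
      using measurable_compose[OF cisU, of f borel] f by (simp add: sets_circ cong: measurable_cong_sets)
    have "(\<integral>t. f (cis t) \<partial>M n) = (\<integral>t. \<rho> n (cis t) *\<^sub>R f (cis t) \<partial>U)"
      unfolding M_def by (rule integral_density[OF fU rmU]) (simp add: r0)
    also have "\<dots> = (\<integral>x. \<rho> n x *\<^sub>R f x \<partial>circ)"
      unfolding cU
      by (rule integral_distr[symmetric, OF cisU])
         (use f rm[of n] in \<open>simp add: sets_circ cong: measurable_cong_sets\<close>)
    also have "\<dots> = (\<integral>x. f x * of_real (\<rho> n x) \<partial>circ)" by (simp add: scaleR_conv_of_real mult.commute)
    finally show ?thesis .
  qed
  have val: "(\<integral>x. (x + z) / (x - z) * of_real (\<rho> n x) \<partial>circ) = (H (of_real (rad n) * z) - \<i> * of_real (Im (H 0))) / of_real c"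
    if z: "cmod z < 1" for n z
  proof -
    have "(\<integral>x. (x + z) / (x - z) * of_real (\<rho> n x) \<partial>circ)
        = (\<integral>x. (x + z) / (x - z) * of_real (Re (H (of_real (rad n) * x))) / of_real c \<partial>circ)"
      by (intro Bochner_Integration.integral_cong refl) (simp add: \<rho>_def)
    then show ?thesis
      using schwarz_formula[OF H _ _ z, of "rad n"] rad_bounds[of n] by (simp only: integral_divide_zero)
  qed
  have gm: "(\<lambda>x. (x + z) / (x - z)) \<in> borel_measurable circ" for z
    by (rule circle_measurable_borel[OF sets_circ]) measurable
  have em: "emeasure (M n) (space (M n)) = 1" for n
  proof -
    have rI: "integrable circ (\<rho> n)"
      unfolding \<rho>_def using dilate_integrable[OF H, of "rad n"] rad_bounds[of n]
      by (intro integrable_divide_zero integrable_Re) auto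
    have "emeasure (M n) (space (M n)) = (\<integral>\<^sup>+t. ennreal (\<rho> n (cis t)) \<partial>U)"
      unfolding M_def using rmU[of n] by (simp add: emeasure_density cong: nn_integral_cong)
    also have "\<dots> = (\<integral>\<^sup>+x. ennreal (\<rho> n x) \<partial>circ)"
      unfolding cU
      by (rule nn_integral_distr[symmetric, OF cisU])
         (use rm[of n] in \<open>simp add: sets_circ cong: measurable_cong_sets\<close>)
    also have "\<dots> = ennreal (\<integral>x. \<rho> n x \<partial>circ)"
      by (intro nn_integral_eq_integral rI AE_I2) (auto simp: space_circ r0)
    also have "(\<integral>x. \<rho> n x \<partial>circ) = 1"
    proof -
      have "AE x in circ. (x + 0) / (x - 0) * of_real (\<rho> n x) = complex_of_real (\<rho> n x)"
        by (rule AE_I2) (auto simp: space_circ)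
      then have "(\<integral>x. (x + 0) / (x - 0) * of_real (\<rho> n x) \<partial>circ) = (\<integral>x. complex_of_real (\<rho> n x) \<partial>circ)"
        using gm[of 0] rm[of n] by (intro integral_cong_AE) auto
      then have "complex_of_real (\<integral>x. \<rho> n x \<partial>circ) = (H 0 - \<i> * of_real (Im (H 0))) / of_real c"
        using val[of 0 n] by (simp add: integral_complex_of_real)
      also have "H 0 - \<i> * of_real (Im (H 0)) = of_real c" by (simp add: c_def complex_eq_iff)
      finally show ?thesis using c by (simp add: of_real_eq_1_iff)
    qed
    finally show ?thesis by simp
  qed
  have rd: "real_distribution (M n)" for n
    by (intro real_distribution.intro prob_spaceI em real_distribution_axioms.intro) (simp add: M_def sU)
  \<comment> \<open>Any half-open interval containing the angles from 0 to \<open>2 * pi\<close>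
    gives tightness; the ends -1 and 7 leave room on both sides.\<close>
  have full: "measure (M n) {-1<..7} = 1" for n
  proof -
    interpret M: real_distribution "M n" by (rule rd)
    have "AE t in U. t \<in> {0..2 * pi}"
      unfolding U_def by (rule AE_uniform_measureI) auto
    then have "AE t in U. t \<in> {-1<..7}" by (rule eventually_mono) (use pi_approx in auto)
    then have "AE t in M n. t \<in> {-1<..7}" unfolding M_def using rmU[of n] by (subst AE_density) auto
    then show ?thesis by (subst M.prob_eq_1) (auto simp: M_def sU)
  qed
  have tight: "tight M"
    unfolding tight_def using rd by (intro conjI allI impI exI[of _ "-1"] exI[of _ 7]) (auto simp: full)
  have "strict_mono (id :: nat \<Rightarrow> nat)" by (simp add: strict_mono_def)
  from tight_imp_convergent_subsubsequence[OF tight this]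
  obtain r L where r: "strict_mono (r :: nat \<Rightarrow> nat)" and L: "real_distribution L" and wc: "weak_conv_m (M \<circ> id \<circ> r) L"
    by blast
  interpret L: real_distribution L by (rule L)
  define \<nu> where "\<nu> = distr L (restrict_space borel (sphere 0 1)) cis"
  define \<mu> where "\<mu> = density \<nu> (\<lambda>_. ennreal c)"
  have cisL: "cis \<in> measurable L (restrict_space borel (sphere 0 1))" by (intro measurable_cis_circle) simp
  have s: "sets \<mu> = sets (restrict_space borel (sphere 0 1))" by (simp add: \<mu>_def \<nu>_def)
  interpret nu: prob_space \<nu> unfolding \<nu>_def by (rule L.prob_space_distr[OF cisL])
  have fin: "finite_measure \<mu>"
    by (rule finite_measureI) (simp add: \<mu>_def emeasure_density nn_integral_cmult nu.emeasure_space_1)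
  have "H z = (\<integral>x. (x + z) / (x - z) \<partial>\<mu>) + \<i> * of_real (Im (H 0))" if z: "cmod z < 1" for z
  proof -
    let ?g = "\<lambda>x. (x + z) / (x - z)"
    have ne: "cis t \<noteq> z" for t using z by auto
    \<comment> \<open>As a function of the angle the integrand is bounded and continuous on the
      whole line, so weak convergence applies. Mass of the limit at 0 and at \<open>2 * pi\<close>
      lands on the same point of the circle.\<close>
    have lim: "(\<lambda>n. \<integral>t. ?g (cis t) \<partial>(M \<circ> id \<circ> r) n) \<longlonglongrightarrow> (\<integral>t. ?g (cis t) \<partial>L)"
    proof (rule weak_conv_imp_integral_bdd_continuous_conv[where B = "2 / (1 - cmod z)"])
      show "real_distribution ((M \<circ> id \<circ> r) n)" for n using rd by simp
      show "isCont (\<lambda>t. ?g (cis t)) t" for t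
      proof -
        have "continuous_on UNIV cis" by (intro continuous_intros)
        then have "isCont cis t" by (simp add: continuous_on_eq_continuous_at)
        then show ?thesis using ne[of t] by (intro continuous_intros) auto
      qed
      show "norm (?g (cis t)) \<le> 2 / (1 - cmod z)" for t
      proof -
        have "cmod (cis t + z) \<le> 2" using norm_triangle_ineq[of "cis t" z] z by simp
        moreover have "1 - cmod z \<le> cmod (cis t - z)" using norm_triangle_ineq2[of "cis t" z] by simp
        ultimately show ?thesis unfolding norm_divide using z by (intro frac_le) auto
      qed
    qed (use L wc in \<open>auto simp: o_def\<close>)
    have "(\<integral>t. ?g (cis t) \<partial>(M \<circ> id \<circ> r) n) = (H (of_real (rad (r n)) * z) - \<i> * of_real (Im (H 0))) / of_real c" for n
      using MI[OF gm] val[OF z] by simp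
    then have "(\<lambda>n. (H (of_real (rad (r n)) * z) - \<i> * of_real (Im (H 0))) / of_real c) \<longlonglongrightarrow> (\<integral>t. ?g (cis t) \<partial>L)"
      using lim by (simp only:)
    moreover have "(\<lambda>n. (H (of_real (rad (r n)) * z) - \<i> * of_real (Im (H 0))) / of_real c)
        \<longlonglongrightarrow> (H z - \<i> * of_real (Im (H 0))) / of_real c"
    proof -
      have "(\<lambda>n. rad (r n)) \<longlonglongrightarrow> 1"
        using LIMSEQ_subseq_LIMSEQ[OF rad_tendsto r] by (simp add: o_def)
      then have "(\<lambda>n. of_real (rad (r n)) * z) \<longlonglongrightarrow> complex_of_real 1 * z" by (intro tendsto_intros)
      then have "(\<lambda>n. of_real (rad (r n)) * z) \<longlonglongrightarrow> z" by simp
      moreover have "isCont H z"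
        using H z by (intro continuous_on_interior[OF holomorphic_on_imp_continuous_on[OF H]]) auto
      ultimately have "(\<lambda>n. H (of_real (rad (r n)) * z)) \<longlonglongrightarrow> H z"
        using isCont_tendsto_compose by blast
      then show ?thesis using c by (intro tendsto_intros) auto
    qed
    ultimately have eqL: "(\<integral>t. ?g (cis t) \<partial>L) = (H z - \<i> * of_real (Im (H 0))) / of_real c"
      by (rule LIMSEQ_unique)
    have gn: "?g \<in> borel_measurable \<nu>"
      using gm[of z] by (simp add: \<nu>_def sets_circ cong: measurable_cong_sets)
    have "(\<integral>x. ?g x \<partial>\<mu>) = (\<integral>x. c *\<^sub>R ?g x \<partial>\<nu>)"
      unfolding \<mu>_def by (rule integral_density[OF gn]) (use c in auto)
    also have "\<dots> = of_real c * (\<integral>x. ?g x \<partial>\<nu>)" by (simp only: scaleR_conv_of_real Bochner_Integration.integral_mult_right_zero)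
    also have "(\<integral>x. ?g x \<partial>\<nu>) = (\<integral>t. ?g (cis t) \<partial>L)"
      unfolding \<nu>_def by (rule integral_distr[OF cisL]) (use gn in \<open>simp add: \<nu>_def\<close>)
    finally show ?thesis unfolding eqL using c by simp
  qed
  then show thesis using fin s by (intro that)
qed

context clark
begin

lemma is_clark: "is_clark_measure \<Theta> a \<mu>"
  unfolding is_clark_measure_def
proof (intro conjI mu ballI)
  fix z :: complex assume "z \<in> ball 0 1"
  then have z: "cmod z < 1" by simp
  interpret finite_measure \<mu> by (rule mu(1))
  obtain t :: real where t: "(a + \<Theta> z) / (a - \<Theta> z) = (\<integral>x. (x + z) / (x - z) \<partial>\<mu>) + \<i> * of_real t"
    using herglotz z by blast
  have i: "integrable \<mu> (\<lambda>x. (x + z) / (x - z))"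
  proof (rule integrable_const_bound[where B = "2 / (1 - cmod z)"])
    show "AE x in \<mu>. norm ((x + z) / (x - z)) \<le> 2 / (1 - cmod z)"
    proof (rule AE_I2)
      fix x assume "x \<in> space \<mu>"
      then have x: "cmod x = 1" by (simp add: space_mu)
      have "cmod (x + z) \<le> 2" using norm_triangle_ineq[of x z] z x by simp
      moreover have "1 - cmod z \<le> cmod (x - z)" using norm_triangle_ineq2[of x z] x by simp
      ultimately show "norm ((x + z) / (x - z)) \<le> 2 / (1 - cmod z)"
        unfolding norm_divide using z by (intro frac_le) auto
    qed
    show "(\<lambda>x. (x + z) / (x - z)) \<in> borel_measurable \<mu>"
      by (rule circle_measurable_borel[OF mu(2)]) measurable
  qed
  have "Re ((a + \<Theta> z) / (a - \<Theta> z)) = (\<integral>x. Re ((x + z) / (x - z)) \<partial>\<mu>)"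
    unfolding t using integral_Re[OF i] by simp
  also have "\<dots> = (\<integral>x. pois z x \<partial>\<mu>)"
    by (intro Bochner_Integration.integral_cong refl) (simp add: herglotz_kernel(2) z space_mu)
  finally show "Re ((a + \<Theta> z) / (a - \<Theta> z)) = (\<integral>\<zeta>. (1 - (cmod z)\<^sup>2) / (cmod (\<zeta> - z))\<^sup>2 \<partial>\<mu>)"
    by (simp add: pois_def)
qed

lemma clark_measure_eq: "clark_measure \<Theta> a = \<mu>"
  unfolding clark_measure_def
proof (rule the_equality[where P = "is_clark_measure \<Theta> a", OF is_clark])
  fix \<nu> assume nu: "is_clark_measure \<Theta> a \<nu>"
  show "\<nu> = \<mu>"
  proof (rule circle_measure_eqI)
    show "(\<integral>x. pois z x \<partial>\<nu>) = (\<integral>x. pois z x \<partial>\<mu>)" if "cmod z < 1" for z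
      using nu is_clark that unfolding is_clark_measure_def pois_def by simp
  qed (use nu mu in \<open>auto simp: is_clark_measure_def\<close>)
qed

end

text \<open>Since \<open>\<Theta>\<close> maps the disc into itself and \<open>a\<close> is
  unimodular, \<open>(a + \<Theta>) / (a - \<Theta>)\<close> has positive real part. Its Herglotz
  measure is a Clark measure, and uniqueness resolves the description in
  \<open>clark_measure\<close>.\<close>

lemma clark_clark_measure:
  assumes inn: "inner_function \<Theta>" and a1: "cmod a = 1"
  shows "clark \<Theta> a (clark_measure \<Theta> a)"
proof -
  interpret inner_fn \<Theta> by unfold_locales (rule inn)
  define H where "H z = (a + \<Theta> z) / (a - \<Theta> z)" for z
  have ne: "a - \<Theta> z \<noteq> 0" if "cmod z < 1" for z using Theta_lt_1[OF that] a1 by auto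
  have H: "H holomorphic_on ball 0 1"
    unfolding H_def using ne Theta_hardy by (intro holomorphic_intros) auto
  have pos: "Re (H z) > 0" if z: "cmod z < 1" for z
  proof -
    have aa: "a * cnj a = 1" using a1 by (simp add: complex_norm_square[symmetric])
    have t: "cmod (a * cnj (\<Theta> z)) < 1" using Theta_lt_1[OF z] a1 by (simp add: norm_mult)
    have "H z = (a + \<Theta> z) * cnj (a - \<Theta> z) / of_real ((cmod (a - \<Theta> z))\<^sup>2)"
      unfolding H_def by (rule complex_div_cnj)
    moreover have "Re ((a + \<Theta> z) * cnj (a - \<Theta> z)) = (cmod a)\<^sup>2 - (cmod (\<Theta> z))\<^sup>2"
      unfolding cmod_power2 by (simp add: power2_eq_square algebra_simps)
    ultimately have "Re (H z) = ((cmod a)\<^sup>2 - (cmod (\<Theta> z))\<^sup>2) / (cmod (a - \<Theta> z))\<^sup>2"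
      by (simp only: Re_divide_of_real)
    moreover have "(cmod (\<Theta> z))\<^sup>2 < 1" using Theta_lt_1[OF z] by (simp add: abs_square_less_1)
    ultimately show ?thesis using a1 ne[OF z] by simp
  qed
  obtain \<mu> where m: "finite_measure \<mu>" "sets \<mu> = sets (restrict_space borel (sphere 0 1))"
    "\<And>z. cmod z < 1 \<Longrightarrow> H z = (\<integral>x. (x + z) / (x - z) \<partial>\<mu>) + \<i> * of_real (Im (H 0))"
  proof (rule herglotz_measure[of H], goal_cases)
    case 1 show ?case by (rule H)
  next
    case (2 z) show ?case by (rule pos[OF 2(2)])
  next
    case (3 \<nu>) show ?case by (rule 3(1)[OF 3(2,3,4)])
  qed
  have hz: "(a + \<Theta> z) / (a - \<Theta> z) = (\<integral>x. (x + z) / (x - z) \<partial>\<mu>) + \<i> * of_real (Im (H 0))" if "cmod z < 1" for z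
    by (rule trans[OF H_def[of z, symmetric] m(3)[OF that]])
  interpret clark \<Theta> a \<mu>
  proof (rule clark.intro[OF inner_fn_axioms], rule clark_axioms.intro)
    show "\<exists>t::real. \<forall>z. cmod z < 1 \<longrightarrow> (a + \<Theta> z) / (a - \<Theta> z) = (\<integral>x. (x + z) / (x - z) \<partial>\<mu>) + \<i> * of_real t"
      by (rule exI[of _ "Im (H 0)"], rule allI, rule impI, rule hz)
  qed (fact a1 m(1) m(2))+
  show ?thesis using clark_measure_eq clark_axioms by simp
qed

section \<open>Common eigenvectors and atoms\<close>

text \<open>The eigenvalue may depend on the operator. The notion refers only to the space and the
  set of operators, so a spatial isomorphism transports it (\<open>eigvecs_unitary\<close>).\<close>

definition eigvecs :: "l2 set \<Rightarrow> (l2 \<Rightarrow> l2) set \<Rightarrow> l2 set" where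
  "eigvecs H A = {x \<in> H. x \<noteq> 0 \<and> (\<forall>T\<in>A. \<exists>c. T x = c *\<^sub>C x)}"

lemma eigvecs_unitary:
  assumes U: "unitary_on H H U" and H: "\<And>c x. x \<in> H \<Longrightarrow> c *\<^sub>C x \<in> H" and x: "x \<in> H"
    and A: "\<And>T. T \<in> A \<Longrightarrow> T x \<in> H"
  shows "U x \<in> eigvecs H ((\<lambda>T. restrict (U \<circ> T \<circ> inv_into H U) H) ` A) \<longleftrightarrow> x \<in> eigvecs H A"
proof -
  have inj: "inj_on U H" and im: "U ` H = H" using U by (auto simp: unitary_on_def bij_betw_def)
  have UH: "U y \<in> H" if "y \<in> H" for y using im that by auto
  have sc: "U (c *\<^sub>C y) = c *\<^sub>C U y" if "y \<in> H" for c y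
    using U that by (auto simp: unitary_on_def complex_linear_on_def)
  have "l2_inner (U x) (U x) = l2_inner x x" using U x by (auto simp: unitary_on_def)
  then have "U x = 0 \<longleftrightarrow> x = 0" by (metis l2_inner_self_eq_0)
  moreover have "U (T x) = c *\<^sub>C U x \<longleftrightarrow> T x = c *\<^sub>C x" if "T \<in> A" for T c
    using inj_on_eq_iff[OF inj A[OF that] H[OF x]] sc[OF x] by simp
  ultimately show ?thesis
    using x UH[OF x] by (simp add: eigvecs_def inv_into_f_f[OF inj x])
qed

context clark
begin

lemma mu_sets: "S \<in> sets borel \<Longrightarrow> S \<subseteq> sphere 0 1 \<Longrightarrow> S \<in> sets \<mu>"
  by (simp add: mu(2) sets_restrict_space_iff)

lemma atoms_iff: "\<zeta> \<in> atoms \<mu> \<longleftrightarrow> cmod \<zeta> = 1 \<and> measure \<mu> {\<zeta>} > 0"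
proof -
  interpret finite_measure \<mu> by (rule mu(1))
  show ?thesis by (simp add: atoms_def space_mu emeasure_eq_measure)
qed

lemma countable_atoms: "countable (atoms \<mu>)"
proof -
  interpret finite_measure \<mu> by (rule mu(1))
  show ?thesis
    by (rule countable_subset[OF _ countable_support]) (auto simp: atoms_iff)
qed

lemma atoms_sets: "atoms \<mu> \<in> sets \<mu>"
proof (rule mu_sets)
  show "atoms \<mu> \<in> sets borel"
    using countable_atoms by (rule sets.countable[rotated]) auto
qed (auto simp: atoms_iff)

lemma atom_sets: "\<zeta> \<in> atoms \<mu> \<Longrightarrow> {\<zeta>} \<in> sets \<mu>"
  by (rule mu_sets) (auto simp: atoms_iff)

lemma sqi_indicator: "S \<in> sets \<mu> \<Longrightarrow> sqi \<mu> (indicator S)"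
  by (rule sqi_bounded[OF mu(1), of _ 1]) (auto simp: indicator_def)

lemma AE_atoms: "AE t in \<mu>. P t \<Longrightarrow> \<zeta> \<in> atoms \<mu> \<Longrightarrow> P \<zeta>"
proof (rule ccontr)
  assume P: "AE t in \<mu>. P t" and z: "\<zeta> \<in> atoms \<mu>" and n: "\<not> P \<zeta>"
  have "AE t in \<mu>. t \<notin> {\<zeta>}" using P n by (auto elim: eventually_mono)
  then have "emeasure \<mu> {\<zeta>} = 0" using AE_iff_measurable[of "{\<zeta>}" \<mu> "\<lambda>t. t \<notin> {\<zeta>}"] atom_sets[OF z] z
    by (auto simp: space_mu atoms_iff)
  then show False using z by (simp add: atoms_def)
qed

lemma AE_atoms_iff:
  assumes "emeasure \<mu> (space \<mu> - atoms \<mu>) = 0" "\<And>\<zeta>. \<zeta> \<in> atoms \<mu> \<Longrightarrow> P \<zeta>"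
  shows "AE t in \<mu>. P t"
proof (rule AE_I')
  show "space \<mu> - atoms \<mu> \<in> null_sets \<mu>" using assms(1) atoms_sets by (intro null_setsI) auto
  show "{x \<in> space \<mu>. \<not> P x} \<subseteq> space \<mu> - atoms \<mu>" using assms(2) by auto
qed

lemma W_eq_0: "sqi \<mu> g \<Longrightarrow> W g = 0 \<longleftrightarrow> (AE t in \<mu>. g t = 0)"
proof -
  assume g: "sqi \<mu> g"
  have "W (\<lambda>t. 0 * g t) = 0 *\<^sub>C W g" by (rule W_scale[OF g])
  moreover have "l2_inner (0 *\<^sub>C W g) (0 *\<^sub>C W g) = 0" by (simp add: l2_inner_scale)
  ultimately have "W (\<lambda>_. 0) = 0" by (simp add: l2_inner_self_eq_0)
  then show ?thesis using W_eq_iff[OF g, of "\<lambda>_. 0"] sqi_scale[OF g, of 0] by simp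
qed

abbreviation "evt \<zeta> \<equiv> W (indicator {\<zeta>})"

text \<open>The coordinate multiplier alone forces the transform of an eigenvector to live where the
  coordinate equals the eigenvalue, that is at a single point, which must carry mass. Conversely
  every multiplier acts on such a vector as its value at the atom.\<close>

lemma eigvecs_sedlock: "eigvecs KK (sedlock \<Theta> a) = {c *\<^sub>C evt \<zeta> | c \<zeta>. \<zeta> \<in> atoms \<mu> \<and> c \<noteq> 0}"
proof (intro equalityI subsetI)
  fix x assume "x \<in> eigvecs KK (sedlock \<Theta> a)"
  then have x: "x \<in> KK" "x \<noteq> 0" and e: "\<And>h. bdd h \<Longrightarrow> \<exists>c. MO h x = c *\<^sub>C x"
    by (auto simp: eigvecs_def sedlock_eq)
  \<comment> \<open>The coordinate function, cut off outside the circle because \<open>bdd\<close>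
    asks for a bound on the whole plane.\<close>
  define h where "h t = (if cmod t = 1 then t else 0)" for t :: complex
  have "h \<in> borel_measurable borel" unfolding h_def by measurable
  then have h: "bdd h" unfolding bdd_def
    by (intro conjI mu_borel exI[of _ 1] allI) (auto simp: h_def)
  obtain c where "MO h x = c *\<^sub>C x" using e[OF h] by blast
  then have "MO h (W (V x)) = W (\<lambda>t. c * V x t)" using x by (simp add: W_V W_scale V_sqi)
  then have "W (\<lambda>t. h t * V x t) = W (\<lambda>t. c * V x t)" using MO_W[OF h V_sqi[OF x(1)]] by simp
  then have "AE t in \<mu>. h t * V x t = c * V x t"
    by (subst (asm) W_eq_iff) (intro bdd_sqi[OF h] sqi_scale V_sqi x)+
  then have *: "AE t in \<mu>. V x t \<noteq> 0 \<longrightarrow> t = c"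
    using AE_space by eventually_elim (auto simp: h_def space_mu)
  have "\<not> (AE t in \<mu>. V x t = 0)" using x W_eq_0[OF V_sqi[OF x(1)]] by (simp add: W_V)
  then have c: "c \<in> atoms \<mu>" "V x c \<noteq> 0"
  proof -
    show "c \<in> atoms \<mu>"
    proof (rule ccontr)
      assume n: "c \<notin> atoms \<mu>"
      have "AE t in \<mu>. t \<noteq> c"
      proof (cases "cmod c = 1")
        case True
        then have "{c} \<in> sets \<mu>" by (intro mu_sets) auto
        moreover have "emeasure \<mu> {c} = 0" using n True by (auto simp: atoms_def space_mu)
        ultimately show ?thesis by (intro AE_I'[of "{c}"]) auto
      qed (use AE_space in \<open>auto simp: space_mu elim!: eventually_mono\<close>)
      then have "AE t in \<mu>. V x t = 0" using * by eventually_elim auto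
      then show False using \<open>\<not> (AE t in \<mu>. V x t = 0)\<close> by simp
    qed
    show "V x c \<noteq> 0"
    proof
      assume "V x c = 0"
      then have "AE t in \<mu>. V x t = 0" using * by (auto elim!: eventually_mono)
      then show False using \<open>\<not> (AE t in \<mu>. V x t = 0)\<close> by simp
    qed
  qed
  have "W (V x) = W (\<lambda>t. V x c * indicator {c} t)"
  proof (intro W_cong V_sqi x sqi_scale sqi_indicator atom_sets c)
    show "AE t in \<mu>. V x t = V x c * indicator {c} t"
      using * by eventually_elim (auto simp: indicator_def)
  qed
  then have "x = V x c *\<^sub>C evt c"
    using W_scale[OF sqi_indicator[OF atom_sets[OF c(1)]]] by (simp add: W_V x)
  then show "x \<in> {c *\<^sub>C evt \<zeta> | c \<zeta>. \<zeta> \<in> atoms \<mu> \<and> c \<noteq> 0}" using c by blast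
next
  fix x assume "x \<in> {c *\<^sub>C evt \<zeta> | c \<zeta>. \<zeta> \<in> atoms \<mu> \<and> c \<noteq> 0}"
  then obtain c \<zeta> where x: "x = c *\<^sub>C evt \<zeta>" "\<zeta> \<in> atoms \<mu>" "c \<noteq> 0" by blast
  have s: "sqi \<mu> (indicator {\<zeta>})" by (intro sqi_indicator atom_sets x)
  have xW: "x = W (\<lambda>t. c * indicator {\<zeta>} t)" using W_scale[OF s] x by simp
  have s': "sqi \<mu> (\<lambda>t. c * indicator {\<zeta>} t)" by (rule sqi_scale[OF s])
  have "x \<noteq> 0"
    using W_eq_0[OF s'] AE_atoms[of "\<lambda>t. c * indicator {\<zeta>} t = 0", OF _ x(2)] x(3) xW by auto
  moreover have "MO h x = h \<zeta> *\<^sub>C x" if h: "bdd h" for h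
  proof -
    have "MO h x = W (\<lambda>t. h t * (c * indicator {\<zeta>} t))" unfolding xW by (rule MO_W[OF h s'])
    also have "(\<lambda>t. h t * (c * indicator {\<zeta>} t)) = (\<lambda>t. h \<zeta> * (c * indicator {\<zeta>} t))"
      by (auto simp: indicator_def)
    finally show ?thesis using W_scale[OF s'] xW by simp
  qed
  moreover have "x \<in> KK" unfolding xW by (rule W_KK[OF s'])
  ultimately show "x \<in> eigvecs KK (sedlock \<Theta> a)" by (auto simp: eigvecs_def sedlock_eq)
qed

lemma ev_KK: "\<zeta> \<in> atoms \<mu> \<Longrightarrow> evt \<zeta> \<in> KK"
  by (intro W_KK sqi_indicator atom_sets)

lemma ev_inner:
  assumes "\<zeta> \<in> atoms \<mu>" "\<zeta>' \<in> atoms \<mu>"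
  shows "l2_inner (evt \<zeta>) (evt \<zeta>') = 0 \<longleftrightarrow> \<zeta> \<noteq> \<zeta>'"
proof (cases "\<zeta> = \<zeta>'")
  case True
  have "\<not> (AE t in \<mu>. indicator {\<zeta>} t = (0::complex))" using AE_atoms[OF _ assms(1)] by fastforce
  then show ?thesis
    using True W_eq_0[OF sqi_indicator[OF atom_sets[OF assms(1)]]] by (simp add: l2_inner_self_eq_0)
next
  case False
  have "l2_inner (evt \<zeta>) (evt \<zeta>') = ip \<mu> (indicator {\<zeta>}) (indicator {\<zeta>'})"
    by (intro W_ip sqi_indicator atom_sets assms)
  moreover have "(\<lambda>t. indicator {\<zeta>} t * cnj (indicator {\<zeta>'} t)) = (\<lambda>t. 0::complex)"
    using False by (auto simp: indicator_def)
  ultimately show ?thesis using False by (simp add: ip_def)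
qed

lemma evt_eigvec: "\<zeta> \<in> atoms \<mu> \<Longrightarrow> evt \<zeta> \<in> eigvecs KK (sedlock \<Theta> a)"
proof -
  assume z: "\<zeta> \<in> atoms \<mu>"
  have "1 *\<^sub>C evt \<zeta> \<in> eigvecs KK (sedlock \<Theta> a)" unfolding eigvecs_sedlock
    by (intro CollectI exI[of _ 1] exI[of _ \<zeta>]) (simp add: z)
  moreover have "1 *\<^sub>C evt \<zeta> = evt \<zeta>"
    unfolding W_scale[OF sqi_indicator[OF atom_sets[OF z]], symmetric] mult_1_left ..
  ultimately show ?thesis by (simp only:)
qed

text \<open>The indicator of the non-atomic part is orthogonal to all eigenvectors; conversely a
  vector orthogonal to them has a transform vanishing at every atom, so it is zero when the atoms
  carry all the mass. The right side is phrased in terms that a unitary preserves.\<close>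

lemma continuous_part:
  "emeasure \<mu> (space \<mu> - atoms \<mu>) \<noteq> 0 \<longleftrightarrow>
     (\<exists>x\<in>KK. x \<noteq> 0 \<and> (\<forall>e\<in>eigvecs KK (sedlock \<Theta> a). l2_inner x e = 0))"
proof
  let ?D = "space \<mu> - atoms \<mu>"
  assume n: "emeasure \<mu> ?D \<noteq> 0"
  have D: "?D \<in> sets \<mu>" using atoms_sets by auto
  note s = sqi_indicator[OF D]
  have "W (indicator ?D) \<noteq> 0"
  proof
    assume "W (indicator ?D) = 0"
    then have "AE t in \<mu>. indicator ?D t = (0::complex)" using W_eq_0[OF s] by simp
    then have "AE t in \<mu>. t \<notin> ?D" by (auto elim!: eventually_mono simp: indicator_def split: if_splits)
    then have "emeasure \<mu> ?D = 0" using AE_iff_measurable[of ?D \<mu> "\<lambda>t. t \<notin> ?D"] D by auto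
    then show False using n by simp
  qed
  moreover have "l2_inner (W (indicator ?D)) e = 0" if ee: "e \<in> eigvecs KK (sedlock \<Theta> a)" for e
  proof -
    obtain c \<zeta> where e: "e = c *\<^sub>C evt \<zeta>" "\<zeta> \<in> atoms \<mu>" using ee unfolding eigvecs_sedlock by blast
    have sz: "sqi \<mu> (indicator {\<zeta>})" by (intro sqi_indicator atom_sets e)
    have "l2_inner (W (indicator ?D)) e = ip \<mu> (indicator ?D) (\<lambda>t. c * indicator {\<zeta>} t)"
      unfolding e(1) W_scale[OF sz, symmetric] by (intro W_ip s sqi_scale sz)
    moreover have "(\<lambda>t. indicator ?D t * cnj (c * indicator {\<zeta>} t)) = (\<lambda>t. 0::complex)"
      using e by (auto simp: indicator_def)
    ultimately show ?thesis by (simp add: ip_def)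
  qed
  ultimately show "\<exists>x\<in>KK. x \<noteq> 0 \<and> (\<forall>e\<in>eigvecs KK (sedlock \<Theta> a). l2_inner x e = 0)"
    using W_KK[OF s] by blast
next
  assume "\<exists>x\<in>KK. x \<noteq> 0 \<and> (\<forall>e\<in>eigvecs KK (sedlock \<Theta> a). l2_inner x e = 0)"
  then obtain x where x: "x \<in> KK" "x \<noteq> 0" and o: "\<And>e. e \<in> eigvecs KK (sedlock \<Theta> a) \<Longrightarrow> l2_inner x e = 0"
    by blast
  show "emeasure \<mu> (space \<mu> - atoms \<mu>) \<noteq> 0"
  proof
    assume 0: "emeasure \<mu> (space \<mu> - atoms \<mu>) = 0"
    have "AE t in \<mu>. V x t = 0"
    proof (rule AE_atoms_iff[OF 0])
      fix \<zeta> assume z: "\<zeta> \<in> atoms \<mu>"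
      have sz: "sqi \<mu> (indicator {\<zeta>})" by (intro sqi_indicator atom_sets z)
      have "l2_inner (W (V x)) (evt \<zeta>) = 0" using o[OF evt_eigvec[OF z]] x by (simp add: W_V)
      then have "ip \<mu> (V x) (indicator {\<zeta>}) = 0" using W_ip[OF V_sqi[OF x(1)] sz] by simp
      moreover have "(\<lambda>t. V x t * cnj (indicator {\<zeta>} t)) = (\<lambda>t. V x \<zeta> * indicator {\<zeta>} t)"
        by (auto simp: indicator_def)
      moreover have "(\<integral>t. V x \<zeta> * indicator {\<zeta>} t \<partial>\<mu>) = V x \<zeta> * (\<integral>t. indicator {\<zeta>} t \<partial>\<mu>)"
        by (rule Bochner_Integration.integral_mult_right_zero)
      moreover have "(\<integral>t. indicator {\<zeta>} t \<partial>\<mu>) = complex_of_real (measure \<mu> {\<zeta>})"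
      proof -
        have "(\<integral>t. indicator {\<zeta>} t \<partial>\<mu>) = (\<integral>t. complex_of_real (indicator {\<zeta>} t) \<partial>\<mu>)"
          by (intro Bochner_Integration.integral_cong) (auto simp: indicator_def)
        then show ?thesis using z by (simp only: integral_complex_of_real) (simp add: space_mu atoms_iff)
      qed
      ultimately have "V x \<zeta> * complex_of_real (measure \<mu> {\<zeta>}) = 0" by (simp add: ip_def)
      then show "V x \<zeta> = 0" using z by (simp add: atoms_iff)
    qed
    then show False using W_eq_0[OF V_sqi[OF x(1)]] x by (simp add: W_V)
  qed
qed

end

text \<open>Eigenvectors of distinct atoms are orthogonal, those of one atom are nonzero multiples
  of each other; a map preserving inner products and eigenvectors therefore sends distinct atoms to
  distinct atoms. It is applied to the unitary and to its inverse.\<close>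

lemma atoms_injection:
  assumes A: "clark \<Theta> a \<mu>" and B: "clark \<Theta> b \<nu>"
    and U: "\<And>x y. x \<in> model_space \<Theta> \<Longrightarrow> y \<in> model_space \<Theta> \<Longrightarrow> l2_inner (U x) (U y) = l2_inner x y"
    and E: "\<And>x. x \<in> eigvecs (model_space \<Theta>) (sedlock \<Theta> a) \<Longrightarrow> U x \<in> eigvecs (model_space \<Theta>) (sedlock \<Theta> b)"
  obtains \<sigma> where "inj_on \<sigma> (atoms \<mu>)" "\<sigma> ` atoms \<mu> \<subseteq> atoms \<nu>"
proof -
  interpret A: clark \<Theta> a \<mu> by (rule A)
  interpret B: clark \<Theta> b \<nu> by (rule B)
  have "\<exists>\<zeta>'. \<zeta>' \<in> atoms \<nu> \<and> (\<exists>c. c \<noteq> 0 \<and> U (A.evt \<zeta>) = c *\<^sub>C B.evt \<zeta>')" if z: "\<zeta> \<in> atoms \<mu>" for \<zeta>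
  proof -
    have "U (A.evt \<zeta>) \<in> eigvecs (model_space \<Theta>) (sedlock \<Theta> b)" by (rule E[OF A.evt_eigvec[OF z]])
    then show ?thesis unfolding B.eigvecs_sedlock by blast
  qed
  then obtain \<sigma> where \<sigma>: "\<And>\<zeta>. \<zeta> \<in> atoms \<mu> \<Longrightarrow> \<sigma> \<zeta> \<in> atoms \<nu>"
      "\<And>\<zeta>. \<zeta> \<in> atoms \<mu> \<Longrightarrow> \<exists>c. c \<noteq> 0 \<and> U (A.evt \<zeta>) = c *\<^sub>C B.evt (\<sigma> \<zeta>)"
    by metis
  have "inj_on \<sigma> (atoms \<mu>)"
  proof (rule inj_onI, rule ccontr)
    fix y z assume yz: "y \<in> atoms \<mu>" "z \<in> atoms \<mu>" "\<sigma> y = \<sigma> z" "y \<noteq> z"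
    obtain c d where c: "c \<noteq> 0" "U (A.evt y) = c *\<^sub>C B.evt (\<sigma> y)" and d: "d \<noteq> 0" "U (A.evt z) = d *\<^sub>C B.evt (\<sigma> y)"
      using \<sigma>(2)[OF yz(1)] \<sigma>(2)[OF yz(2)] yz(3) by auto
    have "l2_inner (U (A.evt y)) (U (A.evt z)) = 0"
      using U[OF A.ev_KK A.ev_KK] A.ev_inner yz by simp
    then have "l2_inner (c *\<^sub>C B.evt (\<sigma> y)) (d *\<^sub>C B.evt (\<sigma> y)) = 0" using c d by simp
    then have "l2_inner (d *\<^sub>C B.evt (\<sigma> y)) (B.evt (\<sigma> y)) = 0"
      using c(1) l2_inner_cnj[of "B.evt (\<sigma> y)" "d *\<^sub>C B.evt (\<sigma> y)"] by (simp add: l2_inner_scale)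
    then have "l2_inner (B.evt (\<sigma> y)) (B.evt (\<sigma> y)) = 0" using d(1) by (simp add: l2_inner_scale)
    then show False using B.ev_inner[OF \<sigma>(1) \<sigma>(1)] yz by simp
  qed
  then show thesis using \<sigma>(1) by (intro that[of \<sigma>]) auto
qed

lemma kappa_invariant:
  assumes A: "clark \<Theta> a \<mu>" and B: "clark \<Theta> b \<nu>"
    and iso: "spatially_isomorphic (model_space \<Theta>) (sedlock \<Theta> a) (model_space \<Theta>) (sedlock \<Theta> b)"
  shows "kappa \<mu> = kappa \<nu>"
proof -
  interpret A: clark \<Theta> a \<mu> by (rule A)
  interpret B: clark \<Theta> b \<nu> by (rule B)
  let ?K = "model_space \<Theta>"
  obtain U where U: "unitary_on ?K ?K U" and S: "(\<lambda>T. restrict (U \<circ> T \<circ> inv_into ?K U) ?K) ` sedlock \<Theta> a = sedlock \<Theta> b"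
    using iso unfolding spatially_isomorphic_def by blast
  have inj: "inj_on U ?K" and im: "U ` ?K = ?K" using U by (auto simp: unitary_on_def bij_betw_def)
  have ip: "l2_inner (U x) (U y) = l2_inner x y" if "x \<in> ?K" "y \<in> ?K" for x y
    using U that by (auto simp: unitary_on_def)
  have K: "T x \<in> ?K" if "T \<in> sedlock \<Theta> a" "x \<in> ?K" for T x
    using that A.MO_bounded unfolding A.sedlock_eq by (auto simp: bounded_operators_def PiE_def Pi_def)
  have E: "U x \<in> eigvecs ?K (sedlock \<Theta> b) \<longleftrightarrow> x \<in> eigvecs ?K (sedlock \<Theta> a)" if "x \<in> ?K" for x
    unfolding S[symmetric]
  proof (rule eigvecs_unitary[OF U])
    show "c *\<^sub>C y \<in> ?K" if "y \<in> ?K" for c y by (rule A.KK_lin(2)[OF that])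
    show "x \<in> ?K" by (rule that)
    show "T x \<in> ?K" if "T \<in> sedlock \<Theta> a" for T by (rule K[OF that \<open>x \<in> ?K\<close>])
  qed
  have EK: "x \<in> ?K" if "x \<in> eigvecs ?K T" for x T using that by (simp add: eigvecs_def)
  let ?V = "inv_into ?K U"
  have V: "?V x \<in> ?K" "U (?V x) = x" if "x \<in> ?K" for x
    using that im by (auto intro: inv_into_into f_inv_into_f)
  obtain \<sigma> where \<sigma>: "inj_on \<sigma> (atoms \<mu>)" "\<sigma> ` atoms \<mu> \<subseteq> atoms \<nu>"
    by (rule atoms_injection[OF A B, of U]) (use ip E EK in auto)
  obtain \<tau> where \<tau>: "inj_on \<tau> (atoms \<nu>)" "\<tau> ` atoms \<nu> \<subseteq> atoms \<mu>"
  proof (rule atoms_injection[OF B A, of ?V])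
    show "l2_inner (?V x) (?V y) = l2_inner x y" if "x \<in> ?K" "y \<in> ?K" for x y
      using ip[of "?V x" "?V y"] V that by simp
    show "?V x \<in> eigvecs ?K (sedlock \<Theta> a)" if "x \<in> eigvecs ?K (sedlock \<Theta> b)" for x
      using E[of "?V x"] V[of x] EK that by simp
  qed blast
  have fin: "finite (atoms \<mu>) \<longleftrightarrow> finite (atoms \<nu>)"
    using inj_on_finite[OF \<sigma>] inj_on_finite[OF \<tau>] by blast
  have card: "card (atoms \<mu>) = card (atoms \<nu>)" if "finite (atoms \<mu>)"
    using card_inj_on_le[OF \<sigma>] card_inj_on_le[OF \<tau>] fin that by force
  have "(\<exists>x\<in>?K. x \<noteq> 0 \<and> (\<forall>e\<in>eigvecs ?K (sedlock \<Theta> a). l2_inner x e = 0)) \<longleftrightarrow>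
    (\<exists>x\<in>?K. x \<noteq> 0 \<and> (\<forall>e\<in>eigvecs ?K (sedlock \<Theta> b). l2_inner x e = 0))" (is "(\<exists>x\<in>?K. ?P x) \<longleftrightarrow> (\<exists>x\<in>?K. ?Q x)")
  proof -
    have PQ: "?P x \<longleftrightarrow> ?Q (U x)" if x: "x \<in> ?K" for x
    proof -
      have "U x = 0 \<longleftrightarrow> x = 0" using ip[OF x x] by (metis l2_inner_self_eq_0)
      moreover have "(\<forall>e\<in>eigvecs ?K (sedlock \<Theta> a). l2_inner x e = 0) \<longleftrightarrow> (\<forall>e\<in>eigvecs ?K (sedlock \<Theta> b). l2_inner (U x) e = 0)"
      proof (intro iffI ballI)
        fix e assume *: "\<forall>e\<in>eigvecs ?K (sedlock \<Theta> a). l2_inner x e = 0" "e \<in> eigvecs ?K (sedlock \<Theta> b)"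
        have e: "e \<in> ?K" by (rule EK[OF *(2)])
        then have "?V e \<in> eigvecs ?K (sedlock \<Theta> a)" using E[of "?V e"] V[OF e] *(2) by simp
        then show "l2_inner (U x) e = 0" using * ip[OF x V(1)[OF e]] V(2)[OF e] by simp
      next
        fix e assume *: "\<forall>e\<in>eigvecs ?K (sedlock \<Theta> b). l2_inner (U x) e = 0" "e \<in> eigvecs ?K (sedlock \<Theta> a)"
        have e: "e \<in> ?K" by (rule EK[OF *(2)])
        then show "l2_inner x e = 0" using * ip[OF x e] E[OF e] by simp
      qed
      ultimately show ?thesis by simp
    qed
    have "(\<exists>x\<in>?K. ?Q x) \<longleftrightarrow> (\<exists>x\<in>U ` ?K. ?Q x)" unfolding im ..
    also have "\<dots> \<longleftrightarrow> (\<exists>x\<in>?K. ?P x)" using PQ by auto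
    finally show ?thesis ..
  qed
  then have "emeasure \<mu> (space \<mu> - atoms \<mu>) = 0 \<longleftrightarrow> emeasure \<nu> (space \<nu> - atoms \<nu>) = 0"
    using A.continuous_part B.continuous_part by blast
  then show ?thesis using fin card by (simp add: kappa_def)
qed

section \<open>Isomorphism of measures on the circle\<close>

text \<open>Without atoms the distribution function is continuous: it is at most \<open>u\<close> to
  the left of the quantile, so also at it, while the pseudoinverse property gives the other
  inequality.\<close>

lemma cdf_quantile:
  assumes N: "real_distribution N" and at: "\<And>x. measure N {x} = 0" and u: "0 < u" "u < 1"
  shows "cdf N (Inf {x. u \<le> cdf N x}) = u"
proof -
  interpret cdf_distribution N by (rule cdf_distribution.intro[OF N])
  define i where "i = I u"
  have le: "u \<le> C x \<longleftrightarrow> i \<le> x" for x unfolding i_def by (rule pseudoinverse[OF u])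
  have "isCont C i" using isCont_cdf at by simp
  then have "(C \<longlongrightarrow> C i) (at_left i)"
    unfolding isCont_def by (rule filterlim_mono[OF _ order_refl at_le]) simp
  moreover have "C x \<le> u" if "x < i" for x
    using le[of x] that by linarith
  then have "\<forall>\<^sub>F x in at_left i. C x \<le> u" by (auto simp: eventually_at_filter)
  ultimately have "C i \<le> u" by (rule tendsto_upperbound) simp
  then show ?thesis using le[of i] unfolding i_def[symmetric] by simp
qed

text \<open>Both measures are images of Lebesgue measure under their quantile functions, which are
  inverted by the distribution functions because there are no atoms.\<close>

lemma atomless_real_isomorphism:
  assumes N: "real_distribution N" "\<And>x. measure N {x} = 0"
    and N': "real_distribution N'" "\<And>x. measure N' {x} = 0"
  obtains T T' where "T \<in> borel_measurable borel" "T' \<in> borel_measurable borel"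
    "distr N' borel T = N" "AE y in N'. T' (T y) = y"
proof -
  interpret N: cdf_distribution N by (rule cdf_distribution.intro[OF N(1)])
  interpret N': cdf_distribution N' by (rule cdf_distribution.intro[OF N'(1)])
  let ?L = "restrict_space lborel {0<..<1::real}"
  have q: "N.C (N.I u) = u" "N'.C (N'.I u) = u" if "0 < u" "u < 1" for u
    using cdf_quantile[OF N that] cdf_quantile[OF N' that] by auto
  \<comment> \<open>The quantile function is meaningful on the open unit interval; extended by 0 it
    is Borel on the line and can be composed with a distribution function.\<close>
  define J where "J u = (if u \<in> {0<..<1} then N.I u else 0)" for u
  define J' where "J' u = (if u \<in> {0<..<1} then N'.I u else 0)" for u
  have JL: "N.I \<in> borel_measurable ?L" "N'.I \<in> borel_measurable ?L"
    using N.measurable_CI N'.measurable_CI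
    by (auto simp: sets_restrict_space cong: measurable_cong_sets)
  have [measurable]: "J \<in> borel_measurable borel" "J' \<in> borel_measurable borel"
    unfolding J_def J'_def
    by (subst borel_measurable_restrict_space_iff[symmetric]
          | rule measurable_restrict_space_iff[THEN iffD1, rotated 2, OF N.measurable_CI]
          | rule measurable_restrict_space_iff[THEN iffD1, rotated 2, OF N'.measurable_CI]
          | simp)+
  define T where "T y = J (N'.C y)" for y
  define T' where "T' x = J' (N.C x)" for x
  have T[measurable]: "T \<in> borel_measurable borel" "T' \<in> borel_measurable borel"
    unfolding T_def T'_def by measurable
  have TI: "T (N'.I u) = N.I u" "T' (N.I u) = N'.I u" if "0 < u" "u < 1" for u
    using that by (simp_all add: T_def T'_def J_def J'_def q)
  have "distr N' borel T = distr (distr ?L borel N'.I) borel T" by (simp only: N'.distr_I_eq_M)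
  also have "\<dots> = distr ?L borel (T \<circ> N'.I)" by (rule distr_distr[OF T(1) JL(2)])
  also have "\<dots> = distr ?L borel N.I"
    by (intro distr_cong refl) (simp add: TI space_restrict_space)
  also have "\<dots> = N" by (rule N.distr_I_eq_M)
  finally have d: "distr N' borel T = N" .
  \<comment> \<open>\<open>T'\<close> inverts \<open>T\<close> on the values of the quantile
    function. These have full measure but may miss points, so the identity is obtained almost
    everywhere.\<close>
  have "AE u in ?L. T' (T (N'.I u)) = N'.I u"
    by (rule AE_I2) (simp add: TI space_restrict_space)
  then have "AE y in distr ?L borel N'.I. T' (T y) = y"
    by (subst AE_distr_iff[OF JL(2)]) measurable
  then have "AE y in N'. T' (T y) = y" by (simp only: N'.distr_I_eq_M)
  then show thesis using T d by (intro that)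
qed

text \<open>The closed upper half circle goes to [-1, 1] by the real part and the open lower half to
  (2, 4) by \<open>3 - Re x\<close>; the ranges are disjoint, so \<open>s\<close> is injective.
  \<open>u\<close> takes the default value 1 wherever the formula for the inverse leaves the
  circle.\<close>

lemma circle_chart:
  obtains s :: "complex \<Rightarrow> real" and u :: "real \<Rightarrow> complex" where "s \<in> borel_measurable borel"
    "u \<in> measurable borel (restrict_space borel (sphere 0 1))" "\<And>x. cmod x = 1 \<Longrightarrow> u (s x) = x"
proof -
  define s where "s x = (if Im x \<ge> 0 then Re x else 3 - Re x)" for x
  define v where "v t = (if t \<le> 1 then Complex t (sqrt (1 - t\<^sup>2)) else Complex (3 - t) (- sqrt (1 - (3 - t)\<^sup>2)))" for t
  define u where "u t = (if cmod (v t) = 1 then v t else 1)" for t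
  have C: "Complex p q = of_real p + \<i> * of_real q" for p q by (simp add: Complex_eq)
  have s: "s \<in> borel_measurable borel" unfolding s_def by measurable
  have [measurable]: "v \<in> borel_measurable borel" unfolding v_def C by measurable
  have u: "u \<in> measurable borel (restrict_space borel (sphere 0 1))"
  proof (rule measurable_restrict_space2)
    show "u \<in> space borel \<rightarrow> sphere 0 1" by (auto simp: u_def)
    show "u \<in> borel_measurable borel" unfolding u_def by measurable
  qed
  have "u (s x) = x" if x: "cmod x = 1" for x
  proof -
    have sq: "(Re x)\<^sup>2 + (Im x)\<^sup>2 = 1" using cmod_power2[of x] x by simp
    then have r: "sqrt (1 - (Re x)\<^sup>2) = \<bar>Im x\<bar>" by (metis add_diff_cancel_left' real_sqrt_abs)
    have "v (s x) = x"
    proof (cases "Im x \<ge> 0")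
      case True
      moreover have "Re x \<le> 1" using complex_Re_le_cmod[of x] x by simp
      ultimately show ?thesis using r by (simp add: v_def s_def complex_eq_iff)
    next
      case False
      moreover have "\<not> 3 - Re x \<le> 1" using complex_Re_le_cmod[of x] x by simp
      ultimately show ?thesis using r by (simp add: v_def s_def complex_eq_iff)
    qed
    then show ?thesis using x by (simp add: u_def)
  qed
  then show thesis using s u by (intro that)
qed

lemma atomless_circle_isomorphism:
  assumes P: "prob_space P" "sets P = sets (restrict_space borel (sphere 0 1))" "\<And>x. cmod x = 1 \<Longrightarrow> measure P {x} = 0"
    and Q: "prob_space Q" "sets Q = sets (restrict_space borel (sphere 0 1))" "\<And>x. cmod x = 1 \<Longrightarrow> measure Q {x} = 0"
  obtains \<tau> \<tau>' where "\<tau> \<in> measurable Q P" "\<tau>' \<in> measurable P Q" "distr Q P \<tau> = P" "AE y in Q. \<tau>' (\<tau> y) = y"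
proof -
  obtain s :: "complex \<Rightarrow> real" and u where s: "s \<in> borel_measurable borel"
    and u: "u \<in> measurable borel (restrict_space borel (sphere 0 1))" and us: "\<And>x. cmod x = 1 \<Longrightarrow> u (s x) = x"
  proof (rule circle_chart, goal_cases)
    case (1 s u) show ?case by (rule 1(1)[OF 1(2,3,4)])
  qed
  have sp: "space P = sphere 0 1" "space Q = sphere 0 1" using circle_space P(2) Q(2) by auto
  have sm: "s \<in> borel_measurable P" "s \<in> borel_measurable Q"
    using circle_measurable_borel[OF P(2) s] circle_measurable_borel[OF Q(2) s] by auto
  have um: "u \<in> measurable borel P" "u \<in> measurable borel Q"
    using u P(2) Q(2) by (simp_all cong: measurable_cong_sets)
  have rd: "real_distribution (distr R borel s) \<and> (\<forall>t. measure (distr R borel s) {t} = 0)"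
    if R: "prob_space R" "s \<in> borel_measurable R" "space R = sphere 0 1" "\<And>x. cmod x = 1 \<Longrightarrow> measure R {x} = 0" for R
  proof (intro conjI allI)
    interpret R: prob_space R by (rule R(1))
    show "real_distribution (distr R borel s)"
      by (intro real_distribution.intro R.prob_space_distr R(2) real_distribution_axioms.intro) auto
    show "measure (distr R borel s) {t} = 0" for t
    proof (cases "\<exists>x. cmod x = 1 \<and> s x = t")
      case True
      then obtain x where x: "cmod x = 1" "s x = t" by blast
      have "s -` {t} \<inter> space R = {x}"
      proof (intro equalityI subsetI)
        fix y assume "y \<in> s -` {t} \<inter> space R"
        then have y: "cmod y = 1" and sy: "s y = t" by (simp_all add: R(3))
        have "y = x" using us[OF y] us[OF x(1)] unfolding sy x(2) by (rule trans[OF sym])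
        then show "y \<in> {x}" by simp
      qed (use x R(3) in auto)
      then show ?thesis using R(4)[OF x(1)] by (simp add: measure_distr R(2))
    next
      case False
      then have "s -` {t} \<inter> space R = {}" using R(3) by auto
      then show ?thesis by (simp add: measure_distr R(2))
    qed
  qed
  let ?N = "distr P borel s" and ?N' = "distr Q borel s"
  obtain T T' where T: "T \<in> borel_measurable borel" "T' \<in> borel_measurable borel"
    "distr ?N' borel T = ?N" "AE y in ?N'. T' (T y) = y"
    using atomless_real_isomorphism[of ?N ?N'] rd[OF P(1) sm(1) sp(1) P(3)] rd[OF Q(1) sm(2) sp(2) Q(3)]
    by blast
  define \<tau> where "\<tau> = u \<circ> (T \<circ> s)"
  define \<tau>' where "\<tau>' = u \<circ> (T' \<circ> s)"
  have Ts: "T \<circ> s \<in> borel_measurable Q" "T' \<circ> s \<in> borel_measurable P"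
    using T sm by (auto intro: measurable_comp)
  have \<tau>: "\<tau> \<in> measurable Q P" "\<tau>' \<in> measurable P Q"
    unfolding \<tau>_def \<tau>'_def using Ts um by (auto intro: measurable_comp)
  have dT: "distr Q borel (T \<circ> s) = ?N" using distr_distr[OF T(1) sm(2)] T(3) by simp
  have "distr Q P \<tau> = distr (distr Q borel (T \<circ> s)) P u"
    unfolding \<tau>_def by (rule distr_distr[symmetric, OF um(1) Ts(1)])
  also have "\<dots> = distr P P (u \<circ> s)" unfolding dT by (rule distr_distr[OF um(1) sm(1)])
  also have "\<dots> = distr P P (\<lambda>x. x)" by (intro distr_cong refl) (simp add: us sp)
  also have "\<dots> = P" by (rule distr_id2) simp
  finally have d: "distr Q P \<tau> = P" .
  have ub: "u \<in> borel_measurable borel" using measurable_restrict_space2_iff[of u borel borel "sphere 0 1"] u by simp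
  \<comment> \<open>\<open>u\<close> inverts \<open>s\<close> on the circle, but
    \<open>\<tau>'\<close> applied after \<open>\<tau>\<close> also meets \<open>s\<close> after
    \<open>u\<close>. That composition is the identity on the range of \<open>s\<close>, which has
    full measure for the image of \<open>P\<close>.\<close>
  have "AE x in P. s (u (s x)) = s x" by (rule AE_I2) (simp add: us sp)
  moreover have "{t \<in> space borel. s (u t) = t} \<in> sets borel"
    by (rule borel_measurable_eq[OF measurable_compose[OF ub s] measurable_ident_sets[OF refl]])
  ultimately have "AE t in ?N. s (u t) = t"
    by (subst AE_distr_iff[OF sm(1)])
  then have "AE y in Q. s (u ((T \<circ> s) y)) = (T \<circ> s) y"
    by (intro AE_distrD[OF Ts(1)]) (simp only: dT)
  moreover have "AE y in Q. T' (T (s y)) = s y" by (rule AE_distrD[OF sm(2) T(4)])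
  ultimately have "AE y in Q. \<tau>' (\<tau> y) = y"
    using AE_space by eventually_elim (simp add: \<tau>_def \<tau>'_def us sp)
  then show thesis using \<tau> d by (intro that)
qed

lemma atoms_measure: "\<zeta> \<in> space \<mu> \<Longrightarrow> finite_measure \<mu> \<Longrightarrow> \<zeta> \<notin> atoms \<mu> \<Longrightarrow> measure \<mu> {\<zeta>} = 0"
  by (auto simp: atoms_def finite_measure.emeasure_eq_measure not_less measure_le_0_iff)

text \<open>The atomless parts are normalised to probability measures; \<open>k\<close> is the ratio
  of their masses. The maps are total on the circle but are controlled only off the atoms, where
  they will be used.\<close>

lemma continuous_part_isomorphism:
  assumes \<mu>: "finite_measure \<mu>" "sets \<mu> = sets (restrict_space borel (sphere 0 1))" "atoms \<mu> \<in> sets \<mu>"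
    and \<nu>: "finite_measure \<nu>" "sets \<nu> = sets (restrict_space borel (sphere 0 1))" "atoms \<nu> \<in> sets \<nu>"
    and iff: "emeasure \<mu> (space \<mu> - atoms \<mu>) = 0 \<longleftrightarrow> emeasure \<nu> (space \<nu> - atoms \<nu>) = 0"
  obtains \<tau> \<tau>' and k :: real where "\<tau> \<in> measurable \<nu> \<mu>" "\<tau>' \<in> measurable \<mu> \<nu>" "k > 0"
    "AE y in \<nu>. y \<notin> atoms \<nu> \<longrightarrow> \<tau> y \<notin> atoms \<mu> \<and> \<tau>' (\<tau> y) = y"
    "\<And>S. S \<in> sets \<mu> \<Longrightarrow> k * measure \<nu> (\<tau> -` S \<inter> (space \<nu> - atoms \<nu>)) = measure \<mu> (S - atoms \<mu>)"
proof -
  interpret M: finite_measure \<mu> by (rule \<mu>(1))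
  interpret N: finite_measure \<nu> by (rule \<nu>(1))
  have sp: "space \<mu> = sphere 0 1" "space \<nu> = sphere 0 1" using circle_space \<mu>(2) \<nu>(2) by auto
  let ?D = "space \<mu> - atoms \<mu>" and ?E = "space \<nu> - atoms \<nu>"
  have D: "?D \<in> sets \<mu>" and E: "?E \<in> sets \<nu>" using \<mu>(3) \<nu>(3) by auto
  show thesis
  proof (cases "emeasure \<mu> ?D = 0")
    case True
    then have nE: "?E \<in> null_sets \<nu>" using iff E by (intro null_setsI) auto
    have nD: "?D \<in> null_sets \<mu>" using True D by (intro null_setsI) auto
    show thesis
    \<comment> \<open>With no continuous part on either side all conditions concern null sets, so
      constant maps to the point 1 of the circle serve.\<close>
    proof (rule that[of "\<lambda>_. 1" "\<lambda>_. 1" 1])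
      show "AE y in \<nu>. y \<notin> atoms \<nu> \<longrightarrow> 1 \<notin> atoms \<mu> \<and> 1 = y"
        by (rule AE_I'[OF nE]) auto
      fix S assume S: "S \<in> sets \<mu>"
      have "S - atoms \<mu> \<in> null_sets \<mu>"
        using S \<mu>(3) sets.sets_into_space[OF S] by (intro null_sets_subset[OF nD]) auto
      moreover have "(\<lambda>_. 1) -` S \<inter> ?E \<in> null_sets \<nu>"
        using nE by (cases "1 \<in> S") auto
      ultimately show "1 * measure \<nu> ((\<lambda>_. 1) -` S \<inter> ?E) = measure \<mu> (S - atoms \<mu>)"
        by (simp add: measure_eq_0_null_sets)
    qed (auto simp: sp)
  next
    case False
    have pos: "emeasure \<mu> ?D \<noteq> 0" "emeasure \<mu> ?D < \<infinity>" "emeasure \<nu> ?E \<noteq> 0" "emeasure \<nu> ?E < \<infinity>"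
      using False iff by (auto simp: less_top[symmetric])
    let ?P = "uniform_measure \<mu> ?D" and ?Q = "uniform_measure \<nu> ?E"
    have pP: "prob_space ?P" "prob_space ?Q" using pos by (auto intro!: prob_space_uniform_measure simp: less_top)
    have mP: "measure ?P S = measure \<mu> (?D \<inter> S) / measure \<mu> ?D" if "S \<in> sets \<mu>" for S
      using that pos by (intro measure_uniform_measure) auto
    have mQ: "measure ?Q S = measure \<nu> (?E \<inter> S) / measure \<nu> ?E" if "S \<in> sets \<nu>" for S
      using that pos by (intro measure_uniform_measure) auto
    have sing: "{x} \<in> sets \<mu>" "{x} \<in> sets \<nu>" if "cmod x = 1" for x
      using that by (auto simp: \<mu>(2) \<nu>(2) sets_restrict_space_iff)
    have aP: "measure ?P {x} = 0" if x: "cmod x = 1" for x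
    proof (cases "x \<in> atoms \<mu>")
      case True
      then have "?D \<inter> {x} = {}" by auto
      then show ?thesis by (simp add: mP[OF sing(1)[OF x]])
    next
      case False
      then have "?D \<inter> {x} = {x}" "measure \<mu> {x} = 0" using x atoms_measure[of x \<mu>] \<mu>(1) by (auto simp: sp)
      then show ?thesis by (simp add: mP[OF sing(1)[OF x]])
    qed
    have aQ: "measure ?Q {x} = 0" if x: "cmod x = 1" for x
    proof (cases "x \<in> atoms \<nu>")
      case True
      then have "?E \<inter> {x} = {}" by auto
      then show ?thesis by (simp add: mQ[OF sing(2)[OF x]])
    next
      case False
      then have "?E \<inter> {x} = {x}" "measure \<nu> {x} = 0" using x atoms_measure[of x \<nu>] \<nu>(1) by (auto simp: sp)
      then show ?thesis by (simp add: mQ[OF sing(2)[OF x]])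
    qed
    obtain \<tau> \<tau>' where t: "\<tau> \<in> measurable ?Q ?P" "\<tau>' \<in> measurable ?P ?Q" "distr ?Q ?P \<tau> = ?P" "AE y in ?Q. \<tau>' (\<tau> y) = y"
    proof (rule atomless_circle_isomorphism[of ?P ?Q], goal_cases)
      case 1 show ?case by (rule pP(1))
    next
      case 2 show ?case using \<mu>(2) by simp
    next
      case (3 x) show ?case by (rule aP[OF 3(2)])
    next
      case 4 show ?case by (rule pP(2))
    next
      case 5 show ?case using \<nu>(2) by simp
    next
      case (6 x) show ?case by (rule aQ[OF 6(2)])
    next
      case (7 \<tau> \<tau>') show ?case by (rule 7(1)[OF 7(2-5)])
    qed
    have tm: "\<tau> \<in> measurable \<nu> \<mu>" "\<tau>' \<in> measurable \<mu> \<nu>"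
      using t(1,2) by (simp_all cong: measurable_cong_sets)
    have "AE x in ?P. x \<notin> atoms \<mu>" using pos by (subst AE_uniform_measure) auto
    then have "AE y in ?Q. \<tau> y \<notin> atoms \<mu>" by (intro AE_distrD[OF t(1)]) (simp only: t(3))
    then have "AE y in ?Q. \<tau> y \<notin> atoms \<mu> \<and> \<tau>' (\<tau> y) = y" using t(4) by eventually_elim simp
    then have "AE y in \<nu>. y \<in> ?E \<longrightarrow> \<tau> y \<notin> atoms \<mu> \<and> \<tau>' (\<tau> y) = y"
      by (simp only: AE_uniform_measure[OF pos(3,4)])
    then have ae: "AE y in \<nu>. y \<notin> atoms \<nu> \<longrightarrow> \<tau> y \<notin> atoms \<mu> \<and> \<tau>' (\<tau> y) = y"
      by (rule AE_mp[OF _ AE_I2]) auto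
    have m0: "measure \<mu> ?D > 0" "measure \<nu> ?E > 0"
      using pos by (simp_all add: M.emeasure_eq_measure N.emeasure_eq_measure zero_less_measure_iff)
    show thesis
    proof (rule that[OF tm _ ae])
      show "measure \<mu> ?D / measure \<nu> ?E > 0" using m0 by simp
      fix S assume S: "S \<in> sets \<mu>"
      have tS: "\<tau> -` S \<inter> space \<nu> \<in> sets \<nu>" by (rule measurable_sets[OF tm(1) S])
      have "measure ?P S = measure (distr ?Q ?P \<tau>) S" by (simp only: t(3))
      also have "\<dots> = measure ?Q (\<tau> -` S \<inter> space \<nu>)" using S by (subst measure_distr[OF t(1)]) auto
      finally have "measure \<mu> (?D \<inter> S) / measure \<mu> ?D = measure \<nu> (?E \<inter> (\<tau> -` S \<inter> space \<nu>)) / measure \<nu> ?E"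
        by (simp only: mP[OF S] mQ[OF tS])
      moreover have "?D \<inter> S = S - atoms \<mu>" using sets.sets_into_space[OF S] by auto
      moreover have "?E \<inter> (\<tau> -` S \<inter> space \<nu>) = \<tau> -` S \<inter> ?E" by auto
      ultimately show "measure \<mu> ?D / measure \<nu> ?E * measure \<nu> (\<tau> -` S \<inter> ?E) = measure \<mu> (S - atoms \<mu>)"
        using m0 by (simp add: field_simps)
    qed
  qed
qed

lemma countable_bijection:
  assumes "countable A" "countable B" "finite A \<longleftrightarrow> finite B" "finite A \<Longrightarrow> card A = card B"
  obtains f where "bij_betw f A B"
proof (cases "finite A")
  case True
  then show thesis using assms finite_same_card_bij[of A B] that by blast
next
  case False
  have "bij_betw (inv_into UNIV (from_nat_into A)) A UNIV"
    using False assms(1) by (intro bij_betw_inv_into bij_betw_from_nat_into)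
  moreover have "bij_betw (from_nat_into B) UNIV B"
    using False assms by (intro bij_betw_from_nat_into) auto
  ultimately show thesis using that bij_betw_trans by blast
qed

text \<open>Glues a bijection of the atoms to the isomorphism of the continuous parts. The density
  \<open>w\<close> corrects the masses: it is the ratio of masses at each atom and the constant
  \<open>k\<close> elsewhere.\<close>

lemma clark_measure_isomorphism:
  assumes A: "clark \<Theta> a \<mu>" and B: "clark \<Theta> b \<nu>" and kappa: "kappa \<mu> = kappa \<nu>"
  obtains \<tau> \<tau>' and w :: "complex \<Rightarrow> real" where "\<tau> \<in> measurable \<nu> \<mu>" "\<tau>' \<in> measurable \<mu> \<nu>"
    "w \<in> borel_measurable \<nu>" "\<And>y. w y > 0" "distr (density \<nu> (\<lambda>y. ennreal (w y))) \<mu> \<tau> = \<mu>" "AE y in \<nu>. \<tau>' (\<tau> y) = y"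
proof -
  interpret A: clark \<Theta> a \<mu> by (rule A)
  interpret B: clark \<Theta> b \<nu> by (rule B)
  interpret M: finite_measure \<mu> by (rule A.mu(1))
  interpret N: finite_measure \<nu> by (rule B.mu(1))
  have z: "emeasure \<mu> (space \<mu> - atoms \<mu>) = 0 \<longleftrightarrow> emeasure \<nu> (space \<nu> - atoms \<nu>) = 0"
    using kappa by (auto simp: kappa_def split: if_splits)
  have f: "finite (atoms \<nu>) \<longleftrightarrow> finite (atoms \<mu>)" "finite (atoms \<nu>) \<Longrightarrow> card (atoms \<nu>) = card (atoms \<mu>)"
    using kappa by (auto simp: kappa_def split: if_splits)
  obtain \<beta> where \<beta>: "bij_betw \<beta> (atoms \<nu>) (atoms \<mu>)"
    using countable_bijection[OF B.countable_atoms A.countable_atoms f] by blast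
  have bm: "\<beta> y \<in> atoms \<mu>" if "y \<in> atoms \<nu>" for y using \<beta> that by (auto simp: bij_betw_def)
  obtain \<sigma> \<sigma>' and k :: real where \<sigma>: "\<sigma> \<in> measurable \<nu> \<mu>" "\<sigma>' \<in> measurable \<mu> \<nu>" "k > 0"
    "AE y in \<nu>. y \<notin> atoms \<nu> \<longrightarrow> \<sigma> y \<notin> atoms \<mu> \<and> \<sigma>' (\<sigma> y) = y"
    "\<And>S. S \<in> sets \<mu> \<Longrightarrow> k * measure \<nu> (\<sigma> -` S \<inter> (space \<nu> - atoms \<nu>)) = measure \<mu> (S - atoms \<mu>)"
    by (rule continuous_part_isomorphism[OF A.mu A.atoms_sets B.mu B.atoms_sets z]) (assumption | rule that)+
  define \<tau> where "\<tau> y = (if y \<in> atoms \<nu> then \<beta> y else \<sigma> y)" for y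
  define \<tau>' where "\<tau>' x = (if x \<in> atoms \<mu> then inv_into (atoms \<nu>) \<beta> x else \<sigma>' x)" for x
  define w where "w y = (if y \<in> atoms \<nu> then measure \<mu> {\<beta> y} / measure \<nu> {y} else k)" for y
  have tm: "\<tau> \<in> measurable \<nu> \<mu>"
    by (rule measurable_discrete_difference[OF \<sigma>(1) B.countable_atoms B.atom_sets])
       (use bm in \<open>auto simp: \<tau>_def A.atoms_iff A.space_mu\<close>)
  have inv: "inv_into (atoms \<nu>) \<beta> x \<in> atoms \<nu>" if "x \<in> atoms \<mu>" for x
    using \<beta> that by (metis bij_betw_imp_surj_on inv_into_into)
  have tm': "\<tau>' \<in> measurable \<mu> \<nu>"
    by (rule measurable_discrete_difference[OF \<sigma>(2) A.countable_atoms A.atom_sets])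
       (use inv in \<open>auto simp: \<tau>'_def B.atoms_iff B.space_mu\<close>)
  have wm: "w \<in> borel_measurable \<nu>"
    by (rule measurable_discrete_difference[OF _ B.countable_atoms B.atom_sets, of "\<lambda>_. k"]) (auto simp: w_def)
  have wpos: "w y > 0" for y
    using \<sigma>(3) bm by (auto simp: w_def A.atoms_iff B.atoms_iff)
  have "AE y in \<nu>. \<tau>' (\<tau> y) = y"
    using \<sigma>(4)
  proof (eventually_elim)
    fix y assume y: "y \<notin> atoms \<nu> \<longrightarrow> \<sigma> y \<notin> atoms \<mu> \<and> \<sigma>' (\<sigma> y) = y"
    show "\<tau>' (\<tau> y) = y"
    proof (cases "y \<in> atoms \<nu>")
      case True
      then show ?thesis using bm[OF True] bij_betw_inv_into_left[OF \<beta> True] by (simp add: \<tau>_def \<tau>'_def)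
    qed (use y in \<open>simp add: \<tau>_def \<tau>'_def\<close>)
  qed
  moreover have "distr (density \<nu> (\<lambda>y. ennreal (w y))) \<mu> \<tau> = \<mu>"
  proof (rule measure_eqI)
    let ?d = "density \<nu> (\<lambda>y. ennreal (w y))"
    fix S assume "S \<in> sets (distr ?d \<mu> \<tau>)"
    then have S: "S \<in> sets \<mu>" by simp
    have wm': "(\<lambda>y. ennreal (w y)) \<in> borel_measurable \<nu>" using wm by simp
    define X where "X = \<tau> -` S \<inter> space \<nu>"
    have X: "X \<in> sets \<nu>" unfolding X_def by (rule measurable_sets[OF tm S])
    have X12: "X \<inter> atoms \<nu> \<in> sets \<nu>" "X - atoms \<nu> \<in> sets \<nu>" using X B.atoms_sets by auto
    have X2: "X - atoms \<nu> = \<sigma> -` S \<inter> (space \<nu> - atoms \<nu>)" by (auto simp: X_def \<tau>_def)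
    have "emeasure ?d (X - atoms \<nu>) = (\<integral>\<^sup>+y. ennreal k * indicator (X - atoms \<nu>) y \<partial>\<nu>)"
      unfolding emeasure_density[OF wm' X12(2)]
      by (intro nn_integral_cong) (auto simp: w_def indicator_def)
    also have "\<dots> = ennreal k * emeasure \<nu> (X - atoms \<nu>)" by (rule nn_integral_cmult_indicator[OF X12(2)])
    also have "\<dots> = ennreal (k * measure \<nu> (X - atoms \<nu>))"
      using \<sigma>(3) by (simp add: N.emeasure_eq_measure ennreal_mult)
    also have "\<dots> = emeasure \<mu> (S - atoms \<mu>)" unfolding X2 \<sigma>(5)[OF S] by (simp add: M.emeasure_eq_measure)
    finally have e2: "emeasure ?d (X - atoms \<nu>) = emeasure \<mu> (S - atoms \<mu>)" .
    have sing: "emeasure ?d {y} = emeasure \<mu> {\<beta> y}" if y: "y \<in> atoms \<nu>" for y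
    proof -
      have "emeasure ?d {y} = (\<integral>\<^sup>+x. ennreal (w y) * indicator {y} x \<partial>\<nu>)"
        unfolding emeasure_density[OF wm' B.atom_sets[OF y]]
        by (intro nn_integral_cong) (auto simp: indicator_def)
      also have "\<dots> = ennreal (w y) * emeasure \<nu> {y}" by (rule nn_integral_cmult_indicator[OF B.atom_sets[OF y]])
      also have "\<dots> = ennreal (w y * measure \<nu> {y})"
        using wpos[of y] by (simp add: N.emeasure_eq_measure ennreal_mult)
      also have "w y * measure \<nu> {y} = measure \<mu> {\<beta> y}" using y by (simp add: w_def B.atoms_iff)
      finally show ?thesis by (simp add: M.emeasure_eq_measure)
    qed
    have cX: "countable (X \<inter> atoms \<nu>)" "countable (S \<inter> atoms \<mu>)" using A.countable_atoms B.countable_atoms by auto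
    have bij: "bij_betw \<beta> (X \<inter> atoms \<nu>) (S \<inter> atoms \<mu>)"
    proof (rule bij_betw_subset[OF \<beta>])
      have "X \<inter> atoms \<nu> = {y \<in> atoms \<nu>. \<beta> y \<in> S}" by (auto simp: X_def \<tau>_def B.space_mu B.atoms_iff)
      moreover have "\<beta> ` atoms \<nu> = atoms \<mu>" using \<beta> by (simp add: bij_betw_def)
      ultimately show "\<beta> ` (X \<inter> atoms \<nu>) = S \<inter> atoms \<mu>" by auto
    qed simp
    \<comment> \<open>Countability of the atoms turns both measures into sums over points, which
      \<open>\<beta>\<close> reindexes.\<close>
    have "emeasure ?d (X \<inter> atoms \<nu>) = (\<integral>\<^sup>+y. emeasure ?d {y} \<partial>count_space (X \<inter> atoms \<nu>))"
      by (rule emeasure_countable_singleton[OF _ cX(1)]) (simp add: B.atom_sets)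
    also have "\<dots> = (\<integral>\<^sup>+y. emeasure \<mu> {\<beta> y} \<partial>count_space (X \<inter> atoms \<nu>))"
      by (intro nn_integral_cong) (simp add: sing)
    also have "\<dots> = (\<integral>\<^sup>+x. emeasure \<mu> {x} \<partial>count_space (S \<inter> atoms \<mu>))"
      by (rule nn_integral_bij_count_space[OF bij])
    also have "\<dots> = emeasure \<mu> (S \<inter> atoms \<mu>)"
      by (rule emeasure_countable_singleton[symmetric, OF _ cX(2)]) (simp add: A.atom_sets)
    finally have e1: "emeasure ?d (X \<inter> atoms \<nu>) = emeasure \<mu> (S \<inter> atoms \<mu>)" .
    have td: "\<tau> \<in> measurable ?d \<mu>" using tm by (simp cong: measurable_cong_sets)
    have "emeasure (distr ?d \<mu> \<tau>) S = emeasure ?d X"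
      using emeasure_distr[OF td S] by (simp add: X_def)
    also have "\<dots> = emeasure ?d (X \<inter> atoms \<nu>) + emeasure ?d (X - atoms \<nu>)"
      using X12 by (subst plus_emeasure) (auto simp: Int_Diff_Un)
    also have "\<dots> = emeasure \<mu> (S \<inter> atoms \<mu>) + emeasure \<mu> (S - atoms \<mu>)" by (simp only: e1 e2)
    also have "\<dots> = emeasure \<mu> S"
      using S A.atoms_sets by (subst plus_emeasure) (auto simp: Int_Diff_Un)
    finally show "emeasure (distr ?d \<mu> \<tau>) S = emeasure \<mu> S" .
  qed simp
  ultimately show thesis using tm tm' wm wpos by (intro that)
qed

text \<open>After multiplication by the square root of \<open>w\<close>, composition with
  \<open>\<tau>\<close> is isometric. Surjectivity of \<open>U\<close>, and of the induced map on
  multipliers, comes from \<open>\<tau>'\<close>.\<close>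

lemma measure_isomorphism_imp_spatial:
  assumes A: "clark \<Theta> a \<mu>" and B: "clark \<Theta> b \<nu>"
    and t: "\<tau> \<in> measurable \<nu> \<mu>" "\<tau>' \<in> measurable \<mu> \<nu>"
    and w: "w \<in> borel_measurable \<nu>" "\<And>y. w y > (0::real)"
    and d: "distr (density \<nu> (\<lambda>y. ennreal (w y))) \<mu> \<tau> = \<mu>" and ae: "AE y in \<nu>. \<tau>' (\<tau> y) = y"
  shows "spatially_isomorphic (model_space \<Theta>) (sedlock \<Theta> a) (model_space \<Theta>) (sedlock \<Theta> b)"
proof -
  interpret A: clark \<Theta> a \<mu> by (rule A)
  interpret B: clark \<Theta> b \<nu> by (rule B)
  let ?K = "model_space \<Theta>" and ?d = "density \<nu> (\<lambda>y. ennreal (w y))"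
  have td: "\<tau> \<in> measurable ?d \<mu>" using t(1) by (simp cong: measurable_cong_sets)
  have w0: "0 \<le> w y" for y using w(2)[of y] by simp
  have comp: "(\<lambda>y. f (\<tau> y)) \<in> borel_measurable \<nu>" if "f \<in> borel_measurable \<mu>" for f :: "complex \<Rightarrow> complex"
    by (rule measurable_compose[OF t(1) that])
  have int_iff: "integrable \<mu> f \<longleftrightarrow> integrable \<nu> (\<lambda>y. w y *\<^sub>R f (\<tau> y))" (is ?I)
    and int_eq: "integral\<^sup>L \<mu> f = integral\<^sup>L \<nu> (\<lambda>y. w y *\<^sub>R f (\<tau> y))" (is ?E)
    if f: "f \<in> borel_measurable \<mu>" for f :: "complex \<Rightarrow> 'b::{banach, second_countable_topology}"
  proof -
    have f\<tau>: "(\<lambda>y. f (\<tau> y)) \<in> borel_measurable \<nu>" by (rule measurable_compose[OF t(1) f])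
    have "integrable \<mu> f \<longleftrightarrow> integrable (distr ?d \<mu> \<tau>) f" by (simp only: d)
    also have "\<dots> \<longleftrightarrow> integrable ?d (\<lambda>y. f (\<tau> y))" by (rule integrable_distr_eq[OF td f])
    also have "\<dots> \<longleftrightarrow> integrable \<nu> (\<lambda>y. w y *\<^sub>R f (\<tau> y))"
      by (rule integrable_density[OF f\<tau> w(1)]) (simp add: w0)
    finally show ?I .
    have "integral\<^sup>L \<mu> f = integral\<^sup>L (distr ?d \<mu> \<tau>) f" by (simp only: d)
    also have "\<dots> = (\<integral>y. f (\<tau> y) \<partial>?d)" by (rule integral_distr[OF td f])
    also have "\<dots> = integral\<^sup>L \<nu> (\<lambda>y. w y *\<^sub>R f (\<tau> y))"
      by (rule integral_density[OF f\<tau> w(1)]) (simp add: w0)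
    finally show ?E .
  qed
  \<comment> \<open>Positivity of \<open>w\<close> matters here: \<nu> and the measure with density
    \<open>w\<close> then have the same null sets, so statements almost everywhere for \<mu> pull
    back along \<open>\<tau>\<close>.\<close>
  have AE_pull: "AE y in \<nu>. P (\<tau> y)" if P: "AE x in \<mu>. P x" for P
  proof -
    have "AE x in distr ?d \<mu> \<tau>. P x" by (simp only: d P)
    from AE_distrD[OF td this] show ?thesis using w by (simp add: AE_density)
  qed
  define \<Phi> where "\<Phi> g y = complex_of_real (sqrt (w y)) * g (\<tau> y)" for g :: "complex \<Rightarrow> complex" and y
  have sw: "complex_of_real (sqrt (w y)) * complex_of_real (sqrt (w y)) = complex_of_real (w y)" for y
    using w0[of y] by (simp flip: of_real_mult)
  have n2: "(cmod (\<Phi> g y))\<^sup>2 = w y *\<^sub>R (cmod (g (\<tau> y)))\<^sup>2" for g y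
    using w0[of y] by (simp add: \<Phi>_def norm_mult power_mult_distrib)
  have \<Phi>m: "\<Phi> g \<in> borel_measurable \<nu>" if "g \<in> borel_measurable \<mu>" for g
    unfolding \<Phi>_def using comp[OF that] w(1) by measurable
  have \<Phi>s: "sqi \<nu> (\<Phi> g) \<longleftrightarrow> sqi \<mu> g" if g: "g \<in> borel_measurable \<mu>" for g
  proof -
    have "(\<lambda>x. (cmod (g x))\<^sup>2) \<in> borel_measurable \<mu>" using g by measurable
    from int_iff[OF this] show ?thesis using g \<Phi>m[OF g] by (simp only: sqi_def n2)
  qed
  have \<Phi>sqi: "sqi \<nu> (\<Phi> g)" if "sqi \<mu> g" for g using \<Phi>s[of g] that by (simp add: sqi_def)
  have \<Phi>ip: "ip \<nu> (\<Phi> f) (\<Phi> g) = ip \<mu> f g" if fg: "sqi \<mu> f" "sqi \<mu> g" for f g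
  proof -
    have "\<Phi> f y * cnj (\<Phi> g y) = w y *\<^sub>R (f (\<tau> y) * cnj (g (\<tau> y)))" for y
      using sw[of y] by (simp add: \<Phi>_def scaleR_conv_of_real algebra_simps)
    moreover have "(\<lambda>x. f x * cnj (g x)) \<in> borel_measurable \<mu>" using fg by (auto simp: sqi_def)
    ultimately show ?thesis unfolding ip_def using int_eq[of "\<lambda>x. f x * cnj (g x)"] by (simp only:)
  qed
  define U where "U x = B.W (\<Phi> (A.V x))" for x
  have UW: "U (A.W g) = B.W (\<Phi> g)" if g: "sqi \<mu> g" for g
    unfolding U_def
  proof (intro B.W_cong \<Phi>sqi A.V_sqi A.W_KK g)
    show "AE y in \<nu>. \<Phi> (A.V (A.W g)) y = \<Phi> g y"
      using AE_pull[OF A.V_W[OF g]] by eventually_elim (simp add: \<Phi>_def)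
  qed
  have UK: "U x \<in> ?K" if "x \<in> ?K" for x
    unfolding U_def using that by (intro B.W_KK \<Phi>sqi A.V_sqi)
  have Uip: "l2_inner (U x) (U y) = l2_inner x y" if "x \<in> ?K" "y \<in> ?K" for x y
    using that by (simp add: U_def B.W_ip \<Phi>sqi A.V_sqi \<Phi>ip A.V_ip)
  have Uadd: "U (x + y) = U x + U y" if xy: "x \<in> ?K" "y \<in> ?K" for x y
  proof -
    have s: "sqi \<mu> (A.V x)" "sqi \<mu> (A.V y)" using xy by (simp_all add: A.V_sqi)
    have "U (x + y) = U (A.W (\<lambda>t. A.V x t + A.V y t))" using A.W_lin[OF s] xy by (simp add: A.W_V)
    also have "\<dots> = B.W (\<lambda>t. \<Phi> (A.V x) t + \<Phi> (A.V y) t)"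
      unfolding UW[OF sqi_add[OF s]] by (simp add: \<Phi>_def[abs_def] distrib_left)
    also have "\<dots> = U x + U y" unfolding U_def by (rule B.W_lin[OF \<Phi>sqi[OF s(1)] \<Phi>sqi[OF s(2)]])
    finally show ?thesis .
  qed
  have Uscale: "U (c *\<^sub>C x) = c *\<^sub>C U x" if x: "x \<in> ?K" for c x
  proof -
    have s: "sqi \<mu> (A.V x)" using x by (rule A.V_sqi)
    have "U (c *\<^sub>C x) = U (A.W (\<lambda>t. c * A.V x t))" using A.W_scale[OF s] x by (simp add: A.W_V)
    also have "\<dots> = B.W (\<lambda>t. c * \<Phi> (A.V x) t)"
      unfolding UW[OF sqi_scale[OF s]] by (simp add: \<Phi>_def[abs_def] mult.left_commute)
    also have "\<dots> = c *\<^sub>C U x" unfolding U_def by (rule B.W_scale[OF \<Phi>sqi[OF s]])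
    finally show ?thesis .
  qed
  have inj: "inj_on U ?K"
  proof (rule inj_onI)
    fix x y assume xy: "x \<in> ?K" "y \<in> ?K" "U x = U y"
    show "x = y"
    proof (rule A.KK_eqI[OF xy(1,2)])
      fix z assume "z \<in> ?K"
      then show "l2_inner x z = l2_inner y z" using Uip[of x z] Uip[of y z] xy by simp
    qed
  qed
  have surj: "y \<in> U ` ?K" if y: "y \<in> ?K" for y
  proof -
    have k: "sqi \<nu> (B.V y)" by (rule B.V_sqi[OF y])
    \<comment> \<open>The preimage divides by the square root of \<open>w\<close> and composes with
      \<open>\<tau>'\<close>; its image under \<open>\<Phi>\<close> is right almost everywhere
      because \<open>\<tau>'\<close> undoes \<open>\<tau>\<close> there.\<close>
    define k' where "k' t = B.V y t / complex_of_real (sqrt (w t))" for t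
    have "k' \<in> borel_measurable \<nu>" unfolding k'_def using k w(1) by (auto simp: sqi_def)
    then have gm: "(\<lambda>x. k' (\<tau>' x)) \<in> borel_measurable \<mu>" by (rule measurable_compose[OF t(2)])
    have e: "AE t in \<nu>. B.V y t = \<Phi> (\<lambda>x. k' (\<tau>' x)) t"
      using ae
    proof (eventually_elim)
      fix t assume "\<tau>' (\<tau> t) = t"
      then show "B.V y t = \<Phi> (\<lambda>x. k' (\<tau>' x)) t" using w(2)[of t] by (simp add: \<Phi>_def k'_def)
    qed
    have s: "sqi \<nu> (\<Phi> (\<lambda>x. k' (\<tau>' x)))" by (rule sqi_cong_AE[OF k \<Phi>m[OF gm] e])
    then have s': "sqi \<mu> (\<lambda>x. k' (\<tau>' x))" using \<Phi>s[OF gm] by simp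
    have "U (A.W (\<lambda>x. k' (\<tau>' x))) = B.W (B.V y)"
      unfolding UW[OF s'] by (rule B.W_cong[OF k s e, symmetric])
    then show ?thesis using A.W_KK[OF s'] by (simp add: B.W_V y rev_image_eqI)
  qed
  have bij: "bij_betw U ?K ?K" using inj surj UK by (auto simp: bij_betw_def)
  have un: "unitary_on ?K ?K U"
    using bij Uip Uadd Uscale by (simp add: unitary_on_def complex_linear_on_def)
  have bd: "B.bdd (\<lambda>y. h (\<tau> y))" if "A.bdd h" for h
    using that comp by (auto simp: A.bdd_def B.bdd_def)
  have bd': "A.bdd (\<lambda>x. h (\<tau>' x))" if "B.bdd h" for h
    using that measurable_compose[OF t(2), of h borel] by (auto simp: A.bdd_def B.bdd_def)
  have conj: "restrict (U \<circ> A.MO h \<circ> inv_into ?K U) ?K = B.MO (\<lambda>y. h (\<tau> y))" if h: "A.bdd h" for h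
  proof
    fix y
    show "restrict (U \<circ> A.MO h \<circ> inv_into ?K U) ?K y = B.MO (\<lambda>y. h (\<tau> y)) y"
    proof (cases "y \<in> ?K")
      case True
      define x where "x = inv_into ?K U y"
      have x: "x \<in> ?K" "U x = y" unfolding x_def using surj[OF True] by (auto intro: inv_into_into f_inv_into_f)
      have s: "sqi \<mu> (A.V x)" by (rule A.V_sqi[OF x(1)])
      have "U (A.MO h x) = U (A.W (\<lambda>t. h t * A.V x t))" using x by (simp add: A.MO_def)
      also have "\<dots> = B.W (\<lambda>t. h (\<tau> t) * \<Phi> (A.V x) t)"
        unfolding UW[OF A.bdd_sqi[OF h s]] by (simp add: \<Phi>_def[abs_def] mult.left_commute)
      also have "\<dots> = B.MO (\<lambda>y. h (\<tau> y)) (U x)"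
        unfolding U_def by (rule B.MO_W[OF bd[OF h] \<Phi>sqi[OF s], symmetric])
      finally show ?thesis using True x by (simp add: x_def)
    qed (simp add: B.MO_def)
  qed
  have "(\<lambda>T. restrict (U \<circ> T \<circ> inv_into ?K U) ?K) ` sedlock \<Theta> a = sedlock \<Theta> b"
    unfolding A.sedlock_eq B.sedlock_eq
  proof (intro equalityI subsetI)
    fix T assume "T \<in> (\<lambda>T. restrict (U \<circ> T \<circ> inv_into ?K U) ?K) ` A.MO ` {h. A.bdd h}"
    then obtain h where h: "A.bdd h" "T = restrict (U \<circ> A.MO h \<circ> inv_into ?K U) ?K" by blast
    then have "T = B.MO (\<lambda>y. h (\<tau> y))" by (simp only: conj[OF h(1)])
    then show "T \<in> B.MO ` {h. B.bdd h}" using bd[OF h(1)] by blast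
  next
    fix T assume "T \<in> B.MO ` {h. B.bdd h}"
    then obtain h where h: "B.bdd h" "T = B.MO h" by blast
    \<comment> \<open>Conjugation by \<open>U\<close> turns the multiplier \<open>h\<close> composed
      with \<open>\<tau>'\<close> into \<open>h\<close> composed with \<open>\<tau>'\<close> and
      \<open>\<tau>\<close>, which is \<open>h\<close> almost everywhere and hence gives the same
      operator.\<close>
    have b: "A.bdd (\<lambda>x. h (\<tau>' x))" by (rule bd'[OF h(1)])
    have "B.MO (\<lambda>y. h (\<tau>' (\<tau> y))) = B.MO h"
    proof
      fix x
      show "B.MO (\<lambda>y. h (\<tau>' (\<tau> y))) x = B.MO h x"
      proof (cases "x \<in> ?K")
        case True
        have s: "sqi \<nu> (B.V x)" by (rule B.V_sqi[OF True])
        have "B.W (\<lambda>t. h (\<tau>' (\<tau> t)) * B.V x t) = B.W (\<lambda>t. h t * B.V x t)"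
          by (rule B.W_cong[OF B.bdd_sqi[OF bd[OF b] s] B.bdd_sqi[OF h(1) s]])
             (use ae in \<open>auto elim!: eventually_mono\<close>)
        then show ?thesis using True by (simp add: B.MO_def)
      qed (simp add: B.MO_def)
    qed
    then have "T = restrict (U \<circ> A.MO (\<lambda>x. h (\<tau>' x)) \<circ> inv_into ?K U) ?K"
      unfolding conj[OF b] h(2) by (rule sym)
    then show "T \<in> (\<lambda>T. restrict (U \<circ> T \<circ> inv_into ?K U) ?K) ` A.MO ` {h. A.bdd h}" using b by blast
  qed
  then show ?thesis unfolding spatially_isomorphic_def using un by blast
qed

theorem theorem4p1:
  fixes \<Theta> :: "complex \<Rightarrow> complex" and a a' :: complex
  assumes "inner_function \<Theta>" and "a \<in> sphere 0 1" and "a' \<in> sphere 0 1"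
  shows "spatially_isomorphic (model_space \<Theta>) (sedlock \<Theta> a) (model_space \<Theta>) (sedlock \<Theta> a')
     \<longleftrightarrow> kappa (clark_measure \<Theta> a) = kappa (clark_measure \<Theta> a')"
proof -
  let ?\<mu> = "clark_measure \<Theta> a" and ?\<nu> = "clark_measure \<Theta> a'"
  have A: "clark \<Theta> a ?\<mu>" and B: "clark \<Theta> a' ?\<nu>" using assms by (simp_all add: clark_clark_measure)
  show ?thesis
  proof
    assume "spatially_isomorphic (model_space \<Theta>) (sedlock \<Theta> a) (model_space \<Theta>) (sedlock \<Theta> a')"
    then show "kappa ?\<mu> = kappa ?\<nu>" by (rule kappa_invariant[OF A B])
  next
    assume "kappa ?\<mu> = kappa ?\<nu>"
    from A B this show "spatially_isomorphic (model_space \<Theta>) (sedlock \<Theta> a) (model_space \<Theta>) (sedlock \<Theta> a')"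
    proof (rule clark_measure_isomorphism, goal_cases)
      case (1 \<tau> \<tau>' w) show ?case by (rule measure_isomorphism_imp_spatial[OF A B 1])
    qed
  qed
qed

end
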